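(* Let $d\ge2$, $n,m\ge1$, let $T\subset\mathbb R^m$ be a nonempty symmetric bounded set and $A=(a_{\mathbf i})_{\mathbf i\in[n]^d\times[m]}$ a real array, $\mathbf i=(i_1,\ldots,i_{d+1})$. Let $g_1,\ldots,g_n$ be i.i.d. standard Gaussian. There is a constant $C(d)$ depending only on $d$ such that for any $p\ge1$, \[\mathbb E\sup_{(x^2,\ldots,x^d,t)\in(B_2^n)^{d-1}\times T}\sum_{\mathbf i}a_{\mathbf i}g_{i_1}\prod_{k=2}^dx^k_{i_k}t_{i_{d+1}}\le C(d)\sum_{k=0}^dp^{\frac{k+1-d}{2}}s_k(A).\]
   Context: $B_2^n$ is the closed Euclidean unit ball; $[d]=\{1,\ldots,d\}$, $i_I=(i_j)_{j\in I}$. $\mathcal P(U)$ is the family of unordered partitions of $U$ into nonempty disjoint blocks; $(\mathcal P,\mathcal P')\in\mathcal P([d])$ means $\mathcal P\cup\mathcal P'\in\mathcal P([d])$ and $\mathcal P\cap\mathcal P'=\emptyset$. For $\mathcal P=\{I_1,\ldots,I_k\}$, $\mathcal P'=\{J_1,\ldots,J_l\}$: $\|A\|_{\mathcal P'\mid\mathcal P}=\sup\{\mathbb E\sup_{t\in T}\sum_{\mathbf i}a_{\mathbf i}\prod_{r=1}^kx^r_{i_{I_r}}\prod_{s=1}^lg^s_{i_{J_s}}t_{i_{d+1}}:\sum_{i_{I_r}}(x^r_{i_{I_r}})^2\le1\ \forall r\}$, where $x^r$ are real arrays indexed by $[n]^{I_r}$ and $(g^s_{i_{J_s}})_{i_{J_s}\in[n]^{J_s}}$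 are independent families of i.i.d. standard Gaussians. $s_k(A)=\sum_{(\mathcal P,\mathcal P')\in\mathcal P([d]),\,|\mathcal P|=k}\|A\|_{\mathcal P'\mid\mathcal P}$. *)

theory Defs
  imports "HOL-Probability.Probability" "HOL-Library.Disjoint_Sets"
begin

definition gauss :: "real measure" where
  "gauss = density lborel std_normal_density"

definition Idx :: "nat \<Rightarrow> nat \<Rightarrow> nat \<Rightarrow> (nat \<Rightarrow> nat) set" where
  "Idx d n m = PiE {1..d+1} (\<lambda>j. if j \<le> d then {1..n} else {1..m})"

text \<open>Independent families (g^J_{i_J}) of iid standard Gaussians, one family per block J of P'.
  A sample is a function on pairs (J, i_J).\<close>
definition gauss_family :: "nat \<Rightarrow> nat set set \<Rightarrow> (nat set \<times> (nat \<Rightarrow> nat) \<Rightarrow> real) measure" where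
  "gauss_family n P' = PiM (SIGMA J:P'. PiE J (\<lambda>_. {1..n})) (\<lambda>_. gauss)"

text \<open>The norm ||A||_{P'|P}; x I is the array x^r indexed by [n]^{I} for the block I of P.\<close>
definition normPP :: "nat \<Rightarrow> nat \<Rightarrow> nat \<Rightarrow> ((nat \<Rightarrow> nat) \<Rightarrow> real) \<Rightarrow> (nat \<Rightarrow> real) set
    \<Rightarrow> nat set set \<Rightarrow> nat set set \<Rightarrow> real" where
  "normPP d n m A T P' P =
     (SUP x \<in> {x :: nat set \<Rightarrow> (nat \<Rightarrow> nat) \<Rightarrow> real.
                 \<forall>I\<in>P. (\<Sum>u\<in>PiE I (\<lambda>_. {1..n}). (x I u)^2) \<le> 1}.
        \<integral>g. (SUP t\<in>T. \<Sum>i\<in>Idx d n m. A i * (\<Prod>I\<in>P. x I (restrict i I))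
                 * (\<Prod>J\<in>P'. g (J, restrict i J)) * t (i (d+1))) \<partial>(gauss_family n P'))"

definition s_k :: "nat \<Rightarrow> nat \<Rightarrow> nat \<Rightarrow> ((nat \<Rightarrow> nat) \<Rightarrow> real) \<Rightarrow> (nat \<Rightarrow> real) set \<Rightarrow> nat \<Rightarrow> real" where
  "s_k d n m A T k =
     (\<Sum>(P, P')\<in>{(P, P'). partition_on {1..d} (P \<union> P') \<and> P \<inter> P' = {} \<and> card P = k}.
        normPP d n m A T P' P)"

end

theory Submission
  imports Defs
begin

text \<open>
  For fixed \<open>A\<close> and \<open>T\<close>, the supremum over \<open>t\<close> is a seminorm of the array paired with \<open>A\<close>; averaging it over
  Gaussian blocks or maximising it over unit arrays again gives a seminorm, so all quantities
  \<open>\<parallel>A\<parallel>\<^bsub>P'|P\<^esub>\<close> are treated alike, and by Hahn-Banach every such seminorm is a supremum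
  over a dual ball. The expected supremum is then that of a Gaussian process indexed by pairs
  \<open>(x, t)\<close>, and it is bounded by chaining, by induction on the number of blocks.

  At scale \<open>e\<close> the index set is cut into at most \<open>exp (C p / (\<eta> e)\<^sup>2)\<close> pieces whose diameter in the metric
  of the process is of order \<open>\<eta> e\<^sup>2 \<sigma> / sqrt p\<close>, so that Gaussian concentration makes the passage to the pieces
  cost \<open>C e \<sigma>\<close>. The covering numbers come from overlapping Gaussian translates of the \<open>x\<close>-variables and from
  Sudakov's bound in the dual variable. Each piece is recentered at one of its points; the induction
  hypothesis, applied to seminorms contracted with a difference of unit arrays, bounds the error by \<open>C e \<sigma>\<close> as well,
  and these costs sum over \<open>e = 2\<^sup>-\<^sup>l\<close>.

  The scale \<open>\<sigma>\<close> has to exceed \<open>S / \<eta> + \<eta> F\<close>, where \<open>S\<close> is the right-hand side of the theorem and \<open>F\<close> the largest quantity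
  of the kind being bounded. Hence \<open>F \<le> C (S / \<eta> + \<eta> F)\<close>, and a small \<open>\<eta>\<close> absorbs \<open>F\<close>.\<close>

subsection \<open>Gaussian measures\<close>

text \<open>Blocks are arbitrary sets of indices because a second moment over Gaussian blocks
  \<open>K\<close> leaves an l2 norm in the merged block \<open>i \<union> \<Union>K\<close>: larger
  blocks appear even if all blocks are singletons at the outset. The seminorm is arbitrary so that
  frozen arrays and averaged blocks can be hidden in it.

  Powers of p: a block that is moved from the supremum to the Gaussian side costs sqrt p, and so
  does a block that is merged away; noise of size \<eta> e / sqrt p pays for either. The e^2 in the
  diameter has two sources, one e from the distance to the center and one from the noise. For d = 2
  the term in which the only x-variable has become noise has a single factor e, and the other one
  must come from the dual variable.

  The obstacle is the entropy of the x-variables. It is governed by a Gaussian average one of whose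
  terms is the very quantity to be bounded. This term arrives multiplied by \<eta>, because noise
  size times sqrt p is \<eta> e, while the constants paid per scale do not involve \<eta>. Hence no
  circularity arises when \<eta> is chosen in the end.\<close>

lemma sets_gauss [measurable_cong, simp]: "sets gauss = sets borel"
  by (simp add: gauss_def)

lemma space_gauss [simp]: "space gauss = UNIV"
  by (simp add: gauss_def)

lemma prob_space_gauss: "prob_space gauss"
  unfolding gauss_def by (rule prob_space_normal_density) simp

interpretation gauss: prob_space gauss
  by (rule prob_space_gauss)

interpretation gauss_prod: product_sigma_finite "\<lambda>_. gauss"
  by unfold_locales

abbreviation gaussv :: "'i set \<Rightarrow> ('i \<Rightarrow> real) measure" where
  "gaussv Y \<equiv> PiM Y (\<lambda>_. gauss)"

abbreviation ip :: "'i set \<Rightarrow> ('i \<Rightarrow> real) \<Rightarrow> ('i \<Rightarrow> real) \<Rightarrow> real" where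
  "ip Y a x \<equiv> \<Sum>b\<in>Y. a b * x b"

lemma prob_space_gaussv: "prob_space (gaussv Y)"
  by (intro prob_space_PiM) (rule prob_space_gauss)

lemma nn_integral_gauss:
  assumes [measurable]: "f \<in> borel_measurable borel"
  shows "(\<integral>\<^sup>+x. f x \<partial>gauss) = (\<integral>\<^sup>+x. ennreal (std_normal_density x) * f x \<partial>lborel)"
  unfolding gauss_def by (subst nn_integral_density) auto

lemma nn_integral_gauss_shift:
  assumes [measurable]: "f \<in> borel_measurable borel"
  shows "(\<integral>\<^sup>+x. f (x + a) \<partial>gauss) = (\<integral>\<^sup>+x. ennreal (exp (a * x - a\<^sup>2 / 2)) * f x \<partial>gauss)"
proof -
  have "(\<integral>\<^sup>+x. f (x + a) \<partial>gauss) = (\<integral>\<^sup>+x. ennreal (std_normal_density x) * f (x + a) \<partial>lborel)"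
    by (subst nn_integral_gauss) auto
  also have "\<dots> = (\<integral>\<^sup>+x. ennreal (std_normal_density (x - a)) * f x \<partial>lborel)"
    by (subst nn_integral_real_affine[where c=1 and t="-a"]) (auto simp: add.commute)
  also have "\<dots> = (\<integral>\<^sup>+x. ennreal (std_normal_density x) * (ennreal (exp (a * x - a\<^sup>2 / 2)) * f x) \<partial>lborel)"
  proof (rule nn_integral_cong)
    fix x
    have "std_normal_density (x - a) = std_normal_density x * exp (a * x - a\<^sup>2 / 2)"
      unfolding std_normal_density_def by (simp add: mult_exp_exp power2_eq_square field_simps)
    then show "ennreal (std_normal_density (x - a)) * f x =
        ennreal (std_normal_density x) * (ennreal (exp (a * x - a\<^sup>2 / 2)) * f x)"
      by (simp add: ennreal_mult mult.assoc)
  qed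
  also have "\<dots> = (\<integral>\<^sup>+x. ennreal (exp (a * x - a\<^sup>2 / 2)) * f x \<partial>gauss)"
    by (subst nn_integral_gauss) auto
  finally show ?thesis .
qed

lemma nn_integral_gauss_uminus:
  assumes [measurable]: "f \<in> borel_measurable borel"
  shows "(\<integral>\<^sup>+x. f (- x) \<partial>gauss) = (\<integral>\<^sup>+x. f x \<partial>gauss)"
proof -
  have "(\<integral>\<^sup>+x. f (- x) \<partial>gauss) = (\<integral>\<^sup>+x. ennreal (std_normal_density x) * f (- x) \<partial>lborel)"
    by (subst nn_integral_gauss) auto
  also have "\<dots> = (\<integral>\<^sup>+x. ennreal (std_normal_density x) * f x \<partial>lborel)"
    by (subst nn_integral_real_affine[where c="-1" and t=0]) (auto simp: std_normal_density_def)
  finally show ?thesis by (subst nn_integral_gauss) auto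
qed

text \<open>For \<open>c > 0\<close> the rotation is carried out by one affine substitution in each
  variable, with Jacobians \<open>1 / c\<close> and \<open>c\<close>, Fubini exchanging the order in
  between. For \<open>c = 0\<close> it is a swap followed by a reflection.\<close>

lemma nn_integral_gauss_rotation:
  assumes f [measurable]: "(\<lambda>(x, y). f x y) \<in> borel_measurable (borel \<Otimes>\<^sub>M borel)"
    and cs: "c\<^sup>2 + s\<^sup>2 = (1::real)" "c \<ge> 0" "s \<ge> 0"
  shows "(\<integral>\<^sup>+x. \<integral>\<^sup>+y. f (c * x + s * y) (c * y - s * x) \<partial>gauss \<partial>gauss) =
         (\<integral>\<^sup>+x. \<integral>\<^sup>+y. f x y \<partial>gauss \<partial>gauss)"
proof (cases "c = 0")
  case True
  then have s: "s = 1" using cs by (simp add: power2_eq_1_iff)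
  have "(\<integral>\<^sup>+x. \<integral>\<^sup>+y. f y (- x) \<partial>gauss \<partial>gauss) = (\<integral>\<^sup>+y. \<integral>\<^sup>+x. f y (- x) \<partial>gauss \<partial>gauss)"
    by (rule pair_sigma_finite.Fubini') (unfold_locales, measurable)
  also have "\<dots> = (\<integral>\<^sup>+y. \<integral>\<^sup>+x. f y x \<partial>gauss \<partial>gauss)"
    by (intro nn_integral_cong nn_integral_gauss_uminus) measurable
  finally show ?thesis using True s by simp
next
  case False
  then have c: "c > 0" using cs by simp
  define \<phi> where "\<phi> = (\<lambda>x y. ennreal (std_normal_density x * std_normal_density y))"
  have \<phi>m [measurable]: "(\<lambda>(x, y). \<phi> x y) \<in> borel_measurable (borel \<Otimes>\<^sub>M borel)"
    unfolding \<phi>_def by measurable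
  have iter: "(\<integral>\<^sup>+x. \<integral>\<^sup>+y. g x y \<partial>gauss \<partial>gauss) = (\<integral>\<^sup>+x. \<integral>\<^sup>+y. \<phi> x y * g x y \<partial>lborel \<partial>lborel)"
    if [measurable]: "(\<lambda>(x, y). g x y) \<in> borel_measurable (borel \<Otimes>\<^sub>M borel)" for g
  proof -
    have "(\<integral>\<^sup>+x. \<integral>\<^sup>+y. g x y \<partial>gauss \<partial>gauss) =
        (\<integral>\<^sup>+x. ennreal (std_normal_density x) * (\<integral>\<^sup>+y. ennreal (std_normal_density y) * g x y \<partial>lborel) \<partial>lborel)"
      by (simp add: nn_integral_gauss)
    also have "\<dots> = (\<integral>\<^sup>+x. \<integral>\<^sup>+y. ennreal (std_normal_density x) * (ennreal (std_normal_density y) * g x y) \<partial>lborel \<partial>lborel)"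
      by (intro nn_integral_cong nn_integral_cmult[symmetric]) measurable
    finally show ?thesis by (simp add: \<phi>_def ennreal_mult mult.assoc)
  qed
  \<comment> \<open>The rotation maps the point \<open>((x - s * y) / c, y)\<close> to
    \<open>(x, (y - s * x) / c)\<close>, so both have the same Euclidean norm and the same
    density.\<close>
  have rot: "\<phi> ((x - s * y) / c) y = \<phi> x ((y - s * x) / c)" for x y
  proof -
    have s2: "s\<^sup>2 = 1 - c\<^sup>2" using cs by simp
    have "((x - s * y) / c)\<^sup>2 + y\<^sup>2 = (x\<^sup>2 - 2 * s * x * y + (s\<^sup>2 + c\<^sup>2) * y\<^sup>2) / c\<^sup>2"
      using c by (simp add: field_simps power2_eq_square)
    also have "\<dots> = ((s\<^sup>2 + c\<^sup>2) * x\<^sup>2 - 2 * s * x * y + y\<^sup>2) / c\<^sup>2"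
      using cs by (simp add: add.commute)
    also have "\<dots> = x\<^sup>2 + ((y - s * x) / c)\<^sup>2"
      using c by (simp add: field_simps power2_eq_square)
    finally have "((x - s * y) / c)\<^sup>2 + y\<^sup>2 = x\<^sup>2 + ((y - s * x) / c)\<^sup>2" .
    then have "exp (- ((x - s * y) / c)\<^sup>2 / 2) * exp (- y\<^sup>2 / 2) = exp (- x\<^sup>2 / 2) * exp (- ((y - s * x) / c)\<^sup>2 / 2)"
      by (simp add: mult_exp_exp field_simps)
    then show ?thesis
      unfolding \<phi>_def std_normal_density_def by simp
  qed
  have simp1: "c * y - s * ((x - s * y) / c) = (y - s * x) / c" for x y
  proof -
    have "c * y - s * ((x - s * y) / c) = ((c\<^sup>2 + s\<^sup>2) * y - s * x) / c"
      using c by (simp add: field_simps power2_eq_square)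
    then show ?thesis using cs by simp
  qed
  have "(\<integral>\<^sup>+x. \<integral>\<^sup>+y. f (c * x + s * y) (c * y - s * x) \<partial>gauss \<partial>gauss) =
     (\<integral>\<^sup>+x. \<integral>\<^sup>+y. \<phi> x y * f (c * x + s * y) (c * y - s * x) \<partial>lborel \<partial>lborel)"
    by (rule iter) measurable
  also have "\<dots> = (\<integral>\<^sup>+y. \<integral>\<^sup>+x. \<phi> x y * f (c * x + s * y) (c * y - s * x) \<partial>lborel \<partial>lborel)"
    by (rule pair_sigma_finite.Fubini') (unfold_locales, measurable)
  also have "\<dots> = (\<integral>\<^sup>+y. \<integral>\<^sup>+x. ennreal (1 / c) * (\<phi> x ((y - s * x) / c) * f x ((y - s * x) / c)) \<partial>lborel \<partial>lborel)"
  proof (rule nn_integral_cong)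
    fix y
    have "(\<integral>\<^sup>+x. \<phi> x y * f (c * x + s * y) (c * y - s * x) \<partial>lborel) =
      ennreal \<bar>1 / c\<bar> * (\<integral>\<^sup>+x. \<phi> (- (s * y / c) + 1 / c * x) y *
         f (c * (- (s * y / c) + 1 / c * x) + s * y) (c * y - s * (- (s * y / c) + 1 / c * x)) \<partial>lborel)"
      by (rule nn_integral_real_affine) (use c in \<open>auto\<close>)
    also have "\<dots> = ennreal (1 / c) * (\<integral>\<^sup>+x. \<phi> x ((y - s * x) / c) * f x ((y - s * x) / c) \<partial>lborel)"
    proof -
      have a: "- (s * y / c) + 1 / c * x = (x - s * y) / c" for x
        using c by (simp add: field_simps)
      have "c * ((x - s * y) / c) + s * y = x" for x using c by simp
      then show ?thesis
        unfolding a simp1 rot using c by simp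
    qed
    finally show "(\<integral>\<^sup>+x. \<phi> x y * f (c * x + s * y) (c * y - s * x) \<partial>lborel) =
      (\<integral>\<^sup>+x. ennreal (1 / c) * (\<phi> x ((y - s * x) / c) * f x ((y - s * x) / c)) \<partial>lborel)"
      by (subst nn_integral_cmult) auto
  qed
  also have "\<dots> = (\<integral>\<^sup>+x. \<integral>\<^sup>+y. ennreal (1 / c) * (\<phi> x ((y - s * x) / c) * f x ((y - s * x) / c)) \<partial>lborel \<partial>lborel)"
    by (rule pair_sigma_finite.Fubini') (unfold_locales, measurable)
  also have "\<dots> = (\<integral>\<^sup>+x. \<integral>\<^sup>+y. \<phi> x y * f x y \<partial>lborel \<partial>lborel)"
  proof (rule nn_integral_cong)
    fix x
    have "(\<integral>\<^sup>+y. ennreal (1 / c) * (\<phi> x ((y - s * x) / c) * f x ((y - s * x) / c)) \<partial>lborel)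
       = ennreal \<bar>c\<bar> * (\<integral>\<^sup>+y. ennreal (1 / c) * (\<phi> x ((s * x + c * y - s * x) / c) * f x ((s * x + c * y - s * x) / c)) \<partial>lborel)"
      by (rule nn_integral_real_affine) (use c in \<open>auto\<close>)
    also have "\<dots> = ennreal c * (ennreal (1 / c) * (\<integral>\<^sup>+y. \<phi> x y * f x y \<partial>lborel))"
      using c by (subst nn_integral_cmult) auto
    also have "\<dots> = (\<integral>\<^sup>+y. \<phi> x y * f x y \<partial>lborel)"
      using c by (simp add: mult.assoc[symmetric] ennreal_mult'[symmetric])
    finally show "(\<integral>\<^sup>+y. ennreal (1 / c) * (\<phi> x ((y - s * x) / c) * f x ((y - s * x) / c)) \<partial>lborel) =
       (\<integral>\<^sup>+y. \<phi> x y * f x y \<partial>lborel)" .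
  qed
  also have "\<dots> = (\<integral>\<^sup>+x. \<integral>\<^sup>+y. f x y \<partial>gauss \<partial>gauss)"
    by (rule iter[symmetric]) measurable
  finally show ?thesis .
qed

text \<open>The Cameron-Martin formula in finite dimension. The density is a product over
  coordinates, so the one-dimensional formula is applied to one coordinate at a time.\<close>

lemma nn_integral_gaussv_shift:
  assumes "finite Y" "f \<in> borel_measurable (gaussv Y)"
  shows "(\<integral>\<^sup>+x. f (\<lambda>b\<in>Y. x b + a b) \<partial>gaussv Y) =
         (\<integral>\<^sup>+x. ennreal (exp (ip Y a x - (\<Sum>b\<in>Y. (a b)\<^sup>2) / 2)) * f x \<partial>gaussv Y)"
  using assms
proof (induction Y arbitrary: f rule: finite_induct)
  case empty
  show ?case
    by (rule nn_integral_cong) (auto simp: space_PiM)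
next
  case (insert i Y)
  note [measurable] = insert.prems
  let ?e = "\<lambda>Y x. ennreal (exp (ip Y a x - (\<Sum>b\<in>Y. (a b)\<^sup>2) / 2))"
  let ?e1 = "\<lambda>y. ennreal (exp (a i * y - (a i)\<^sup>2 / 2))"
  have [simp]: "x(i := y) \<in> space (gaussv (insert i Y))" if "x \<in> space (gaussv Y)" for x and y :: real
    using that by (auto simp: space_PiM PiE_def extensional_def)
  have [measurable]: "(\<lambda>x. \<lambda>b\<in>Y. x b + a b) \<in> gaussv Y \<rightarrow>\<^sub>M gaussv Y"
    by measurable
  have shm: "(\<lambda>x. \<lambda>b\<in>insert i Y. x b + a b) \<in> gaussv (insert i Y) \<rightarrow>\<^sub>M gaussv (insert i Y)"
    by measurable
  have "(\<integral>\<^sup>+x. f (\<lambda>b\<in>insert i Y. x b + a b) \<partial>gaussv (insert i Y)) =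
      (\<integral>\<^sup>+x. \<integral>\<^sup>+y. f (\<lambda>b\<in>insert i Y. (x(i := y)) b + a b) \<partial>gauss \<partial>gaussv Y)"
    by (rule gauss_prod.product_nn_integral_insert) (use insert shm in auto)
  also have "\<dots> = (\<integral>\<^sup>+x. \<integral>\<^sup>+y. f ((\<lambda>b\<in>Y. x b + a b)(i := y + a i)) \<partial>gauss \<partial>gaussv Y)"
    using insert.hyps
    by (intro nn_integral_cong arg_cong[of _ _ f]) (auto simp: fun_eq_iff restrict_def)
  also have "\<dots> = (\<integral>\<^sup>+x. \<integral>\<^sup>+y. ?e1 y * f ((\<lambda>b\<in>Y. x b + a b)(i := y)) \<partial>gauss \<partial>gaussv Y)"
  proof (rule nn_integral_cong)
    fix x assume "x \<in> space (gaussv Y)"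
    then have *: "(\<lambda>b\<in>Y. x b + a b) \<in> space (gaussv Y)"
      by (auto simp: space_PiM)
    have "(\<lambda>y. (\<lambda>b\<in>Y. x b + a b)(i := y)) \<in> borel \<rightarrow>\<^sub>M gaussv (insert i Y)"
      by (rule measurable_fun_upd[where J=Y and I="insert i Y"]) (use * in auto)
    then show "(\<integral>\<^sup>+y. f ((\<lambda>b\<in>Y. x b + a b)(i := y + a i)) \<partial>gauss) =
         (\<integral>\<^sup>+y. ?e1 y * f ((\<lambda>b\<in>Y. x b + a b)(i := y)) \<partial>gauss)"
      by (intro nn_integral_gauss_shift) measurable
  qed
  also have "\<dots> = (\<integral>\<^sup>+x. ?e Y x * (\<integral>\<^sup>+y. ?e1 y * f (x(i := y)) \<partial>gauss) \<partial>gaussv Y)"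
  proof (rule insert.IH)
    have "(\<lambda>p. f ((fst p)(i := snd p))) \<in> borel_measurable (gaussv Y \<Otimes>\<^sub>M gauss)"
      by (intro measurable_compose[OF _ insert.prems] measurable_fun_upd[where J=Y]) auto
    then show "(\<lambda>x. \<integral>\<^sup>+y. ?e1 y * f (x(i := y)) \<partial>gauss) \<in> borel_measurable (gaussv Y)"
      by (intro gauss.borel_measurable_nn_integral) (simp add: split_beta')
  qed
  also have "\<dots> = (\<integral>\<^sup>+x. \<integral>\<^sup>+y. ?e (insert i Y) (x(i := y)) * f (x(i := y)) \<partial>gauss \<partial>gaussv Y)"
  proof (rule nn_integral_cong)
    fix x assume x: "x \<in> space (gaussv Y)"
    have "(\<lambda>y. x(i := y)) \<in> borel \<rightarrow>\<^sub>M gaussv (insert i Y)"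
      by (rule measurable_fun_upd[where J=Y and I="insert i Y"]) (use x in auto)
    then have [measurable]: "(\<lambda>y. f (x(i := y))) \<in> borel_measurable borel"
      by (rule measurable_compose[OF _ insert.prems])
    have "?e Y x * (\<integral>\<^sup>+y. ?e1 y * f (x(i := y)) \<partial>gauss) =
        (\<integral>\<^sup>+y. ?e Y x * (?e1 y * f (x(i := y))) \<partial>gauss)"
      by (intro nn_integral_cmult[symmetric]) measurable
    also have "\<dots> = (\<integral>\<^sup>+y. ?e (insert i Y) (x(i := y)) * f (x(i := y)) \<partial>gauss)"
    proof (rule nn_integral_cong)
      fix y
      have "ip Y a (x(i := y)) = ip Y a x"
        using insert.hyps by (intro sum.cong) auto
      then have "?e (insert i Y) (x(i := y)) = ?e Y x * ?e1 y"
        using insert.hyps by (simp add: ennreal_mult[symmetric] mult_exp_exp add_divide_distrib algebra_simps)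
      then show "?e Y x * (?e1 y * f (x(i := y))) = ?e (insert i Y) (x(i := y)) * f (x(i := y))"
        by (simp add: mult.assoc)
    qed
    finally show "?e Y x * (\<integral>\<^sup>+y. ?e1 y * f (x(i := y)) \<partial>gauss) =
       (\<integral>\<^sup>+y. ?e (insert i Y) (x(i := y)) * f (x(i := y)) \<partial>gauss)" .
  qed
  also have "\<dots> = (\<integral>\<^sup>+x. ?e (insert i Y) x * f x \<partial>gaussv (insert i Y))"
    by (rule gauss_prod.product_nn_integral_insert[symmetric]) (use insert in auto)
  finally show ?case .
qed

lemma nn_integral_gaussv_uminus:
  assumes "finite Y" "f \<in> borel_measurable (gaussv Y)"
  shows "(\<integral>\<^sup>+x. f (\<lambda>b\<in>Y. - x b) \<partial>gaussv Y) = (\<integral>\<^sup>+x. f x \<partial>gaussv Y)"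
proof -
  have "distr gauss gauss uminus = gauss"
  proof (rule measure_eqI)
    fix A :: "real set" assume "A \<in> sets (distr gauss gauss uminus)"
    then have [measurable]: "A \<in> sets borel" by simp
    have "emeasure gauss A = (\<integral>\<^sup>+x. indicator A x \<partial>gauss)" by simp
    also have "\<dots> = (\<integral>\<^sup>+x. indicator A (- x) \<partial>gauss)"
      by (rule nn_integral_gauss_uminus[symmetric]) measurable
    also have "\<dots> = (\<integral>\<^sup>+x. indicator A x \<partial>distr gauss gauss uminus)"
      by (subst nn_integral_distr) auto
    finally show "emeasure (distr gauss gauss uminus) A = emeasure gauss A" by simp
  qed simp
  then have eq: "distr (gaussv Y) (gaussv Y) (compose Y uminus) = gaussv Y"
    using distr_PiM_finite_prob_space'[of Y "\<lambda>_. gauss" "\<lambda>_. gauss" uminus] assms(1)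
    by (simp add: prob_space_gauss)
  have m: "compose Y uminus \<in> gaussv Y \<rightarrow>\<^sub>M gaussv Y"
    unfolding compose_def by measurable
  have "(\<integral>\<^sup>+x. f x \<partial>gaussv Y) = (\<integral>\<^sup>+x. f x \<partial>distr (gaussv Y) (gaussv Y) (compose Y uminus))"
    using eq by simp
  also have "\<dots> = (\<integral>\<^sup>+x. f (compose Y uminus x) \<partial>gaussv Y)"
    using m assms(2) by (subst nn_integral_distr) simp_all
  also have "\<dots> = (\<integral>\<^sup>+x. f (\<lambda>b\<in>Y. - x b) \<partial>gaussv Y)"
    by (simp add: compose_def)
  finally show ?thesis by simp
qed

text \<open>By Cameron-Martin the shifted measure has density \<open>exp (ip Y a x - r)\<close>,
  where \<open>r\<close> is half the squared norm of \<open>a\<close>. Symmetry of \<open>A\<close>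
  allows averaging over \<open>x\<close> and \<open>- x\<close>, and cosh \<ge> 1 then removes the
  linear term.\<close>

lemma emeasure_gaussv_shift:
  assumes "finite Y" and A [measurable]: "A \<in> sets (gaussv Y)"
    and sym: "\<And>x. x \<in> A \<Longrightarrow> (\<lambda>b\<in>Y. - x b) \<in> A"
  shows "ennreal (exp (- (\<Sum>b\<in>Y. (a b)\<^sup>2) / 2)) * emeasure (gaussv Y) A
     \<le> (\<integral>\<^sup>+x. indicator A (\<lambda>b\<in>Y. x b + a b) \<partial>gaussv Y)"
proof -
  let ?n = "\<lambda>x. \<lambda>b\<in>Y. - x b :: real"
  let ?c = "exp (- (\<Sum>b\<in>Y. (a b)\<^sup>2) / 2)"
  let ?e = "\<lambda>x. ennreal (exp (ip Y a x - (\<Sum>b\<in>Y. (a b)\<^sup>2) / 2))"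
  have [measurable]: "?e \<in> borel_measurable (gaussv Y)" by measurable
  let ?I = "\<integral>\<^sup>+x. ?e x * indicator A x \<partial>gaussv Y"
  have indn: "indicator A (?n x) = (indicator A x :: ennreal)" if "x \<in> space (gaussv Y)" for x
  proof -
    have "?n (?n x) = x" using that by (auto simp: space_PiM PiE_def extensional_def restrict_def)
    then show ?thesis using sym[of x] sym[of "?n x"] by (auto simp: indicator_def)
  qed
  have I2: "?I = (\<integral>\<^sup>+x. ?e (?n x) * indicator A x \<partial>gaussv Y)"
  proof -
    have "?I = (\<integral>\<^sup>+x. ?e (?n x) * indicator A (?n x) \<partial>gaussv Y)"
      by (rule nn_integral_gaussv_uminus[symmetric, OF assms(1)]) measurable
    also have "\<dots> = (\<integral>\<^sup>+x. ?e (?n x) * indicator A x \<partial>gaussv Y)"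
      by (rule nn_integral_cong) (simp only: indn)
    finally show ?thesis .
  qed
  have "2 * (ennreal ?c * emeasure (gaussv Y) A) = ennreal (2 * ?c) * emeasure (gaussv Y) A"
    by (subst ennreal_mult) (simp_all add: mult.assoc)
  also have "\<dots> = (\<integral>\<^sup>+x. ennreal (2 * ?c) * indicator A x \<partial>gaussv Y)"
    by (rule nn_integral_cmult_indicator[symmetric]) (rule A)
  also have "\<dots> \<le> (\<integral>\<^sup>+x. ?e x * indicator A x + ?e (?n x) * indicator A x \<partial>gaussv Y)"
  proof (rule nn_integral_mono)
    fix x
    let ?s = "ip Y a x"
    have n: "ip Y a (?n x) = - ?s" by (simp add: sum_negf)
    have "2 \<le> exp ?s + exp (- ?s)"
      using cosh_real_ge_1[of ?s] by (simp add: cosh_def)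
    then have "2 * ?c \<le> (exp ?s + exp (- ?s)) * ?c"
      by (intro mult_right_mono) auto
    then have "2 * ?c \<le> exp (?s - (\<Sum>b\<in>Y. (a b)\<^sup>2) / 2) + exp (ip Y a (?n x) - (\<Sum>b\<in>Y. (a b)\<^sup>2) / 2)"
      unfolding n by (simp only: distrib_right mult_exp_exp diff_conv_add_uminus minus_divide_left)
    then have "ennreal (2 * ?c) \<le> ?e x + ?e (?n x)"
      by (subst ennreal_plus[symmetric]) (simp_all only: ennreal_leI exp_ge_zero)
    then show "ennreal (2 * ?c) * indicator A x \<le> ?e x * indicator A x + ?e (?n x) * indicator A x"
      by (cases "x \<in> A") (simp_all only: indicator_simps mult_1_right mult_zero_right add_0_right order_refl simp_thms)
  qed
  also have "\<dots> = 2 * ?I"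
  proof -
    have "(\<integral>\<^sup>+x. ?e x * indicator A x + ?e (?n x) * indicator A x \<partial>gaussv Y) =
        ?I + (\<integral>\<^sup>+x. ?e (?n x) * indicator A x \<partial>gaussv Y)"
      by (rule nn_integral_add) measurable
    also have "\<dots> = 2 * ?I"
      unfolding I2[symmetric] by (rule mult_2[symmetric])
    finally show ?thesis .
  qed
  finally have "ennreal ?c * emeasure (gaussv Y) A \<le> ?I"
    by (rule iffD1[OF ennreal_mult_le_mult_iff, rotated 2]) simp_all
  also have "?I = (\<integral>\<^sup>+x. indicator A (\<lambda>b\<in>Y. x b + a b) \<partial>gaussv Y)"
    by (rule nn_integral_gaussv_shift[symmetric]) (use assms in auto)
  finally show ?thesis .
qed

text \<open>Markov's inequality at level 4 loses a quarter for \<Phi> and a quarter for its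
  reflection. Intersecting the two makes the set symmetric although \<Phi> need not be even, as the
  translation bound requires.\<close>

lemma prob_sym_sublevel_gaussv:
  fixes \<Phi> :: "('i \<Rightarrow> real) \<Rightarrow> real"
  assumes Y: "finite Y" and [measurable]: "\<Phi> \<in> borel_measurable (gaussv Y)"
    and int: "integrable (gaussv Y) \<Phi>" and le: "(\<integral>x. \<Phi> x \<partial>gaussv Y) \<le> 1"
    and nonneg: "\<And>x. x \<in> space (gaussv Y) \<Longrightarrow> \<Phi> x \<ge> 0"
  shows "measure (gaussv Y) {x \<in> space (gaussv Y). \<Phi> x \<le> 4 \<and> \<Phi> (\<lambda>b\<in>Y. - x b) \<le> 4} \<ge> 1 / 2"
proof -
  interpret P: prob_space "gaussv Y" by (rule prob_space_gaussv)
  let ?M = "gaussv Y" and ?n = "\<lambda>x. \<lambda>b\<in>Y. - x b :: real"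
  let ?B = "{x \<in> space ?M. \<Phi> x > 4}" and ?C = "{x \<in> space ?M. \<Phi> (?n x) > 4}"
  have "measure ?M {x \<in> space ?M. \<Phi> x \<ge> 4} \<le> (\<integral>x. \<Phi> x \<partial>?M) / 4"
    using integral_Markov_inequality_measure[OF int, of "space ?M" 4] nonneg by auto
  moreover have "measure ?M ?B \<le> measure ?M {x \<in> space ?M. \<Phi> x \<ge> 4}"
    by (intro P.finite_measure_mono) auto
  ultimately have B: "measure ?M ?B \<le> 1 / 4" using le by simp
  have "emeasure ?M ?C = (\<integral>\<^sup>+x. indicator ?B (?n x) \<partial>?M)"
  proof -
    have "emeasure ?M ?C = (\<integral>\<^sup>+x. indicator ?C x \<partial>?M)" by simp
    also have "\<dots> = (\<integral>\<^sup>+x. indicator ?B (?n x) \<partial>?M)"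
      by (intro nn_integral_cong) (auto simp: indicator_def space_PiM)
    finally show ?thesis .
  qed
  also have "\<dots> = (\<integral>\<^sup>+x. indicator ?B x \<partial>?M)"
    by (rule nn_integral_gaussv_uminus[OF Y]) measurable
  finally have C: "measure ?M ?C \<le> 1 / 4"
    using B by (simp add: measure_def)
  have "measure ?M (?B \<union> ?C) \<le> 1 / 2"
    using measure_Un_le[of ?B ?M ?C] B C by simp
  then have "measure ?M (space ?M - (?B \<union> ?C)) \<ge> 1 / 2"
    by (subst P.prob_compl) auto
  also have "space ?M - (?B \<union> ?C) = {x \<in> space ?M. \<Phi> x \<le> 4 \<and> \<Phi> (?n x) \<le> 4}" by auto
  finally show ?thesis .
qed

subsection \<open>Packing and Sudakov's bound\<close>

text \<open>Every translate of a symmetric set of Gaussian measure at least a half by a vector of norm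
  at most \<open>r\<close> has measure at least \<open>exp (- r\<^sup>2 / 2) / 2\<close>, so many translates must overlap.\<close>

lemma gauss_packing:
  fixes \<xi> :: "'j \<Rightarrow> 'i \<Rightarrow> real" and \<Phi> :: "'j \<Rightarrow> ('i \<Rightarrow> real) \<Rightarrow> real"
  assumes Y: "finite Y" and J: "finite J" and \<xi>: "\<And>j. j \<in> J \<Longrightarrow> (\<Sum>b\<in>Y. (\<xi> j b)\<^sup>2) \<le> R"
    and meas: "\<And>j. j \<in> J \<Longrightarrow> \<Phi> j \<in> borel_measurable (gaussv Y)"
    and int: "\<And>j. j \<in> J \<Longrightarrow> integrable (gaussv Y) (\<Phi> j)"
    and le: "\<And>j. j \<in> J \<Longrightarrow> (\<integral>x. \<Phi> j x \<partial>gaussv Y) \<le> 1"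
    and nonneg: "\<And>j x. j \<in> J \<Longrightarrow> x \<in> space (gaussv Y) \<Longrightarrow> \<Phi> j x \<ge> 0"
  shows "\<exists>y\<in>space (gaussv Y). real (card J) / 2 * exp (- R / 2) \<le>
           real (card {j \<in> J. \<Phi> j (\<lambda>b\<in>Y. y b - \<xi> j b) \<le> 4})"
proof -
  interpret P: prob_space "gaussv Y" by (rule prob_space_gaussv)
  let ?M = "gaussv Y" and ?n = "\<lambda>x. \<lambda>b\<in>Y. - x b :: real"
  define A where "A j = {x \<in> space ?M. \<Phi> j x \<le> 4 \<and> \<Phi> j (?n x) \<le> 4}" for j
  have A [measurable]: "A j \<in> sets ?M" if "j \<in> J" for j
  proof -
    note [measurable] = meas[OF that]
    show ?thesis unfolding A_def by measurable
  qed
  define cnt where "cnt y = card {j \<in> J. (\<lambda>b\<in>Y. y b - \<xi> j b) \<in> A j}" for y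
  have cnt_le: "cnt y \<le> card J" for y
    unfolding cnt_def using J by (intro card_mono) auto
  have fin: "finite (cnt ` space ?M)"
    by (rule finite_subset[of _ "{..card J}"]) (use cnt_le in auto)
  have ne: "cnt ` space ?M \<noteq> {}" using P.not_empty by auto
  \<comment> \<open>\<open>K\<close> is the largest number of translates with a common point. It
    dominates the expected number of translates that contain a Gaussian point, which is the sum of
    their measures.\<close>
  define K where "K = Max (cnt ` space ?M)"
  obtain y where y: "y \<in> space ?M" "cnt y = K"
    using Max_in[OF fin ne] unfolding K_def by auto
  have "ennreal (real (card J) / 2 * exp (- R / 2)) = (\<Sum>j\<in>J. ennreal (exp (- R / 2) * (1 / 2)))"
    by (subst sum_ennreal) auto
  also have "\<dots> \<le> (\<Sum>j\<in>J. \<integral>\<^sup>+x. indicator (A j) (\<lambda>b\<in>Y. x b + - \<xi> j b) \<partial>?M)"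
  proof (rule sum_mono)
    fix j assume j: "j \<in> J"
    have "ennreal (1 / 2) \<le> emeasure ?M (A j)"
      unfolding A_def P.emeasure_eq_measure
      using prob_sym_sublevel_gaussv[OF Y meas[OF j] int[OF j] le[OF j] nonneg[OF j]]
      by (intro ennreal_leI) auto
    moreover have "exp (- R / 2) \<le> exp (- (\<Sum>b\<in>Y. (- \<xi> j b)\<^sup>2) / 2)"
      using \<xi>[OF j] by simp
    ultimately have "ennreal (exp (- R / 2) * (1 / 2)) \<le>
       ennreal (exp (- (\<Sum>b\<in>Y. (- \<xi> j b)\<^sup>2) / 2)) * emeasure ?M (A j)"
      by (subst ennreal_mult) (auto intro!: mult_mono ennreal_leI)
    also have "\<dots> \<le> (\<integral>\<^sup>+x. indicator (A j) (\<lambda>b\<in>Y. x b + - \<xi> j b) \<partial>?M)"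
    proof (rule emeasure_gaussv_shift[OF Y A[OF j]])
      fix x assume x: "x \<in> A j"
      then have "?n (?n x) = x"
        by (auto simp: A_def space_PiM PiE_def extensional_def restrict_def)
      then show "?n x \<in> A j" using x by (auto simp: A_def space_PiM)
    qed
    finally show "ennreal (exp (- R / 2) * (1 / 2)) \<le>
       (\<integral>\<^sup>+x. indicator (A j) (\<lambda>b\<in>Y. x b + - \<xi> j b) \<partial>?M)" .
  qed
  also have "\<dots> = (\<integral>\<^sup>+x. (\<Sum>j\<in>J. indicator (A j) (\<lambda>b\<in>Y. x b + - \<xi> j b)) \<partial>?M)"
    using A by (intro nn_integral_sum[symmetric]) measurable
  also have "\<dots> \<le> (\<integral>\<^sup>+x. ennreal (real K) \<partial>?M)"
  proof (rule nn_integral_mono)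
    fix x assume x: "x \<in> space ?M"
    have "(\<Sum>j\<in>J. indicator (A j) (\<lambda>b\<in>Y. x b + - \<xi> j b)) = (of_nat (cnt x) :: ennreal)"
      unfolding cnt_def using J by (simp add: indicator_def sum.If_cases Int_def)
    moreover have "cnt x \<le> K"
      unfolding K_def using fin x by (intro Max_ge) auto
    ultimately show "(\<Sum>j\<in>J. indicator (A j) (\<lambda>b\<in>Y. x b + - \<xi> j b)) \<le> ennreal (real K)"
      by (simp add: ennreal_of_nat_eq_real_of_nat)
  qed
  also have "\<dots> = ennreal (real K)" by (simp add: P.emeasure_space_1)
  finally have "real (card J) / 2 * exp (- R / 2) \<le> real K" by simp
  also have "\<dots> \<le> real (card {j \<in> J. \<Phi> j (\<lambda>b\<in>Y. y b - \<xi> j b) \<le> 4})"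
    unfolding y(2)[symmetric] cnt_def
    using J by (intro of_nat_mono card_mono) (auto simp: A_def)
  finally show ?thesis using y(1) by blast
qed

text \<open>By \<open>sep\<close>, no point lies in two of the translated sublevel sets of
  \<open>h\<close> at level \<open>4 * M\<close>. The point that \<open>gauss_packing\<close> finds
  in many of them therefore lies in at most one, which bounds their number.\<close>

lemma gauss_packing_seminorm:
  fixes \<xi> :: "'j \<Rightarrow> 'i \<Rightarrow> real" and h :: "('i \<Rightarrow> real) \<Rightarrow> real"
  assumes Y: "finite Y" and J: "finite J" and \<xi>: "\<And>j. j \<in> J \<Longrightarrow> (\<Sum>b\<in>Y. (\<xi> j b)\<^sup>2) \<le> R"
    and h: "integrable (gaussv Y) h" "(\<integral>x. h x \<partial>gaussv Y) \<le> M" "M > 0"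
    and nonneg: "\<And>x. x \<in> space (gaussv Y) \<Longrightarrow> h x \<ge> 0"
    and sep: "\<And>j k y. j \<in> J \<Longrightarrow> k \<in> J \<Longrightarrow> j \<noteq> k \<Longrightarrow> y \<in> space (gaussv Y) \<Longrightarrow>
        h (\<lambda>b\<in>Y. y b - \<xi> j b) + h (\<lambda>b\<in>Y. y b - \<xi> k b) > 8 * M"
  shows "real (card J) \<le> 2 * exp (R / 2)"
proof -
  have "\<exists>y\<in>space (gaussv Y). real (card J) / 2 * exp (- R / 2) \<le>
           real (card {j \<in> J. h (\<lambda>b\<in>Y. y b - \<xi> j b) / M \<le> 4})"
    using assms by (intro gauss_packing) auto
  then obtain y where y: "y \<in> space (gaussv Y)" and
    c: "real (card J) / 2 * exp (- R / 2) \<le> real (card {j \<in> J. h (\<lambda>b\<in>Y. y b - \<xi> j b) / M \<le> 4})"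
    by blast
  have "card {j \<in> J. h (\<lambda>b\<in>Y. y b - \<xi> j b) / M \<le> 4} \<le> 1"
  proof (rule ccontr)
    assume "\<not> ?thesis"
    then obtain j k where jk: "j \<in> J" "k \<in> J" "j \<noteq> k"
      "h (\<lambda>b\<in>Y. y b - \<xi> j b) / M \<le> 4" "h (\<lambda>b\<in>Y. y b - \<xi> k b) / M \<le> 4"
      by (auto simp: card_le_Suc0_iff_eq J)
    then show False using sep[OF jk(1-3) y] h(3) by (simp add: field_simps)
  qed
  then have "real (card J) / 2 * exp (- R / 2) \<le> 1" using c by simp
  then show ?thesis by (simp add: exp_minus field_simps)
qed

text \<open>Separated sets have bounded size, so one of largest size exists; a point near none of
  its members could be added. The relation is only reflexive and symmetric, so that it can be a
  distance bound.\<close>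

lemma cover_of_packing:
  assumes pack: "\<And>F. finite F \<Longrightarrow> F \<subseteq> V \<Longrightarrow> (\<And>u v. u \<in> F \<Longrightarrow> v \<in> F \<Longrightarrow> u \<noteq> v \<Longrightarrow> \<not> near u v) \<Longrightarrow> real (card F) \<le> B"
    and refl: "\<And>u. u \<in> V \<Longrightarrow> near u u" and sym: "\<And>u v. near u v \<Longrightarrow> near v u"
  obtains F where "finite F" "F \<subseteq> V" "real (card F) \<le> B"
    "\<And>u v. u \<in> F \<Longrightarrow> v \<in> F \<Longrightarrow> u \<noteq> v \<Longrightarrow> \<not> near u v" "\<And>v. v \<in> V \<Longrightarrow> \<exists>u\<in>F. near u v"
proof -
  define P where "P F \<longleftrightarrow> finite F \<and> F \<subseteq> V \<and> (\<forall>u\<in>F. \<forall>v\<in>F. u \<noteq> v \<longrightarrow> \<not> near u v)" for F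
  have bd: "card F \<le> nat \<lfloor>B\<rfloor>" if "P F" for F
    using pack[of F] that unfolding P_def by (auto simp: le_nat_floor)
  have "P {}" by (simp add: P_def)
  then obtain F where F: "P F" and max: "\<And>G. P G \<Longrightarrow> card G \<le> card F"
    using ex_has_greatest_nat[of P "{}" card "Suc (nat \<lfloor>B\<rfloor>)"] bd by (metis less_Suc_eq_le)
  show thesis
  proof
    show "finite F" "F \<subseteq> V" using F by (auto simp: P_def)
    show "real (card F) \<le> B" using pack[of F] F by (auto simp: P_def)
    show "\<not> near u v" if "u \<in> F" "v \<in> F" "u \<noteq> v" for u v using F that by (auto simp: P_def)
    show "\<exists>u\<in>F. near u v" if v: "v \<in> V" for v
    proof (rule ccontr)
      assume n: "\<not> ?thesis"
      then have "v \<notin> F" using refl[OF v] by auto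
      moreover have "P (insert v F)" using F n v sym unfolding P_def by blast
      ultimately show False using max[of "insert v F"] F by (simp add: P_def)
    qed
  qed
qed

section \<open>Sudakov minoration by counting Gaussian translates\<close>

abbreviation l2dist :: "'i set \<Rightarrow> ('i \<Rightarrow> real) \<Rightarrow> ('i \<Rightarrow> real) \<Rightarrow> real" where
  "l2dist Y v w \<equiv> L2_set (\<lambda>b. v b - w b) Y"

lemma l2dist_triangle: "l2dist Y u w \<le> l2dist Y u v + l2dist Y v w"
proof -
  have "l2dist Y u w = L2_set (\<lambda>b. (u b - v b) + (v b - w b)) Y" by simp
  also have "\<dots> \<le> l2dist Y u v + l2dist Y v w" by (rule L2_set_triangle_ineq)
  finally show ?thesis .
qed

lemma l2dist_sym: "l2dist Y u v = l2dist Y v u"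
  by (simp add: L2_set_def power2_commute)

lemma L2_set_power2: "(L2_set v Y)\<^sup>2 = (\<Sum>b\<in>Y. (v b)\<^sup>2)"
  by (simp add: L2_set_def sum_nonneg)

text \<open>Setting of Sudakov's bound: \<open>h\<close> dominates all functionals given by
  differences of the vectors \<open>w j\<close>. Domination is asked for in two-point form, since it
  is applied to one point seen from two translates.\<close>

locale gauss_dominated =
  fixes Y :: "'i set" and h :: "('i \<Rightarrow> real) \<Rightarrow> real" and M :: real and w :: "'j \<Rightarrow> 'i \<Rightarrow> real" and J :: "'j set"
  assumes Y: "finite Y"
    and int: "integrable (gaussv Y) h" and le: "(\<integral>x. h x \<partial>gaussv Y) \<le> M" and M: "M > 0"
    and dom: "\<And>j k x y. j \<in> J \<Longrightarrow> k \<in> J \<Longrightarrow>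
       \<bar>\<Sum>b\<in>Y. (w j b - w k b) * (x b - y b)\<bar> \<le> 2 * (h x + h y)"
begin

lemma h_nonneg:
  assumes "j \<in> J" shows "h x \<ge> 0"
  using dom[OF assms assms, of x x] by simp

lemma packing_in_ball:
  assumes F: "finite F" "F \<subseteq> J" and c: "c \<in> J" and b: "b > 0"
    and ball: "\<And>j. j \<in> F \<Longrightarrow> l2dist Y (w j) (w c) \<le> 2 * b"
    and sep: "\<And>j k. j \<in> F \<Longrightarrow> k \<in> F \<Longrightarrow> j \<noteq> k \<Longrightarrow> l2dist Y (w j) (w k) \<ge> b"
  shows "real (card F) \<le> 2 * exp (578 * (M / b)\<^sup>2)"
proof -
  \<comment> \<open>Two translates of one point pair to at least
    \<open>l * b\<^sup>2 = 17 * M\<close>, which exceeds twice the \<open>8 * M\<close> needed for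
    separation. The translation vectors have norm at most \<open>2 * b * l = 34 * M / b\<close>, and
    34^2 / 2 = 578.\<close>
  define l where "l = 17 * M / b\<^sup>2"
  have l: "l > 0" using b M by (simp add: l_def)
  have "real (card F) \<le> 2 * exp ((l\<^sup>2 * (2 * b)\<^sup>2) / 2)"
  proof (rule gauss_packing_seminorm[OF Y F(1) _ int le M, where \<xi>="\<lambda>j b. l * (w j b - w c b)"])
    fix j assume "j \<in> F"
    then have "(l2dist Y (w j) (w c))\<^sup>2 \<le> (2 * b)\<^sup>2"
      using ball by (intro power_mono) auto
    then have "l\<^sup>2 * (l2dist Y (w j) (w c))\<^sup>2 \<le> l\<^sup>2 * (2 * b)\<^sup>2"
      by (intro mult_left_mono) auto
    then show "(\<Sum>b\<in>Y. (l * (w j b - w c b))\<^sup>2) \<le> l\<^sup>2 * (2 * b)\<^sup>2"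
      unfolding L2_set_power2 by (simp add: power_mult_distrib sum_distrib_left)
  next
    fix x show "0 \<le> h x" using h_nonneg[OF c] .
  next
    fix j k y assume jk: "j \<in> F" "k \<in> F" "j \<noteq> k"
    let ?x = "\<lambda>b\<in>Y. y b - l * (w k b - w c b)" and ?y = "\<lambda>b\<in>Y. y b - l * (w j b - w c b)"
    have "(\<Sum>b\<in>Y. (w j b - w k b) * (?x b - ?y b)) = l * (l2dist Y (w j) (w k))\<^sup>2"
      unfolding L2_set_power2 sum_distrib_left
      by (intro sum.cong) (auto simp: power2_eq_square algebra_simps)
    also have "\<dots> \<ge> l * b\<^sup>2"
      using sep[OF jk] b l by (intro mult_left_mono power_mono) auto
    also have "l * b\<^sup>2 = 17 * M" using b by (simp add: l_def)
    finally have "17 * M \<le> (\<Sum>b\<in>Y. (w j b - w k b) * (?x b - ?y b))" .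
    also have "\<dots> \<le> 2 * (h ?x + h ?y)"
    proof (rule order_trans[OF abs_ge_self dom])
      show "j \<in> J" "k \<in> J" using jk F by auto
    qed
    finally have "17 * M \<le> 2 * (h ?x + h ?y)" .
    then show "h ?y + h ?x > 8 * M" using M by simp
  qed
  also have "(l\<^sup>2 * (2 * b)\<^sup>2) / 2 = 578 * (M / b)\<^sup>2"
    using b by (simp add: l_def power2_eq_square field_simps)
  finally show ?thesis .
qed

text \<open>Four translates at steps of length 1/4 along the direction of \<open>w j - w k\<close>.
  At distance above \<open>64 * M\<close>, neighbours pair to more than \<open>16 * M\<close>, so
  all four are separated and the packing bound gives 4 \<le> 2 exp (9/32) < 4.\<close>

lemma diam_le:
  assumes "j \<in> J" "k \<in> J"
  shows "l2dist Y (w j) (w k) \<le> 64 * M"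
proof (rule ccontr)
  let ?d = "l2dist Y (w j) (w k)"
  assume "\<not> ?thesis"
  then have d: "?d > 64 * M" by simp
  then have d0: "?d > 0" using M by simp
  define a where "a = 1 / 4 / ?d"
  have "real (card {0..<4::nat}) \<le> 2 * exp ((9/16) / 2)"
  proof (rule gauss_packing_seminorm[OF Y _ _ int le M, where \<xi>="\<lambda>r b. real r * a * (w j b - w k b)"])
    fix r assume "r \<in> {0..<4::nat}"
    then have "real r * (1 / 4) \<le> 3/4" by auto
    then have "(real r * (1 / 4))\<^sup>2 \<le> (3/4)\<^sup>2" by (intro power_mono) auto
    moreover have "(\<Sum>b\<in>Y. (real r * a * (w j b - w k b))\<^sup>2) = (real r * a)\<^sup>2 * ?d\<^sup>2"
      unfolding L2_set_power2 by (simp add: power_mult_distrib sum_distrib_left)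
    moreover have "(real r * a)\<^sup>2 * ?d\<^sup>2 = (real r * (1 / 4))\<^sup>2"
      using d0 by (simp add: a_def power_mult_distrib power_divide)
    ultimately show "(\<Sum>b\<in>Y. (real r * a * (w j b - w k b))\<^sup>2) \<le> 9/16"
      by (simp only: power_divide) simp
  next
    fix x show "0 \<le> h x" using h_nonneg[OF assms(1)] .
  next
    fix r s :: nat and y assume rs: "r \<in> {0..<4}" "s \<in> {0..<4}" "r \<noteq> s"
    let ?x = "\<lambda>b\<in>Y. y b - real r * a * (w j b - w k b)" and ?y = "\<lambda>b\<in>Y. y b - real s * a * (w j b - w k b)"
    have "(\<Sum>b\<in>Y. (w j b - w k b) * (?x b - ?y b)) = (real s - real r) * a * ?d\<^sup>2"
      unfolding L2_set_power2 sum_distrib_left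
      by (intro sum.cong) (auto simp: power2_eq_square algebra_simps)
    also have "\<dots> = (real s - real r) * (?d / 4)"
      using d0 by (simp add: a_def power2_eq_square)
    finally have e: "(\<Sum>b\<in>Y. (w j b - w k b) * (?x b - ?y b)) = (real s - real r) * (?d / 4)" .
    have "\<bar>real s - real r\<bar> * (?d / 4) = \<bar>\<Sum>b\<in>Y. (w j b - w k b) * (?x b - ?y b)\<bar>"
      unfolding e using d0 by (simp only: abs_mult)
    also have "\<dots> \<le> 2 * (h ?x + h ?y)"
      by (rule dom[OF assms])
    finally have "\<bar>real s - real r\<bar> * (?d / 4) \<le> 2 * (h ?x + h ?y)" .
    moreover have "1 * (?d / 4) \<le> \<bar>real s - real r\<bar> * (?d / 4)"
      using rs d0 by (intro mult_right_mono) auto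
    ultimately show "8 * M < h ?x + h ?y" using d by simp
  qed auto
  moreover have "exp ((9/16) / 2) < exp (1 / 2 :: real)" by simp
  then have "exp ((9/16) / 2) < (2::real)" using exp_half_le2 by linarith
  ultimately show False by simp
qed

text \<open>Halving the radius: a ball of radius \<open>2 ^ Suc s * b\<close> is covered by the
  balls around a maximal \<open>2 ^ s * b\<close>-separated set, whose size
  \<open>packing_in_ball\<close> bounds. The exponents decrease by a factor 4 per doubling of the
  radius and form a geometric sum.\<close>

lemma sudakov_aux:
  assumes F: "finite F" "F \<subseteq> J" and c: "c \<in> F" and b: "b > 0"
    and ball: "\<And>j. j \<in> F \<Longrightarrow> l2dist Y (w j) (w c) < 2 ^ s * b"
    and sep: "\<And>j k. j \<in> F \<Longrightarrow> k \<in> F \<Longrightarrow> j \<noteq> k \<Longrightarrow> l2dist Y (w j) (w k) \<ge> b"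
  shows "real (card F) \<le> 2 ^ s * exp (578 * (M / b)\<^sup>2 * (\<Sum>r<s. (1 / 4) ^ r))"
  using F c ball sep
proof (induction s arbitrary: F c)
  case 0
  have "j = c" if "j \<in> F" for j
    using 0(4)[OF that] 0(5)[OF that 0(3)] by auto
  then have "F = {c}" using 0(3) by blast
  then show ?case by simp
next
  case (Suc s)
  let ?B = "2 * exp (578 * (M / (2 ^ s * b))\<^sup>2)"
  let ?near = "\<lambda>j k. l2dist Y (w j) (w k) < 2 ^ s * b"
  have pos: "2 ^ s * b > 0" using b by simp
  obtain G where G: "finite G" "G \<subseteq> F" "real (card G) \<le> ?B"
     and cov: "\<And>v. v \<in> F \<Longrightarrow> \<exists>u\<in>G. ?near u v"
  proof (rule cover_of_packing[of F ?near ?B])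
    fix H assume H: "finite H" "H \<subseteq> F" "\<And>u v. u \<in> H \<Longrightarrow> v \<in> H \<Longrightarrow> u \<noteq> v \<Longrightarrow> \<not> ?near u v"
    show "real (card H) \<le> ?B"
    proof (rule packing_in_ball[OF H(1) _ _ pos])
      show "H \<subseteq> J" "c \<in> J" using H Suc.prems by auto
      show "l2dist Y (w j) (w c) \<le> 2 * (2 ^ s * b)" if "j \<in> H" for j
        using Suc.prems(4)[of j] that H by auto
    qed (use H(3) in \<open>auto simp: not_less\<close>)
  next
    show "?near u u" for u using pos by (simp add: L2_set_def)
    show "?near v u" if "?near u v" for u v using that by (subst l2dist_sym)
  qed blast
  define E where "E u = {v \<in> F. ?near u v}" for u
  let ?X = "2 ^ s * exp (578 * (M / b)\<^sup>2 * (\<Sum>r<s. (1 / 4) ^ r))"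
  have "real (card F) \<le> real (card (\<Union>u\<in>G. E u))"
    using cov G Suc.prems by (intro of_nat_mono card_mono) (auto simp: E_def)
  also have "\<dots> \<le> (\<Sum>u\<in>G. real (card (E u)))"
    using card_UN_le[OF G(1), of E] by (metis of_nat_mono of_nat_sum)
  also have "\<dots> \<le> (\<Sum>u\<in>G. ?X)"
  proof (intro sum_mono)
    fix u assume u: "u \<in> G"
    show "real (card (E u)) \<le> ?X"
    proof (rule Suc.IH[of "E u" u])
      show "finite (E u)" "E u \<subseteq> J" using Suc.prems by (auto simp: E_def)
      show "u \<in> E u" using u G pos by (auto simp: E_def L2_set_def)
      show "l2dist Y (w j) (w u) < 2 ^ s * b" if "j \<in> E u" for j
        using that unfolding E_def by (subst l2dist_sym) blast
      show "b \<le> l2dist Y (w j) (w k)" if "j \<in> E u" "k \<in> E u" "j \<noteq> k" for j k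
        using that Suc.prems(5) by (auto simp: E_def)
    qed
  qed
  also have "\<dots> = real (card G) * ?X" by simp
  also have "\<dots> \<le> ?B * ?X" by (intro mult_right_mono G) auto
  also have "\<dots> = 2 ^ Suc s * exp (578 * (M / b)\<^sup>2 * (\<Sum>r<Suc s. (1 / 4) ^ r))"
  proof -
    have "578 * (M / (2 ^ s * b))\<^sup>2 = 578 * (M / b)\<^sup>2 * (1 / 4) ^ s"
      by (simp add: power_mult_distrib power_divide power2_eq_square[of "2 ^ s"] power_mult_distrib[symmetric])
    then show ?thesis by (simp add: mult_exp_exp distrib_left add.commute)
  qed
  finally show ?case .
qed

lemma sudakov:
  assumes F: "finite F" "F \<subseteq> J" and b: "b > 0"
    and sep: "\<And>j k. j \<in> F \<Longrightarrow> k \<in> F \<Longrightarrow> j \<noteq> k \<Longrightarrow> l2dist Y (w j) (w k) \<ge> b"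
  shows "real (card F) \<le> exp (10000 * (M / b)\<^sup>2)"
proof (cases "card F \<le> 1")
  case True
  then have "real (card F) \<le> 1" by simp
  also have "1 \<le> exp (10000 * (M / b)\<^sup>2)" by simp
  finally show ?thesis .
next
  case False
  then obtain j k where jk: "j \<in> F" "k \<in> F" "j \<noteq> k"
    using F by (auto simp: card_le_Suc0_iff_eq)
  define u where "u = M / b"
  have "j \<in> J" "k \<in> J" using jk F by auto
  then have "b \<le> 64 * M" using sep[OF jk] diam_le by (meson order_trans)
  then have u: "u > 0" "64 * u \<ge> 1"
    using b M by (auto simp: u_def field_simps)
  \<comment> \<open>The first dyadic radius beyond the diameter, in units of \<open>b\<close>. The
    factor \<open>2 ^ s\<close> is at most 128 u, hence at most 8192 u^2 because 64 u \<ge> 1;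
    together with 2 * 578 this gives 9348, rounded up to 10000.\<close>
  obtain s :: nat where s: "64 * u < 2 ^ s" "2 ^ s \<le> 128 * u"
  proof -
    define s where "s = (LEAST s. 64 * u < 2 ^ s)"
    have ex: "\<exists>s. 64 * u < 2 ^ s"
      using real_arch_pow[of 2 "64 * u"] by auto
    have 1: "64 * u < 2 ^ s" unfolding s_def by (rule LeastI_ex[OF ex])
    moreover have "2 ^ s \<le> 128 * u"
    proof (cases s)
      case 0 then show ?thesis using u by simp
    next
      case (Suc r)
      then have "\<not> 64 * u < 2 ^ r" unfolding s_def by (intro not_less_Least) simp
      then show ?thesis using Suc by simp
    qed
    ultimately show thesis using that by blast
  qed
  have "real (card F) \<le> 2 ^ s * exp (578 * (M / b)\<^sup>2 * (\<Sum>r<s. (1 / 4) ^ r))"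
  proof (rule sudakov_aux[OF F jk(1) b _ sep])
    fix i assume "i \<in> F"
    then have "l2dist Y (w i) (w j) \<le> 64 * M" using diam_le[of i j] jk F by auto
    also have "\<dots> = 64 * u * b" using b by (simp add: u_def)
    also have "\<dots> < 2 ^ s * b" using s b by (intro mult_strict_right_mono) auto
    finally show "l2dist Y (w i) (w j) < 2 ^ s * b" .
  qed
  also have "\<dots> \<le> exp (128 * 64 * u\<^sup>2) * exp (578 * (M / b)\<^sup>2 * 2)"
  proof (intro mult_mono)
    have "2 ^ s \<le> 128 * u" by (rule s)
    also have "\<dots> \<le> 128 * u * (64 * u)" using u by (simp add: mult_left_mono)
    also have "\<dots> = 128 * 64 * u\<^sup>2" by (simp add: power2_eq_square)
    also have "\<dots> \<le> exp (128 * 64 * u\<^sup>2)"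
      using exp_ge_add_one_self[of "128 * 64 * u\<^sup>2"] by linarith
    finally show "2 ^ s \<le> exp (128 * 64 * u\<^sup>2)" .
    have "(\<Sum>r<s. (1 / 4 :: real) ^ r) = (1 - (1 / 4) ^ s) / (3 / 4)"
      by (simp add: sum_gp_strict)
    also have "\<dots> \<le> 2" by (simp add: field_simps)
    finally have "578 * (M / b)\<^sup>2 * (\<Sum>r<s. (1 / 4 :: real) ^ r) \<le> 578 * (M / b)\<^sup>2 * 2"
      by (intro mult_left_mono) auto
    then show "exp (578 * (M / b)\<^sup>2 * (\<Sum>r<s. (1 / 4) ^ r)) \<le> exp (578 * (M / b)\<^sup>2 * 2)"
      by simp
  qed auto
  also have "\<dots> = exp (9348 * u\<^sup>2)" by (simp add: mult_exp_exp u_def)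
  also have "\<dots> \<le> exp (10000 * (M / b)\<^sup>2)" by (simp add: u_def mult_right_mono)
  finally show ?thesis .
qed

end

subsection \<open>Concentration of maxima of linear functions\<close>

lemma measurable_gaussv_upd:
  assumes "f \<in> N \<rightarrow>\<^sub>M gaussv Y" "g \<in> borel_measurable N"
  shows "(\<lambda>z. (f z)(i := g z)) \<in> N \<rightarrow>\<^sub>M gaussv (insert i Y)"
  using assms by (intro measurable_fun_upd[where J=Y]) auto

lemma nn_integral_gaussv_pair_insert:
  assumes Y: "finite Y" "i \<notin> Y"
    and H: "(\<lambda>(x, y). H x y) \<in> borel_measurable (gaussv (insert i Y) \<Otimes>\<^sub>M gaussv (insert i Y))"
  shows "(\<integral>\<^sup>+x. \<integral>\<^sup>+y. H x y \<partial>gaussv (insert i Y) \<partial>gaussv (insert i Y)) =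
    (\<integral>\<^sup>+x. \<integral>\<^sup>+y. \<integral>\<^sup>+u. \<integral>\<^sup>+v. H (x(i := u)) (y(i := v)) \<partial>gauss \<partial>gauss \<partial>gaussv Y \<partial>gaussv Y)"
proof -
  interpret PY: prob_space "gaussv Y" by (rule prob_space_gaussv)
  interpret PI: prob_space "gaussv (insert i Y)" by (rule prob_space_gaussv)
  interpret Q: pair_sigma_finite gauss "gaussv Y" ..
  have Hc: "(\<lambda>z. H (a z) (b z)) \<in> borel_measurable N"
    if "a \<in> N \<rightarrow>\<^sub>M gaussv (insert i Y)" "b \<in> N \<rightarrow>\<^sub>M gaussv (insert i Y)" for a b N
    using measurable_compose[OF measurable_Pair[OF that] H] by simp
  have "(\<integral>\<^sup>+x. \<integral>\<^sup>+y. H x y \<partial>gaussv (insert i Y) \<partial>gaussv (insert i Y)) =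
     (\<integral>\<^sup>+x. \<integral>\<^sup>+u. \<integral>\<^sup>+y. H (x(i := u)) y \<partial>gaussv (insert i Y) \<partial>gauss \<partial>gaussv Y)"
    by (rule gauss_prod.product_nn_integral_insert[OF Y])
       (intro PI.borel_measurable_nn_integral H)
  also have "\<dots> = (\<integral>\<^sup>+x. \<integral>\<^sup>+u. \<integral>\<^sup>+y. \<integral>\<^sup>+v. H (x(i := u)) (y(i := v)) \<partial>gauss \<partial>gaussv Y \<partial>gauss \<partial>gaussv Y)"
  proof (intro nn_integral_cong)
    fix x u assume x: "x \<in> space (gaussv Y)"
    then have "x(i := u) \<in> space (gaussv (insert i Y))"
      by (auto simp: space_PiM PiE_def extensional_def)
    then show "(\<integral>\<^sup>+y. H (x(i := u)) y \<partial>gaussv (insert i Y)) =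
        (\<integral>\<^sup>+y. \<integral>\<^sup>+v. H (x(i := u)) (y(i := v)) \<partial>gauss \<partial>gaussv Y)"
      by (intro gauss_prod.product_nn_integral_insert[OF Y] Hc) auto
  qed
  also have "\<dots> = (\<integral>\<^sup>+x. \<integral>\<^sup>+y. \<integral>\<^sup>+u. \<integral>\<^sup>+v. H (x(i := u)) (y(i := v)) \<partial>gauss \<partial>gauss \<partial>gaussv Y \<partial>gaussv Y)"
  proof (intro nn_integral_cong)
    fix x assume x: "x \<in> space (gaussv Y)"
    have "(\<lambda>z. H (x(i := fst (fst z))) ((snd (fst z))(i := snd z))) \<in> borel_measurable ((gauss \<Otimes>\<^sub>M gaussv Y) \<Otimes>\<^sub>M gauss)"
      using x by (intro Hc measurable_gaussv_upd) (auto intro!: measurable_const)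
    then show "(\<integral>\<^sup>+u. \<integral>\<^sup>+y. \<integral>\<^sup>+v. H (x(i := u)) (y(i := v)) \<partial>gauss \<partial>gaussv Y \<partial>gauss) =
        (\<integral>\<^sup>+y. \<integral>\<^sup>+u. \<integral>\<^sup>+v. H (x(i := u)) (y(i := v)) \<partial>gauss \<partial>gauss \<partial>gaussv Y)"
      by (intro Q.Fubini'[symmetric] gauss.borel_measurable_nn_integral) (simp add: split_beta')
  qed
  finally show ?thesis .
qed

lemma nn_integral_gaussv_rotation:
  assumes "finite Y" and F: "(\<lambda>(x, y). F x y) \<in> borel_measurable (gaussv Y \<Otimes>\<^sub>M gaussv Y)"
    and cs: "c\<^sup>2 + s\<^sup>2 = (1::real)" "c \<ge> 0" "s \<ge> 0"
  shows "(\<integral>\<^sup>+x. \<integral>\<^sup>+y. F (\<lambda>b\<in>Y. c * x b + s * y b) (\<lambda>b\<in>Y. c * y b - s * x b) \<partial>gaussv Y \<partial>gaussv Y) =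
         (\<integral>\<^sup>+x. \<integral>\<^sup>+y. F x y \<partial>gaussv Y \<partial>gaussv Y)"
  using assms(1,2)
proof (induction Y arbitrary: F rule: finite_induct)
  case empty
  show ?case
    by (intro nn_integral_cong) (auto simp: space_PiM)
next
  case (insert i Y)
  let ?I = "insert i Y"
  let ?A = "\<lambda>Y x y. \<lambda>b\<in>Y. c * x b + s * y b" and ?B = "\<lambda>Y x y. \<lambda>b\<in>Y. c * y b - s * x b"
  interpret PY: prob_space "gaussv Y" by (rule prob_space_gaussv)
  have Fc: "(\<lambda>z. F (a z) (b z)) \<in> borel_measurable N"
    if "a \<in> N \<rightarrow>\<^sub>M gaussv ?I" "b \<in> N \<rightarrow>\<^sub>M gaussv ?I" for a b N
    using measurable_compose[OF measurable_Pair[OF that] insert.prems] by simp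
  have AB: "(\<lambda>z. ?A ?I (fst z) (snd z)) \<in> gaussv ?I \<Otimes>\<^sub>M gaussv ?I \<rightarrow>\<^sub>M gaussv ?I"
    "(\<lambda>z. ?B ?I (fst z) (snd z)) \<in> gaussv ?I \<Otimes>\<^sub>M gaussv ?I \<rightarrow>\<^sub>M gaussv ?I"
    by measurable
  define K where "K x y = (\<integral>\<^sup>+u. \<integral>\<^sup>+v. F (x(i := u)) (y(i := v)) \<partial>gauss \<partial>gauss)" for x y
  have "(\<integral>\<^sup>+x. \<integral>\<^sup>+y. F (?A ?I x y) (?B ?I x y) \<partial>gaussv ?I \<partial>gaussv ?I) =
     (\<integral>\<^sup>+x. \<integral>\<^sup>+y. \<integral>\<^sup>+u. \<integral>\<^sup>+v. F (?A ?I (x(i := u)) (y(i := v))) (?B ?I (x(i := u)) (y(i := v))) \<partial>gauss \<partial>gauss \<partial>gaussv Y \<partial>gaussv Y)"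
    by (rule nn_integral_gaussv_pair_insert[OF insert.hyps]) (use Fc[OF AB] in \<open>simp add: split_beta'\<close>)
  also have "\<dots> = (\<integral>\<^sup>+x. \<integral>\<^sup>+y. \<integral>\<^sup>+u. \<integral>\<^sup>+v. F ((?A Y x y)(i := c * u + s * v)) ((?B Y x y)(i := c * v - s * u)) \<partial>gauss \<partial>gauss \<partial>gaussv Y \<partial>gaussv Y)"
    using insert.hyps
    by (intro nn_integral_cong arg_cong2[of _ _ _ _ F]) (auto simp: fun_eq_iff restrict_def)
  also have "\<dots> = (\<integral>\<^sup>+x. \<integral>\<^sup>+y. K (?A Y x y) (?B Y x y) \<partial>gaussv Y \<partial>gaussv Y)"
  proof (intro nn_integral_cong)
    fix x y
    have "?A Y x y \<in> space (gaussv Y)" "?B Y x y \<in> space (gaussv Y)"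
      by (auto simp: space_PiM)
    then have "(\<lambda>z. F ((?A Y x y)(i := fst z)) ((?B Y x y)(i := snd z))) \<in> borel_measurable (borel \<Otimes>\<^sub>M borel)"
      by (intro Fc measurable_gaussv_upd) (auto intro!: measurable_const)
    then show "(\<integral>\<^sup>+u. \<integral>\<^sup>+v. F ((?A Y x y)(i := c * u + s * v)) ((?B Y x y)(i := c * v - s * u)) \<partial>gauss \<partial>gauss) = K (?A Y x y) (?B Y x y)"
      unfolding K_def by (intro nn_integral_gauss_rotation cs) (simp add: split_beta')
  qed
  also have "\<dots> = (\<integral>\<^sup>+x. \<integral>\<^sup>+y. K x y \<partial>gaussv Y \<partial>gaussv Y)"
  proof (rule insert.IH)
    have "(\<lambda>z. F ((fst (fst (fst z)))(i := snd (fst z))) ((snd (fst (fst z)))(i := snd z))) \<in>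
        borel_measurable (((gaussv Y \<Otimes>\<^sub>M gaussv Y) \<Otimes>\<^sub>M gauss) \<Otimes>\<^sub>M gauss)"
      by (intro Fc measurable_gaussv_upd) auto
    then show "(\<lambda>(x, y). K x y) \<in> borel_measurable (gaussv Y \<Otimes>\<^sub>M gaussv Y)"
      unfolding K_def split_beta' by (intro gauss.borel_measurable_nn_integral) (simp add: split_beta')
  qed
  also have "\<dots> = (\<integral>\<^sup>+x. \<integral>\<^sup>+y. F x y \<partial>gaussv ?I \<partial>gaussv ?I)"
    unfolding K_def by (rule nn_integral_gaussv_pair_insert[symmetric, OF insert.hyps insert.prems])
  finally show ?case .
qed

lemma nn_integral_exp_ip:
  assumes "finite Y"
  shows "(\<integral>\<^sup>+x. ennreal (exp (ip Y a x)) \<partial>gaussv Y) = ennreal (exp ((L2_set a Y)\<^sup>2 / 2))"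
proof -
  interpret P: prob_space "gaussv Y" by (rule prob_space_gaussv)
  let ?c = "(\<Sum>b\<in>Y. (a b)\<^sup>2) / 2"
  have "(\<integral>\<^sup>+x. ennreal (exp (ip Y a x)) \<partial>gaussv Y) = (\<integral>\<^sup>+x. ennreal (exp ?c) * ennreal (exp (ip Y a x - ?c)) \<partial>gaussv Y)"
    by (intro nn_integral_cong) (simp add: ennreal_mult[symmetric] mult_exp_exp)
  also have "\<dots> = ennreal (exp ?c) * (\<integral>\<^sup>+x. ennreal (exp (ip Y a x - ?c)) * 1 \<partial>gaussv Y)"
    by (subst nn_integral_cmult) auto
  also have "(\<integral>\<^sup>+x. ennreal (exp (ip Y a x - ?c)) * 1 \<partial>gaussv Y) = (\<integral>\<^sup>+x. 1 \<partial>gaussv Y)"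
    by (rule nn_integral_gaussv_shift[symmetric]) (use assms in auto)
  also have "\<dots> = 1" by (simp add: P.emeasure_space_1)
  finally show ?thesis by (simp add: L2_set_power2)
qed

lemma integrable_gaussv_component:
  assumes "finite Y" "b \<in> Y"
  shows "integrable (gaussv Y) (\<lambda>x. x b)" "(\<integral>x. x b \<partial>gaussv Y) = 0"
proof -
  have d: "distr (gaussv Y) gauss (\<lambda>x. x b) = gauss"
    using assms by (intro distr_PiM_component) (auto simp: prob_space_gauss)
  have i: "integrable gauss (\<lambda>x. x)" "(\<integral>x. x \<partial>gauss) = 0"
    unfolding gauss_def
    using integrable_std_normal_moment[of 1] integral_std_normal_moment_odd[of 0]
    by (simp_all add: integrable_density integral_density)
  have m: "(\<lambda>x. x b) \<in> gaussv Y \<rightarrow>\<^sub>M gauss" using assms by measurable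
  show "integrable (gaussv Y) (\<lambda>x. x b)"
    using integrable_distr[OF m, of "\<lambda>x. x"] i d by simp
  show "(\<integral>x. x b \<partial>gaussv Y) = 0"
    using integral_distr[OF m, of "\<lambda>x. x"] i d by simp
qed

lemma integrable_ip:
  assumes "finite Y"
  shows "integrable (gaussv Y) (ip Y a)" "(\<integral>x. ip Y a x \<partial>gaussv Y) = 0"
  using assms by (auto simp: integrable_gaussv_component)

abbreviation maxip :: "'i set \<Rightarrow> 'j set \<Rightarrow> ('j \<Rightarrow> 'i \<Rightarrow> real) \<Rightarrow> ('i \<Rightarrow> real) \<Rightarrow> real" where
  "maxip Y Q v x \<equiv> Max ((\<lambda>q. ip Y (v q) x) ` Q)"

lemma measurable_maxip:
  assumes "finite Q"
  shows "maxip Y Q v \<in> borel_measurable (gaussv Y)"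
  using assms by measurable

lemma integrable_maxip:
  assumes "finite Y" "finite Q" "Q \<noteq> {}"
  shows "integrable (gaussv Y) (maxip Y Q v)"
proof (rule Bochner_Integration.integrable_bound)
  show "integrable (gaussv Y) (\<lambda>x. \<Sum>q\<in>Q. \<bar>ip Y (v q) x\<bar>)"
    using assms by (intro Bochner_Integration.integrable_sum integrable_abs integrable_ip)
  show "AE x in gaussv Y. norm (maxip Y Q v x) \<le> norm (\<Sum>q\<in>Q. \<bar>ip Y (v q) x\<bar>)"
  proof (rule AE_I2)
    fix x
    have "maxip Y Q v x \<in> (\<lambda>q. ip Y (v q) x) ` Q"
      using assms by (intro Max_in) auto
    then obtain q where "q \<in> Q" "maxip Y Q v x = ip Y (v q) x" by auto
    then show "norm (maxip Y Q v x) \<le> norm (\<Sum>q\<in>Q. \<bar>ip Y (v q) x\<bar>)"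
      using member_le_sum[of q Q "\<lambda>q. \<bar>ip Y (v q) x\<bar>"] assms by (simp add: sum_nonneg)
  qed
qed (use assms measurable_maxip in auto)

text \<open>A common vector contributes a linear term outside the maximum. Its Gaussian mean is
  zero, so expected maxima depend on differences of the vectors only and norms can be replaced by
  the diameter.\<close>

lemma maxip_diff:
  assumes "finite Q" "Q \<noteq> {}"
  shows "maxip Y Q v x = maxip Y Q (\<lambda>q b. v q b - c b) x + ip Y c x"
proof -
  have "(\<lambda>q. ip Y (v q) x) ` Q = (\<lambda>t. t + ip Y c x) ` ((\<lambda>q. ip Y (\<lambda>b. v q b - c b) x) ` Q)"
    by (simp add: image_image left_diff_distrib sum_subtractf)
  then show ?thesis
    using assms Max_add_commute[of "(\<lambda>q. ip Y (\<lambda>b. v q b - c b) x) ` Q" id "ip Y c x"]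
    by (simp add: image_image)
qed

lemma one_minus_cos_le: "1 - cos x \<le> x\<^sup>2 / 2" for x :: real
proof -
  have "1 - cos x = 2 * (sin (x / 2))\<^sup>2"
    using cos_double_sin[of "x / 2"] by simp
  also have "(sin (x / 2))\<^sup>2 \<le> (x / 2)\<^sup>2"
    using abs_sin_x_le_abs_x[of "x / 2"] by (simp add: abs_le_square_iff[symmetric])
  finally show ?thesis by (simp add: power2_eq_square)
qed

text \<open>Maurey and Pisier's argument: rotate \<open>y\<close> into \<open>x\<close> in \<open>m\<close> steps. The subgradient of the
  maximum at one end of a step is independent of the rotated partner vector, and by convexity of
  \<open>exp\<close> the steps can be averaged instead of multiplied.\<close>

lemma exp_maxip_diff_step:
  fixes w :: "nat \<Rightarrow> 'i \<Rightarrow> real"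
  assumes Y: "finite Y" and N: "N > 0" and w: "\<And>j. j < N \<Longrightarrow> L2_set (w j) Y \<le> R"
    and l: "l \<ge> 0" and m: "m \<ge> (2::nat)"
  shows "(\<integral>\<^sup>+x. \<integral>\<^sup>+y. ennreal (exp (l * (maxip Y {..<N} w x - maxip Y {..<N} w y))) \<partial>gaussv Y \<partial>gaussv Y)
    \<le> ennreal (exp (l\<^sup>2 * pi\<^sup>2 * R\<^sup>2 / 8) * (1 + 2 / real m * (real N * exp (l\<^sup>2 * R\<^sup>2 / 2))))"
proof -
  interpret P: prob_space "gaussv Y" by (rule prob_space_gaussv)
  let ?M = "gaussv Y"
  define f where "f = maxip Y {..<N} w"
  have f_meas [measurable]: "f \<in> borel_measurable ?M"
    unfolding f_def by (rule measurable_maxip) simp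
  have f_ge: "ip Y (w j) x \<le> f x" if "j < N" for j x
    unfolding f_def using that by (intro Max_ge) auto
  define sel where "sel x = (LEAST j. j < N \<and> f x \<le> ip Y (w j) x)" for x
  have sel: "sel x < N" "f x = ip Y (w (sel x)) x" for x
  proof -
    have "f x \<in> (\<lambda>j. ip Y (w j) x) ` {..<N}"
      unfolding f_def using N by (intro Max_in) auto
    then have "\<exists>j. j < N \<and> f x \<le> ip Y (w j) x" by auto
    then have "sel x < N \<and> f x \<le> ip Y (w (sel x)) x"
      unfolding sel_def by (rule LeastI_ex)
    then show "sel x < N" "f x = ip Y (w (sel x)) x" using f_ge[of "sel x" x] by auto
  qed
  have sel_meas [measurable]: "sel \<in> ?M \<rightarrow>\<^sub>M count_space UNIV"
    unfolding sel_def[abs_def]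
  proof (rule measurable_Least)
    fix j
    have "ip Y (w j) \<in> borel_measurable ?M" by measurable
    then have "{x \<in> space ?M. f x \<le> ip Y (w j) x} \<in> sets ?M"
      by (rule borel_measurable_le[OF f_meas])
    then show "(\<lambda>x. j < N \<and> f x \<le> ip Y (w j) x) \<in> ?M \<rightarrow>\<^sub>M count_space UNIV"
      by (cases "j < N") (simp_all add: pred_def)
  qed
  have f_cong: "f x = f y" if "\<And>b. b \<in> Y \<Longrightarrow> x b = y b" for x y
    unfolding f_def using that by (intro arg_cong[of _ _ Max] image_cong sum.cong) auto
  have R0: "R \<ge> 0" using w[OF N] L2_set_nonneg order_trans by blast
  define h where "h = pi / (2 * real m)"
  have h: "0 < h" "h \<le> pi / 2"
    using m by (auto simp: h_def divide_simps)
  \<comment> \<open>\<open>a\<close> and \<open>bM\<close> are the coefficients of the radial and of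
    the orthogonal part of one rotation step, multiplied by the number of steps. The first is O(1/m)
    and disappears in the limit; the second is at most pi / 2 and determines the variance.\<close>
  define a where "a = real m * (1 - cos h)"
  define bM where "bM = real m * sin h"
  have a: "0 \<le> a" "a \<le> 2 / real m" "a \<le> 1"
  proof -
    show "0 \<le> a" by (simp add: a_def)
    have "a \<le> real m * (h\<^sup>2 / 2)" unfolding a_def by (intro mult_left_mono one_minus_cos_le) auto
    also have "\<dots> = pi\<^sup>2 / 8 / real m" using m by (simp add: h_def power2_eq_square field_simps)
    also have "\<dots> \<le> 2 / real m"
    proof (intro divide_right_mono)
      have "pi\<^sup>2 \<le> 4\<^sup>2" using pi_less_4 by (intro power_mono) auto
      then show "pi\<^sup>2 / 8 \<le> 2" by simp
    qed auto
    finally show "a \<le> 2 / real m" .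
    also have "\<dots> \<le> 1" using m by simp
    finally show "a \<le> 1" .
  qed
  have bM: "0 \<le> bM" "bM \<le> pi / 2"
  proof -
    have "sin h \<ge> 0" using h by (intro sin_ge_zero) auto
    then show "0 \<le> bM" by (simp add: bM_def)
    have "bM \<le> real m * h" unfolding bM_def using h by (intro mult_left_mono sin_x_le_x) auto
    then show "bM \<le> pi / 2" using m by (simp add: h_def)
  qed
  let ?A = "\<lambda>r x y. \<lambda>b\<in>Y. sin (real r * h) * x b + cos (real r * h) * y b"
  let ?B = "\<lambda>r x y. \<lambda>b\<in>Y. sin (real r * h) * y b - cos (real r * h) * x b"
  define \<Psi> where "\<Psi> u v = exp (l * (a * f u - bM * ip Y (w (sel u)) v))" for u v
  have \<Psi>_meas: "(\<lambda>(u, v). ennreal (\<Psi> u v)) \<in> borel_measurable (?M \<Otimes>\<^sub>M ?M)"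
  proof -
    have "(\<lambda>p. w (sel (fst p)) b) \<in> borel_measurable (?M \<Otimes>\<^sub>M ?M)" for b
      by (rule measurable_compose[OF measurable_compose[OF measurable_fst sel_meas]]) simp
    then show ?thesis unfolding \<Psi>_def split_beta' by measurable
  qed
  \<comment> \<open>Stepping back, \<open>?A r = cos h * ?A (Suc r) + sin h * ?B (Suc r)\<close>.
    The vector selected at \<open>?A (Suc r)\<close> gives a lower bound for
    \<open>f (?A r)\<close>.\<close>
  have step: "f (?A (Suc r) x y) - f (?A r x y) \<le>
      (1 - cos h) * f (?A (Suc r) x y) - sin h * ip Y (w (sel (?A (Suc r) x y))) (?B (Suc r) x y)" for r x y
  proof -
    let ?j = "sel (?A (Suc r) x y)"
    have s: "sin (real r * h) = sin (real (Suc r) * h) * cos h - cos (real (Suc r) * h) * sin h"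
      and c: "cos (real r * h) = cos (real (Suc r) * h) * cos h + sin (real (Suc r) * h) * sin h"
      using sin_diff[of "real (Suc r) * h" h] cos_diff[of "real (Suc r) * h" h]
      by (simp_all add: algebra_simps)
    have "ip Y (w ?j) (?A r x y) = cos h * ip Y (w ?j) (?A (Suc r) x y) + sin h * ip Y (w ?j) (?B (Suc r) x y)"
      unfolding sum_distrib_left sum.distrib[symmetric] s c
      by (intro sum.cong) (auto simp: algebra_simps)
    moreover have "ip Y (w ?j) (?A r x y) \<le> f (?A r x y)" by (rule f_ge[OF sel(1)])
    moreover have "f (?A (Suc r) x y) = ip Y (w ?j) (?A (Suc r) x y)" by (rule sel(2))
    ultimately show ?thesis by (simp add: left_diff_distrib)
  qed
  \<comment> \<open>The telescoping sum is read as an average of m terms, each m times a single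
    increment, so that Jensen's inequality for exp turns it into an average of exponentials. By
    rotation invariance all of these have the same integral.\<close>
  have main: "exp (l * (f x - f y)) \<le> (1 / real m) * (\<Sum>r<m. \<Psi> (?A (Suc r) x y) (?B (Suc r) x y))" for x y
  proof -
    let ?t = "\<lambda>r. l * (real m * (f (?A (Suc r) x y) - f (?A r x y)))"
    have "f (?A m x y) = f x" by (rule f_cong) (use m in \<open>simp add: h_def\<close>)
    moreover have "f (?A 0 x y) = f y" by (rule f_cong) simp
    ultimately have tel: "f x - f y = (\<Sum>r<m. f (?A (Suc r) x y) - f (?A r x y))"
      using sum_lessThan_telescope[of "\<lambda>r. f (?A r x y)" m] by simp
    have "l * (f x - f y) = (\<Sum>r<m. (1 / real m) *\<^sub>R ?t r)"
      unfolding tel sum_distrib_left using m by (intro sum.cong) auto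
    then have "exp (l * (f x - f y)) = exp (\<Sum>r<m. (1 / real m) *\<^sub>R ?t r)" by simp
    also have "\<dots> \<le> (\<Sum>r<m. (1 / real m) * exp (?t r))"
      using m by (intro convex_on_sum[OF _ _ exp_convex]) (auto simp: lessThan_empty_iff)
    also have "\<dots> \<le> (\<Sum>r<m. (1 / real m) * \<Psi> (?A (Suc r) x y) (?B (Suc r) x y))"
    proof (intro sum_mono mult_left_mono)
      fix r
      have alg: "p * ((1 - c) * F - s * I) = p * (1 - c) * F - p * s * I" for p c F s I :: real
        by (simp add: algebra_simps)
      have "real m * (f (?A (Suc r) x y) - f (?A r x y)) \<le>
          real m * ((1 - cos h) * f (?A (Suc r) x y) - sin h * ip Y (w (sel (?A (Suc r) x y))) (?B (Suc r) x y))"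
        by (intro mult_left_mono step) auto
      also have "\<dots> = a * f (?A (Suc r) x y) - bM * ip Y (w (sel (?A (Suc r) x y))) (?B (Suc r) x y)"
        unfolding a_def bM_def by (rule alg)
      finally show "exp (?t r) \<le> \<Psi> (?A (Suc r) x y) (?B (Suc r) x y)"
        unfolding \<Psi>_def using l by (simp add: mult_left_mono)
    qed auto
    finally show ?thesis by (simp only: sum_distrib_left)
  qed
  have rot: "(\<integral>\<^sup>+x. \<integral>\<^sup>+y. ennreal (\<Psi> (?A r x y) (?B r x y)) \<partial>?M \<partial>?M) = (\<integral>\<^sup>+x. \<integral>\<^sup>+y. ennreal (\<Psi> x y) \<partial>?M \<partial>?M)"
    if "r \<le> m" for r
  proof (rule nn_integral_gaussv_rotation[OF Y \<Psi>_meas])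
    have "real r * h \<le> real m * h" using that h by (intro mult_right_mono) auto
    also have "\<dots> = pi / 2" using m by (simp add: h_def)
    finally have r: "0 \<le> real r * h" "real r * h \<le> pi / 2" using h by auto
    show "sin (real r * h) \<ge> 0" using r by (intro sin_ge_zero) auto
    show "cos (real r * h) \<ge> 0" using r by (intro cos_ge_zero) auto
  qed simp
  have AB_meas: "(\<lambda>p. ?A r (fst p) (snd p)) \<in> ?M \<Otimes>\<^sub>M ?M \<rightarrow>\<^sub>M ?M"
    "(\<lambda>p. ?B r (fst p) (snd p)) \<in> ?M \<Otimes>\<^sub>M ?M \<rightarrow>\<^sub>M ?M" for r
    by measurable
  have \<Psi>AB: "(\<lambda>p. ennreal (\<Psi> (?A r (fst p) (snd p)) (?B r (fst p) (snd p)))) \<in> borel_measurable (?M \<Otimes>\<^sub>M ?M)" for r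
    using measurable_compose[OF measurable_Pair[OF AB_meas] \<Psi>_meas] by simp
  have \<Psi>AB2: "(\<lambda>y. ennreal (\<Psi> (?A r x y) (?B r x y))) \<in> borel_measurable ?M" if "x \<in> space ?M" for r x
    using measurable_compose[OF measurable_Pair[OF measurable_const[OF that] measurable_ident] \<Psi>AB] by simp
  have \<Psi>AB1: "(\<lambda>x. \<integral>\<^sup>+y. ennreal (\<Psi> (?A r x y) (?B r x y)) \<partial>?M) \<in> borel_measurable ?M" for r
    using \<Psi>AB by (intro P.borel_measurable_nn_integral) (simp add: split_beta')
  have "(\<integral>\<^sup>+x. \<integral>\<^sup>+y. ennreal (exp (l * (f x - f y))) \<partial>?M \<partial>?M) \<le>
     (\<integral>\<^sup>+x. \<integral>\<^sup>+y. ennreal (1 / real m) * (\<Sum>r<m. ennreal (\<Psi> (?A (Suc r) x y) (?B (Suc r) x y))) \<partial>?M \<partial>?M)"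
  proof (intro nn_integral_mono)
    fix x y
    have "ennreal (exp (l * (f x - f y))) \<le> ennreal ((1 / real m) * (\<Sum>r<m. \<Psi> (?A (Suc r) x y) (?B (Suc r) x y)))"
      by (intro ennreal_leI main)
    also have "\<dots> = ennreal (1 / real m) * (\<Sum>r<m. ennreal (\<Psi> (?A (Suc r) x y) (?B (Suc r) x y)))"
      by (subst ennreal_mult) (auto simp: \<Psi>_def sum_nonneg)
    finally show "ennreal (exp (l * (f x - f y))) \<le> \<dots>" .
  qed
  also have "\<dots> = (\<integral>\<^sup>+x. ennreal (1 / real m) * (\<Sum>r<m. \<integral>\<^sup>+y. ennreal (\<Psi> (?A (Suc r) x y) (?B (Suc r) x y)) \<partial>?M) \<partial>?M)"
  proof (rule nn_integral_cong)
    fix x assume x: "x \<in> space ?M"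
    let ?k = "\<lambda>r y. ennreal (\<Psi> (?A (Suc r) x y) (?B (Suc r) x y))"
    have 1: "(\<integral>\<^sup>+y. ennreal (1 / real m) * (\<Sum>r<m. ?k r y) \<partial>?M) = ennreal (1 / real m) * (\<integral>\<^sup>+y. (\<Sum>r<m. ?k r y) \<partial>?M)"
      by (rule nn_integral_cmult) (rule borel_measurable_sum, rule \<Psi>AB2[OF x])
    have 2: "(\<integral>\<^sup>+y. (\<Sum>r<m. ?k r y) \<partial>?M) = (\<Sum>r<m. \<integral>\<^sup>+y. ?k r y \<partial>?M)"
      by (rule nn_integral_sum) (rule \<Psi>AB2[OF x])
    show "(\<integral>\<^sup>+y. ennreal (1 / real m) * (\<Sum>r<m. ?k r y) \<partial>?M) =
      ennreal (1 / real m) * (\<Sum>r<m. \<integral>\<^sup>+y. ?k r y \<partial>?M)"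
      by (simp only: 1 2)
  qed
  also have "\<dots> = ennreal (1 / real m) * (\<Sum>r<m. \<integral>\<^sup>+x. \<integral>\<^sup>+y. ennreal (\<Psi> (?A (Suc r) x y) (?B (Suc r) x y)) \<partial>?M \<partial>?M)"
  proof -
    let ?k = "\<lambda>r x. \<integral>\<^sup>+y. ennreal (\<Psi> (?A (Suc r) x y) (?B (Suc r) x y)) \<partial>?M"
    have 1: "(\<integral>\<^sup>+x. ennreal (1 / real m) * (\<Sum>r<m. ?k r x) \<partial>?M) = ennreal (1 / real m) * (\<integral>\<^sup>+x. (\<Sum>r<m. ?k r x) \<partial>?M)"
      by (rule nn_integral_cmult) (rule borel_measurable_sum, rule \<Psi>AB1)
    have 2: "(\<integral>\<^sup>+x. (\<Sum>r<m. ?k r x) \<partial>?M) = (\<Sum>r<m. \<integral>\<^sup>+x. ?k r x \<partial>?M)"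
      by (rule nn_integral_sum) (rule \<Psi>AB1)
    show ?thesis by (simp only: 1 2)
  qed
  also have "\<dots> = ennreal (1 / real m) * (\<Sum>r<m. \<integral>\<^sup>+x. \<integral>\<^sup>+y. ennreal (\<Psi> x y) \<partial>?M \<partial>?M)"
    by (intro arg_cong2[of _ _ _ _ "(*)"] refl sum.cong rot) auto
  also have "\<dots> = (\<integral>\<^sup>+x. \<integral>\<^sup>+y. ennreal (\<Psi> x y) \<partial>?M \<partial>?M)"
  proof -
    have "ennreal (1 / real m) * of_nat m = 1"
      using m by (simp add: ennreal_of_nat_eq_real_of_nat ennreal_mult[symmetric])
    then show ?thesis by (simp add: mult.assoc[symmetric])
  qed
  \<comment> \<open>For fixed \<open>x\<close> the selected vector is fixed, and \<open>y\<close>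
    integrates to a Laplace transform with norm at most pi R l / 2. The factor exp (l a f x) is at
    most 1 - a + a exp (l f x) by convexity; the crude sum over all N vectors is harmless since it
    is multiplied by \<open>a\<close>.\<close>
  also have "\<dots> \<le> (\<integral>\<^sup>+x. ennreal (exp (l\<^sup>2 * pi\<^sup>2 * R\<^sup>2 / 8)) * (ennreal (1 - a) + ennreal a * (\<Sum>j<N. ennreal (exp (ip Y (\<lambda>b. l * w j b) x)))) \<partial>?M)"
  proof (rule nn_integral_mono)
    fix x
    let ?v = "\<lambda>b. - (l * bM) * w (sel x) b"
    have "(\<integral>\<^sup>+y. ennreal (\<Psi> x y) \<partial>?M) = (\<integral>\<^sup>+y. ennreal (exp (l * a * f x)) * ennreal (exp (ip Y ?v y)) \<partial>?M)"
    proof (rule nn_integral_cong)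
      fix y
      have "ip Y ?v y = - (l * bM) * ip Y (w (sel x)) y"
        unfolding sum_distrib_left by (simp only: mult.assoc)
      then have "\<Psi> x y = exp (l * a * f x) * exp (ip Y ?v y)"
        unfolding \<Psi>_def mult_exp_exp by (simp add: algebra_simps)
      then show "ennreal (\<Psi> x y) = ennreal (exp (l * a * f x)) * ennreal (exp (ip Y ?v y))"
        by (simp add: ennreal_mult)
    qed
    also have "\<dots> = ennreal (exp (l * a * f x)) * ennreal (exp ((L2_set ?v Y)\<^sup>2 / 2))"
      unfolding nn_integral_exp_ip[OF Y, of ?v, symmetric]
      by (rule nn_integral_cmult) measurable
    also have "\<dots> \<le> (ennreal (1 - a) + ennreal a * (\<Sum>j<N. ennreal (exp (ip Y (\<lambda>b. l * w j b) x)))) * ennreal (exp (l\<^sup>2 * pi\<^sup>2 * R\<^sup>2 / 8))"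
    proof (intro mult_mono)
      have "exp (l * a * f x) = exp ((1 - a) *\<^sub>R 0 + a *\<^sub>R (l * f x))" by (simp add: mult_ac)
      also have "\<dots> \<le> (1 - a) * exp 0 + a * exp (l * f x)"
        using a by (intro convex_onD[OF exp_convex]) auto
      also have "l * f x = ip Y (\<lambda>b. l * w (sel x) b) x"
        using sel(2)[of x] by (simp add: sum_distrib_left mult.assoc)
      also have "exp (ip Y (\<lambda>b. l * w (sel x) b) x) \<le> (\<Sum>j<N. exp (ip Y (\<lambda>b. l * w j b) x))"
        using sel(1)[of x] by (intro member_le_sum) auto
      finally have "exp (l * a * f x) \<le> (1 - a) + a * (\<Sum>j<N. exp (ip Y (\<lambda>b. l * w j b) x))"
        using a by (simp add: mult_left_mono)
      then have "ennreal (exp (l * a * f x)) \<le> ennreal ((1 - a) + a * (\<Sum>j<N. exp (ip Y (\<lambda>b. l * w j b) x)))"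
        by (rule ennreal_leI)
      also have "\<dots> = ennreal (1 - a) + ennreal a * (\<Sum>j<N. ennreal (exp (ip Y (\<lambda>b. l * w j b) x)))"
        using a by (simp add: ennreal_plus ennreal_mult sum_nonneg)
      finally show "ennreal (exp (l * a * f x)) \<le> \<dots>" .
      have "(L2_set ?v Y)\<^sup>2 = (l * bM)\<^sup>2 * (L2_set (w (sel x)) Y)\<^sup>2"
        unfolding L2_set_power2 by (simp add: power_mult_distrib sum_distrib_left)
      also have "\<dots> \<le> (l * (pi / 2))\<^sup>2 * R\<^sup>2"
        using w[OF sel(1)[of x]] bM l by (intro mult_mono power_mono) (auto intro: mult_left_mono)
      also have "\<dots> = l\<^sup>2 * pi\<^sup>2 * R\<^sup>2 / 4" by (simp add: power_mult_distrib power_divide)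
      finally show "ennreal (exp ((L2_set ?v Y)\<^sup>2 / 2)) \<le> ennreal (exp (l\<^sup>2 * pi\<^sup>2 * R\<^sup>2 / 8))"
        by (intro ennreal_leI) simp
    qed auto
    finally show "(\<integral>\<^sup>+y. ennreal (\<Psi> x y) \<partial>?M) \<le> ennreal (exp (l\<^sup>2 * pi\<^sup>2 * R\<^sup>2 / 8)) *
       (ennreal (1 - a) + ennreal a * (\<Sum>j<N. ennreal (exp (ip Y (\<lambda>b. l * w j b) x))))"
      by (simp only: mult.commute)
  qed
  also have "\<dots> = ennreal (exp (l\<^sup>2 * pi\<^sup>2 * R\<^sup>2 / 8)) * (ennreal (1 - a) + ennreal a * (\<Sum>j<N. ennreal (exp ((L2_set (\<lambda>b. l * w j b) Y)\<^sup>2 / 2))))"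
  proof -
    have "(\<integral>\<^sup>+x. (\<Sum>j<N. ennreal (exp (ip Y (\<lambda>b. l * w j b) x))) \<partial>?M) = (\<Sum>j<N. ennreal (exp ((L2_set (\<lambda>b. l * w j b) Y)\<^sup>2 / 2)))"
      by (subst nn_integral_sum) (auto simp: nn_integral_exp_ip[OF Y])
    then have "(\<integral>\<^sup>+x. (ennreal (1 - a) + ennreal a * (\<Sum>j<N. ennreal (exp (ip Y (\<lambda>b. l * w j b) x)))) \<partial>?M) =
       (ennreal (1 - a) + ennreal a * (\<Sum>j<N. ennreal (exp ((L2_set (\<lambda>b. l * w j b) Y)\<^sup>2 / 2))))"
      by (subst nn_integral_add) (auto simp: nn_integral_cmult P.emeasure_space_1)
    then show ?thesis by (subst nn_integral_cmult) auto
  qed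
  also have "\<dots> \<le> ennreal (exp (l\<^sup>2 * pi\<^sup>2 * R\<^sup>2 / 8)) * (ennreal 1 + ennreal (2 / real m) * (\<Sum>j<N. ennreal (exp (l\<^sup>2 * R\<^sup>2 / 2))))"
  proof (intro mult_left_mono add_mono mult_mono sum_mono ennreal_leI)
    fix j assume "j \<in> {..<N}"
    then have "(L2_set (w j) Y)\<^sup>2 \<le> R\<^sup>2" using w by (intro power_mono) auto
    then have "l\<^sup>2 * (L2_set (w j) Y)\<^sup>2 \<le> l\<^sup>2 * R\<^sup>2" by (intro mult_left_mono) auto
    then show "exp ((L2_set (\<lambda>b. l * w j b) Y)\<^sup>2 / 2) \<le> exp (l\<^sup>2 * R\<^sup>2 / 2)"
      unfolding L2_set_power2 by (simp add: power_mult_distrib sum_distrib_left)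
  qed (use a in auto)
  also have "\<dots> = ennreal (exp (l\<^sup>2 * pi\<^sup>2 * R\<^sup>2 / 8) * (1 + 2 / real m * (real N * exp (l\<^sup>2 * R\<^sup>2 / 2))))"
  proof -
    let ?E = "exp (l\<^sup>2 * pi\<^sup>2 * R\<^sup>2 / 8)" and ?K = "real N * exp (l\<^sup>2 * R\<^sup>2 / 2)"
    have "(\<Sum>j<N. ennreal (exp (l\<^sup>2 * R\<^sup>2 / 2))) = ennreal ?K"
      by (subst sum_ennreal) auto
    moreover have "ennreal (2 / real m * ?K) = ennreal (2 / real m) * ennreal ?K"
      by (rule ennreal_mult) auto
    moreover have "ennreal (1 + 2 / real m * ?K) = ennreal 1 + ennreal (2 / real m * ?K)"
      by (rule ennreal_plus) auto
    moreover have "ennreal (?E * (1 + 2 / real m * ?K)) = ennreal ?E * ennreal (1 + 2 / real m * ?K)"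
      by (rule ennreal_mult) auto
    ultimately show ?thesis by (simp only:)
  qed
  finally show ?thesis unfolding f_def .
qed

text \<open>Letting the number of rotation steps tend to infinity removes the term that contains
  \<open>N\<close>, so the bound depends neither on the number of vectors nor on the
  dimension.\<close>

lemma exp_maxip_diff:
  fixes w :: "nat \<Rightarrow> 'i \<Rightarrow> real"
  assumes "finite Y" "N > 0" "\<And>j. j < N \<Longrightarrow> L2_set (w j) Y \<le> R" "l \<ge> 0"
  shows "(\<integral>\<^sup>+x. \<integral>\<^sup>+y. ennreal (exp (l * (maxip Y {..<N} w x - maxip Y {..<N} w y))) \<partial>gaussv Y \<partial>gaussv Y)
    \<le> ennreal (exp (l\<^sup>2 * pi\<^sup>2 * R\<^sup>2 / 8))"
proof (rule LIMSEQ_le_const)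
  let ?E = "exp (l\<^sup>2 * pi\<^sup>2 * R\<^sup>2 / 8)" and ?K = "real N * exp (l\<^sup>2 * R\<^sup>2 / 2)"
  have "(\<lambda>m. 2 / real m) \<longlonglongrightarrow> 0" by (rule lim_const_over_n)
  then have "(\<lambda>m. ?E * (1 + 2 / real m * ?K)) \<longlonglongrightarrow> ?E * (1 + 0 * ?K)"
    by (intro tendsto_intros)
  then show "(\<lambda>m. ennreal (?E * (1 + 2 / real m * ?K))) \<longlonglongrightarrow> ennreal ?E"
    by (intro tendsto_ennrealI) simp
  show "\<exists>n. \<forall>m\<ge>n. (\<integral>\<^sup>+x. \<integral>\<^sup>+y. ennreal (exp (l * (maxip Y {..<N} w x - maxip Y {..<N} w y))) \<partial>gaussv Y \<partial>gaussv Y)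
      \<le> ennreal (?E * (1 + 2 / real m * ?K))"
    using exp_maxip_diff_step[where w=w and R=R, OF assms(1,2) _ assms(4)] assms(3) by blast
qed

text \<open>Jensen's inequality in the independent copy \<open>y\<close> replaces \<open>f y\<close>
  by its mean. Should the exponential fail to be integrable in \<open>y\<close>, the right-hand side
  is infinite.\<close>

lemma exp_maxip_centered:
  fixes v :: "'q \<Rightarrow> 'i \<Rightarrow> real"
  assumes Y: "finite Y" and Q: "finite Q" "Q \<noteq> {}" and v: "\<And>q. q \<in> Q \<Longrightarrow> L2_set (v q) Y \<le> R" and l: "l \<ge> 0"
  shows "(\<integral>\<^sup>+x. ennreal (exp (l * (maxip Y Q v x - (\<integral>y. maxip Y Q v y \<partial>gaussv Y)))) \<partial>gaussv Y)
    \<le> ennreal (exp (l\<^sup>2 * pi\<^sup>2 * R\<^sup>2 / 8))"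
proof -
  interpret P: prob_space "gaussv Y" by (rule prob_space_gaussv)
  let ?f = "maxip Y Q v"
  have [measurable]: "?f \<in> borel_measurable (gaussv Y)"
    using Q by (intro measurable_maxip) auto
  have int: "integrable (gaussv Y) ?f" by (intro integrable_maxip Y Q)
  obtain e where e: "bij_betw e {..<card Q} Q"
    using ex_bij_betw_nat_finite[OF Q(1)] by (auto simp: atLeast0LessThan)
  have eq: "maxip Y {..<card Q} (v \<circ> e) = ?f"
  proof
    fix x
    have "(\<lambda>j. ip Y ((v \<circ> e) j) x) ` {..<card Q} = (\<lambda>q. ip Y (v q) x) ` (e ` {..<card Q})"
      by (simp add: image_image)
    then show "maxip Y {..<card Q} (v \<circ> e) x = ?f x"
      using e by (simp add: bij_betw_def)
  qed
  have "(\<integral>\<^sup>+x. ennreal (exp (l * (?f x - (\<integral>y. ?f y \<partial>gaussv Y)))) \<partial>gaussv Y) \<le>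
     (\<integral>\<^sup>+x. \<integral>\<^sup>+y. ennreal (exp (l * (?f x - ?f y))) \<partial>gaussv Y \<partial>gaussv Y)"
  proof (rule nn_integral_mono)
    fix x
    let ?g = "\<lambda>y. exp (l * (?f x - ?f y))"
    show "ennreal (exp (l * (?f x - (\<integral>y. ?f y \<partial>gaussv Y)))) \<le> (\<integral>\<^sup>+y. ennreal (?g y) \<partial>gaussv Y)"
    proof (cases "integrable (gaussv Y) ?g")
      case True
      have "exp (\<integral>y. l * (?f x - ?f y) \<partial>gaussv Y) \<le> (\<integral>y. ?g y \<partial>gaussv Y)"
        using int True by (intro P.jensens_inequality[where I=UNIV] exp_convex) auto
      moreover have "(\<integral>y. l * (?f x - ?f y) \<partial>gaussv Y) = l * (?f x - (\<integral>y. ?f y \<partial>gaussv Y))"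
        using int by (simp add: P.prob_space)
      ultimately have "exp (l * (?f x - (\<integral>y. ?f y \<partial>gaussv Y))) \<le> (\<integral>y. ?g y \<partial>gaussv Y)"
        by (simp only:)
      moreover have "(\<integral>\<^sup>+y. ennreal (?g y) \<partial>gaussv Y) = ennreal (\<integral>y. ?g y \<partial>gaussv Y)"
        by (rule nn_integral_eq_integral[OF True]) simp
      ultimately show ?thesis by (simp add: ennreal_leI)
    next
      case False
      have "(\<integral>\<^sup>+y. ennreal (?g y) \<partial>gaussv Y) = \<infinity>"
      proof (rule ccontr)
        assume "\<not> ?thesis"
        then have "integrable (gaussv Y) ?g"
          by (intro integrableI_nonneg) (auto simp: less_top)
        then show False using False by simp
      qed
      then show ?thesis by simp
    qed
  qed
  also have "\<dots> = (\<integral>\<^sup>+x. \<integral>\<^sup>+y. ennreal (exp (l * (maxip Y {..<card Q} (v \<circ> e) x - maxip Y {..<card Q} (v \<circ> e) y))) \<partial>gaussv Y \<partial>gaussv Y)"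
    by (simp only: fun_cong[OF eq])
  also have "\<dots> \<le> ennreal (exp (l\<^sup>2 * pi\<^sup>2 * R\<^sup>2 / 8))"
    using Q e by (intro exp_maxip_diff[OF Y _ _ l]) (auto intro!: v simp: card_gt_0_iff bij_betw_def)
  finally show ?thesis .
qed

text \<open>The maximum over \<open>Q\<close> is a maximum of at most exp L variables, each with
  mean at most \<open>s\<close> and subgaussian around its mean at scale \<open>R\<close>. Summing
  exponential moments over the pieces and applying 1 + t \<le> exp t costs
  \<open>A = (L + D) / l\<close>.\<close>

lemma integral_maxip_Union_le:
  fixes v :: "'q \<Rightarrow> 'i \<Rightarrow> real"
  assumes Y: "finite Y" and J: "finite J" "real (card J) \<le> exp L" "L > 0"
    and G: "\<And>j. j \<in> J \<Longrightarrow> finite (G j)" "Q = (\<Union>j\<in>J. G j)" "Q \<noteq> {}"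
    and R: "R > 0" and diam: "\<And>q q'. q \<in> Q \<Longrightarrow> q' \<in> Q \<Longrightarrow> l2dist Y (v q) (v q') \<le> R"
    and le: "\<And>j. j \<in> J \<Longrightarrow> G j \<noteq> {} \<Longrightarrow> (\<integral>x. maxip Y (G j) v x \<partial>gaussv Y) \<le> s"
  shows "(\<integral>x. maxip Y Q v x \<partial>gaussv Y) \<le> s + 3 * R * sqrt L"
proof -
  interpret P: prob_space "gaussv Y" by (rule prob_space_gaussv)
  have Q: "finite Q" using G J by auto
  obtain q0 where q0: "q0 \<in> Q" using G by auto
  define w where "w q b = v q b - v q0 b" for q b
  define J' where "J' = {j \<in> J. G j \<noteq> {}}"
  have J': "finite J'" "card J' \<le> card J" "\<And>j. j \<in> J' \<Longrightarrow> finite (G j) \<and> G j \<noteq> {} \<and> G j \<subseteq> Q \<and> j \<in> J"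
    using J G by (auto simp: J'_def intro: card_mono)
  have wdiff: "maxip Y H v x = maxip Y H w x + ip Y (v q0) x" if "finite H" "H \<noteq> {}" for H x
    unfolding w_def by (rule maxip_diff[OF that])
  have wint: "(\<integral>x. maxip Y H v x \<partial>gaussv Y) = (\<integral>x. maxip Y H w x \<partial>gaussv Y)" if "finite H" "H \<noteq> {}" for H
    unfolding wdiff[OF that] using integrable_maxip[OF Y that] integrable_ip[OF Y] by simp
  \<comment> \<open>This choice balances the entropy term \<open>L / l\<close> against the variance
    term, which is of order \<open>l * R\<^sup>2\<close>. As pi^2 / 8 \<le> 2, the sum is at most
    \<open>3 * R * sqrt L\<close>.\<close>
  define l where "l = sqrt L / R"
  have l: "l > 0" using J R by (simp add: l_def)
  define c where "c j = (\<integral>x. maxip Y (G j) w x \<partial>gaussv Y)" for j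
  have c: "c j \<le> s" if "j \<in> J'" for j
    using le[of j] wint[of "G j"] J'(3)[OF that] by (simp add: c_def)
  define D where "D = l\<^sup>2 * pi\<^sup>2 * R\<^sup>2 / 8"
  define A where "A = (L + D) / l"
  let ?g = "maxip Y Q w"
  have [measurable]: "maxip Y H w \<in> borel_measurable (gaussv Y)" if "finite H" for H
    by (rule measurable_maxip[OF that])
  have gm [measurable]: "?g \<in> borel_measurable (gaussv Y)" by (rule measurable_maxip[OF Q])
  have gint: "integrable (gaussv Y) ?g" using G by (intro integrable_maxip Y Q) auto
  have bound: "(\<integral>\<^sup>+x. ennreal (exp (l * (?g x - s - A))) \<partial>gaussv Y) \<le> 1"
  proof -
    have "(\<integral>\<^sup>+x. ennreal (exp (l * (?g x - s - A))) \<partial>gaussv Y) \<le>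
      (\<integral>\<^sup>+x. ennreal (exp (- (l * A))) * (\<Sum>j\<in>J'. ennreal (exp (l * (maxip Y (G j) w x - c j)))) \<partial>gaussv Y)"
    proof (rule nn_integral_mono)
      fix x
      have "?g x \<in> (\<lambda>q. ip Y (w q) x) ` Q" using Q G by (intro Max_in) auto
      then obtain q where q: "q \<in> Q" "?g x = ip Y (w q) x" by auto
      then obtain j where j: "j \<in> J'" "q \<in> G j" using G by (auto simp: J'_def)
      have "?g x \<le> maxip Y (G j) w x"
        unfolding q(2) using j J' by (intro Max_ge) auto
      then have "l * (?g x - s - A) \<le> - (l * A) + l * (maxip Y (G j) w x - c j)"
        using c[OF j(1)] l by (simp add: algebra_simps add_mono mult_left_mono)
      then have "exp (l * (?g x - s - A)) \<le> exp (- (l * A)) * exp (l * (maxip Y (G j) w x - c j))"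
        unfolding mult_exp_exp by simp
      also have "\<dots> \<le> exp (- (l * A)) * (\<Sum>j\<in>J'. exp (l * (maxip Y (G j) w x - c j)))"
        by (intro mult_left_mono member_le_sum[OF j(1)] J') auto
      finally have "ennreal (exp (l * (?g x - s - A))) \<le> ennreal (exp (- (l * A)) * (\<Sum>j\<in>J'. exp (l * (maxip Y (G j) w x - c j))))"
        by (rule ennreal_leI)
      also have "\<dots> = ennreal (exp (- (l * A))) * (\<Sum>j\<in>J'. ennreal (exp (l * (maxip Y (G j) w x - c j))))"
        by (subst ennreal_mult) (auto simp: sum_nonneg)
      finally show "ennreal (exp (l * (?g x - s - A))) \<le> \<dots>" .
    qed
    also have "\<dots> = ennreal (exp (- (l * A))) * (\<Sum>j\<in>J'. \<integral>\<^sup>+x. ennreal (exp (l * (maxip Y (G j) w x - c j))) \<partial>gaussv Y)"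
    proof -
      have m: "(\<lambda>x. ennreal (exp (l * (maxip Y (G j) w x - c j)))) \<in> borel_measurable (gaussv Y)" if "j \<in> J'" for j
      proof -
        have [measurable]: "maxip Y (G j) w \<in> borel_measurable (gaussv Y)"
          using J'(3)[OF that] by (intro measurable_maxip) auto
        show ?thesis by measurable
      qed
      show ?thesis
        using nn_integral_cmult[OF borel_measurable_sum[of J', OF m]] nn_integral_sum[of J', OF m] by simp
    qed
    also have "\<dots> \<le> ennreal (exp (- (l * A))) * (\<Sum>j\<in>J'. ennreal (exp D))"
      unfolding D_def c_def
    proof (intro mult_left_mono sum_mono exp_maxip_centered Y)
      fix j q assume "j \<in> J'" "q \<in> G j"
      then have "q \<in> Q" using J' by auto
      then show "L2_set (w q) Y \<le> R" using diam[of q q0] q0 by (simp add: w_def[abs_def])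
    qed (use J' l in auto)
    also have "\<dots> = ennreal (exp (- (l * A)) * (real (card J') * exp D))"
      by (simp add: ennreal_mult ennreal_of_nat_eq_real_of_nat)
    also have "\<dots> \<le> ennreal 1"
    proof (rule ennreal_leI)
      have "real (card J') * exp D \<le> exp L * exp D"
        using J J'(2) by (intro mult_right_mono) auto
      then have "exp (- (l * A)) * (real (card J') * exp D) \<le> exp (- (l * A)) * (exp L * exp D)"
        by (intro mult_left_mono) auto
      also have "\<dots> = 1" using l by (simp add: A_def mult_exp_exp)
      finally show "exp (- (l * A)) * (real (card J') * exp D) \<le> 1" .
    qed
    finally show ?thesis by simp
  qed
  let ?e = "\<lambda>x. exp (l * (?g x - s - A))"
  have eint: "integrable (gaussv Y) ?e"
    using bound by (intro integrableI_nonneg) (auto intro: le_less_trans)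
  have "ennreal (\<integral>x. ?e x \<partial>gaussv Y) = (\<integral>\<^sup>+x. ennreal (?e x) \<partial>gaussv Y)"
    by (rule nn_integral_eq_integral[symmetric, OF eint]) simp
  then have "ennreal (\<integral>x. ?e x \<partial>gaussv Y) \<le> ennreal 1" using bound by (simp only: ennreal_1)
  then have e1: "(\<integral>x. ?e x \<partial>gaussv Y) \<le> 1" by (simp only: ennreal_le_iff zero_le_one)
  have "(\<integral>x. 1 + l * (?g x - s - A) \<partial>gaussv Y) \<le> (\<integral>x. ?e x \<partial>gaussv Y)"
    using gint eint exp_ge_add_one_self by (intro integral_mono) auto
  moreover have "(\<integral>x. 1 + l * (?g x - s - A) \<partial>gaussv Y) = 1 + l * ((\<integral>x. ?g x \<partial>gaussv Y) - s - A)"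
    using gint by (simp add: P.prob_space)
  ultimately have "l * ((\<integral>x. ?g x \<partial>gaussv Y) - s - A) \<le> 0" using e1 by linarith
  then have "(\<integral>x. ?g x \<partial>gaussv Y) \<le> s + A" using l by (simp add: mult_le_0_iff)
  moreover have "A \<le> 3 * R * sqrt L"
  proof -
    have "D = L * (pi\<^sup>2 / 8)" using R J by (simp add: D_def l_def power_divide)
    moreover have "pi\<^sup>2 \<le> 4\<^sup>2" using pi_less_4 by (intro power_mono) auto
    then have "pi\<^sup>2 / 8 \<le> 2" by simp
    then have "L * (pi\<^sup>2 / 8) \<le> L * 2" using J by (intro mult_left_mono) auto
    ultimately have "L + D \<le> 3 * L" by linarith
    then have "A \<le> 3 * L / l" unfolding A_def using l by (intro divide_right_mono) auto
    also have "\<dots> = 3 * R * (L / sqrt L)" using R by (simp add: l_def)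
    also have "L / sqrt L = sqrt L" using J by (simp add: real_div_sqrt)
    finally show ?thesis .
  qed
  ultimately show ?thesis using wint[OF Q] G by simp
qed

subsection \<open>Seminorms on arrays\<close>

type_synonym idx = "nat \<Rightarrow> nat"
type_synonym tensor = "idx \<Rightarrow> real"

definition ibox :: "nat \<Rightarrow> nat set \<Rightarrow> idx set" where
  "ibox n U = PiE U (\<lambda>_. {1..n})"

definition tprod :: "nat set set \<Rightarrow> (nat set \<Rightarrow> tensor) \<Rightarrow> tensor" where
  "tprod P x i = (\<Prod>I\<in>P. x I (restrict i I))"

definition unit_arrays :: "nat \<Rightarrow> nat set set \<Rightarrow> (nat set \<Rightarrow> tensor) set" where
  "unit_arrays n P = {x. \<forall>I\<in>P. (\<Sum>u\<in>ibox n I. (x I u)\<^sup>2) \<le> 1}"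

definition box_seminorm :: "nat \<Rightarrow> nat set \<Rightarrow> (tensor \<Rightarrow> real) \<Rightarrow> bool" where
  "box_seminorm n U N \<longleftrightarrow> (\<forall>f g. N (\<lambda>i. f i + g i) \<le> N f + N g) \<and>
     (\<forall>c f. N (\<lambda>i. c * f i) = \<bar>c\<bar> * N f) \<and>
     (\<forall>f g. (\<forall>i\<in>ibox n U. f i = g i) \<longrightarrow> N f = N g)"

text \<open>The weight \<open>z\<close> carries arrays of blocks that are treated elsewhere. It lets
  averages and suprema over different blocks be nested and makes the result a seminorm in
  \<open>z\<close> again.\<close>

definition gauss_avg :: "nat \<Rightarrow> (tensor \<Rightarrow> real) \<Rightarrow> nat set set \<Rightarrow> tensor \<Rightarrow> real" where
  "gauss_avg n N P' z = (\<integral>g. N (\<lambda>i. z i * tprod P' (curry g) i) \<partial>gauss_family n P')"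

definition unit_sup :: "nat \<Rightarrow> (tensor \<Rightarrow> real) \<Rightarrow> nat set set \<Rightarrow> tensor \<Rightarrow> real" where
  "unit_sup n N P z = (SUP x\<in>unit_arrays n P. N (\<lambda>i. z i * tprod P x i))"

text \<open>The array \<open>x\<close> is frozen inside the seminorm, and the index set of the
  tensors does not shrink. All seminorms of the induction thus live on the same box; only the set
  that remains to be partitioned gets smaller.\<close>

definition contract :: "(tensor \<Rightarrow> real) \<Rightarrow> nat set \<Rightarrow> tensor \<Rightarrow> tensor \<Rightarrow> real" where
  "contract N k x z = N (\<lambda>i. z i * x (restrict i k))"

lemma finite_ibox [simp]: "finite U \<Longrightarrow> finite (ibox n U)"
  by (simp add: ibox_def finite_PiE)

lemma restrict_ibox: "i \<in> ibox n U \<Longrightarrow> I \<subseteq> U \<Longrightarrow> restrict i I \<in> ibox n I"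
  by (auto simp: ibox_def)

lemma tprod_cong: "(\<And>I. I \<in> P \<Longrightarrow> x I (restrict i I) = y I (restrict i I)) \<Longrightarrow> tprod P x i = tprod P y i"
  by (simp add: tprod_def)

lemma tprod_empty [simp]: "tprod {} x i = 1"
  by (simp add: tprod_def)

lemma tprod_insert: "finite P \<Longrightarrow> I \<notin> P \<Longrightarrow> tprod (insert I P) x i = x I (restrict i I) * tprod P x i"
  by (simp add: tprod_def)

lemma tprod_Un: "finite P \<Longrightarrow> finite Q \<Longrightarrow> P \<inter> Q = {} \<Longrightarrow> tprod (P \<union> Q) x i = tprod P x i * tprod Q x i"
  by (simp add: tprod_def prod.union_disjoint)

lemma unit_arrays_bound:
  assumes "x \<in> unit_arrays n P" "I \<in> P" "finite I" "u \<in> ibox n I"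
  shows "\<bar>x I u\<bar> \<le> 1"
proof -
  have "(x I u)\<^sup>2 \<le> (\<Sum>u\<in>ibox n I. (x I u)\<^sup>2)"
    using assms by (intro member_le_sum) auto
  also have "\<dots> \<le> 1" using assms by (simp add: unit_arrays_def)
  finally show ?thesis by (simp add: abs_square_le_1)
qed

lemma tprod_unit_arrays_bound:
  assumes "x \<in> unit_arrays n P" "finite U" "\<Union>P \<subseteq> U" "i \<in> ibox n U"
  shows "\<bar>tprod P x i\<bar> \<le> 1"
  unfolding tprod_def abs_prod
proof (rule prod_le_1)
  fix I assume I: "I \<in> P"
  then have "I \<subseteq> U" using assms(3) by auto
  then have "finite I" using assms(2) finite_subset by metis
  then show "0 \<le> \<bar>x I (restrict i I)\<bar> \<and> \<bar>x I (restrict i I)\<bar> \<le> 1"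
    using unit_arrays_bound[OF assms(1) I _ restrict_ibox[OF assms(4) \<open>I \<subseteq> U\<close>]] by auto
qed

lemma zero_in_unit_arrays: "(\<lambda>_ _. 0) \<in> unit_arrays n P"
  by (simp add: unit_arrays_def)

locale tensor_seminorm =
  fixes n :: nat and U :: "nat set" and N :: "tensor \<Rightarrow> real"
  assumes finite_U: "finite U" and box_seminorm: "box_seminorm n U N"
begin

lemma add: "N (\<lambda>i. f i + g i) \<le> N f + N g"
  using box_seminorm by (simp add: box_seminorm_def)

lemma scale: "N (\<lambda>i. c * f i) = \<bar>c\<bar> * N f"
  using box_seminorm by (simp add: box_seminorm_def)

lemma cong: "(\<And>i. i \<in> ibox n U \<Longrightarrow> f i = g i) \<Longrightarrow> N f = N g"
  using box_seminorm unfolding box_seminorm_def by blast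

lemma zero: "N (\<lambda>i. 0) = 0"
  using scale[of 0 "\<lambda>_. 0"] by simp

lemma uminus: "N (\<lambda>i. - f i) = N f"
  using scale[of "-1" f] by simp

lemma nonneg: "0 \<le> N f"
  using add[of f "\<lambda>i. - f i"] uminus[of f] zero by simp

lemma diff: "N f - N g \<le> N (\<lambda>i. f i - g i)"
  using add[of "\<lambda>i. f i - g i" g] by simp

lemma diff_le: "N (\<lambda>i. f i - g i) \<le> N f + N g"
  using add[of f "\<lambda>i. - g i"] uminus[of g] by simp

lemma sum_le: "finite A \<Longrightarrow> N (\<lambda>i. \<Sum>a\<in>A. f a i) \<le> (\<Sum>a\<in>A. N (f a))"
proof (induction A rule: finite_induct)
  case (insert a A)
  have "N (\<lambda>i. \<Sum>a\<in>insert a A. f a i) = N (\<lambda>i. f a i + (\<Sum>a\<in>A. f a i))"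
    using insert by simp
  also have "\<dots> \<le> N (f a) + N (\<lambda>i. \<Sum>a\<in>A. f a i)" by (rule add)
  finally show ?case using insert by simp
qed (simp add: zero)

definition unit_norm :: "idx \<Rightarrow> real" where
  "unit_norm a = N (\<lambda>i. if i = a then 1 else 0)"

text \<open>A crude bound by coordinates. It serves finiteness, integrability and measurability and
  enters no constant of the theorem.\<close>

lemma le_units: "N f \<le> (\<Sum>a\<in>ibox n U. \<bar>f a\<bar> * unit_norm a)"
proof -
  have "N f = N (\<lambda>i. \<Sum>a\<in>ibox n U. f a * (if i = a then 1 else 0))"
  proof (rule cong)
    fix i assume "i \<in> ibox n U"
    then show "f i = (\<Sum>a\<in>ibox n U. f a * (if i = a then 1 else 0))"
      using finite_U by (simp add: if_distrib[of "\<lambda>x. _ * x"] cong: if_cong)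
  qed
  also have "\<dots> \<le> (\<Sum>a\<in>ibox n U. N (\<lambda>i. f a * (if i = a then 1 else 0)))"
    using finite_U by (intro sum_le) auto
  finally show ?thesis by (simp add: scale unit_norm_def)
qed

lemma unit_norm_nonneg: "0 \<le> unit_norm a"
  by (simp add: unit_norm_def nonneg)

text \<open>A Lipschitz function is the infimum of its Lipschitz majorants at rational points:
  \<open>N z\<close> is the infimum of \<open>N q\<close> plus a weighted l1 distance from
  \<open>z\<close> to \<open>q\<close>. Each term involves finitely many coordinates, and countably
  many \<open>q\<close> suffice.\<close>

lemma measurable_comp:
  assumes Z: "\<And>i. i \<in> ibox n U \<Longrightarrow> (\<lambda>w. Z w i) \<in> borel_measurable M"
  shows "(\<lambda>w. N (Z w)) \<in> borel_measurable M"
proof -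
  let ?B = "ibox n U"
  define Q where "Q = PiE ?B (\<lambda>_. (\<rat> :: real set))"
  define E where "E q z = N q + (\<Sum>a\<in>?B. \<bar>z a - q a\<bar> * unit_norm a)" for q z
  have Q: "countable Q"
    unfolding Q_def using finite_U by (intro countable_PiE) (auto simp: countable_rat)
  have Qne: "Q \<noteq> {}" unfolding Q_def PiE_eq_empty_iff by (auto intro: Rats_0)
  have lower: "N z \<le> E q z" for q z
    using diff[of z q] le_units[of "\<lambda>i. z i - q i"] by (simp add: E_def)
  have bdd: "bdd_below ((\<lambda>q. E q z) ` Q)" for z
    using lower by (intro bdd_belowI2[of _ "N z"]) auto
  have eq: "N z = (INF q\<in>Q. E q z)" for z
  proof (rule antisym)
    show "N z \<le> (INF q\<in>Q. E q z)" using Qne lower by (intro cINF_greatest) auto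
    show "(INF q\<in>Q. E q z) \<le> N z"
    proof (rule field_le_epsilon)
      fix e :: real assume e: "e > 0"
      define S where "S = (\<Sum>a\<in>?B. unit_norm a)"
      have S: "S \<ge> 0" unfolding S_def by (intro sum_nonneg unit_norm_nonneg)
      define \<eta> where "\<eta> = e / (2 * (S + 1))"
      have \<eta>: "\<eta> > 0" using e S by (simp add: \<eta>_def)
      have "\<exists>r\<in>\<rat>. \<bar>z a - r\<bar> \<le> \<eta>" for a
      proof -
        obtain r where "r \<in> \<rat>" "z a < r" "r < z a + \<eta>"
          using Rats_dense_in_real[of "z a" "z a + \<eta>"] \<eta> by auto
        then show ?thesis by (intro bexI[of _ r]) auto
      qed
      then obtain r where r: "\<And>a. r a \<in> \<rat>" "\<And>a. \<bar>z a - r a\<bar> \<le> \<eta>" by metis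
      define q where "q = restrict r ?B"
      have q: "q \<in> Q" using r by (auto simp: q_def Q_def)
      have "(\<Sum>a\<in>?B. \<bar>z a - q a\<bar> * unit_norm a) \<le> (\<Sum>a\<in>?B. \<eta> * unit_norm a)"
        using r by (intro sum_mono mult_right_mono unit_norm_nonneg) (auto simp: q_def)
      also have "\<dots> = \<eta> * S" by (simp add: S_def sum_distrib_left)
      finally have d: "(\<Sum>a\<in>?B. \<bar>z a - q a\<bar> * unit_norm a) \<le> \<eta> * S" .
      have "N q - N z \<le> N (\<lambda>i. q i - z i)" by (rule diff)
      also have "\<dots> \<le> (\<Sum>a\<in>?B. \<bar>z a - q a\<bar> * unit_norm a)"
        using le_units[of "\<lambda>i. q i - z i"] by (simp add: abs_minus_commute)
      finally have "E q z \<le> N z + 2 * (\<eta> * S)" using d by (simp add: E_def)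
      also have "2 * (\<eta> * S) \<le> e"
        using e S by (simp add: \<eta>_def field_simps)
      finally have "E q z \<le> N z + e" by simp
      moreover have "(INF q\<in>Q. E q z) \<le> E q z" using bdd q by (intro cINF_lower) auto
      ultimately show "(INF q\<in>Q. E q z) \<le> N z + e" by simp
    qed
  qed
  have "(\<lambda>w. INF q\<in>Q. E q (Z w)) \<in> borel_measurable M"
  proof (rule borel_measurable_cINF[OF Q])
    fix q
    show "(\<lambda>w. E q (Z w)) \<in> borel_measurable M"
      unfolding E_def using Z
      by (intro borel_measurable_add borel_measurable_sum borel_measurable_times borel_measurable_abs
          borel_measurable_diff borel_measurable_const) auto
  qed (rule bdd)
  then show ?thesis unfolding eq[symmetric] .
qed

lemma bdd_above_ball:
  assumes "\<Union>P \<subseteq> U"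
  shows "bdd_above ((\<lambda>x. N (\<lambda>i. z i * tprod P x i)) ` unit_arrays n P)"
proof (rule bdd_aboveI2)
  fix x assume x: "x \<in> unit_arrays n P"
  have "N (\<lambda>i. z i * tprod P x i) \<le> (\<Sum>a\<in>ibox n U. \<bar>z a * tprod P x a\<bar> * unit_norm a)"
    by (rule le_units)
  also have "\<dots> \<le> (\<Sum>a\<in>ibox n U. \<bar>z a\<bar> * unit_norm a)"
  proof (intro sum_mono mult_right_mono unit_norm_nonneg)
    fix a assume "a \<in> ibox n U"
    then show "\<bar>z a * tprod P x a\<bar> \<le> \<bar>z a\<bar>"
      using mult_left_mono[OF tprod_unit_arrays_bound[OF x finite_U assms], of a "\<bar>z a\<bar>"] by (simp add: abs_mult)
  qed
  finally show "N (\<lambda>i. z i * tprod P x i) \<le> (\<Sum>a\<in>ibox n U. \<bar>z a\<bar> * unit_norm a)" .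
qed

lemma unit_sup_upper:
  assumes "\<Union>P \<subseteq> U" "x \<in> unit_arrays n P"
  shows "N (\<lambda>i. z i * tprod P x i) \<le> unit_sup n N P z"
  unfolding unit_sup_def using assms bdd_above_ball by (intro cSUP_upper) auto

lemma unit_sup_least:
  assumes "\<And>x. x \<in> unit_arrays n P \<Longrightarrow> N (\<lambda>i. z i * tprod P x i) \<le> b"
  shows "unit_sup n N P z \<le> b"
  unfolding unit_sup_def using assms zero_in_unit_arrays by (intro cSUP_least) auto

lemma unit_sup_nonneg: "\<Union>P \<subseteq> U \<Longrightarrow> 0 \<le> unit_sup n N P z"
  using unit_sup_upper[OF _ zero_in_unit_arrays, of P z] nonneg by (meson order_trans)

lemma box_seminorm_unit_sup:
  assumes P: "\<Union>P \<subseteq> U"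
  shows "box_seminorm n U (unit_sup n N P)"
  unfolding box_seminorm_def
proof (intro conjI allI impI)
  fix f g :: tensor
  show "unit_sup n N P (\<lambda>i. f i + g i) \<le> unit_sup n N P f + unit_sup n N P g"
  proof (rule unit_sup_least)
    fix x assume x: "x \<in> unit_arrays n P"
    have "N (\<lambda>i. (f i + g i) * tprod P x i) \<le> N (\<lambda>i. f i * tprod P x i) + N (\<lambda>i. g i * tprod P x i)"
      using add[of "\<lambda>i. f i * tprod P x i" "\<lambda>i. g i * tprod P x i"] by (simp add: distrib_right)
    also have "\<dots> \<le> unit_sup n N P f + unit_sup n N P g" by (intro add_mono unit_sup_upper P x)
    finally show "N (\<lambda>i. (f i + g i) * tprod P x i) \<le> unit_sup n N P f + unit_sup n N P g" .
  qed
  have le: "unit_sup n N P (\<lambda>i. c * f i) \<le> \<bar>c\<bar> * unit_sup n N P f" for c f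
  proof (rule unit_sup_least)
    fix x assume x: "x \<in> unit_arrays n P"
    have "N (\<lambda>i. c * f i * tprod P x i) = \<bar>c\<bar> * N (\<lambda>i. f i * tprod P x i)"
      using scale[of c "\<lambda>i. f i * tprod P x i"] by (simp add: mult.assoc)
    also have "\<dots> \<le> \<bar>c\<bar> * unit_sup n N P f" by (intro mult_left_mono unit_sup_upper P x) auto
    finally show "N (\<lambda>i. c * f i * tprod P x i) \<le> \<bar>c\<bar> * unit_sup n N P f" .
  qed
  fix c :: real
  show "unit_sup n N P (\<lambda>i. c * f i) = \<bar>c\<bar> * unit_sup n N P f"
  proof (rule antisym[OF le])
    show "\<bar>c\<bar> * unit_sup n N P f \<le> unit_sup n N P (\<lambda>i. c * f i)"
    proof (cases "c = 0")
      case True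
      then show ?thesis using unit_sup_nonneg[OF P] by simp
    next
      case False
      have "unit_sup n N P (\<lambda>i. inverse c * (c * f i)) \<le> \<bar>inverse c\<bar> * unit_sup n N P (\<lambda>i. c * f i)" by (rule le)
      then have "unit_sup n N P f \<le> \<bar>inverse c\<bar> * unit_sup n N P (\<lambda>i. c * f i)"
        using False by (simp add: mult.assoc[symmetric])
      then show ?thesis using False by (simp add: field_simps abs_inverse)
    qed
  qed
next
  fix f g :: tensor assume "\<forall>i\<in>ibox n U. f i = g i"
  then show "unit_sup n N P f = unit_sup n N P g"
    unfolding unit_sup_def by (intro SUP_cong refl cong) auto
qed

lemma box_seminorm_contract: "box_seminorm n U (contract N k x)"
  unfolding box_seminorm_def contract_def
proof (intro conjI allI impI)
  fix f g :: tensor and c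
  show "N (\<lambda>i. (f i + g i) * x (restrict i k)) \<le> N (\<lambda>i. f i * x (restrict i k)) + N (\<lambda>i. g i * x (restrict i k))"
    unfolding distrib_right by (rule add)
  show "N (\<lambda>i. c * f i * x (restrict i k)) = \<bar>c\<bar> * N (\<lambda>i. f i * x (restrict i k))"
    unfolding mult.assoc by (rule scale)
  assume "\<forall>i\<in>ibox n U. f i = g i"
  then show "N (\<lambda>i. f i * x (restrict i k)) = N (\<lambda>i. g i * x (restrict i k))"
    by (intro cong) simp
qed

end

section \<open>Gaussian averages of seminorms\<close>

abbreviation gfam :: "nat \<Rightarrow> nat set set \<Rightarrow> (nat set \<times> idx) set" where
  "gfam n P \<equiv> SIGMA J:P. ibox n J"

lemma gauss_family_eq: "gauss_family n P = gaussv (gfam n P)"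
  by (simp add: gauss_family_def ibox_def)

lemma finite_gfam: "finite P \<Longrightarrow> (\<And>J. J \<in> P \<Longrightarrow> finite J) \<Longrightarrow> finite (gfam n P)"
  by (intro finite_SigmaI) auto

lemma integrable_gauss_abs: "integrable gauss (\<lambda>x. \<bar>x\<bar>)"
  unfolding gauss_def using integrable_std_normal_moment_abs[of 1] by (simp add: integrable_density)

lemma integrable_prod_components:
  assumes "finite Y" "C \<subseteq> Y"
  shows "integrable (gaussv Y) (\<lambda>g. \<Prod>c\<in>C. \<bar>g c\<bar>)"
proof -
  have "integrable (gaussv Y) (\<lambda>g. \<Prod>c\<in>Y. (if c \<in> C then \<bar>g c\<bar> else 1))"
  proof (rule gauss_prod.product_integrable_prod[OF assms(1)])
    fix c
    show "integrable gauss (\<lambda>x. if c \<in> C then \<bar>x\<bar> else 1)"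
      by (cases "c \<in> C") (simp_all add: integrable_gauss_abs)
  qed
  moreover have "(\<Prod>c\<in>Y. (if c \<in> C then \<bar>g c\<bar> else 1)) = (\<Prod>c\<in>C. \<bar>g c\<bar>)" for g :: "'a \<Rightarrow> real"
    using assms by (subst prod.If_cases) (auto simp: Int_absorb1)
  ultimately show ?thesis by simp
qed

context tensor_seminorm
begin

lemma finite_blocks: "\<Union>P \<subseteq> U \<Longrightarrow> finite P" "\<Union>P \<subseteq> U \<Longrightarrow> J \<in> P \<Longrightarrow> finite J"
proof -
  assume P: "\<Union>P \<subseteq> U"
  then have "P \<subseteq> Pow U" by auto
  then show "finite P" using finite_U finite_subset by auto
  assume "J \<in> P"
  then have "J \<subseteq> U" using P by auto
  then show "finite J" using finite_U finite_subset by metis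
qed

lemma finite_gfam_blocks: "\<Union>P \<subseteq> U \<Longrightarrow> finite (gfam n P)"
  using finite_blocks by (intro finite_gfam) auto

lemma measurable_tprod_curry:
  assumes "K \<subseteq> D" "\<Union>D \<subseteq> U" "i \<in> ibox n U"
  shows "(\<lambda>g. tprod K (curry g) i) \<in> borel_measurable (gaussv (gfam n D))"
  unfolding tprod_def curry_def
proof (rule borel_measurable_prod)
  fix I assume "I \<in> K"
  then have "(I, restrict i I) \<in> gfam n D" using assms restrict_ibox[of i n U I] by auto
  then show "(\<lambda>g. g (I, restrict i I)) \<in> borel_measurable (gaussv (gfam n D))" by measurable
qed

lemma integrable_gauss_avg:
  assumes K: "K \<subseteq> D" and D: "\<Union>D \<subseteq> U"
  shows "integrable (gaussv (gfam n D)) (\<lambda>g. N (\<lambda>i. z i * tprod K (curry g) i))"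
proof (rule Bochner_Integration.integrable_bound)
  let ?h = "\<lambda>g. \<Sum>a\<in>ibox n U. \<bar>z a\<bar> * \<bar>tprod K (curry g) a\<bar> * unit_norm a"
  have fin: "finite (gfam n D)" using D by (rule finite_gfam_blocks)
  show "integrable (gaussv (gfam n D)) ?h"
  proof (intro Bochner_Integration.integrable_sum integrable_mult_left integrable_mult_right)
    fix a assume a: "a \<in> ibox n U"
    have "\<bar>tprod K (curry g) a\<bar> = (\<Prod>c\<in>(\<lambda>I. (I, restrict a I)) ` K. \<bar>g c\<bar>)" for g
      unfolding tprod_def by (subst prod.reindex) (auto simp: inj_on_def abs_prod)
    moreover have "integrable (gaussv (gfam n D)) (\<lambda>g. \<Prod>c\<in>(\<lambda>I. (I, restrict a I)) ` K. \<bar>g c\<bar>)"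
    proof (rule integrable_prod_components[OF fin])
      show "(\<lambda>I. (I, restrict a I)) ` K \<subseteq> gfam n D"
        using a K D by (auto intro!: restrict_ibox)
    qed
    ultimately show "integrable (gaussv (gfam n D)) (\<lambda>g. \<bar>tprod K (curry g) a\<bar>)" by simp
  qed
  show "AE g in gaussv (gfam n D). norm (N (\<lambda>i. z i * tprod K (curry g) i)) \<le> norm (?h g)"
  proof (rule AE_I2)
    fix g
    have "N (\<lambda>i. z i * tprod K (curry g) i) \<le> ?h g"
      using le_units[of "\<lambda>i. z i * tprod K (curry g) i"] by (simp add: abs_mult)
    then show "norm (N (\<lambda>i. z i * tprod K (curry g) i)) \<le> norm (?h g)"
      using nonneg[of "\<lambda>i. z i * tprod K (curry g) i"] by simp
  qed
  show "(\<lambda>g. N (\<lambda>i. z i * tprod K (curry g) i)) \<in> borel_measurable (gaussv (gfam n D))"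
    by (intro measurable_comp borel_measurable_times borel_measurable_const measurable_tprod_curry K D)
qed

lemma integrable_gauss_avg': "\<Union>D \<subseteq> U \<Longrightarrow> integrable (gauss_family n D) (\<lambda>g. N (\<lambda>i. z i * tprod D (curry g) i))"
  unfolding gauss_family_eq by (rule integrable_gauss_avg) auto

lemma gauss_avg_mono_add:
  assumes "\<Union>P \<subseteq> U"
  shows "gauss_avg n N P (\<lambda>i. f i + g i) \<le> gauss_avg n N P f + gauss_avg n N P g"
proof -
  have "gauss_avg n N P (\<lambda>i. f i + g i) \<le> (\<integral>h. N (\<lambda>i. f i * tprod P (curry h) i) + N (\<lambda>i. g i * tprod P (curry h) i) \<partial>gauss_family n P)"
    unfolding gauss_avg_def
  proof (intro integral_mono Bochner_Integration.integrable_add integrable_gauss_avg' assms)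
    fix h
    show "N (\<lambda>i. (f i + g i) * tprod P (curry h) i) \<le> N (\<lambda>i. f i * tprod P (curry h) i) + N (\<lambda>i. g i * tprod P (curry h) i)"
      unfolding distrib_right by (rule add)
  qed
  also have "\<dots> = gauss_avg n N P f + gauss_avg n N P g"
    unfolding gauss_avg_def by (intro Bochner_Integration.integral_add integrable_gauss_avg' assms)
  finally show ?thesis .
qed

lemma box_seminorm_gauss_avg:
  assumes "\<Union>P \<subseteq> U"
  shows "box_seminorm n U (gauss_avg n N P)"
  unfolding box_seminorm_def
proof (intro conjI allI impI)
  fix f g :: tensor and c
  show "gauss_avg n N P (\<lambda>i. f i + g i) \<le> gauss_avg n N P f + gauss_avg n N P g" by (rule gauss_avg_mono_add[OF assms])
  show "gauss_avg n N P (\<lambda>i. c * f i) = \<bar>c\<bar> * gauss_avg n N P f"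
    unfolding gauss_avg_def mult.assoc scale by simp
  assume "\<forall>i\<in>ibox n U. f i = g i"
  then show "gauss_avg n N P f = gauss_avg n N P g"
    unfolding gauss_avg_def by (intro Bochner_Integration.integral_cong refl cong) simp
qed

text \<open>Smoothing draws Gaussians for all blocks of \<open>D\<close> at once, while a term of
  the expanded product sees those of \<open>K\<close> only. The other coordinates integrate to
  one.\<close>

lemma gauss_avg_marginal:
  assumes K: "K \<subseteq> D" and D: "\<Union>D \<subseteq> U"
  shows "(\<integral>g. N (\<lambda>i. z i * tprod K (curry g) i) \<partial>gauss_family n D) = gauss_avg n N K z"
proof -
  have KU: "\<Union>K \<subseteq> U" and DU: "\<Union>(D - K) \<subseteq> U" using K D by auto
  have eq: "gfam n D = gfam n K \<union> gfam n (D - K)" using K by auto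
  have "(\<integral>g. N (\<lambda>i. z i * tprod K (curry g) i) \<partial>gauss_family n D) =
     (\<integral>g. \<integral>h. N (\<lambda>i. z i * tprod K (curry (merge (gfam n K) (gfam n (D - K)) (g, h))) i) \<partial>gaussv (gfam n (D - K)) \<partial>gaussv (gfam n K))"
    unfolding gauss_family_eq eq
    by (rule gauss_prod.product_integral_fold)
       (use integrable_gauss_avg[OF K D] finite_gfam_blocks[OF KU] finite_gfam_blocks[OF DU] in \<open>auto simp: eq[symmetric]\<close>)
  also have "\<dots> = (\<integral>g. \<integral>h. N (\<lambda>i. z i * tprod K (curry g) i) \<partial>gaussv (gfam n (D - K)) \<partial>gaussv (gfam n K))"
  proof (intro Bochner_Integration.integral_cong refl cong)
    fix g h :: "nat set \<times> idx \<Rightarrow> real" and i assume i: "i \<in> ibox n U"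
    have "tprod K (curry (merge (gfam n K) (gfam n (D - K)) (g, h))) i = tprod K (curry g) i"
      using restrict_ibox[OF i] KU by (intro tprod_cong) (auto simp: merge_def)
    then show "z i * tprod K (curry (merge (gfam n K) (gfam n (D - K)) (g, h))) i = z i * tprod K (curry g) i" by simp
  qed
  also have "\<dots> = gauss_avg n N K z"
    using prob_space.prob_space[OF prob_space_gaussv, of "gfam n (D - K)"] by (simp add: gauss_avg_def gauss_family_eq)
  finally show ?thesis .
qed

text \<open>Fubini. Disjointness of \<open>P\<close> and \<open>Q\<close> makes the two Gaussian
  families independent, even when blocks overlap as sets, because coordinates are labelled by their
  block.\<close>

lemma gauss_avg_gauss_avg:
  assumes P: "\<Union>P \<subseteq> U" and Q: "\<Union>Q \<subseteq> U" and disj: "P \<inter> Q = {}"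
  shows "gauss_avg n (gauss_avg n N P) Q z = gauss_avg n N (P \<union> Q) z"
proof -
  have PQ: "\<Union>(P \<union> Q) \<subseteq> U" using P Q by auto
  have eq: "gfam n (P \<union> Q) = gfam n Q \<union> gfam n P" by auto
  have "gauss_avg n N (P \<union> Q) z =
     (\<integral>h. \<integral>g. N (\<lambda>i. z i * tprod (P \<union> Q) (curry (merge (gfam n Q) (gfam n P) (h, g))) i) \<partial>gaussv (gfam n P) \<partial>gaussv (gfam n Q))"
    unfolding gauss_avg_def gauss_family_eq eq
    by (rule gauss_prod.product_integral_fold)
       (use disj integrable_gauss_avg'[OF PQ, of z] finite_gfam_blocks[OF P] finite_gfam_blocks[OF Q] in \<open>auto simp: eq[symmetric] gauss_family_eq\<close>)
  also have "\<dots> = (\<integral>h. \<integral>g. N (\<lambda>i. (z i * tprod Q (curry h) i) * tprod P (curry g) i) \<partial>gaussv (gfam n P) \<partial>gaussv (gfam n Q))"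
  proof (intro Bochner_Integration.integral_cong refl cong)
    fix g h :: "nat set \<times> idx \<Rightarrow> real" and i assume i: "i \<in> ibox n U"
    let ?m = "merge (gfam n Q) (gfam n P) (h, g)"
    have "tprod Q (curry ?m) i = tprod Q (curry h) i"
      using restrict_ibox[OF i] Q by (intro tprod_cong) (auto simp: merge_def)
    moreover have "tprod P (curry ?m) i = tprod P (curry g) i"
      using restrict_ibox[OF i] P disj by (intro tprod_cong) (auto simp: merge_def)
    moreover have "tprod (P \<union> Q) (curry ?m) i = tprod P (curry ?m) i * tprod Q (curry ?m) i"
      using finite_blocks P Q disj by (intro tprod_Un) auto
    ultimately show "z i * tprod (P \<union> Q) (curry ?m) i = z i * tprod Q (curry h) i * tprod P (curry g) i" by simp
  qed
  also have "\<dots> = gauss_avg n (gauss_avg n N P) Q z"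
    by (simp add: gauss_avg_def gauss_family_eq)
  finally show ?thesis by simp
qed

lemma gauss_avg_contract: "gauss_avg n (contract N k x) P z = gauss_avg n N P (\<lambda>i. z i * x (restrict i k))"
  unfolding gauss_avg_def contract_def by (simp add: mult_ac)

lemma unit_sup_gauss_avg_contract: "unit_sup n (gauss_avg n (contract N k x) P') P z = unit_sup n (gauss_avg n N P') P (\<lambda>i. z i * x (restrict i k))"
  unfolding unit_sup_def gauss_avg_contract by (simp add: mult_ac)

lemma norm_tprod_le:
  assumes P: "\<Union>P \<subseteq> U" and r: "r > 0"
    and x: "\<And>I. I \<in> P \<Longrightarrow> (\<Sum>u\<in>ibox n I. (x I u)\<^sup>2) \<le> r\<^sup>2"
  shows "N (\<lambda>i. z i * tprod P x i) \<le> r ^ card P * unit_sup n N P z"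
proof -
  have "tprod P x i = r ^ card P * tprod P (\<lambda>I u. x I u / r) i" for i
    using r by (simp add: tprod_def prod_dividef power_divide)
  then have "N (\<lambda>i. z i * tprod P x i) = N (\<lambda>i. r ^ card P * (z i * tprod P (\<lambda>I u. x I u / r) i))"
    by (simp add: mult_ac)
  also have "\<dots> = r ^ card P * N (\<lambda>i. z i * tprod P (\<lambda>I u. x I u / r) i)"
    using scale r by simp
  also have "\<dots> \<le> r ^ card P * unit_sup n N P z"
  proof (intro mult_left_mono unit_sup_upper P)
    show "(\<lambda>I u. x I u / r) \<in> unit_arrays n P"
      using x r by (auto simp: unit_arrays_def power_divide sum_divide_distrib[symmetric])
  qed (use r in auto)
  finally show ?thesis .
qed

end

subsection \<open>Duality\<close>

text \<open>Homogeneity is asked for nonnegative factors only: the intermediate functionals in the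
  Hahn-Banach argument are no longer symmetric.\<close>

definition sublinear :: "(tensor \<Rightarrow> real) \<Rightarrow> bool" where
  "sublinear q \<longleftrightarrow> (\<forall>f g. q (\<lambda>i. f i + g i) \<le> q f + q g) \<and> (\<forall>c\<ge>0. \<forall>f. q (\<lambda>i. c * f i) = c * q f)"

text \<open>\<open>q'\<close> is linear along \<open>z\<close>; iterating this over a basis
  yields the Hahn-Banach theorem.\<close>

lemma sublinear_linearize:
  assumes q: "sublinear q"
  obtains q' where "sublinear q'" "\<And>f. q' f \<le> q f" "q' (\<lambda>i. - z i) \<le> - q z"
proof -
  have qa: "q (\<lambda>i. f i + g i) \<le> q f + q g" for f g using q by (simp add: sublinear_def)
  have qs: "q (\<lambda>i. c * f i) = c * q f" if "c \<ge> 0" for c f using q that by (simp add: sublinear_def)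
  have q0: "q (\<lambda>i. 0) = 0" using qs[of 0 "\<lambda>_. 0"] by simp
  \<comment> \<open>The infimum over \<open>s\<close> is the largest sublinear functional below
    \<open>q\<close> whose value at \<open>- z\<close> is at most \<open>- q z\<close>: for such a
    functional \<open>r\<close>, \<open>r f\<close> is at most
    \<open>r (f + s z) + s * r (- z)\<close>.\<close>
  define h where "h f s = q (\<lambda>i. f i + s * z i) - s * q z" for f and s :: real
  define q' where "q' f = (INF s\<in>{0..}. h f s)" for f
  have lower: "- q (\<lambda>i. - f i) \<le> h f s" if "s \<ge> 0" for f s
  proof -
    have "q (\<lambda>i. s * z i) \<le> q (\<lambda>i. f i + s * z i) + q (\<lambda>i. - f i)"
      using qa[of "\<lambda>i. f i + s * z i" "\<lambda>i. - f i"] by simp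
    then show ?thesis using qs[OF that, of z] by (simp add: h_def)
  qed
  have bdd: "bdd_below (h f ` {0..})" for f
    using lower[of _ f] by (intro bdd_belowI2[of _ "- q (\<lambda>i. - f i)"]) auto
  have le: "q' f \<le> h f s" if "s \<ge> 0" for f s
    unfolding q'_def using that bdd by (intro cINF_lower) auto
  have ge: "b \<le> q' f" if "\<And>s. s \<ge> 0 \<Longrightarrow> b \<le> h f s" for b f
    unfolding q'_def using that by (intro cINF_greatest) auto
  have scl: "c * q' f \<le> q' (\<lambda>i. c * f i)" if c: "c > 0" for c f
  proof (rule ge)
    fix s :: real assume s: "s \<ge> 0"
    have "q' f \<le> h f (s / c)" using s c by (intro le) auto
    then have "c * q' f \<le> c * h f (s / c)" using c by simp
    also have "\<dots> = h (\<lambda>i. c * f i) s"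
      using c qs[of c "\<lambda>i. f i + s / c * z i"] by (simp add: h_def algebra_simps)
    finally show "c * q' f \<le> h (\<lambda>i. c * f i) s" .
  qed
  show thesis
  proof
    show "q' f \<le> q f" for f using le[of 0 f] by (simp add: h_def)
    show "q' (\<lambda>i. - z i) \<le> - q z" using le[of 1 "\<lambda>i. - z i"] q0 by (simp add: h_def)
    show "sublinear q'"
      unfolding sublinear_def
    proof (intro conjI allI impI)
      fix f g :: tensor
      have "q' (\<lambda>i. f i + g i) - h f s \<le> h g t" if "s \<ge> 0" "t \<ge> 0" for s t
      proof -
        have "q' (\<lambda>i. f i + g i) \<le> h (\<lambda>i. f i + g i) (s + t)" using that by (intro le) auto
        also have "\<dots> = q (\<lambda>i. (f i + s * z i) + (g i + t * z i)) - (s + t) * q z"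
          by (simp add: h_def algebra_simps)
        also have "\<dots> \<le> h f s + h g t"
          using qa[of "\<lambda>i. f i + s * z i" "\<lambda>i. g i + t * z i"] by (simp add: h_def algebra_simps)
        finally show ?thesis by simp
      qed
      then have *: "q' (\<lambda>i. f i + g i) - h f s \<le> q' g" if "s \<ge> 0" for s
        using that by (intro ge) auto
      have "q' (\<lambda>i. f i + g i) - q' g \<le> h f s" if "s \<ge> 0" for s
        using *[OF that] by linarith
      then have "q' (\<lambda>i. f i + g i) - q' g \<le> q' f" by (rule ge)
      then show "q' (\<lambda>i. f i + g i) \<le> q' f + q' g" by simp
    next
      fix c :: real and f assume c: "c \<ge> 0"
      show "q' (\<lambda>i. c * f i) = c * q' f"
      proof (cases "c = 0")
        case True
        have "h (\<lambda>i. 0) s = 0" if "s \<ge> 0" for s using qs[OF that, of z] by (simp add: h_def)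
        then have "q' (\<lambda>i. 0) = 0" using le[of 0 "\<lambda>i. 0"] ge[of 0 "\<lambda>i. 0"] by force
        then show ?thesis using True by simp
      next
        case False
        then have c: "c > 0" using c by simp
        have "inverse c * q' (\<lambda>i. c * f i) \<le> q' (\<lambda>i. inverse c * (c * f i))"
          using c by (intro scl) auto
        also have "(\<lambda>i. inverse c * (c * f i)) = f" using c by (simp add: mult.assoc[symmetric])
        finally have "q' (\<lambda>i. c * f i) \<le> c * q' f" using c by (simp add: field_simps)
        then show ?thesis using scl[OF c, of f] by simp
      qed
    qed
  qed
qed

definition dual_ball :: "nat \<Rightarrow> nat set \<Rightarrow> (tensor \<Rightarrow> real) \<Rightarrow> tensor set" where
  "dual_ball n U N = {t. \<forall>f. ip (ibox n U) t f \<le> N f}"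

context tensor_seminorm
begin

text \<open>Linearizing along \<open>z\<close> fixes the value \<open>N z\<close>; later
  linearizations along the unit tensors only decrease the functional and so preserve it. In the end
  the functional agrees on the box with the pairing given by its values on the unit tensors.\<close>

lemma hahn_banach: "\<exists>t\<in>dual_ball n U N. ip (ibox n U) t z = N z"
proof -
  define \<delta> :: "idx \<Rightarrow> tensor" where "\<delta> a i = (if i = a then 1 else 0)" for a i
  have sub: "sublinear N" unfolding sublinear_def using add scale by simp
  have "\<exists>q. sublinear q \<and> (\<forall>f. q f \<le> N f) \<and> q (\<lambda>i. - z i) \<le> - N z \<and> (\<forall>a\<in>A. q (\<lambda>i. - \<delta> a i) \<le> - q (\<delta> a))"
    if "finite A" for A
    using that
  proof (induction A rule: finite_induct)
    case empty
    obtain q where "sublinear q" "\<And>f. q f \<le> N f" "q (\<lambda>i. - z i) \<le> - N z"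
      using sublinear_linearize[OF sub, of z] by metis
    then show ?case by auto
  next
    case (insert a A)
    then obtain q where q: "sublinear q" "\<And>f. q f \<le> N f" "q (\<lambda>i. - z i) \<le> - N z"
      "\<And>a. a \<in> A \<Longrightarrow> q (\<lambda>i. - \<delta> a i) \<le> - q (\<delta> a)" by auto
    obtain q' where q': "sublinear q'" "\<And>f. q' f \<le> q f" "q' (\<lambda>i. - \<delta> a i) \<le> - q (\<delta> a)"
      using sublinear_linearize[OF q(1), of "\<delta> a"] by metis
    have "q' (\<lambda>i. - \<delta> b i) \<le> - q' (\<delta> b)" if "b \<in> insert a A" for b
    proof (cases "b = a")
      case True then show ?thesis using q'(2)[of "\<delta> a"] q'(3) by simp
    next
      case False
      then have "b \<in> A" using that by simp
      then show ?thesis using q(4)[of b] q'(2)[of "\<delta> b"] q'(2)[of "\<lambda>i. - \<delta> b i"] by simp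
    qed
    moreover have "q' f \<le> N f" for f using q'(2)[of f] q(2)[of f] by simp
    moreover have "q' (\<lambda>i. - z i) \<le> - N z" using q'(2)[of "\<lambda>i. - z i"] q(3) by simp
    ultimately show ?case using q'(1) by blast
  qed
  from this[OF finite_ibox[OF finite_U, of n]]
  obtain q where q: "sublinear q" "\<And>f. q f \<le> N f" "q (\<lambda>i. - z i) \<le> - N z"
    "\<And>a. a \<in> ibox n U \<Longrightarrow> q (\<lambda>i. - \<delta> a i) \<le> - q (\<delta> a)" by auto
  have qa: "q (\<lambda>i. f i + g i) \<le> q f + q g" for f g using q(1) by (simp add: sublinear_def)
  have qs: "q (\<lambda>i. c * f i) = c * q f" if "c \<ge> 0" for c f using q(1) that by (simp add: sublinear_def)
  have q0: "q (\<lambda>i. 0) = 0" using qs[of 0 "\<lambda>_. 0"] by simp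
  have qsum: "q (\<lambda>i. \<Sum>a\<in>A. f a i) \<le> (\<Sum>a\<in>A. q (f a))" if "finite A" for A and f :: "idx \<Rightarrow> tensor"
    using that
  proof (induction A rule: finite_induct)
    case (insert a A)
    have "q (\<lambda>i. \<Sum>a\<in>insert a A. f a i) = q (\<lambda>i. f a i + (\<Sum>a\<in>A. f a i))" using insert by simp
    also have "\<dots> \<le> q (f a) + q (\<lambda>i. \<Sum>a\<in>A. f a i)" by (rule qa)
    finally show ?case using insert by simp
  qed (simp add: q0)
  define t where "t a = q (\<delta> a)" for a
  have q_le: "q f \<le> ip (ibox n U) t f" for f
  proof -
    have "q f \<le> q (\<lambda>i. \<Sum>a\<in>ibox n U. f a * \<delta> a i) + q (\<lambda>i. f i - (\<Sum>a\<in>ibox n U. f a * \<delta> a i))"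
      using qa[of "\<lambda>i. \<Sum>a\<in>ibox n U. f a * \<delta> a i" "\<lambda>i. f i - (\<Sum>a\<in>ibox n U. f a * \<delta> a i)"] by simp
    also have "q (\<lambda>i. f i - (\<Sum>a\<in>ibox n U. f a * \<delta> a i)) \<le> N (\<lambda>i. f i - (\<Sum>a\<in>ibox n U. f a * \<delta> a i))"
      by (rule q)
    also have "\<dots> = N (\<lambda>i. 0)"
    proof (rule cong)
      fix i assume "i \<in> ibox n U"
      then show "f i - (\<Sum>a\<in>ibox n U. f a * \<delta> a i) = 0"
        using finite_U by (simp add: \<delta>_def if_distrib[of "\<lambda>x. _ * x"] cong: if_cong)
    qed
    also have "\<dots> = 0" by (rule zero)
    also have "q (\<lambda>i. \<Sum>a\<in>ibox n U. f a * \<delta> a i) \<le> (\<Sum>a\<in>ibox n U. q (\<lambda>i. f a * \<delta> a i))"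
      using finite_U by (intro qsum) auto
    also have "\<dots> \<le> (\<Sum>a\<in>ibox n U. t a * f a)"
    proof (rule sum_mono)
      fix a assume a: "a \<in> ibox n U"
      show "q (\<lambda>i. f a * \<delta> a i) \<le> t a * f a"
      proof (cases "f a \<ge> 0")
        case True then show ?thesis by (simp add: qs t_def)
      next
        case False
        have "q (\<lambda>i. f a * \<delta> a i) = q (\<lambda>i. (- f a) * (- \<delta> a i))" by simp
        also have "\<dots> = (- f a) * q (\<lambda>i. - \<delta> a i)" using False by (intro qs) auto
        also have "\<dots> \<le> (- f a) * (- q (\<delta> a))" using False q(4)[OF a] by (intro mult_left_mono) auto
        finally show ?thesis by (simp add: t_def mult.commute)
      qed
    qed
    finally show ?thesis by simp
  qed
  have le_q: "ip (ibox n U) t f \<le> - q (\<lambda>i. - f i)" for f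
    using q_le[of "\<lambda>i. - f i"] by (simp add: sum_negf)
  have "- q (\<lambda>i. - f i) \<le> q f" for f using qa[of f "\<lambda>i. - f i"] q0 by simp
  then have "ip (ibox n U) t f \<le> N f" for f
    using le_q[of f] q(2)[of f] by (meson order_trans)
  then have "t \<in> dual_ball n U N" by (simp add: dual_ball_def)
  moreover have "N z \<le> ip (ibox n U) t z"
    using le_q[of "\<lambda>i. - z i"] q(3) q_le[of z]  qa[of z "\<lambda>i. - z i"] q0 by (simp add: sum_negf)
  ultimately show ?thesis
    unfolding dual_ball_def by (intro bexI[of _ t]) (auto intro: antisym)
qed

lemma dual_ball_uminus: "t \<in> dual_ball n U N \<Longrightarrow> (\<lambda>i. - t i) \<in> dual_ball n U N"
  unfolding dual_ball_def
proof safe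
  fix f assume a: "\<forall>f. ip (ibox n U) t f \<le> N f"
  from spec[OF a, of "\<lambda>i. - f i"]
  show "ip (ibox n U) (\<lambda>i. - t i) f \<le> N f" by (simp add: uminus)
qed

lemma dual_ball_abs: "t \<in> dual_ball n U N \<Longrightarrow> \<bar>ip (ibox n U) t f\<bar> \<le> N f"
  using dual_ball_uminus[of t] by (auto simp: dual_ball_def sum_negf abs_le_iff)

end

subsection \<open>Block norms and their weighted sum\<close>

text \<open>\<open>d\<close> bounds the number of blocks and not the size of \<open>V\<close>: a
  block may contain several indices, and freezing or averaging blocks lowers the budget. Coarser
  partitions are included, since merging produces them.\<close>

definition splits :: "nat set \<Rightarrow> nat \<Rightarrow> (nat set set \<times> nat set set) set" where
  "splits V d = {(P, P'). P \<inter> P' = {} \<and> partition_on V (P \<union> P') \<and> card (P \<union> P') \<le> d}"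

text \<open>One more block in the supremum multiplies the weight by sqrt p, and so does lowering
  \<open>d\<close> by one. In particular the pairs \<open>(d - 1, k)\<close> and
  \<open>(d, k + 1)\<close> have equal weight, which is why freezing a block preserves
  weights.\<close>

definition weight :: "real \<Rightarrow> nat \<Rightarrow> nat \<Rightarrow> real" where
  "weight p d k = p powr ((real k + 1 - real d) / 2)"

text \<open>For the seminorm \<open>N = array_norm d n m A T\<close> below, \<open>block_norm n N P' P\<close> is \<open>\<parallel>A\<parallel>\<^bsub>P'|P\<^esub>\<close> and
  \<open>wsum n N {1..d} d p\<close> is the sum in the theorem. The block \<open>i\<close> of \<open>gauss_sup\<close> is the Gaussian one.\<close>

definition block_norm :: "nat \<Rightarrow> (tensor \<Rightarrow> real) \<Rightarrow> nat set set \<Rightarrow> nat set set \<Rightarrow> real" where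
  "block_norm n N P' P = unit_sup n (gauss_avg n N P') P (\<lambda>_. 1)"

definition wsup :: "nat \<Rightarrow> (tensor \<Rightarrow> real) \<Rightarrow> nat set \<Rightarrow> nat \<Rightarrow> real \<Rightarrow> tensor \<Rightarrow> real" where
  "wsup n N V d p z = (\<Sum>(P, P')\<in>splits V d. weight p d (card P) * unit_sup n (gauss_avg n N P') P z)"

definition wsum :: "nat \<Rightarrow> (tensor \<Rightarrow> real) \<Rightarrow> nat set \<Rightarrow> nat \<Rightarrow> real \<Rightarrow> real" where
  "wsum n N V d p = (\<Sum>(P, P')\<in>splits V d. weight p d (card P) * block_norm n N P' P)"

definition gauss_sup :: "nat \<Rightarrow> (tensor \<Rightarrow> real) \<Rightarrow> nat set set \<Rightarrow> nat set \<Rightarrow> real" where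
  "gauss_sup n N D i = gauss_avg n (unit_sup n N (D - {i})) {i} (\<lambda>_. 1)"

lemma splitsD:
  assumes "(P, P') \<in> splits V d"
  shows "P \<inter> P' = {}" "\<Union>P \<subseteq> V" "\<Union>P' \<subseteq> V" "\<Union>P \<union> \<Union>P' = V" "disjoint (P \<union> P')" "{} \<notin> P \<union> P'" "card (P \<union> P') \<le> d"
  using assms by (auto simp: splits_def partition_on_def)

lemma finite_splits: "finite V \<Longrightarrow> finite (splits V d)"
  by (rule finite_subset[of _ "Pow (Pow V) \<times> Pow (Pow V)"]) (auto simp: splits_def partition_on_def)

lemma weight_nonneg [simp]: "weight p d k \<ge> 0"
  by (simp add: weight_def)

lemma wsum_eq_wsup: "wsum n N V d p = wsup n N V d p (\<lambda>_. 1)"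
  by (simp add: wsum_def wsup_def block_norm_def)

lemma wsum_contract: "wsum n (contract N k x) V d p = wsup n N V d p (\<lambda>i. x (restrict i k))"
  unfolding wsum_def wsup_def block_norm_def using tensor_seminorm.unit_sup_gauss_avg_contract by (simp add: unit_sup_def gauss_avg_def contract_def mult_ac)

context tensor_seminorm
begin

lemma gauss_avg_seminorm: "\<Union>P \<subseteq> U \<Longrightarrow> tensor_seminorm n U (gauss_avg n N P)"
  using finite_U box_seminorm_gauss_avg by (simp add: tensor_seminorm_def)

lemma unit_sup_seminorm: "\<Union>P \<subseteq> U \<Longrightarrow> tensor_seminorm n U (unit_sup n N P)"
  using finite_U box_seminorm_unit_sup by (simp add: tensor_seminorm_def)

lemma contract_seminorm: "tensor_seminorm n U (contract N k x)"
  using finite_U box_seminorm_contract by (simp add: tensor_seminorm_def)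

lemma gauss_avg_empty: "gauss_avg n N {} = N"
proof
  fix z
  have "gauss_avg n N {} z = (\<integral>g. N z \<partial>gaussv (gfam n {}))" by (simp add: gauss_avg_def gauss_family_eq)
  then show "gauss_avg n N {} z = N z"
    using prob_space.prob_space[OF prob_space_gaussv, of "gfam n {}"] by simp
qed

lemma unit_sup_gauss_avg_nonneg: "\<Union>P \<subseteq> U \<Longrightarrow> \<Union>P' \<subseteq> U \<Longrightarrow> 0 \<le> unit_sup n (gauss_avg n N P') P z"
  using tensor_seminorm.unit_sup_nonneg[OF gauss_avg_seminorm] by blast

lemma block_norm_nonneg: "\<Union>P \<subseteq> U \<Longrightarrow> \<Union>P' \<subseteq> U \<Longrightarrow> 0 \<le> block_norm n N P' P"
  by (simp add: block_norm_def unit_sup_gauss_avg_nonneg)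

lemma wsup_term:
  assumes "V \<subseteq> U" "(P, P') \<in> splits V d"
  shows "weight p d (card P) * unit_sup n (gauss_avg n N P') P z \<le> wsup n N V d p z"
proof -
  have "finite V" using assms(1) finite_U finite_subset by metis
  then have "(case (P, P') of (P, P') \<Rightarrow> weight p d (card P) * unit_sup n (gauss_avg n N P') P z) \<le> wsup n N V d p z"
    unfolding wsup_def
  proof (intro member_le_sum assms(2) finite_splits)
    fix x assume "x \<in> splits V d - {(P, P')}"
    then obtain Q Q' where x: "x = (Q, Q')" "(Q, Q') \<in> splits V d" by (cases x) auto
    have "\<Union>Q \<subseteq> U" "\<Union>Q' \<subseteq> U" using splitsD(2,3)[OF x(2)] assms(1) by auto
    then show "0 \<le> (case x of (P, P') \<Rightarrow> weight p d (card P) * unit_sup n (gauss_avg n N P') P z)"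
      using unit_sup_gauss_avg_nonneg x by simp
  qed
  then show ?thesis by simp
qed

lemma wsum_term:
  assumes "V \<subseteq> U" "(P, P') \<in> splits V d"
  shows "weight p d (card P) * block_norm n N P' P \<le> wsum n N V d p"
  unfolding wsum_eq_wsup block_norm_def by (rule wsup_term[OF assms])

lemma wsup_seminorm:
  assumes V: "V \<subseteq> U"
  shows "tensor_seminorm n U (wsup n N V d p)"
proof -
  have sub: "\<Union>P \<subseteq> U" "\<Union>P' \<subseteq> U" if "(P, P') \<in> splits V d" for P P'
    using splitsD(2,3)[OF that] V by auto
  have t: "tensor_seminorm n U (unit_sup n (gauss_avg n N P') P)" if "(P, P') \<in> splits V d" for P P'
    using tensor_seminorm.unit_sup_seminorm[OF gauss_avg_seminorm] sub[OF that] by blast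
  have "box_seminorm n U (wsup n N V d p)"
    unfolding box_seminorm_def
  proof (intro conjI allI impI)
    fix f g :: tensor and c :: real
    have "wsup n N V d p (\<lambda>i. f i + g i) \<le> (\<Sum>(P, P')\<in>splits V d. weight p d (card P) * (unit_sup n (gauss_avg n N P') P f + unit_sup n (gauss_avg n N P') P g))"
      unfolding wsup_def
    proof (rule sum_mono, clarify)
      fix P P' assume "(P, P') \<in> splits V d"
      from tensor_seminorm.add[OF t[OF this], of f g]
      show "weight p d (card P) * unit_sup n (gauss_avg n N P') P (\<lambda>i. f i + g i) \<le>
         weight p d (card P) * (unit_sup n (gauss_avg n N P') P f + unit_sup n (gauss_avg n N P') P g)"
        by (intro mult_left_mono) auto
    qed
    also have "\<dots> = wsup n N V d p f + wsup n N V d p g"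
      unfolding wsup_def sum.distrib[symmetric] by (intro sum.cong) (auto simp: distrib_left)
    finally show "wsup n N V d p (\<lambda>i. f i + g i) \<le> wsup n N V d p f + wsup n N V d p g" .
    show "wsup n N V d p (\<lambda>i. c * f i) = \<bar>c\<bar> * wsup n N V d p f"
      unfolding wsup_def sum_distrib_left
    proof (rule sum.cong[OF refl], clarify)
      fix P P' assume "(P, P') \<in> splits V d"
      from tensor_seminorm.scale[OF t[OF this], of c f]
      show "weight p d (card P) * unit_sup n (gauss_avg n N P') P (\<lambda>i. c * f i) = \<bar>c\<bar> * (weight p d (card P) * unit_sup n (gauss_avg n N P') P f)"
        by simp
    qed
    assume fg: "\<forall>i\<in>ibox n U. f i = g i"
    show "wsup n N V d p f = wsup n N V d p g"
      unfolding wsup_def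
    proof (rule sum.cong[OF refl], clarify)
      fix P P' assume "(P, P') \<in> splits V d"
      from tensor_seminorm.cong[OF t[OF this], of f g] fg
      show "weight p d (card P) * unit_sup n (gauss_avg n N P') P f = weight p d (card P) * unit_sup n (gauss_avg n N P') P g"
        by simp
    qed
  qed
  then show ?thesis using finite_U by (simp add: tensor_seminorm_def)
qed

lemma wsum_nonneg: "V \<subseteq> U \<Longrightarrow> 0 \<le> wsum n N V d p"
  unfolding wsum_eq_wsup using tensor_seminorm.nonneg[OF wsup_seminorm] by blast

text \<open>Adding \<open>P'\<close> on the Gaussian side injects the splits of the remaining set
  into those of \<open>V\<close>. The number of blocks in the supremum stays the same, so all
  weights change by one common power of p.\<close>

lemma wsum_gauss_avg_le:
  assumes V: "V \<subseteq> U" and P': "\<Union>P' \<subseteq> V" "disjoint P'" "{} \<notin> P'" and e: "e + card P' \<le> d" and p: "p \<ge> 1"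
  shows "wsum n (gauss_avg n N P') (V - \<Union>P') e p \<le> p powr ((real d - real e) / 2) * wsum n N V d p"
proof -
  let ?W = "V - \<Union>P'" and ?f = "\<lambda>(Q :: nat set set, Q'). (Q, P' \<union> Q')"
  have finV: "finite V" using V finite_U finite_subset by metis
  have fP': "finite P'" using P' V by (intro finite_blocks) auto
  have props: "Q' \<inter> P' = {} \<and> (Q, P' \<union> Q') \<in> splits V d" if c: "(Q, Q') \<in> splits ?W e" for Q Q'
  proof -
    note cd = splitsD[OF c]
    have d1: "\<Union>(Q \<union> Q') \<inter> \<Union>P' = {}" using cd(4) by auto
    have d2: "(Q \<union> Q') \<inter> P' = {}"
    proof (rule ccontr)
      assume "\<not> ?thesis"
      then obtain J where J: "J \<in> Q \<union> Q'" "J \<in> P'" by auto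
      then have "J \<subseteq> \<Union>(Q \<union> Q') \<inter> \<Union>P'" by blast
      then have "J = {}" unfolding d1 by simp
      then show False using J P' by auto
    qed
    have "disjoint (Q \<union> (P' \<union> Q'))"
      unfolding disjoint_def
    proof (intro ballI impI)
      fix A B assume AB: "A \<in> Q \<union> (P' \<union> Q')" "B \<in> Q \<union> (P' \<union> Q')" "A \<noteq> B"
      show "A \<inter> B = {}"
      proof (cases "A \<in> P'"; cases "B \<in> P'")
        assume "A \<in> P'" "B \<in> P'"
        then show ?thesis using P'(2) AB(3) by (auto simp: disjoint_def)
      next
        assume "A \<notin> P'" "B \<notin> P'"
        then show ?thesis using cd(5) AB by (auto simp: disjoint_def)
      next
        assume "A \<in> P'" "B \<notin> P'"
        then have "A \<subseteq> \<Union>P'" "B \<subseteq> \<Union>(Q \<union> Q')" using AB by auto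
        then show ?thesis using d1 by blast
      next
        assume "A \<notin> P'" "B \<in> P'"
        then have "A \<subseteq> \<Union>(Q \<union> Q')" "B \<subseteq> \<Union>P'" using AB by auto
        then show ?thesis using d1 by blast
      qed
    qed
    moreover have "\<Union>(Q \<union> (P' \<union> Q')) = V" using cd(4) P'(1) by auto
    moreover have "{} \<notin> Q \<union> (P' \<union> Q')" using cd(6) P'(3) by auto
    moreover have "card (Q \<union> (P' \<union> Q')) \<le> d"
    proof -
      have "Q \<union> (P' \<union> Q') = (Q \<union> Q') \<union> P'" by auto
      then have "card (Q \<union> (P' \<union> Q')) \<le> card (Q \<union> Q') + card P'" by (metis card_Un_le)
      then show ?thesis using cd(7) e by simp
    qed
    ultimately show ?thesis using d2 cd(1) by (auto simp: splits_def partition_on_def)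
  qed
  have inj: "inj_on ?f (splits ?W e)"
  proof (rule inj_onI)
    fix x y assume xy: "x \<in> splits ?W e" "y \<in> splits ?W e" "?f x = ?f y"
    obtain Q1 Q1' Q2 Q2' where e: "x = (Q1, Q1')" "y = (Q2, Q2')" by (cases x, cases y)
    then have "Q1' \<inter> P' = {}" "Q2' \<inter> P' = {}" using xy props by blast+
    moreover have "Q1 = Q2" "P' \<union> Q1' = P' \<union> Q2'" using xy(3) e by auto
    ultimately show "x = y" using e by blast
  qed
  have "wsum n (gauss_avg n N P') ?W e p =
     (\<Sum>(Q, Q')\<in>splits ?W e. p powr ((real d - real e) / 2) * (weight p d (card Q) * block_norm n N (P' \<union> Q') Q))"
    unfolding wsum_def
  proof (rule sum.cong[OF refl], clarify)
    fix Q Q' assume c: "(Q, Q') \<in> splits ?W e"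
    have "\<Union>P' \<subseteq> U" "\<Union>Q' \<subseteq> U" using splitsD(3)[OF c] P' V by auto
    then have "gauss_avg n (gauss_avg n N P') Q' = gauss_avg n N (P' \<union> Q')"
      using gauss_avg_gauss_avg[of P' Q'] props[OF c] by (simp add: fun_eq_iff Int_commute)
    moreover have "weight p e (card Q) = p powr ((real d - real e) / 2) * weight p d (card Q)"
      unfolding weight_def powr_add[symmetric] by (rule arg_cong[of _ _ "(powr) p"]) (simp add: field_simps)
    ultimately show "weight p e (card Q) * block_norm n (gauss_avg n N P') Q' Q =
        p powr ((real d - real e) / 2) * (weight p d (card Q) * block_norm n N (P' \<union> Q') Q)"
      by (simp add: block_norm_def)
  qed
  also have "\<dots> = p powr ((real d - real e) / 2) * (\<Sum>x\<in>?f ` splits ?W e. (case x of (P, P') \<Rightarrow> weight p d (card P) * block_norm n N P' P))"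
    unfolding sum.reindex[OF inj] sum_distrib_left by (intro sum.cong) auto
  also have "\<dots> \<le> p powr ((real d - real e) / 2) * wsum n N V d p"
    unfolding wsum_def
  proof (intro mult_left_mono sum_mono2 finite_splits finV)
    show "?f ` splits ?W e \<subseteq> splits V d" using props by auto
    fix x assume "x \<in> splits V d - ?f ` splits ?W e"
    then obtain Q Q' where x: "x = (Q, Q')" "(Q, Q') \<in> splits V d" by (cases x) auto
    have "\<Union>Q \<subseteq> U" "\<Union>Q' \<subseteq> U" using splitsD(2,3)[OF x(2)] V by auto
    then show "0 \<le> (case x of (P, P') \<Rightarrow> weight p d (card P) * block_norm n N P' P)"
      using block_norm_nonneg x by simp
  qed simp
  finally show ?thesis .
qed

lemma unit_sup_insert_upper:
  assumes "\<Union>(insert k P) \<subseteq> U" "k \<notin> P" "(\<Sum>u\<in>ibox n k. (x u)\<^sup>2) \<le> 1"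
  shows "unit_sup n N P (\<lambda>i. z i * x (restrict i k)) \<le> unit_sup n N (insert k P) z"
proof (rule unit_sup_least)
  fix y assume y: "y \<in> unit_arrays n P"
  let ?y = "y(k := x)"
  have fin: "finite P" using finite_blocks(1)[of P] assms(1) by auto
  have "tprod (insert k P) ?y i = x (restrict i k) * tprod P y i" for i
    using fin assms(2) by (subst tprod_insert) (auto intro!: tprod_cong)
  then have "N (\<lambda>i. z i * x (restrict i k) * tprod P y i) = N (\<lambda>i. z i * tprod (insert k P) ?y i)"
    by (simp add: mult.assoc)
  also have "\<dots> \<le> unit_sup n N (insert k P) z"
    using y assms by (intro unit_sup_upper) (auto simp: unit_arrays_def)
  finally show "N (\<lambda>i. z i * x (restrict i k) * tprod P y i) \<le> unit_sup n N (insert k P) z" .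
qed

lemma splits_insert:
  assumes c: "(P, P') \<in> splits (V - k) e" and k: "k \<subseteq> V" "k \<noteq> {}" and fin: "finite V"
  shows "k \<notin> P" "k \<notin> P'" "(insert k P, P') \<in> splits V (Suc e)"
proof -
  note cd = splitsD[OF c]
  have dk: "J \<inter> k = {}" if "J \<in> P \<union> P'" for J using that cd(4) by auto
  then show kP: "k \<notin> P" "k \<notin> P'" using k by auto
  have "disjoint (insert k P \<union> P')"
    using cd(5) dk unfolding disjoint_def by auto
  moreover have "card (insert k P \<union> P') \<le> Suc e"
    using cd(7) card_insert_le_m1 by (metis Suc_le_mono Un_insert_left card_insert_le_m1 card_insert_if finite_insert card.infinite le_SucI zero_le)
  moreover have "\<Union>(insert k P \<union> P') = V" using cd(4) k by auto
  ultimately show "(insert k P, P') \<in> splits V (Suc e)"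
    using cd(1,6) kP k by (auto simp: splits_def partition_on_def)
qed

text \<open>Adding the block \<open>k\<close> to the supremum injects the splits for
  \<open>(V - k, d - 1)\<close> into those for \<open>(V, d)\<close> without changing weights, and
  \<open>x\<close> is a competitor in the enlarged supremum. In the chaining this says that unit
  arrays have size at most \<open>S\<close>.\<close>

lemma wsup_le_wsum:
  assumes V: "V \<subseteq> U" and k: "k \<subseteq> V" "k \<noteq> {}" and x: "(\<Sum>u\<in>ibox n k. (x u)\<^sup>2) \<le> 1" and d: "d > 0"
  shows "wsup n N (V - k) (d - 1) p (\<lambda>i. x (restrict i k)) \<le> wsum n N V d p"
proof -
  let ?f = "\<lambda>(Q :: nat set set, Q' :: nat set set). (insert k Q, Q')"
  have finV: "finite V" using V finite_U finite_subset by metis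
  have props: "k \<notin> Q \<and> (insert k Q, Q') \<in> splits V d" if c: "(Q, Q') \<in> splits (V - k) (d - 1)" for Q Q'
    using splits_insert[OF c k finV] d by simp
  have inj: "inj_on ?f (splits (V - k) (d - 1))"
  proof (rule inj_onI)
    fix x y assume xy: "x \<in> splits (V - k) (d - 1)" "y \<in> splits (V - k) (d - 1)" "?f x = ?f y"
    obtain Q1 Q1' Q2 Q2' where e: "x = (Q1, Q1')" "y = (Q2, Q2')" by (cases x, cases y)
    then have "k \<notin> Q1" "k \<notin> Q2" using xy props by blast+
    then show "x = y" using xy(3) e by (auto simp: insert_ident)
  qed
  have "wsup n N (V - k) (d - 1) p (\<lambda>i. x (restrict i k)) \<le>
     (\<Sum>(Q, Q')\<in>splits (V - k) (d - 1). weight p d (card (insert k Q)) * block_norm n N Q' (insert k Q))"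
    unfolding wsup_def
  proof (rule sum_mono, clarify)
    fix Q Q' assume c: "(Q, Q') \<in> splits (V - k) (d - 1)"
    have sub: "\<Union>(insert k Q) \<subseteq> U" "\<Union>Q' \<subseteq> U" using splitsD(2,3)[OF c] k V by auto
    then have "finite Q" using finite_blocks(1)[of Q] by auto
    then have "weight p (d - 1) (card Q) = weight p d (card (insert k Q))"
      using props[OF c] d by (simp add: weight_def of_nat_diff add_diff_eq)
    moreover have "unit_sup n (gauss_avg n N Q') Q (\<lambda>i. x (restrict i k)) \<le> block_norm n N Q' (insert k Q)"
      using tensor_seminorm.unit_sup_insert_upper[OF gauss_avg_seminorm[OF sub(2)] sub(1) _ x, of "\<lambda>_. 1"] props[OF c]
      by (simp add: block_norm_def)
    ultimately show "weight p (d - 1) (card Q) * unit_sup n (gauss_avg n N Q') Q (\<lambda>i. x (restrict i k)) \<le>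
        weight p d (card (insert k Q)) * block_norm n N Q' (insert k Q)"
      by (simp add: mult_left_mono)
  qed
  also have "\<dots> = (\<Sum>x\<in>?f ` splits (V - k) (d - 1). (case x of (P, P') \<Rightarrow> weight p d (card P) * block_norm n N P' P))"
    unfolding sum.reindex[OF inj] by (intro sum.cong) auto
  also have "\<dots> \<le> wsum n N V d p"
    unfolding wsum_def
  proof (intro sum_mono2 finite_splits finV)
    show "?f ` splits (V - k) (d - 1) \<subseteq> splits V d" using props by auto
    fix x assume "x \<in> splits V d - ?f ` splits (V - k) (d - 1)"
    then obtain Q Q' where x: "x = (Q, Q')" "(Q, Q') \<in> splits V d" by (cases x) auto
    have "\<Union>Q \<subseteq> U" "\<Union>Q' \<subseteq> U" using splitsD(2,3)[OF x(2)] V by auto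
    then show "0 \<le> (case x of (P, P') \<Rightarrow> weight p d (card P) * block_norm n N P' P)"
      using block_norm_nonneg x by simp
  qed
  finally show ?thesis .
qed

text \<open>Averaging the term \<open>(P, P')\<close> over the block \<open>k\<close> gives a
  \<open>gauss_sup\<close> for the partition \<open>insert k P\<close> and the seminorm averaged
  over \<open>P'\<close>. The induction hypothesis applies unless this partition has all
  \<open>d\<close> blocks.\<close>

lemma gauss_avg_wsup_le:
  assumes V: "V \<subseteq> U" and k: "k \<subseteq> V" "k \<noteq> {}" and d: "d > 0" and p: "p \<ge> 1" and C: "C \<ge> 0" and F0: "F \<ge> 0"
    and IH: "\<And>N' W e D. tensor_seminorm n U N' \<Longrightarrow> W \<subseteq> U \<Longrightarrow> e < d \<Longrightarrow> partition_on W D \<Longrightarrow> card D = e \<Longrightarrow> k \<in> D \<Longrightarrow>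
        gauss_sup n N' D k \<le> C * wsum n N' W e p"
    and F: "\<And>D. partition_on V D \<Longrightarrow> card D = d \<Longrightarrow> k \<in> D \<Longrightarrow> gauss_sup n N D k \<le> F"
  shows "gauss_avg n (wsup n N (V - k) (d - 1) p) {k} (\<lambda>_. 1) \<le>
    sqrt p * (real (card (splits (V - k) (d - 1))) * (C * wsum n N V d p + F))"
proof -
  let ?splits = "splits (V - k) (d - 1)" and ?S = "wsum n N V d p"
  have finV: "finite V" using V finite_U finite_subset by metis
  have kU: "\<Union>{k} \<subseteq> U" using k V by auto
  have sub: "\<Union>P \<subseteq> U" "\<Union>P' \<subseteq> U" if "(P, P') \<in> ?splits" for P P'
    using splitsD(2,3)[OF that] V by auto
  have sn: "tensor_seminorm n U (unit_sup n (gauss_avg n N P') P)" if "(P, P') \<in> ?splits" for P P'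
    using tensor_seminorm.unit_sup_seminorm[OF gauss_avg_seminorm] sub[OF that] by blast
  have "gauss_avg n (wsup n N (V - k) (d - 1) p) {k} (\<lambda>_. 1) =
      (\<Sum>(P, P')\<in>?splits. weight p (d - 1) (card P) * gauss_avg n (unit_sup n (gauss_avg n N P') P) {k} (\<lambda>_. 1))"
    unfolding gauss_avg_def[of n "wsup n N (V - k) (d - 1) p"] gauss_avg_def[of n "unit_sup n _ _"] wsup_def split_beta'
  proof (subst Bochner_Integration.integral_sum)
    fix x assume "x \<in> ?splits"
    then have "(fst x, snd x) \<in> ?splits" by simp
    from tensor_seminorm.integrable_gauss_avg'[OF sn[OF this] kU, of "\<lambda>_. 1"]
    show "integrable (gauss_family n {k}) (\<lambda>g. weight p (d - 1) (card (fst x)) * unit_sup n (gauss_avg n N (snd x)) (fst x) (\<lambda>i. 1 * tprod {k} (curry g) i))"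
      by (rule integrable_mult_right)
  qed simp
  also have "\<dots> \<le> (\<Sum>(P, P')\<in>?splits. sqrt p * (C * ?S + F))"
  proof (rule sum_mono, clarify)
    fix P P' assume c: "(P, P') \<in> ?splits"
    note cd = splitsD[OF c]
    note ci = splits_insert[OF c k finV]
    let ?D = "insert k P"
    have finP: "finite P" "finite P'" using finite_blocks(1) sub[OF c] by auto
    have cardD: "card ?D = Suc (card P)" using ci(1) finP by simp
    have cardsum: "card P + card P' \<le> d - 1"
      using cd(1,7) finP by (simp add: card_Un_disjoint)
    have D: "partition_on (V - \<Union>P') ?D"
    proof -
      have "k \<inter> \<Union>P' = {}" using cd(3) by auto
      moreover have "\<Union>P \<inter> \<Union>P' = {}"
      proof (rule ccontr)
        assume "\<not> ?thesis"
        then obtain A B a where "A \<in> P" "B \<in> P'" "a \<in> A" "a \<in> B" by auto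
        moreover from this have "A \<noteq> B" using cd(1) by auto
        ultimately show False using cd(5) unfolding disjoint_def by blast
      qed
      ultimately have "\<Union>?D = V - \<Union>P'" using cd(4) k by auto
      moreover have "disjoint ?D" "{} \<notin> ?D"
        using splitsD(5,6)[OF ci(3)] by (auto simp: disjoint_def)
      ultimately show ?thesis by (simp add: partition_on_def)
    qed
    have eq: "gauss_avg n (unit_sup n (gauss_avg n N P') P) {k} (\<lambda>_. 1) = gauss_sup n (gauss_avg n N P') ?D k"
      using ci(1) by (simp add: gauss_sup_def)
    \<comment> \<open>With fewer than \<open>d\<close> blocks the powers of p from the weight and
      from \<open>wsum_gauss_avg_le\<close> multiply to sqrt p. With \<open>d\<close> blocks
      \<open>P'\<close> is empty, the term is a \<open>gauss_sup\<close> of \<open>N\<close> itself,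
      and only \<open>F\<close> is available.\<close>
    show "weight p (d - 1) (card P) * gauss_avg n (unit_sup n (gauss_avg n N P') P) {k} (\<lambda>_. 1) \<le> sqrt p * (C * ?S + F)"
    proof (cases "card ?D < d")
      case True
      have "gauss_sup n (gauss_avg n N P') ?D k \<le> C * wsum n (gauss_avg n N P') (V - \<Union>P') (card ?D) p"
        using V True D by (intro IH gauss_avg_seminorm sub[OF c]) auto
      also have "\<dots> \<le> C * (p powr ((real d - real (card ?D)) / 2) * ?S)"
      proof (intro mult_left_mono C wsum_gauss_avg_le V p)
        show "disjoint P'" "{} \<notin> P'" using cd(5,6) by (auto simp: disjoint_def)
        show "card ?D + card P' \<le> d" using cardD cardsum d by linarith
        show "\<Union>P' \<subseteq> V" using cd(3) by auto
      qed
      finally have "weight p (d - 1) (card P) * gauss_sup n (gauss_avg n N P') ?D k \<le>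
        weight p (d - 1) (card P) * (C * (p powr ((real d - real (card ?D)) / 2) * ?S))"
        by (intro mult_left_mono) auto
      also have "\<dots> = (weight p (d - 1) (card P) * p powr ((real d - real (card ?D)) / 2)) * (C * ?S)" by simp
      also have "weight p (d - 1) (card P) * p powr ((real d - real (card ?D)) / 2) = p powr (1 / 2)"
        unfolding weight_def powr_add[symmetric] cardD using d
        by (intro arg_cong[of _ _ "(powr) p"]) (simp add: of_nat_diff field_simps)
      also have "p powr (1 / 2) = sqrt p" using p by (simp add: powr_half_sqrt)
      also have "sqrt p * (C * ?S) \<le> sqrt p * (C * ?S + F)"
        using F0 p by (intro mult_left_mono) auto
      finally show ?thesis unfolding eq .
    next
      case False
      then have cP: "card P = d - 1" "card P' = 0" using cardsum cardD d by auto
      then have P': "P' = {}" using finP by simp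
      then have "gauss_sup n (gauss_avg n N P') ?D k = gauss_sup n N ?D k" by (simp add: gauss_avg_empty)
      also have "\<dots> \<le> F" using D P' cP cardD d by (intro F) auto
      also have "\<dots> \<le> C * ?S + F" using C wsum_nonneg[OF V] by simp
      finally have "gauss_sup n (gauss_avg n N P') ?D k \<le> C * ?S + F" .
      moreover have "weight p (d - 1) (card P) = p powr (1 / 2)"
        unfolding cP weight_def using d by (simp add: of_nat_diff)
      moreover have "p powr (1 / 2) = sqrt p" using p by (simp add: powr_half_sqrt)
      ultimately show ?thesis unfolding eq using p by (simp add: mult_left_mono)
    qed
  qed
  also have "\<dots> = sqrt p * (real (card ?splits) * (C * ?S + F))" by (simp add: split_beta')
  finally show ?thesis .
qed

end

subsection \<open>Second moments\<close>

definition fibre_sum :: "nat \<Rightarrow> nat set \<Rightarrow> tensor \<Rightarrow> nat set \<Rightarrow> tensor" where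
  "fibre_sum n U s L c = (\<Sum>a\<in>{a \<in> ibox n U. restrict a L = c}. s a)"

text \<open>The marginal of \<open>s\<close> on the block, labelled like the coordinates of a
  Gaussian family. A chaos of first order in that block then becomes \<open>ip\<close> of this
  vector with the Gaussian sample.\<close>

definition fibre_vec :: "nat \<Rightarrow> nat set \<Rightarrow> tensor \<Rightarrow> (nat set \<times> idx) \<Rightarrow> real" where
  "fibre_vec n U s b = fibre_sum n U s (fst b) (snd b)"

lemma sum_fibre_sum:
  assumes "finite U" "L \<subseteq> U"
  shows "(\<Sum>c\<in>ibox n L. fibre_sum n U s L c * y c) = (\<Sum>a\<in>ibox n U. s a * y (restrict a L))"
proof -
  have "(\<Sum>c\<in>ibox n L. fibre_sum n U s L c * y c) = (\<Sum>c\<in>ibox n L. \<Sum>a\<in>{a \<in> ibox n U. restrict a L = c}. s a * y (restrict a L))"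
    by (intro sum.cong refl) (simp add: fibre_sum_def sum_distrib_right)
  also have "\<dots> = (\<Sum>a\<in>ibox n U. s a * y (restrict a L))"
    using assms finite_subset[OF assms(2,1)] by (intro sum.group) (auto simp: restrict_ibox)
  finally show ?thesis .
qed

lemma sum_fibre_sum_power2:
  assumes "finite U" "L \<subseteq> U"
  shows "(\<Sum>c\<in>ibox n L. (fibre_sum n U s L c)\<^sup>2) =
    (\<Sum>a\<in>ibox n U. \<Sum>a'\<in>ibox n U. s a * s a' * (if restrict a L = restrict a' L then 1 else 0))"
proof -
  have "(\<Sum>c\<in>ibox n L. (fibre_sum n U s L c)\<^sup>2) = (\<Sum>a\<in>ibox n U. s a * fibre_sum n U s L (restrict a L))"
    unfolding power2_eq_square by (rule sum_fibre_sum[OF assms])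
  also have "\<dots> = (\<Sum>a\<in>ibox n U. \<Sum>a'\<in>ibox n U. s a * s a' * (if restrict a L = restrict a' L then 1 else 0))"
  proof (rule sum.cong[OF refl])
    fix a
    have "fibre_sum n U s L (restrict a L) = (\<Sum>a'\<in>ibox n U. if restrict a L = restrict a' L then s a' else 0)"
      unfolding fibre_sum_def using assms(1) by (subst sum.inter_filter) (auto intro!: sum.cong)
    then show "s a * fibre_sum n U s L (restrict a L) = (\<Sum>a'\<in>ibox n U. s a * s a' * (if restrict a L = restrict a' L then 1 else 0))"
      by (simp add: sum_distrib_left mult.assoc if_distrib[of "(*) _"] cong: if_cong)
  qed
  finally show ?thesis .
qed

lemma fibre_sum_add: "fibre_sum n U (\<lambda>a. s a + s' a) L c = fibre_sum n U s L c + fibre_sum n U s' L c"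
  by (simp add: fibre_sum_def sum.distrib)

lemma fibre_sum_diff: "fibre_sum n U (\<lambda>a. s a - s' a) L c = fibre_sum n U s L c - fibre_sum n U s' L c"
  by (simp add: fibre_sum_def sum_subtractf)

lemma fibre_sum_scale: "fibre_sum n U (\<lambda>a. r * s a) L c = r * fibre_sum n U s L c"
  by (simp add: fibre_sum_def sum_distrib_left)

lemma fibre_vec_add: "fibre_vec n U (\<lambda>a. s a + s' a) b = fibre_vec n U s b + fibre_vec n U s' b"
  by (simp add: fibre_vec_def fibre_sum_add)

lemma fibre_vec_diff: "fibre_vec n U (\<lambda>a. s a - s' a) b = fibre_vec n U s b - fibre_vec n U s' b"
  by (simp add: fibre_vec_def fibre_sum_diff)

lemma fibre_vec_scale: "fibre_vec n U (\<lambda>a. r * s a) b = r * fibre_vec n U s b"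
  by (simp add: fibre_vec_def fibre_sum_scale)

lemma sum_gfam_single: "(\<Sum>b\<in>gfam n {L}. f b) = (\<Sum>c\<in>ibox n L. f (L, c))"
proof -
  have "gfam n {L} = Pair L ` ibox n L" by auto
  then show ?thesis by (simp add: sum.reindex inj_on_def)
qed

lemma L2_fibre_vec: "L2_set (fibre_vec n U s) (gfam n {L}) = L2_set (fibre_sum n U s L) (ibox n L)"
  unfolding L2_set_def sum_gfam_single by (simp add: fibre_vec_def)

lemma ip_fibre_vec:
  assumes "finite U" "L \<subseteq> U"
  shows "ip (gfam n {L}) (fibre_vec n U s) g = (\<Sum>a\<in>ibox n U. s a * tprod {L} (curry g) a)"
  unfolding sum_gfam_single fibre_vec_def using sum_fibre_sum[OF assms, of n s "\<lambda>c. g (L, c)"]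
  by (simp add: tprod_def)

lemma gauss_second_moment: "integrable gauss (\<lambda>x. x)" "(\<integral>x. x \<partial>gauss) = 0"
  "integrable gauss (\<lambda>x. x * x)" "(\<integral>x. x * x \<partial>gauss) = 1"
  unfolding gauss_def
  using integrable_std_normal_moment[of 1] integral_std_normal_moment_odd[of 0]
    integrable_std_normal_moment[of 2] integral_std_normal_moment_even[of 1]
  by (simp_all add: integrable_density integral_density power2_eq_square)

text \<open>If \<open>a\<close> and \<open>a'\<close> differ on some block \<open>I\<close>, the
  coordinate \<open>(I, restrict a I)\<close> occurs exactly once in the product and has mean zero;
  otherwise every factor is a squared standard Gaussian.\<close>

lemma gauss_tprod_orthonormal:
  assumes U: "finite U" and K: "\<Union>K \<subseteq> U" "finite K" and a: "a \<in> ibox n U" "a' \<in> ibox n U"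
  shows "integrable (gauss_family n K) (\<lambda>g. tprod K (curry g) a * tprod K (curry g) a')"
    "(\<integral>g. tprod K (curry g) a * tprod K (curry g) a' \<partial>gauss_family n K) =
       (if \<forall>I\<in>K. restrict a I = restrict a' I then 1 else 0)"
proof -
  let ?c = "\<lambda>a I. (I, restrict a I)"
  let ?Y = "gfam n K"
  have sub: "finite J" "restrict a J \<in> ibox n J" "restrict a' J \<in> ibox n J" if "J \<in> K" for J
    using U K a that by (auto intro!: restrict_ibox intro: finite_subset[of _ U])
  have Y: "finite ?Y" using K sub by (intro finite_gfam) auto
  define \<phi> where "\<phi> b x = (if b \<in> ?c a ` K then x else 1) * (if b \<in> ?c a' ` K then x else (1::real))" for b x
  have \<phi>: "\<phi> b = (\<lambda>x. x * x) \<or> \<phi> b = (\<lambda>x. x) \<or> \<phi> b = (\<lambda>x. 1)" for b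
    by (auto simp: \<phi>_def fun_eq_iff)
  have int: "integrable gauss (\<phi> b)" for b
    using \<phi>[of b] gauss_second_moment by auto
  have tpp: "tprod K (curry g) e = (\<Prod>b\<in>?Y. if b \<in> ?c e ` K then g b else 1)" if "e = a \<or> e = a'" for e g
  proof -
    have "tprod K (curry g) e = (\<Prod>b\<in>?c e ` K. g b)"
      unfolding tprod_def by (subst prod.reindex) (auto simp: inj_on_def)
    also have "\<dots> = (\<Prod>b\<in>?Y. if b \<in> ?c e ` K then g b else 1)"
      using Y sub that by (subst prod.If_cases) (auto intro!: prod.cong)
    finally show ?thesis .
  qed
  have eq: "tprod K (curry g) a * tprod K (curry g) a' = (\<Prod>b\<in>?Y. \<phi> b (g b))" for g
    unfolding tpp[of a, simplified] tpp[of a', simplified] prod.distrib[symmetric] \<phi>_def ..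
  show "integrable (gauss_family n K) (\<lambda>g. tprod K (curry g) a * tprod K (curry g) a')"
    unfolding eq gauss_family_eq by (rule gauss_prod.product_integrable_prod[OF Y int])
  have "(\<integral>g. tprod K (curry g) a * tprod K (curry g) a' \<partial>gauss_family n K) = (\<Prod>b\<in>?Y. \<integral>x. \<phi> b x \<partial>gauss)"
    unfolding eq gauss_family_eq by (rule gauss_prod.product_integral_prod[OF Y int])
  also have "\<dots> = (if \<forall>I\<in>K. restrict a I = restrict a' I then 1 else 0)"
  proof (cases "\<forall>I\<in>K. restrict a I = restrict a' I")
    case True
    then have "?c a ` K = ?c a' ` K" by (intro image_cong) auto
    then have "(\<integral>x. \<phi> b x \<partial>gauss) = 1" for b
      using gauss_second_moment gauss.prob_space by (cases "b \<in> ?c a ` K") (auto simp: \<phi>_def)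
    then show ?thesis using True by simp
  next
    case False
    then obtain I where I: "I \<in> K" "restrict a I \<noteq> restrict a' I" by auto
    then have "?c a I \<notin> ?c a' ` K" "?c a I \<in> ?c a ` K" by auto
    then have "(\<integral>x. \<phi> (?c a I) x \<partial>gauss) = 0"
      using gauss_second_moment by (simp add: \<phi>_def)
    moreover have "?c a I \<in> ?Y" using I sub by auto
    ultimately have "(\<Prod>b\<in>?Y. \<integral>x. \<phi> b x \<partial>gauss) = 0" using Y by (meson prod_zero)
    then show ?thesis using False by auto
  qed
  finally show "(\<integral>g. tprod K (curry g) a * tprod K (curry g) a' \<partial>gauss_family n K) =
       (if \<forall>I\<in>K. restrict a I = restrict a' I then 1 else 0)" .
qed

lemma restrict_Un_eq_iff: "restrict a (A \<union> \<Union>K) = restrict a' (A \<union> \<Union>K) \<longleftrightarrow>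
    restrict a A = restrict a' A \<and> (\<forall>I\<in>K. restrict a I = restrict a' I)"
  by (auto simp: fun_eq_iff restrict_def; metis)

lemma box_seminorm_L2_fibre_vec:
  assumes U: "finite U"
  shows "tensor_seminorm n U (\<lambda>z. L2_set (fibre_vec n U (\<lambda>a. t a * z a)) Y)"
proof -
  have "box_seminorm n U (\<lambda>z. L2_set (fibre_vec n U (\<lambda>a. t a * z a)) Y)"
    unfolding box_seminorm_def
  proof (intro conjI allI impI)
    fix f g :: tensor and c :: real
    show "L2_set (fibre_vec n U (\<lambda>a. t a * (f a + g a))) Y \<le> L2_set (fibre_vec n U (\<lambda>a. t a * f a)) Y + L2_set (fibre_vec n U (\<lambda>a. t a * g a)) Y"
      unfolding distrib_left fibre_vec_add[abs_def] by (rule L2_set_triangle_ineq)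
    have "fibre_vec n U (\<lambda>a. t a * (c * f a)) = (\<lambda>b. c * fibre_vec n U (\<lambda>a. t a * f a) b)"
      by (rule ext) (simp add: fibre_vec_scale[symmetric] mult_ac)
    then show "L2_set (fibre_vec n U (\<lambda>a. t a * (c * f a))) Y = \<bar>c\<bar> * L2_set (fibre_vec n U (\<lambda>a. t a * f a)) Y"
      by (simp add: L2_set_def power_mult_distrib sum_distrib_left[symmetric] real_sqrt_mult)
    assume "\<forall>i\<in>ibox n U. f i = g i"
    then have "fibre_vec n U (\<lambda>a. t a * f a) = fibre_vec n U (\<lambda>a. t a * g a)"
      by (auto simp: fibre_vec_def fibre_sum_def fun_eq_iff intro!: sum.cong)
    then show "L2_set (fibre_vec n U (\<lambda>a. t a * f a)) Y = L2_set (fibre_vec n U (\<lambda>a. t a * g a)) Y" by simp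
  qed
  then show ?thesis using U by (simp add: tensor_seminorm_def)
qed

text \<open>The mean is at most the root of the second moment. By orthonormality only pairs of
  indices that agree on \<open>i\<close> and on every block of \<open>K\<close> survive, which means
  agreement on the union. Merged blocks originate here.\<close>

lemma gauss_avg_L2_fibre_vec_le:
  assumes U: "finite U" and K: "\<Union>K \<subseteq> U" and i: "i \<subseteq> U"
  shows "gauss_avg n (\<lambda>z. L2_set (fibre_vec n U (\<lambda>a. t a * z a)) (gfam n {i})) K z \<le>
    L2_set (fibre_sum n U (\<lambda>a. t a * z a) (i \<union> \<Union>K)) (ibox n (i \<union> \<Union>K))"
proof -
  let ?M = "\<lambda>z. L2_set (fibre_vec n U (\<lambda>a. t a * z a)) (gfam n {i})"
  let ?L = "i \<union> \<Union>K" and ?B = "ibox n U"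
  interpret M: tensor_seminorm n U ?M by (rule box_seminorm_L2_fibre_vec[OF U])
  interpret P: prob_space "gauss_family n K" unfolding gauss_family_eq by (rule prob_space_gaussv)
  define X where "X g = ?M (\<lambda>a. z a * tprod K (curry g) a)" for g
  define s where "s a = t a * z a" for a
  have finK: "finite K" using M.finite_blocks(1)[OF K] .
  have intX: "integrable (gauss_family n K) X" unfolding X_def by (rule M.integrable_gauss_avg'[OF K])
  have X2: "(X g)\<^sup>2 = (\<Sum>a\<in>?B. \<Sum>a'\<in>?B. s a * s a' * (if restrict a i = restrict a' i then 1 else 0) *
      (tprod K (curry g) a * tprod K (curry g) a'))" for g
    unfolding X_def L2_fibre_vec L2_set_power2 sum_fibre_sum_power2[OF U i]
    by (intro sum.cong refl) (simp add: s_def mult_ac)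
  have int2: "integrable (gauss_family n K) (\<lambda>g. (X g)\<^sup>2)"
    unfolding X2 by (intro Bochner_Integration.integrable_sum integrable_mult_right gauss_tprod_orthonormal(1)[OF U K finK])
  have "(\<integral>g. (X g)\<^sup>2 \<partial>gauss_family n K) = (\<Sum>a\<in>?B. \<Sum>a'\<in>?B. s a * s a' * (if restrict a i = restrict a' i then 1 else 0) *
      (\<integral>g. tprod K (curry g) a * tprod K (curry g) a' \<partial>gauss_family n K))"
    unfolding X2 using gauss_tprod_orthonormal(1)[OF U K finK]
    by (subst Bochner_Integration.integral_sum; (intro Bochner_Integration.integrable_sum integrable_mult_right)?)
       (auto intro!: sum.cong simp: Bochner_Integration.integral_sum)
  also have "\<dots> = (\<Sum>a\<in>?B. \<Sum>a'\<in>?B. s a * s a' * (if restrict a ?L = restrict a' ?L then 1 else 0))"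
    unfolding restrict_Un_eq_iff by (intro sum.cong refl) (simp add: gauss_tprod_orthonormal(2)[OF U K finK])
  also have "\<dots> = (\<Sum>c\<in>ibox n ?L. (fibre_sum n U s ?L c)\<^sup>2)"
    using i K by (intro sum_fibre_sum_power2[OF U, symmetric]) auto
  also have "\<dots> = (L2_set (fibre_sum n U s ?L) (ibox n ?L))\<^sup>2" by (simp add: L2_set_power2)
  finally have m2: "(\<integral>g. (X g)\<^sup>2 \<partial>gauss_family n K) = (L2_set (fibre_sum n U s ?L) (ibox n ?L))\<^sup>2" .
  have "0 \<le> (\<integral>g. (X g - (\<integral>g. X g \<partial>gauss_family n K))\<^sup>2 \<partial>gauss_family n K)" by (rule Bochner_Integration.integral_nonneg) simp
  also have "\<dots> = (\<integral>g. (X g)\<^sup>2 \<partial>gauss_family n K) - (\<integral>g. X g \<partial>gauss_family n K)\<^sup>2"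
    by (rule P.variance_eq[OF intX int2])
  finally have "(\<integral>g. X g \<partial>gauss_family n K)\<^sup>2 \<le> (L2_set (fibre_sum n U s ?L) (ibox n ?L))\<^sup>2" using m2 by simp
  then have "(\<integral>g. X g \<partial>gauss_family n K) \<le> L2_set (fibre_sum n U s ?L) (ibox n ?L)"
    by (rule power2_le_imp_le) simp
  then show ?thesis by (simp add: gauss_avg_def X_def s_def[abs_def])
qed

context tensor_seminorm
begin

text \<open>The l2 norm is attained at the normalized fibre sum, a unit array on the block
  \<open>L\<close>; a functional in the dual ball paired with the resulting tensor is at most the
  seminorm.\<close>

lemma dual_L2_le:
  assumes t: "t \<in> dual_ball n U N" and L: "L \<subseteq> U"
  shows "L2_set (fibre_sum n U (\<lambda>a. t a * z a) L) (ibox n L) \<le> unit_sup n N {L} z"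
proof (cases "L2_set (fibre_sum n U (\<lambda>a. t a * z a) L) (ibox n L) = 0")
  case True
  then show ?thesis using unit_sup_nonneg[of "{L}" z] L by simp
next
  case False
  let ?f = "fibre_sum n U (\<lambda>a. t a * z a) L"
  let ?h = "L2_set ?f (ibox n L)"
  have h: "?h > 0" using False by (simp add: order_less_le)
  define y where "y = (\<lambda>(_ :: nat set) c. ?f c / ?h)"
  have "(\<Sum>u\<in>ibox n L. (y L u)\<^sup>2) = (\<Sum>u\<in>ibox n L. (?f u)\<^sup>2) / ?h\<^sup>2"
    unfolding y_def by (simp add: power_divide sum_divide_distrib)
  also have "\<dots> = ?h\<^sup>2 / ?h\<^sup>2" by (simp only: L2_set_power2)
  finally have "(\<Sum>u\<in>ibox n L. (y L u)\<^sup>2) = ?h\<^sup>2 / ?h\<^sup>2" .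
  then have y: "y \<in> unit_arrays n {L}" using h by (simp add: unit_arrays_def)
  have "?h = ?h\<^sup>2 / ?h" using h by (simp add: power2_eq_square)
  also have "\<dots> = (\<Sum>c\<in>ibox n L. ?f c * y L c)"
    unfolding L2_set_power2 y_def by (simp add: sum_divide_distrib power2_eq_square)
  also have "\<dots> = ip (ibox n U) t (\<lambda>a. z a * tprod {L} y a)"
    unfolding sum_fibre_sum[OF finite_U L] by (simp add: tprod_def mult.assoc)
  also have "\<dots> \<le> N (\<lambda>a. z a * tprod {L} y a)" by (rule order_trans[OF abs_ge_self dual_ball_abs[OF t]])
  also have "\<dots> \<le> unit_sup n N {L} z" using L y by (intro unit_sup_upper) auto
  finally show ?thesis .
qed

text \<open>Sudakov's bound for the dual ball in the l2 metric that the weight \<open>z\<close>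
  induces on the block \<open>L\<close>. The dominating function is the seminorm of \<open>z\<close>
  times the Gaussian array, whose mean is \<open>gauss_avg n N {L} z\<close>. Functionals are
  indexed by \<open>F\<close> so that pairs with a dual component can be counted directly.\<close>

lemma sudakov_dual:
  assumes L: "L \<subseteq> U" and M: "gauss_avg n N {L} z \<le> M" "M > 0" and b: "b > 0"
    and F: "finite F" "f ` F \<subseteq> dual_ball n U N"
    and sep: "\<And>q q'. q \<in> F \<Longrightarrow> q' \<in> F \<Longrightarrow> q \<noteq> q' \<Longrightarrow>
       b \<le> l2dist (gfam n {L}) (fibre_vec n U (\<lambda>a. f q a * z a)) (fibre_vec n U (\<lambda>a. f q' a * z a))"
  shows "real (card F) \<le> exp (10000 * (M / b)\<^sup>2)"
proof -
  let ?Y = "gfam n {L}" and ?h = "\<lambda>g. N (\<lambda>a. z a * tprod {L} (curry g) a)"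
  let ?w = "\<lambda>q. fibre_vec n U (\<lambda>a. f q a * z a)"
  have LU: "\<Union>{L} \<subseteq> U" using L by simp
  interpret gauss_dominated ?Y ?h M ?w F
  proof
    show "finite ?Y" by (rule finite_gfam_blocks[OF LU])
    show "integrable (gaussv ?Y) ?h" using integrable_gauss_avg'[OF LU] by (simp add: gauss_family_eq)
    show "(\<integral>x. ?h x \<partial>gaussv ?Y) \<le> M" using M by (simp add: gauss_avg_def gauss_family_eq)
    show "M > 0" by (rule M)
    fix j k and x y :: "nat set \<times> idx \<Rightarrow> real" assume jk: "j \<in> F" "k \<in> F"
    let ?e = "\<lambda>a. z a * tprod {L} (curry (\<lambda>b. x b - y b)) a"
    have e: "?e = (\<lambda>a. z a * tprod {L} (curry x) a - z a * tprod {L} (curry y) a)"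
      by (simp add: tprod_def right_diff_distrib)
    have "(\<Sum>b\<in>?Y. (?w j b - ?w k b) * (x b - y b)) = ip ?Y (fibre_vec n U (\<lambda>a. f j a * z a - f k a * z a)) (\<lambda>b. x b - y b)"
      by (simp add: fibre_vec_diff)
    also have "\<dots> = ip (ibox n U) (f j) ?e - ip (ibox n U) (f k) ?e"
      unfolding ip_fibre_vec[OF finite_U L] by (simp add: left_diff_distrib sum_subtractf mult.assoc)
    finally have "\<bar>\<Sum>b\<in>?Y. (?w j b - ?w k b) * (x b - y b)\<bar> \<le> N ?e + N ?e"
      using dual_ball_abs[of "f j" ?e] dual_ball_abs[of "f k" ?e] jk F(2) by force
    also have "N ?e \<le> ?h x + ?h y" unfolding e by (rule diff_le)
    finally show "\<bar>\<Sum>b\<in>?Y. (?w j b - ?w k b) * (x b - y b)\<bar> \<le> 2 * (?h x + ?h y)" by simp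
  qed
  show ?thesis using F(1) b sep by (intro sudakov) auto
qed

end

subsection \<open>Covering at one scale\<close>

text \<open>In the application \<open>K\<close> consists of \<open>i\<close> and the blocks replaced
  by noise, and \<open>k\<close> is a block whose array remains and is frozen.\<close>

lemma partition_on_merge:
  assumes D: "partition_on V D" and K: "K \<subseteq> D" "K \<noteq> {}" and k: "k \<in> D - K"
  shows "partition_on (V - k) (insert (\<Union>K) (D - K - {k}))" "\<Union>K \<notin> D - K - {k}"
proof -
  have dis: "A \<inter> B = {}" if "A \<in> D" "B \<in> D" "A \<noteq> B" for A B
    using D that by (auto simp: partition_on_def disjoint_def)
  have ne: "A \<noteq> {}" if "A \<in> D" for A using D that by (auto simp: partition_on_def)
  have UV: "\<Union>D = V" using D by (auto simp: partition_on_def)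
  have disK: "\<Union>K \<inter> B = {}" if "B \<in> D - K" for B
    using dis K(1) that by blast
  have Kne: "\<Union>K \<noteq> {}" using K ne by blast
  show nin: "\<Union>K \<notin> D - K - {k}" using disK Kne by blast
  have "\<Union>(insert (\<Union>K) (D - K - {k})) = V - k"
  proof
    show "\<Union>(insert (\<Union>K) (D - K - {k})) \<subseteq> V - k"
      using UV K(1) disK[OF k] dis k by blast
    show "V - k \<subseteq> \<Union>(insert (\<Union>K) (D - K - {k}))" using UV by blast
  qed
  moreover have "disjoint (insert (\<Union>K) (D - K - {k}))"
    unfolding disjoint_def
  proof (intro ballI impI)
    fix A B assume AB: "A \<in> insert (\<Union>K) (D - K - {k})" "B \<in> insert (\<Union>K) (D - K - {k})" "A \<noteq> B"
    then consider "A = \<Union>K" "B \<in> D - K" | "B = \<Union>K" "A \<in> D - K" | "A \<in> D" "B \<in> D" by blast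
    then show "A \<inter> B = {}"
    proof cases
      case 1 then show ?thesis using disK by blast
    next
      case 2 then show ?thesis using disK by blast
    next
      case 3 then show ?thesis using dis AB(3) by blast
    qed
  qed
  moreover have "{} \<notin> insert (\<Union>K) (D - K - {k})" using ne Kne by auto
  ultimately show "partition_on (V - k) (insert (\<Union>K) (D - K - {k}))"
    by (simp add: partition_on_def)
qed

lemma partition_on_remove:
  assumes "partition_on V D" "k \<in> D"
  shows "partition_on (V - k) (D - {k})"
proof -
  have dis: "A \<inter> B = {}" if "A \<in> D" "B \<in> D" "A \<noteq> B" for A B
    using assms that by (auto simp: partition_on_def disjoint_def)
  have "\<Union>D = V" using assms by (auto simp: partition_on_def)
  then have "\<Union>(D - {k}) = V - k" using dis assms(2) by blast
  then show ?thesis using assms(1) by (auto simp: partition_on_def disjoint_def)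
qed

lemma tprod_add:
  assumes "finite D"
  shows "tprod D (\<lambda>k v. y k v + w k v) a = (\<Sum>K\<in>Pow D. tprod (D - K) y a * tprod K w a)"
proof -
  have "tprod D (\<lambda>k v. y k v + w k v) a = (\<Prod>k\<in>D. w k (restrict a k) + y k (restrict a k))"
    by (simp add: tprod_def add.commute)
  also have "\<dots> = (\<Sum>K\<in>Pow D. tprod (D - K) y a * tprod K w a)"
    unfolding prod_add[OF assms] by (simp add: tprod_def mult.commute)
  finally show ?thesis .
qed

lemma tprod_single: "tprod {L} x a = x L (restrict a L)"
  by (simp add: tprod_def)

lemma tprod_scale: "tprod K (\<lambda>k v. r * w k v) a = r ^ card K * tprod K w a"
  by (simp add: tprod_def prod.distrib)

lemma unit_arrays_diff:
  assumes "x \<in> unit_arrays n P" "z \<in> unit_arrays n P" "k \<in> P"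
  shows "(\<Sum>u\<in>ibox n k. (x k u - z k u)\<^sup>2) \<le> 2\<^sup>2"
proof -
  have "L2_set (x k) (ibox n k) \<le> 1" "L2_set (z k) (ibox n k) \<le> 1"
    using assms by (auto simp: L2_set_def unit_arrays_def)
  moreover have "L2_set (\<lambda>u. x k u + (- z k u)) (ibox n k) \<le> L2_set (x k) (ibox n k) + L2_set (\<lambda>u. - z k u) (ibox n k)"
    by (rule L2_set_triangle_ineq)
  moreover have "L2_set (\<lambda>u. - z k u) (ibox n k) = L2_set (z k) (ibox n k)" by (simp add: L2_set_def)
  ultimately have "L2_set (\<lambda>u. x k u - z k u) (ibox n k) \<le> 2" by simp
  then have "(L2_set (\<lambda>u. x k u - z k u) (ibox n k))\<^sup>2 \<le> 2\<^sup>2" by (intro power_mono) auto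
  then show ?thesis by (simp only: L2_set_power2)
qed

text \<open>\<open>\<kappa>\<close> bounds the number of splits of a subset of \<open>U\<close>, and \<open>F\<close> all \<open>gauss_sup n N D i\<close> over partitions \<open>D\<close> of \<open>V\<close>
  into \<open>d\<close> blocks. \<open>F\<close> enters \<open>EB\<close> because averaging a term of \<open>wsup\<close> over the block \<open>k\<close> can produce a quantity of that kind.\<close>

locale chain_setup = tensor_seminorm +
  fixes V :: "nat set" and D :: "nat set set" and i :: "nat set" and d :: nat
    and p C \<kappa> F \<eta> \<sigma> :: real
  assumes V: "V \<subseteq> U" and D: "partition_on V D" and cardD: "card D = d" and d2: "d \<ge> 2" and i: "i \<in> D"
    and p: "p \<ge> 1" and \<eta>: "0 < \<eta>" "\<eta> \<le> 1" and C: "C \<ge> 1" and \<kappa>: "\<kappa> \<ge> 1" and F: "F \<ge> 0"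
    and \<sigma>0: "\<sigma> > 0" and \<sigma>: "wsum n N V d p / \<eta> + \<eta> * F \<le> \<sigma>"
    and IH: "\<And>k x. k \<in> D - {i} \<Longrightarrow> gauss_sup n (contract N k x) (D - {k}) i \<le> C * wsup n N (V - k) (d - 1) p (\<lambda>a. x (restrict a k))"
    and EB: "\<And>k. k \<in> D - {i} \<Longrightarrow> gauss_avg n (wsup n N (V - k) (d - 1) p) {k} (\<lambda>_. 1) \<le> sqrt p * (\<kappa> * (C * wsum n N V d p + F))"
begin

abbreviation "S \<equiv> wsum n N V d p"
abbreviation "D' \<equiv> D - {i}"
abbreviation "T \<equiv> dual_ball n U N"
abbreviation "Y \<equiv> gfam n {i}"

text \<open>The size of a difference of arrays in block \<open>k\<close>. By the induction
  hypothesis it controls the cost of moving the center, and it also dominates all norms in which a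
  frozen \<open>x\<close> remains after smoothing.\<close>

definition B :: "nat set \<Rightarrow> tensor \<Rightarrow> real" where
  "B k x = wsup n N (V - k) (d - 1) p (\<lambda>a. x (restrict a k))"

text \<open>Chosen so that \<open>c * (e / 2) * \<sigma>\<close> is 8 times the Gaussian mean
  \<open>real d * \<kappa> * C * e * \<sigma>\<close> in \<open>packing_B\<close>, as the packing
  bound demands.\<close>

definition c :: real where "c = 16 * real d * \<kappa> * C"

definition marginal_L2 :: "tensor \<Rightarrow> real" where "marginal_L2 s = L2_set (fibre_sum n U s V) (ibox n V)"

text \<open>The coefficient vector, in the Gaussian block \<open>i\<close>, of the recentered
  process. The center is subtracted in each factor separately and not from the product, so that each
  x-factor becomes small; the cross terms dropped are paid for by
  \<open>gmax_recenter\<close>.\<close>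

definition coef :: "(nat set \<Rightarrow> tensor) \<Rightarrow> tensor \<Rightarrow> (nat set \<Rightarrow> tensor) \<times> tensor \<Rightarrow> nat set \<times> idx \<Rightarrow> real" where
  "coef z \<tau> q = fibre_vec n U (\<lambda>a. (snd q a - \<tau> a) * tprod D' (\<lambda>k u. fst q k u - z k u) a)"

lemma finite_V: "finite V" using V finite_U finite_subset by metis

lemma finite_D: "finite D"
  using d2 cardD card.infinite by fastforce

lemma UD: "\<Union>D = V" using D by (simp add: partition_on_def)

lemma block: "k \<in> D \<Longrightarrow> k \<subseteq> V" "k \<in> D \<Longrightarrow> k \<subseteq> U" "k \<in> D \<Longrightarrow> k \<noteq> {}"
  using UD V D by (auto simp: partition_on_def)

lemma DU: "K \<subseteq> D \<Longrightarrow> \<Union>K \<subseteq> U" using UD V by auto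

lemma iU: "i \<subseteq> U" "\<Union>{i} \<subseteq> U" using block(2)[OF i] by auto

lemma V_ne: "V \<noteq> {}" using block[OF i] by auto

lemma finite_D': "finite D'" "card D' = d - 1"
  using finite_D i cardD by auto

lemma S0: "S \<ge> 0" by (rule wsum_nonneg[OF V])

lemma c_ge: "c \<ge> 1" "c \<ge> 16 * real d" "c > 0"
proof -
  have "1 * 1 \<le> \<kappa> * C" using \<kappa> C by (intro mult_mono) auto
  then have "16 * real d * 1 \<le> 16 * real d * (\<kappa> * C)" by (intro mult_left_mono) auto
  then show "c \<ge> 16 * real d" by (simp add: c_def mult.assoc)
  then show "c \<ge> 1" "c > 0" using d2 by linarith+
qed

lemma S_le: "S \<le> \<eta> * \<sigma>" "S \<le> \<sigma>" "\<eta> * F \<le> \<sigma>"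
proof -
  have 1: "S / \<eta> \<ge> 0" "\<eta> * F \<ge> 0" using S0 \<eta> F by auto
  then have "S / \<eta> \<le> \<sigma>" using \<sigma> by linarith
  then show a: "S \<le> \<eta> * \<sigma>" using \<eta> by (simp add: field_simps)
  show "\<eta> * F \<le> \<sigma>" using 1 \<sigma> by linarith
  have "\<eta> * \<sigma> \<le> 1 * \<sigma>" using \<eta> \<sigma>0 by (intro mult_right_mono) auto
  then show "S \<le> \<sigma>" using a by simp
qed

lemma wsup_sn: "tensor_seminorm n U (wsup n N (V - k) (d - 1) p)"
  using V by (intro wsup_seminorm) auto

lemma B_nonneg: "0 \<le> B k x"
  unfolding B_def by (rule tensor_seminorm.nonneg[OF wsup_sn])

lemma B_diff_le: "B k (\<lambda>u. x u - z u) \<le> B k x + B k z"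
  unfolding B_def by (rule tensor_seminorm.diff_le[OF wsup_sn])

lemma B_minus: "B k (\<lambda>u. x u - z u) = B k (\<lambda>u. z u - x u)"
  unfolding B_def using tensor_seminorm.uminus[OF wsup_sn, of k "\<lambda>a. x (restrict a k) - z (restrict a k)"] by simp

lemma B_ball_le: "k \<in> D' \<Longrightarrow> x \<in> unit_arrays n D' \<Longrightarrow> B k (x k) \<le> S"
  unfolding B_def using block[of k] d2 by (intro wsup_le_wsum V) (auto simp: unit_arrays_def)

lemma wsup_term':
  assumes "(P, P') \<in> splits (V - k) (d - 1)" and w: "weight p (d - 1) (card P) = p powr (- r)"
  shows "unit_sup n (gauss_avg n N P') P (\<lambda>a. x (restrict a k)) \<le> p powr r * B k x"
proof -
  have "p powr (- r) * unit_sup n (gauss_avg n N P') P (\<lambda>a. x (restrict a k)) \<le> B k x"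
    unfolding B_def w[symmetric] using V by (intro wsup_term assms(1)) auto
  then have "p powr r * (p powr (- r) * unit_sup n (gauss_avg n N P') P (\<lambda>a. x (restrict a k))) \<le> p powr r * B k x"
    by (intro mult_left_mono) auto
  then show ?thesis using p by (simp add: mult.assoc[symmetric] powr_add[symmetric])
qed

lemma wsum_term':
  assumes "(P, P') \<in> splits V d" and w: "weight p d (card P) = p powr (- r)"
  shows "block_norm n N P' P \<le> p powr r * S"
proof -
  have "p powr (- r) * block_norm n N P' P \<le> S"
    unfolding w[symmetric] by (intro wsum_term assms(1) V)
  then have "p powr r * (p powr (- r) * block_norm n N P' P) \<le> p powr r * S"
    by (intro mult_left_mono) auto
  then show ?thesis using p by (simp add: mult.assoc[symmetric] powr_add[symmetric])
qed

lemma dual_diff_L2: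
  assumes "t \<in> T" "\<tau> \<in> T" "L \<subseteq> U"
  shows "L2_set (fibre_sum n U (\<lambda>a. (t a - \<tau> a) * z a) L) (ibox n L) \<le> 2 * unit_sup n N {L} z"
proof -
  have "fibre_sum n U (\<lambda>a. (t a - \<tau> a) * z a) L = (\<lambda>b. fibre_sum n U (\<lambda>a. t a * z a) L b + - fibre_sum n U (\<lambda>a. \<tau> a * z a) L b)"
    by (simp add: fun_eq_iff left_diff_distrib fibre_sum_diff)
  then have "L2_set (fibre_sum n U (\<lambda>a. (t a - \<tau> a) * z a) L) (ibox n L) \<le>
    L2_set (fibre_sum n U (\<lambda>a. t a * z a) L) (ibox n L) + L2_set (\<lambda>b. - fibre_sum n U (\<lambda>a. \<tau> a * z a) L b) (ibox n L)"
    by (simp only: L2_set_triangle_ineq)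
  also have "L2_set (\<lambda>b. - fibre_sum n U (\<lambda>a. \<tau> a * z a) L b) (ibox n L) = L2_set (fibre_sum n U (\<lambda>a. \<tau> a * z a) L) (ibox n L)"
    by (simp add: L2_set_def)
  finally show ?thesis using dual_L2_le[OF assms(1,3), of z] dual_L2_le[OF assms(2,3), of z] by simp
qed

lemma tprod_split:
  assumes "K \<subseteq> D'" "k \<in> D' - K"
  shows "tprod (D' - K) y a = y k (restrict a k) * tprod (D' - K - {k}) y a"
proof -
  have "D' - K = insert k (D' - K - {k})" using assms by auto
  then show ?thesis using finite_D' by (metis Diff_iff finite_Diff insertI1 tprod_insert)
qed

lemma card_D'_diff:
  assumes "K \<subseteq> D'" "k \<in> D' - K"
  shows "card (D' - K - {k}) = d - 2 - card K" "card K \<le> d - 2"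
proof -
  have "insert k K \<subseteq> D'" using assms by auto
  then have "card (insert k K) \<le> d - 1" using finite_D' card_mono by metis
  moreover have "card (insert k K) = Suc (card K)"
    using assms finite_D' finite_subset by (metis Diff_iff card_insert_disjoint)
  ultimately show "card K \<le> d - 2" by simp
  have "card (D' - K) = d - 1 - card K"
    using assms finite_D' by (metis card_Diff_subset finite_subset)
  then show "card (D' - K - {k}) = d - 2 - card K"
    using assms finite_D' by (simp add: card_Diff_singleton_if)
qed

text \<open>With \<open>y k\<close> frozen, the merged block and the blocks in
  \<open>D' - K - {k}\<close> form a split of \<open>V - k\<close> without Gaussian part and with
  \<open>d - 1 - card K\<close> blocks, so the seminorm is a term of \<open>B k\<close>. Differences
  of unit arrays have norm at most 2, whence \<open>2 ^ d\<close>.\<close>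

lemma unit_sup_merged_le:
  assumes K: "K \<subseteq> D'" "k \<in> D' - K"
    and y: "\<And>I. I \<in> D' \<Longrightarrow> (\<Sum>u\<in>ibox n I. (y I u)\<^sup>2) \<le> 2\<^sup>2"
  shows "unit_sup n N {i \<union> \<Union>K} (tprod (D' - K) y) \<le> 2 ^ d * (p powr ((real (card K) - 1) / 2) * B k (y k))"
proof (rule unit_sup_least)
  fix y' assume y': "y' \<in> unit_arrays n {i \<union> \<Union>K}"
  let ?L = "i \<union> \<Union>K"
  let ?Q = "insert ?L (D' - K - {k})"
  let ?w = "y(?L := y' ?L)"
  have iK: "insert i K \<subseteq> D" "insert i K \<noteq> {}" "k \<in> D - insert i K" using K i by auto
  have set_eq: "D - insert i K - {k} = D' - K - {k}" by auto
  have part: "partition_on (V - k) ?Q" and nin: "?L \<notin> D' - K - {k}"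
    using partition_on_merge[OF D iK] unfolding set_eq by auto
  have finR: "finite (D' - K - {k})" using finite_D' by simp
  have cQ: "card ?Q = d - 1 - card K"
    using nin finR card_D'_diff[OF K] d2 by simp
  have splits: "(?Q, {}) \<in> splits (V - k) (d - 1)"
    using part cQ by (simp add: splits_def)
  have QU: "\<Union>?Q \<subseteq> U" using part V by (auto simp: partition_on_def)
  have eq: "tprod (D' - K) y a * tprod {?L} y' a = y k (restrict a k) * tprod ?Q ?w a" for a
  proof -
    have "tprod ?Q ?w a = y' ?L (restrict a ?L) * tprod (D' - K - {k}) ?w a"
      using nin finR by (simp add: tprod_insert)
    also have "tprod (D' - K - {k}) ?w a = tprod (D' - K - {k}) y a"
      using nin by (intro tprod_cong) auto
    finally show ?thesis unfolding tprod_split[OF K] tprod_single by (simp only: mult_ac)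
  qed
  have "N (\<lambda>a. tprod (D' - K) y a * tprod {?L} y' a) = N (\<lambda>a. y k (restrict a k) * tprod ?Q ?w a)"
    by (simp only: eq)
  also have "\<dots> \<le> 2 ^ card ?Q * unit_sup n N ?Q (\<lambda>a. y k (restrict a k))"
  proof (rule norm_tprod_le[OF QU])
    fix I assume I: "I \<in> ?Q"
    show "(\<Sum>u\<in>ibox n I. (?w I u)\<^sup>2) \<le> 2\<^sup>2"
    proof (cases "I = ?L")
      case True
      have "(\<Sum>u\<in>ibox n ?L. (y' ?L u)\<^sup>2) \<le> 1" using y' by (simp add: unit_arrays_def)
      then show ?thesis using True by simp
    next
      case False
      then show ?thesis using I y[of I] by auto
    qed
  qed simp
  also have "\<dots> \<le> 2 ^ d * (p powr ((real (card K) - 1) / 2) * B k (y k))"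
  proof (intro mult_mono)
    show "(2::real) ^ card ?Q \<le> 2 ^ d" using cQ by (intro power_increasing) auto
    have "weight p (d - 1) (card ?Q) = p powr (- ((real (card K) - 1) / 2))"
      unfolding cQ weight_def using card_D'_diff(2)[OF K] d2
      by (intro arg_cong[of _ _ "(powr) p"]) (simp add: of_nat_diff field_simps)
    from wsup_term'[OF splits this, of "y k"]
    show "unit_sup n N ?Q (\<lambda>a. y k (restrict a k)) \<le> p powr ((real (card K) - 1) / 2) * B k (y k)"
      by (simp add: gauss_avg_empty)
    show "0 \<le> unit_sup n N ?Q (\<lambda>a. y k (restrict a k))" by (rule unit_sup_nonneg[OF QU])
  qed auto
  finally show "N (\<lambda>a. tprod (D' - K) y a * tprod {?L} y' a) \<le> 2 ^ d * (p powr ((real (card K) - 1) / 2) * B k (y k))" .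
qed

text \<open>Here the noise blocks stay Gaussian together with \<open>i\<close> instead of being
  merged, so only \<open>d - 2 - card K\<close> blocks remain in the supremum. The price is one more
  factor sqrt p than in the merged case.\<close>

lemma gauss_avg_partial_le:
  assumes K: "K \<subseteq> D'" "k \<in> D' - K"
    and y: "\<And>I. I \<in> D' \<Longrightarrow> (\<Sum>u\<in>ibox n I. (y I u)\<^sup>2) \<le> 2\<^sup>2"
  shows "gauss_avg n (gauss_avg n N {i}) K (tprod (D' - K) y) \<le> 2 ^ d * (p powr (real (card K) / 2) * B k (y k))"
proof -
  let ?P' = "insert i K" and ?P = "D' - K - {k}"
  have P'U: "\<Union>?P' \<subseteq> U" and PU: "\<Union>?P \<subseteq> U" using K i by (auto intro!: DU[THEN subsetD])
  interpret G: tensor_seminorm n U "gauss_avg n N ?P'" by (rule gauss_avg_seminorm[OF P'U])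
  have eqPD: "?P \<union> ?P' = D - {k}" using K i by auto
  have cP: "card ?P = d - 2 - card K" by (rule card_D'_diff(1)[OF K])
  have splits: "(?P, ?P') \<in> splits (V - k) (d - 1)"
    unfolding splits_def using partition_on_remove[OF D, of k] K cardD finite_D eqPD by (auto simp: Un_commute)
  have "gauss_avg n (gauss_avg n N {i}) K (tprod (D' - K) y) = gauss_avg n N ?P' (tprod (D' - K) y)"
    using gauss_avg_gauss_avg[OF iU(2), of K] K P'U by auto
  also have "\<dots> = gauss_avg n N ?P' (\<lambda>a. y k (restrict a k) * tprod ?P y a)"
    by (intro arg_cong[of _ _ "gauss_avg n N ?P'"] ext tprod_split[OF K])
  also have "\<dots> \<le> 2 ^ card ?P * unit_sup n (gauss_avg n N ?P') ?P (\<lambda>a. y k (restrict a k))"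
    using y by (intro G.norm_tprod_le[OF PU]) auto
  also have "\<dots> \<le> 2 ^ d * (p powr (real (card K) / 2) * B k (y k))"
  proof (intro mult_mono)
    show "(2::real) ^ card ?P \<le> 2 ^ d" using cP by (intro power_increasing) auto
    have "weight p (d - 1) (card ?P) = p powr (- (real (card K) / 2))"
      unfolding cP weight_def using card_D'_diff(2)[OF K] d2
      by (intro arg_cong[of _ _ "(powr) p"]) (simp add: of_nat_diff field_simps)
    from wsup_term'[OF splits this, of "y k"]
    show "unit_sup n (gauss_avg n N ?P') ?P (\<lambda>a. y k (restrict a k)) \<le> p powr (real (card K) / 2) * B k (y k)" .
    show "0 \<le> unit_sup n (gauss_avg n N ?P') ?P (\<lambda>a. y k (restrict a k))" by (rule G.unit_sup_nonneg[OF PU])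
  qed auto
  finally show ?thesis .
qed

text \<open>The case in which every x-variable has been replaced by noise and all blocks are merged
  into one. No difference is left for \<open>B\<close>, and the bound comes from
  \<open>S\<close>.\<close>

lemma unit_sup_full_le: "unit_sup n N {V} (\<lambda>_. 1) \<le> p powr ((real d - 2) / 2) * S"
proof -
  have "({V}, {}) \<in> splits V d" using V_ne d2 by (auto simp: splits_def partition_on_def disjoint_def)
  moreover have "weight p d (card {V}) = p powr (- ((real d - 2) / 2))"
    unfolding weight_def by (intro arg_cong[of _ _ "(powr) p"]) (simp add: field_simps)
  ultimately have "block_norm n N {} {V} \<le> p powr ((real d - 2) / 2) * S" by (rule wsum_term')
  then show ?thesis by (simp add: block_norm_def gauss_avg_empty)
qed

lemma gauss_avg_full_le: "gauss_avg n N D (\<lambda>_. 1) \<le> p powr ((real d - 1) / 2) * S"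
proof -
  have "({}, D) \<in> splits V d" using D cardD by (auto simp: splits_def)
  moreover have "weight p d (card ({} :: nat set set)) = p powr (- ((real d - 1) / 2))"
    unfolding weight_def by (intro arg_cong[of _ _ "(powr) p"]) (simp add: field_simps)
  ultimately have "block_norm n N D {} \<le> p powr ((real d - 1) / 2) * S" by (rule wsum_term')
  moreover have "unit_sup n (gauss_avg n N D) {} (\<lambda>_. 1) = gauss_avg n N D (\<lambda>_. 1)"
    using zero_in_unit_arrays by (auto simp: unit_sup_def unit_arrays_def)
  ultimately show ?thesis by (simp add: block_norm_def)
qed

lemma gauss_avg_V_le: "gauss_avg n N {V} (\<lambda>_. 1) \<le> p powr ((real d - 1) / 2) * S"
proof -
  have "({}, {V}) \<in> splits V d" using V_ne d2 by (auto simp: splits_def partition_on_def disjoint_def)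
  moreover have "weight p d (card ({} :: nat set set)) = p powr (- ((real d - 1) / 2))"
    unfolding weight_def by (intro arg_cong[of _ _ "(powr) p"]) (simp add: field_simps)
  ultimately have "block_norm n N {V} {} \<le> p powr ((real d - 1) / 2) * S" by (rule wsum_term')
  moreover have "unit_sup n (gauss_avg n N {V}) {} (\<lambda>_. 1) = gauss_avg n N {V} (\<lambda>_. 1)"
    using zero_in_unit_arrays by (auto simp: unit_sup_def unit_arrays_def)
  ultimately show ?thesis by (simp add: block_norm_def)
qed

text \<open>For \<open>d = 2\<close> moving the \<open>x\<close>-variables does not suffice, and the dual variable is recentered as well.\<close>

definition near :: "real \<Rightarrow> (nat set \<Rightarrow> tensor) \<Rightarrow> tensor \<Rightarrow> (nat set \<Rightarrow> tensor) \<times> tensor \<Rightarrow> bool" where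
  "near r z \<tau> q \<longleftrightarrow> (\<forall>k\<in>D'. B k (\<lambda>u. fst q k u - z k u) \<le> r) \<and> (d = 2 \<longrightarrow> marginal_L2 (\<lambda>a. snd q a - \<tau> a) \<le> r)"

lemma ratio_pow:
  assumes "0 < e" "e \<le> 1"
  shows "(\<eta> * e / sqrt p) ^ m * p powr (real m / 2) = (\<eta> * e) ^ m"
proof -
  have "p powr (real m / 2) = (p powr (1 / 2)) ^ m"
    using p by (simp add: powr_realpow[symmetric] powr_powr)
  also have "p powr (1 / 2) = sqrt p" using p by (simp add: powr_half_sqrt)
  finally show ?thesis using p by (simp add: power_divide)
qed

lemma ratio_pow':
  assumes "0 < e" "e \<le> 1"
  shows "(\<eta> * e / sqrt p) ^ m * p powr ((real m - 1) / 2) = (\<eta> * e) ^ m / sqrt p"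
proof -
  have "p powr ((real m - 1) / 2) = p powr (real m / 2) / sqrt p"
    using p by (simp add: diff_divide_distrib powr_diff powr_half_sqrt)
  then show ?thesis using ratio_pow[OF assms, of m] by simp
qed

lemma \<eta>e_pow: "0 < e \<Longrightarrow> e \<le> 1 \<Longrightarrow> 0 < \<eta> * e \<and> \<eta> * e \<le> 1"
  using \<eta> by (simp add: mult_le_one)

text \<open>Smoothing: \<open>y + \<delta> g\<close> with \<open>\<delta> = \<eta> e / sqrt p\<close> replaces \<open>y\<close>, and the
  product over the coordinates is expanded.\<close>

lemma smooth_L2_term:
  assumes e: "0 < e" "e \<le> 1" and K: "K \<subseteq> D'" "K \<noteq> {}" and t: "t \<in> T" "\<tau> \<in> T" and z: "z \<in> unit_arrays n D'" and x: "x \<in> unit_arrays n D'"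
    and near: "near (c * e * \<sigma>) z \<tau> (x, t)"
  shows "(\<eta> * e / sqrt p) ^ card K * gauss_avg n (\<lambda>w. L2_set (fibre_vec n U (\<lambda>a. (t a - \<tau> a) * w a)) Y) K (tprod (D' - K) (\<lambda>k u. x k u - z k u))
     \<le> 2 * 2 ^ d * c * \<eta> * e\<^sup>2 * \<sigma> / sqrt p"
proof -
  let ?y = "\<lambda>k u. x k u - z k u" and ?\<delta> = "\<eta> * e / sqrt p"
  let ?L = "i \<union> \<Union>K"
  have LU: "?L \<subseteq> U" and KU: "\<Union>K \<subseteq> U" using K i iU by (auto intro!: DU[THEN subsetD])
  have \<delta>0: "?\<delta> > 0" using \<eta> e p by simp
  have y2: "(\<Sum>u\<in>ibox n I. (?y I u)\<^sup>2) \<le> 2\<^sup>2" if "I \<in> D'" for I using unit_arrays_diff[OF x z that] .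
  have finK: "finite K" using K finite_D' finite_subset by metis
  then have cK: "card K \<ge> 1" using K by (simp add: Suc_leI card_gt_0_iff)
  have \<eta>e: "0 < \<eta> * e" "\<eta> * e \<le> 1" using \<eta>e_pow[OF e] by auto
  have pw: "(\<eta> * e) ^ card K \<le> \<eta> * e"
    using power_decreasing[OF cK, of "\<eta> * e"] \<eta>e by simp
  have "gauss_avg n (\<lambda>w. L2_set (fibre_vec n U (\<lambda>a. (t a - \<tau> a) * w a)) Y) K (tprod (D' - K) ?y) \<le>
      L2_set (fibre_sum n U (\<lambda>a. (t a - \<tau> a) * tprod (D' - K) ?y a) ?L) (ibox n ?L)"
    by (rule gauss_avg_L2_fibre_vec_le[OF finite_U KU iU(1)])
  then have le1: "?\<delta> ^ card K * gauss_avg n (\<lambda>w. L2_set (fibre_vec n U (\<lambda>a. (t a - \<tau> a) * w a)) Y) K (tprod (D' - K) ?y) \<le>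
      ?\<delta> ^ card K * L2_set (fibre_sum n U (\<lambda>a. (t a - \<tau> a) * tprod (D' - K) ?y a) ?L) (ibox n ?L)"
    using \<delta>0 by (intro mult_left_mono) auto
  \<comment> \<open>If some block \<open>k\<close> is not noise, its difference contributes a factor
    e through \<open>B\<close>, and the nonempty \<open>K\<close> contributes another one. For
    \<open>K = D'\<close> no difference remains.\<close>
  show ?thesis
  proof (cases "K = D'")
    case False
    then obtain k where k: "k \<in> D' - K" using K by auto
    have wsup: "B k (?y k) \<le> c * e * \<sigma>" using near k by (simp add: near_def)
    have "L2_set (fibre_sum n U (\<lambda>a. (t a - \<tau> a) * tprod (D' - K) ?y a) ?L) (ibox n ?L) \<le> 2 * unit_sup n N {?L} (tprod (D' - K) ?y)"
      by (rule dual_diff_L2[OF t LU])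
    also have "\<dots> \<le> 2 * (2 ^ d * (p powr ((real (card K) - 1) / 2) * B k (?y k)))"
      using unit_sup_merged_le[OF K(1) k y2] by simp
    finally have "?\<delta> ^ card K * L2_set (fibre_sum n U (\<lambda>a. (t a - \<tau> a) * tprod (D' - K) ?y a) ?L) (ibox n ?L) \<le>
       ?\<delta> ^ card K * (2 * (2 ^ d * (p powr ((real (card K) - 1) / 2) * B k (?y k))))"
      using \<delta>0 by (intro mult_left_mono) auto
    also have "\<dots> = 2 * 2 ^ d * (?\<delta> ^ card K * p powr ((real (card K) - 1) / 2)) * B k (?y k)" by simp
    also have "\<dots> = 2 * 2 ^ d * ((\<eta> * e) ^ card K / sqrt p) * B k (?y k)"
      unfolding ratio_pow'[OF e] ..
    also have "\<dots> \<le> 2 * 2 ^ d * (\<eta> * e / sqrt p) * (c * e * \<sigma>)"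
      using pw wsup \<eta>e p B_nonneg by (intro mult_mono divide_right_mono) auto
    also have "\<dots> = 2 * 2 ^ d * c * \<eta> * e\<^sup>2 * \<sigma> / sqrt p" by (simp add: power2_eq_square)
    finally show ?thesis using le1 by linarith
  next
    case True
    have LV: "?L = V" using True UD i by auto
    have cKd: "card K = d - 1" using True finite_D' by simp
    have tp1: "tprod (D' - K) ?y a = 1" for a using True by simp
    have marginal_L2_eq: "L2_set (fibre_sum n U (\<lambda>a. (t a - \<tau> a) * tprod (D' - K) ?y a) ?L) (ibox n ?L) = marginal_L2 (\<lambda>a. t a - \<tau> a)"
      unfolding tp1 LV marginal_L2_def by simp
    \<comment> \<open>For \<open>d \<ge> 3\<close> at least two noise factors give e^2 already. For
      \<open>d = 2\<close> there is a single one, and the second e comes from the distance of the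
      dual variables.\<close>
    show ?thesis
    proof (cases "d = 2")
      case d2: True
      have "marginal_L2 (\<lambda>a. t a - \<tau> a) \<le> c * e * \<sigma>" 
        using near[unfolded near_def, THEN conjunct2, rule_format, OF d2] by (simp only: snd_conv)
      then have "?\<delta> ^ card K * marginal_L2 (\<lambda>a. t a - \<tau> a) \<le> ?\<delta> * (c * e * \<sigma>)"
        using cKd d2 \<delta>0 by (simp del: times_divide_eq_left)
      also have "\<dots> = c * \<eta> * e\<^sup>2 * \<sigma> / sqrt p" by (simp add: power2_eq_square)
      also have "\<dots> \<le> (2 * 2 ^ d) * (c * \<eta> * e\<^sup>2 * \<sigma> / sqrt p)"
      proof -
        have "0 \<le> c * \<eta> * e\<^sup>2 * \<sigma> / sqrt p" using c_ge \<eta> \<sigma>0 p by simp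
        moreover have "(1::real) \<le> 2 * 2 ^ d" using one_le_power[of "2::real" d] by linarith
        ultimately show ?thesis using mult_right_mono[of 1 "2 * 2 ^ d"] by fastforce
      qed
      finally show ?thesis using le1 unfolding marginal_L2_eq by (simp add: mult_ac)
    next
      case d3: False
      then have d3: "d \<ge> 3" using d2 by simp
      have "marginal_L2 (\<lambda>a. t a - \<tau> a) \<le> 2 * unit_sup n N {V} (\<lambda>_. 1)"
        using dual_diff_L2[OF t V, of "\<lambda>_. 1"] by (simp add: marginal_L2_def)
      also have "\<dots> \<le> 2 * (p powr ((real (card K) - 1) / 2) * S)"
        using unit_sup_full_le d2 by (simp add: cKd of_nat_diff)
      finally have "?\<delta> ^ card K * marginal_L2 (\<lambda>a. t a - \<tau> a) \<le> ?\<delta> ^ card K * (2 * (p powr ((real (card K) - 1) / 2) * S))"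
        using \<delta>0 by (intro mult_left_mono) auto
      also have "\<dots> = 2 * (?\<delta> ^ card K * p powr ((real (card K) - 1) / 2)) * S" by simp
      also have "\<dots> = 2 * ((\<eta> * e) ^ card K / sqrt p) * S" unfolding ratio_pow'[OF e] ..
      also have "\<dots> \<le> 2 * ((\<eta> * e) ^ 2 / sqrt p) * \<sigma>"
        using d3 cKd \<eta>e p S0 S_le by (intro mult_mono divide_right_mono power_decreasing) auto
      also have "\<dots> = 2 * (\<eta> * (\<eta> * e\<^sup>2 * \<sigma> / sqrt p))" by (simp add: power2_eq_square)
      also have "\<dots> \<le> 2 * ((2 ^ d * c) * (\<eta> * e\<^sup>2 * \<sigma> / sqrt p))"
      proof (intro mult_left_mono mult_right_mono)
        have "1 * 1 \<le> 2 ^ d * c" using c_ge by (intro mult_mono) auto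
        then show "\<eta> \<le> 2 ^ d * c" using \<eta> by simp
      qed (use \<eta> \<sigma>0 p in auto)
      finally show ?thesis using le1 unfolding marginal_L2_eq by (simp add: mult_ac)
    qed
  qed
qed

text \<open>Nothing is merged in this average: each noise block costs sqrt p, exactly what the noise
  size pays for. The bound is of order e \<sigma>, as Sudakov's bound needs it; for
  \<open>K = D'\<close> it comes from \<open>S\<close>.\<close>

lemma smooth_N_term:
  assumes e: "0 < e" "e \<le> 1" and K: "K \<subseteq> D'" and z: "z \<in> unit_arrays n D'" and x: "x \<in> unit_arrays n D'"
    and near: "near (c * e * \<sigma>) z \<tau> (x, t)"
  shows "(\<eta> * e / sqrt p) ^ card K * gauss_avg n (gauss_avg n N {i}) K (tprod (D' - K) (\<lambda>k u. x k u - z k u))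
     \<le> 2 ^ d * c * e * \<sigma>"
proof -
  let ?y = "\<lambda>k u. x k u - z k u" and ?\<delta> = "\<eta> * e / sqrt p"
  have \<delta>0: "?\<delta> > 0" using \<eta> e p by simp
  have \<eta>e: "0 < \<eta> * e" "\<eta> * e \<le> 1" using \<eta>e_pow[OF e] by auto
  have y2: "(\<Sum>u\<in>ibox n I. (?y I u)\<^sup>2) \<le> 2\<^sup>2" if "I \<in> D'" for I using unit_arrays_diff[OF x z that] .
  have pc: "1 \<le> 2 ^ d * c"
  proof -
    have "1 * 1 \<le> 2 ^ d * c" using c_ge by (intro mult_mono) auto
    then show ?thesis by simp
  qed
  show ?thesis
  proof (cases "K = D'")
    case False
    then obtain k where k: "k \<in> D' - K" using K by auto
    have wsup: "B k (?y k) \<le> c * e * \<sigma>" using near k by (simp add: near_def)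
    have "?\<delta> ^ card K * gauss_avg n (gauss_avg n N {i}) K (tprod (D' - K) ?y) \<le>
      ?\<delta> ^ card K * (2 ^ d * (p powr (real (card K) / 2) * B k (?y k)))"
      using \<delta>0 by (intro mult_left_mono gauss_avg_partial_le[OF K k y2]) auto
    also have "\<dots> = 2 ^ d * (?\<delta> ^ card K * p powr (real (card K) / 2)) * B k (?y k)" by simp
    also have "\<dots> = 2 ^ d * (\<eta> * e) ^ card K * B k (?y k)" unfolding ratio_pow[OF e] ..
    also have "\<dots> \<le> 2 ^ d * 1 * (c * e * \<sigma>)"
      using \<eta>e wsup B_nonneg by (intro mult_mono power_le_one) auto
    finally show ?thesis by (simp add: mult.assoc)
  next
    case True
    have cKd: "card K = d - 1" using True finite_D' by simp
    have "gauss_avg n (gauss_avg n N {i}) K (tprod (D' - K) ?y) = gauss_avg n N D (tprod (D' - K) ?y)"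
    proof -
      have "\<Union>K \<subseteq> U" "{i} \<union> K = D" "{i} \<inter> K = {}" using True i by (auto intro!: DU[THEN subsetD])
      then show ?thesis using gauss_avg_gauss_avg[OF iU(2), of K] by auto
    qed
    also have tpe: "tprod (D' - K) ?y = (\<lambda>_. 1)" using True by (simp add: fun_eq_iff)
    also have "gauss_avg n N D (\<lambda>_. 1) \<le> p powr (real (card K) / 2) * S"
      using gauss_avg_full_le d2 by (simp add: cKd of_nat_diff)
    finally have le1: "gauss_avg n (gauss_avg n N {i}) K (\<lambda>_. 1) \<le> p powr (real (card K) / 2) * S" .
    have le: "gauss_avg n (gauss_avg n N {i}) K (tprod (D' - K) ?y) \<le> p powr (real (card K) / 2) * S"
      unfolding tpe by (rule le1)
    have "?\<delta> ^ card K * gauss_avg n (gauss_avg n N {i}) K (tprod (D' - K) ?y) \<le> ?\<delta> ^ card K * (p powr (real (card K) / 2) * S)"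
      by (rule mult_left_mono[OF le]) (use \<delta>0 in auto)
    also have "\<dots> = (\<eta> * e) ^ card K * S" unfolding mult.assoc[symmetric] ratio_pow[OF e] ..
    also have "\<dots> \<le> (\<eta> * e) ^ 1 * \<sigma>"
      using \<eta>e cKd d2 S0 S_le by (intro mult_mono power_decreasing) auto
    also have "\<dots> \<le> 1 * (e * \<sigma>)" using \<eta> e \<sigma>0 by (simp add: mult_right_mono)
    also have "\<dots> \<le> (2 ^ d * c) * (e * \<sigma>)" using pc e \<sigma>0 by (intro mult_right_mono) auto
    finally show ?thesis by (simp add: mult_ac)
  qed
qed

end

section \<open>Smoothing errors and covering numbers\<close>

context chain_setup
begin

abbreviation "Y' \<equiv> gfam n D'"

definition dl :: "real \<Rightarrow> real" where "dl e = \<eta> * e / sqrt p"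
text \<open>The entropy scale, equal to \<open>1 / (dl e)\<^sup>2\<close>. The next two definitions
  fit it: \<open>ec e / eb e\<close> is half of \<open>sqrt (X e)\<close>, so Sudakov's bound gives
  entropy of order \<open>X e\<close>, and \<open>eb e * sqrt (X e)\<close> is of order e
  \<sigma>.\<close>

definition X :: "real \<Rightarrow> real" where "X e = p / (\<eta> * e)\<^sup>2"
definition eb :: "real \<Rightarrow> real" where "eb e = 2 ^ d * (2 * 2 ^ d * c * \<eta> * e\<^sup>2 * \<sigma> / sqrt p)"
definition ec :: "real \<Rightarrow> real" where "ec e = 2 ^ d * (2 ^ d * c * e * \<sigma>)"

text \<open>Majorant for the change of the coefficient vector under smoothing, hence without the
  empty \<open>K\<close>. Its companion \<open>csum\<close> bounds the average seminorm of the whole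
  smoothed tensor and retains that term.\<close>

definition bsum :: "real \<Rightarrow> tensor \<Rightarrow> (nat set \<Rightarrow> tensor) \<Rightarrow> (nat set \<times> idx \<Rightarrow> real) \<Rightarrow> real" where
  "bsum e s y u = (\<Sum>K\<in>Pow D' - {{}}. dl e ^ card K *
     L2_set (fibre_vec n U (\<lambda>a. s a * (tprod (D' - K) y a * tprod K (curry u) a))) Y)"

definition csum :: "real \<Rightarrow> (nat set \<Rightarrow> tensor) \<Rightarrow> (nat set \<times> idx \<Rightarrow> real) \<Rightarrow> real" where
  "csum e y u = (\<Sum>K\<in>Pow D'. dl e ^ card K * gauss_avg n N {i} (\<lambda>a. tprod (D' - K) y a * tprod K (curry u) a))"

lemma dl_pos: "0 < e \<Longrightarrow> dl e > 0"
  using \<eta> p by (simp add: dl_def)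

lemma eb_pos: "0 < e \<Longrightarrow> eb e > 0"
  using \<eta> p c_ge \<sigma>0 by (simp add: eb_def)

lemma ec_pos: "0 < e \<Longrightarrow> ec e > 0"
  using c_ge \<sigma>0 by (simp add: ec_def)

lemma X_ge: "0 < e \<Longrightarrow> e \<le> 1 \<Longrightarrow> X e \<ge> 1"
proof -
  assume e: "0 < e" "e \<le> 1"
  have "(\<eta> * e)\<^sup>2 \<le> 1" "(\<eta> * e)\<^sup>2 > 0" using \<eta>e_pow[OF e] by (auto intro: power_le_one)
  then show ?thesis using p by (simp add: X_def)
qed

lemma inv_dl: "0 < e \<Longrightarrow> 1 / (dl e)\<^sup>2 = X e"
  using p by (simp add: dl_def X_def power_divide)

lemma card_Pow_D': "real (card (Pow D')) \<le> 2 ^ d" "real (card (Pow D' - {{}})) \<le> 2 ^ d"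
proof -
  have "card (Pow D') = 2 ^ (d - 1)" using finite_D' by (simp add: card_Pow)
  also have "(2::nat) ^ (d - 1) \<le> 2 ^ d" by (intro power_increasing) auto
  finally have a: "card (Pow D') \<le> 2 ^ d" .
  then show "real (card (Pow D')) \<le> 2 ^ d" by (metis of_nat_le_iff of_nat_numeral of_nat_power)
  have "card (Pow D' - {{}}) \<le> card (Pow D')" using finite_D' by (intro card_mono) auto
  then have "card (Pow D' - {{}}) \<le> 2 ^ d" using a by simp
  then show "real (card (Pow D' - {{}})) \<le> 2 ^ d" by (metis of_nat_le_iff of_nat_numeral of_nat_power)
qed

lemma D'U: "K \<subseteq> D' \<Longrightarrow> \<Union>K \<subseteq> U" by (rule DU) auto

lemma bsum_expectation:
  assumes e: "0 < e" "e \<le> 1" and t: "t \<in> T" "\<tau> \<in> T" and z: "z \<in> unit_arrays n D'" and x: "x \<in> unit_arrays n D'"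
    and near: "near (c * e * \<sigma>) z \<tau> (x, t)"
  shows "integrable (gaussv Y') (bsum e (\<lambda>a. t a - \<tau> a) (\<lambda>k u. x k u - z k u))"
    "(\<integral>u. bsum e (\<lambda>a. t a - \<tau> a) (\<lambda>k u. x k u - z k u) u \<partial>gaussv Y') \<le> eb e"
proof -
  let ?s = "\<lambda>a. t a - \<tau> a" and ?y = "\<lambda>k u. x k u - z k u"
  interpret M: tensor_seminorm n U "\<lambda>w. L2_set (fibre_vec n U (\<lambda>a. ?s a * w a)) Y" by (rule box_seminorm_L2_fibre_vec[OF finite_U])
  have int: "integrable (gaussv Y') (\<lambda>u. L2_set (fibre_vec n U (\<lambda>a. ?s a * (tprod (D' - K) ?y a * tprod K (curry u) a))) Y)" if "K \<subseteq> D'" for K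
    using M.integrable_gauss_avg[OF that D'U[OF order_refl], of "tprod (D' - K) ?y"] by simp
  show "integrable (gaussv Y') (bsum e ?s ?y)"
    unfolding bsum_def using int by (intro Bochner_Integration.integrable_sum integrable_mult_right) auto
  have "(\<integral>u. bsum e ?s ?y u \<partial>gaussv Y') =
     (\<Sum>K\<in>Pow D' - {{}}. dl e ^ card K * (\<integral>u. L2_set (fibre_vec n U (\<lambda>a. ?s a * (tprod (D' - K) ?y a * tprod K (curry u) a))) Y \<partial>gaussv Y'))"
    unfolding bsum_def using int by (subst Bochner_Integration.integral_sum) (auto intro!: integrable_mult_right)
  also have "\<dots> \<le> (\<Sum>K\<in>Pow D' - {{}}. 2 * 2 ^ d * c * \<eta> * e\<^sup>2 * \<sigma> / sqrt p)"
  proof (rule sum_mono)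
    fix K assume K: "K \<in> Pow D' - {{}}"
    then have "(\<integral>u. L2_set (fibre_vec n U (\<lambda>a. ?s a * (tprod (D' - K) ?y a * tprod K (curry u) a))) Y \<partial>gaussv Y') =
       gauss_avg n (\<lambda>w. L2_set (fibre_vec n U (\<lambda>a. ?s a * w a)) Y) K (tprod (D' - K) ?y)"
      using M.gauss_avg_marginal[of K D' "tprod (D' - K) ?y"] D'U[OF order_refl] by (simp add: gauss_family_eq)
    then show "dl e ^ card K * (\<integral>u. L2_set (fibre_vec n U (\<lambda>a. ?s a * (tprod (D' - K) ?y a * tprod K (curry u) a))) Y \<partial>gaussv Y') \<le>
        2 * 2 ^ d * c * \<eta> * e\<^sup>2 * \<sigma> / sqrt p"
      unfolding dl_def using smooth_L2_term[OF e _ _ t z x near, of K] K by auto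
  qed
  also have "\<dots> = real (card (Pow D' - {{}})) * (2 * 2 ^ d * c * \<eta> * e\<^sup>2 * \<sigma> / sqrt p)" by simp
  also have "\<dots> \<le> eb e"
    unfolding eb_def using card_Pow_D' \<eta> p c_ge \<sigma>0 by (intro mult_right_mono) auto
  finally show "(\<integral>u. bsum e ?s ?y u \<partial>gaussv Y') \<le> eb e" .
qed

lemma csum_expectation:
  assumes e: "0 < e" "e \<le> 1" and z: "z \<in> unit_arrays n D'" and x: "x \<in> unit_arrays n D'"
    and near: "near (c * e * \<sigma>) z \<tau> (x, t)"
  shows "integrable (gaussv Y') (csum e (\<lambda>k u. x k u - z k u))"
    "(\<integral>u. csum e (\<lambda>k u. x k u - z k u) u \<partial>gaussv Y') \<le> ec e"
proof -
  let ?y = "\<lambda>k u. x k u - z k u"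
  interpret M: tensor_seminorm n U "gauss_avg n N {i}" by (rule gauss_avg_seminorm[OF iU(2)])
  have int: "integrable (gaussv Y') (\<lambda>u. gauss_avg n N {i} (\<lambda>a. tprod (D' - K) ?y a * tprod K (curry u) a))" if "K \<subseteq> D'" for K
    using M.integrable_gauss_avg[OF that D'U[OF order_refl], of "tprod (D' - K) ?y"] by simp
  show "integrable (gaussv Y') (csum e ?y)"
    unfolding csum_def using int by (intro Bochner_Integration.integrable_sum integrable_mult_right) auto
  have "(\<integral>u. csum e ?y u \<partial>gaussv Y') =
     (\<Sum>K\<in>Pow D'. dl e ^ card K * (\<integral>u. gauss_avg n N {i} (\<lambda>a. tprod (D' - K) ?y a * tprod K (curry u) a) \<partial>gaussv Y'))"
    unfolding csum_def using int by (subst Bochner_Integration.integral_sum) (auto intro!: integrable_mult_right)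
  also have "\<dots> \<le> (\<Sum>K\<in>Pow D'. 2 ^ d * c * e * \<sigma>)"
  proof (rule sum_mono)
    fix K assume K: "K \<in> Pow D'"
    then have "(\<integral>u. gauss_avg n N {i} (\<lambda>a. tprod (D' - K) ?y a * tprod K (curry u) a) \<partial>gaussv Y') = gauss_avg n (gauss_avg n N {i}) K (tprod (D' - K) ?y)"
      using M.gauss_avg_marginal[of K D' "tprod (D' - K) ?y"] D'U[OF order_refl] by (simp add: gauss_family_eq)
    then show "dl e ^ card K * (\<integral>u. gauss_avg n N {i} (\<lambda>a. tprod (D' - K) ?y a * tprod K (curry u) a) \<partial>gaussv Y') \<le> 2 ^ d * c * e * \<sigma>"
      unfolding dl_def using smooth_N_term[OF e _ z x near, of K] K by auto
  qed
  also have "\<dots> = real (card (Pow D')) * (2 ^ d * c * e * \<sigma>)" by simp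
  also have "\<dots> \<le> ec e"
    unfolding ec_def using card_Pow_D' c_ge \<sigma>0 e by (intro mult_right_mono) auto
  finally show "(\<integral>u. csum e ?y u \<partial>gaussv Y') \<le> ec e" .
qed

lemma tprod_smooth: "tprod D' (\<lambda>k v. y k v + dl e * u (k, v)) a =
    (\<Sum>K\<in>Pow D'. dl e ^ card K * (tprod (D' - K) y a * tprod K (curry u) a))"
proof -
  have "tprod D' (\<lambda>k v. y k v + dl e * u (k, v)) a = tprod D' (\<lambda>k v. y k v + dl e * curry u k v) a" by simp
  also have "\<dots> = (\<Sum>K\<in>Pow D'. tprod (D' - K) y a * tprod K (\<lambda>k v. dl e * curry u k v) a)"
    by (rule tprod_add[OF finite_D'(1)])
  also have "\<dots> = (\<Sum>K\<in>Pow D'. dl e ^ card K * (tprod (D' - K) y a * tprod K (curry u) a))"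
    unfolding tprod_scale by (intro sum.cong refl) (simp only: mult_ac)
  finally show ?thesis .
qed

lemma bsum_bound:
  assumes "0 < e"
  shows "L2_set (fibre_vec n U (\<lambda>a. s a * (tprod D' (\<lambda>k v. y k v + dl e * u (k, v)) a - tprod D' y a))) Y \<le> bsum e s y u"
proof -
  interpret M: tensor_seminorm n U "\<lambda>w. L2_set (fibre_vec n U (\<lambda>a. s a * w a)) Y" by (rule box_seminorm_L2_fibre_vec[OF finite_U])
  have "tprod D' (\<lambda>k v. y k v + dl e * u (k, v)) a - tprod D' y a =
     (\<Sum>K\<in>Pow D' - {{}}. dl e ^ card K * (tprod (D' - K) y a * tprod K (curry u) a))" for a
    unfolding tprod_smooth using finite_D' by (subst sum.remove[of "Pow D'" "{}"]) auto
  then have "L2_set (fibre_vec n U (\<lambda>a. s a * (tprod D' (\<lambda>k v. y k v + dl e * u (k, v)) a - tprod D' y a))) Y =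
    L2_set (fibre_vec n U (\<lambda>a. s a * (\<Sum>K\<in>Pow D' - {{}}. dl e ^ card K * (tprod (D' - K) y a * tprod K (curry u) a)))) Y" by simp
  also have "\<dots> \<le> (\<Sum>K\<in>Pow D' - {{}}. L2_set (fibre_vec n U (\<lambda>a. s a * (dl e ^ card K * (tprod (D' - K) y a * tprod K (curry u) a)))) Y)"
    using finite_D' by (intro M.sum_le) auto
  also have "\<dots> = bsum e s y u"
    unfolding bsum_def using dl_pos[OF assms] by (intro sum.cong refl) (subst M.scale, simp)
  finally show ?thesis .
qed

lemma csum_bound:
  assumes "0 < e"
  shows "gauss_avg n N {i} (tprod D' (\<lambda>k v. y k v + dl e * u (k, v))) \<le> csum e y u"
proof -
  interpret M: tensor_seminorm n U "gauss_avg n N {i}" by (rule gauss_avg_seminorm[OF iU(2)])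
  have "gauss_avg n N {i} (tprod D' (\<lambda>k v. y k v + dl e * u (k, v))) =
     gauss_avg n N {i} (\<lambda>a. \<Sum>K\<in>Pow D'. dl e ^ card K * (tprod (D' - K) y a * tprod K (curry u) a))"
    by (intro arg_cong[of _ _ "gauss_avg n N {i}"] ext tprod_smooth)
  also have "\<dots> \<le> (\<Sum>K\<in>Pow D'. gauss_avg n N {i} (\<lambda>a. dl e ^ card K * (tprod (D' - K) y a * tprod K (curry u) a)))"
    using finite_D' by (intro M.sum_le) auto
  also have "\<dots> = csum e y u"
    unfolding csum_def using dl_pos[OF assms] by (intro sum.cong refl) (subst M.scale, simp)
  finally show ?thesis .
qed

lemma bsum_nonneg: "0 < e \<Longrightarrow> 0 \<le> bsum e s y u"
  unfolding bsum_def using dl_pos by (intro sum_nonneg mult_nonneg_nonneg) (auto simp: less_imp_le)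

lemma csum_nonneg: "0 < e \<Longrightarrow> 0 \<le> csum e y u"
  unfolding csum_def using dl_pos tensor_seminorm.nonneg[OF gauss_avg_seminorm[OF iU(2)]]
  by (intro sum_nonneg mult_nonneg_nonneg) (auto simp: less_imp_le)

lemma ball_shift_sum:
  assumes r: "\<And>k. k \<in> D' \<Longrightarrow> (\<Sum>u\<in>ibox n k. (y k u)\<^sup>2) \<le> r" and e: "0 < e" and r0: "r \<ge> 0"
  shows "(\<Sum>b\<in>Y'. (y (fst b) (snd b) / dl e)\<^sup>2) \<le> real d * r * X e"
proof -
  have fin: "\<forall>k\<in>D'. finite (ibox n k)"
    using block(1) finite_V finite_subset by (metis Diff_iff finite_ibox)
  have "(\<Sum>b\<in>Y'. (y (fst b) (snd b) / dl e)\<^sup>2) = (\<Sum>k\<in>D'. \<Sum>u\<in>ibox n k. (y k u / dl e)\<^sup>2)"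
    using sum.Sigma[OF finite_D'(1) fin, of "\<lambda>k u. (y k u / dl e)\<^sup>2"] by (simp add: split_beta')
  also have "\<dots> = (\<Sum>k\<in>D'. \<Sum>u\<in>ibox n k. (y k u)\<^sup>2) * X e"
    unfolding inv_dl[OF e, symmetric] by (simp add: power_divide sum_divide_distrib)
  also have "\<dots> \<le> (\<Sum>k\<in>D'. r) * X e"
    using r p by (intro mult_right_mono sum_mono) (auto simp: X_def)
  also have "(\<Sum>k\<in>D'. r) \<le> real d * r" using finite_D' r0 by (simp add: mult_right_mono)
  finally show ?thesis using p by (simp add: X_def mult_right_mono divide_right_mono)
qed

lemma Y'_finite: "finite Y'"
  by (rule finite_gfam_blocks[OF D'U]) simp

text \<open>Gaussian smoothing in the \<open>x\<close>-variables yields one array \<open>w\<close> serving many points; for it,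
  Sudakov's bound controls the dual functionals.\<close>

lemma packing_fibre_vec:
  fixes J :: "((nat set \<Rightarrow> tensor) \<times> tensor) set"
  assumes e: "0 < e" "e \<le> 1" and z: "z \<in> unit_arrays n D'" and \<tau>: "\<tau> \<in> T"
    and J: "finite J" "\<And>q. q \<in> J \<Longrightarrow> fst q \<in> unit_arrays n D' \<and> snd q \<in> T \<and> near (c * e * \<sigma>) z \<tau> q"
    and sep: "\<And>q q'. q \<in> J \<Longrightarrow> q' \<in> J \<Longrightarrow> q \<noteq> q' \<Longrightarrow> \<not> l2dist Y (coef z \<tau> q) (coef z \<tau> q') \<le> 32 * eb e"
  shows "real (card J) \<le> 2 * exp ((2 * real d + 625) * X e)"
proof -
  let ?y = "\<lambda>q k u. fst q k u - z k u" and ?s = "\<lambda>q a. snd q a - \<tau> a"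
  define \<xi> where "\<xi> q b = ?y q (fst b) (snd b) / dl e" for q :: "(nat set \<Rightarrow> tensor) \<times> tensor" and b :: "nat set \<times> idx"
  \<comment> \<open>Each part is divided by twice its bound, so the mean is at most 1, and \<Phi>
    \<le> 4 controls both parts at once, within a factor 8 of their bounds.\<close>
  define \<Phi> where "\<Phi> q u = bsum e (?s q) (?y q) u / (2 * eb e) + csum e (?y q) u / (2 * ec e)" for q u
  note pos = eb_pos[OF e(1)] ec_pos[OF e(1)] dl_pos[OF e(1)]
  have ints: "integrable (gaussv Y') (bsum e (?s q) (?y q))" "(\<integral>u. bsum e (?s q) (?y q) u \<partial>gaussv Y') \<le> eb e"
     "integrable (gaussv Y') (csum e (?y q))" "(\<integral>u. csum e (?y q) u \<partial>gaussv Y') \<le> ec e" if "q \<in> J" for q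
    using bsum_expectation[OF e _ \<tau> z, of "snd q" "fst q"] csum_expectation[OF e z, of "fst q" \<tau> "snd q"] J(2)[OF that] by auto
  have "\<exists>u\<in>space (gaussv Y'). real (card J) / 2 * exp (- (4 * real d * X e) / 2) \<le>
           real (card {q \<in> J. \<Phi> q (\<lambda>b\<in>Y'. u b - \<xi> q b) \<le> 4})"
  proof (rule gauss_packing[OF Y'_finite J(1)])
    fix q assume q: "q \<in> J"
    have "(\<Sum>b\<in>Y'. (?y q (fst b) (snd b) / dl e)\<^sup>2) \<le> real d * 4 * X e"
      using unit_arrays_diff[OF _ z] J(2)[OF q] by (intro ball_shift_sum e) auto
    then show "(\<Sum>b\<in>Y'. (\<xi> q b)\<^sup>2) \<le> 4 * real d * X e" by (simp add: \<xi>_def mult.commute)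
    show int: "integrable (gaussv Y') (\<Phi> q)"
      unfolding \<Phi>_def using ints[OF q] by (intro Bochner_Integration.integrable_add integrable_divide)
    then show "\<Phi> q \<in> borel_measurable (gaussv Y')" by (rule borel_measurable_integrable)
    have "(\<integral>u. \<Phi> q u \<partial>gaussv Y') = (\<integral>u. bsum e (?s q) (?y q) u \<partial>gaussv Y') / (2 * eb e) + (\<integral>u. csum e (?y q) u \<partial>gaussv Y') / (2 * ec e)"
      unfolding \<Phi>_def using ints[OF q] by simp
    also have "\<dots> \<le> eb e / (2 * eb e) + ec e / (2 * ec e)"
      using ints[OF q] pos by (intro add_mono divide_right_mono) auto
    also have "\<dots> = 1" using pos by simp
    finally show "(\<integral>u. \<Phi> q u \<partial>gaussv Y') \<le> 1" .
    fix u
    show "0 \<le> \<Phi> q u" unfolding \<Phi>_def using bsum_nonneg[OF e(1)] csum_nonneg[OF e(1)] pos by simp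
  qed
  then obtain u where u: "real (card J) / 2 * exp (- (4 * real d * X e) / 2) \<le>
           real (card {q \<in> J. \<Phi> q (\<lambda>b\<in>Y'. u b - \<xi> q b) \<le> 4})" by blast
  define G where "G = {q \<in> J. \<Phi> q (\<lambda>b\<in>Y'. u b - \<xi> q b) \<le> 4}"
  \<comment> \<open>Translating by \<xi> cancels the dependence on \<open>q\<close>:
    \<open>?y q + dl e * (u - \<xi> q)\<close> equals \<open>dl e * u\<close> for every
    \<open>q\<close>. One tensor \<open>w\<close> therefore replaces the different x-parts of all
    points in \<open>G\<close>, leaving only their dual parts to be distinguished.\<close>
  define w where "w = tprod D' (\<lambda>k v. dl e * u (k, v))"
  interpret M: tensor_seminorm n U "gauss_avg n N {i}" by (rule gauss_avg_seminorm[OF iU(2)])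
  have w_eq: "tprod D' (\<lambda>k v. ?y q k v + dl e * (\<lambda>b\<in>Y'. u b - \<xi> q b) (k, v)) a = w a" if "a \<in> ibox n U" for q a
    unfolding w_def
  proof (rule tprod_cong)
    fix k assume k: "k \<in> D'"
    then have "(k, restrict a k) \<in> Y'" using restrict_ibox[OF that, of k] block(2)[of k] by auto
    then show "?y q k (restrict a k) + dl e * (\<lambda>b\<in>Y'. u b - \<xi> q b) (k, restrict a k) = dl e * u (k, restrict a k)"
      using pos(3) by (simp add: \<xi>_def right_diff_distrib diff_divide_distrib)
  qed
  have G: "bsum e (?s q) (?y q) (\<lambda>b\<in>Y'. u b - \<xi> q b) \<le> 8 * eb e" "csum e (?y q) (\<lambda>b\<in>Y'. u b - \<xi> q b) \<le> 8 * ec e" if "q \<in> G" for q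
  proof -
    let ?u = "\<lambda>b\<in>Y'. u b - \<xi> q b"
    have le: "bsum e (?s q) (?y q) ?u / (2 * eb e) + csum e (?y q) ?u / (2 * ec e) \<le> 4"
      using that by (simp add: G_def \<Phi>_def)
    have n: "0 \<le> bsum e (?s q) (?y q) ?u / (2 * eb e)" "0 \<le> csum e (?y q) ?u / (2 * ec e)"
      using bsum_nonneg[OF e(1)] csum_nonneg[OF e(1)] pos by simp_all
    have "bsum e (?s q) (?y q) ?u / (2 * eb e) \<le> 4" using le n by linarith
    then show "bsum e (?s q) (?y q) ?u \<le> 8 * eb e" using pos by (simp add: pos_divide_le_eq)
    have "csum e (?y q) ?u / (2 * ec e) \<le> 4" using le n by linarith
    then show "csum e (?y q) ?u \<le> 8 * ec e" using pos by (simp add: pos_divide_le_eq)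
  qed
  have wb: "L2_set (fibre_vec n U (\<lambda>a. ?s q a * (w a - tprod D' (?y q) a))) Y \<le> 8 * eb e" if "q \<in> G" for q
  proof -
    let ?u = "\<lambda>b\<in>Y'. u b - \<xi> q b"
    have "fibre_vec n U (\<lambda>a. ?s q a * (w a - tprod D' (?y q) a)) = fibre_vec n U (\<lambda>a. ?s q a * (tprod D' (\<lambda>k v. ?y q k v + dl e * ?u (k, v)) a - tprod D' (?y q) a))"
      unfolding fibre_vec_def fibre_sum_def using w_eq by (intro ext sum.cong refl) simp
    then show ?thesis using bsum_bound[OF e(1), of "?s q" "?y q" ?u] G(1)[OF that] by simp
  qed
  \<comment> \<open>Passing to \<open>w\<close> costs \<open>8 * eb e\<close> at either end, so of
    the separation \<open>32 * eb e\<close> at least \<open>16 * eb e\<close> is left for the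
    functionals weighted by \<open>w\<close>.\<close>
  have vdist: "l2dist Y (coef z \<tau> q) (coef z \<tau> q') \<le> l2dist Y (fibre_vec n U (\<lambda>a. snd q a * w a)) (fibre_vec n U (\<lambda>a. snd q' a * w a)) + 16 * eb e"
    if q: "q \<in> G" "q' \<in> G" for q q'
  proof -
    let ?v = "\<lambda>q. fibre_vec n U (\<lambda>a. ?s q a * w a)"
    have d1: "l2dist Y (?v q) (coef z \<tau> q) \<le> 8 * eb e" if "q \<in> G" for q
      using wb[OF that] unfolding coef_def by (simp add: fibre_vec_diff[symmetric] right_diff_distrib)
    have "l2dist Y (coef z \<tau> q) (coef z \<tau> q') \<le> l2dist Y (coef z \<tau> q) (?v q) + l2dist Y (?v q) (coef z \<tau> q')"
      by (rule l2dist_triangle)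
    also have "l2dist Y (?v q) (coef z \<tau> q') \<le> l2dist Y (?v q) (?v q') + l2dist Y (?v q') (coef z \<tau> q')"
      by (rule l2dist_triangle)
    also have "l2dist Y (?v q) (?v q') = l2dist Y (fibre_vec n U (\<lambda>a. snd q a * w a)) (fibre_vec n U (\<lambda>a. snd q' a * w a))"
      by (simp add: left_diff_distrib fibre_vec_diff)
    finally show ?thesis using d1[OF q(1)] d1[OF q(2)] l2dist_sym[where Y=Y and u="coef z \<tau> q" and v="?v q"] by linarith
  qed
  have "real (card G) \<le> exp (10000 * (8 * ec e / (16 * eb e))\<^sup>2)"
  proof (cases "G = {}")
    case False
    then obtain q0 where q0: "q0 \<in> G" by auto
    let ?u = "\<lambda>b\<in>Y'. u b - \<xi> q0 b"
    have "gauss_avg n N {i} w = gauss_avg n N {i} (tprod D' (\<lambda>k v. ?y q0 k v + dl e * ?u (k, v)))"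
      using w_eq by (intro M.cong) simp
    also have "\<dots> \<le> 8 * ec e" using csum_bound[OF e(1), of "?y q0" ?u] G(2)[OF q0] by simp
    finally have gw: "gauss_avg n N {i} w \<le> 8 * ec e" .
    show ?thesis
    proof (rule sudakov_dual[OF iU(1) gw, where f=snd])
      show "finite G" using J by (simp add: G_def)
      show "snd ` G \<subseteq> T" using J(2) by (auto simp: G_def)
      fix q q' assume q: "q \<in> G" "q' \<in> G" "q \<noteq> q'"
      then have "\<not> l2dist Y (coef z \<tau> q) (coef z \<tau> q') \<le> 32 * eb e" using sep by (simp add: G_def)
      then show "16 * eb e \<le> l2dist Y (fibre_vec n U (\<lambda>a. snd q a * w a)) (fibre_vec n U (\<lambda>a. snd q' a * w a))"
        using vdist[OF q(1,2)] by linarith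
    qed (use pos in auto)
  qed simp
  \<comment> \<open>The quotient is a quarter of \<open>sqrt (X e)\<close>, and 10000 / 16 =
    625.\<close>
  also have "10000 * (8 * ec e / (16 * eb e))\<^sup>2 = 625 * X e"
  proof -
    have "8 * ec e / (16 * eb e) = sqrt p / (4 * (\<eta> * e))"
      using e \<eta> p c_ge \<sigma>0 by (simp add: ec_def eb_def field_simps power2_eq_square)
    then show ?thesis using p by (simp add: X_def power_divide power_mult_distrib)
  qed
  finally have cG: "real (card G) \<le> exp (625 * X e)" .
  have "real (card J) / 2 * exp (- (2 * real d * X e)) \<le> exp (625 * X e)"
    using u cG unfolding G_def[symmetric] by (simp add: mult.assoc)
  then have "real (card J) / 2 * exp (- (2 * real d * X e)) * exp (2 * real d * X e) \<le> exp (625 * X e) * exp (2 * real d * X e)"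
    by (intro mult_right_mono) auto
  then show ?thesis by (simp add: mult.assoc mult_exp_exp distrib_right add.commute)
qed

lemma integrable_wsup_component:
  assumes k: "k \<in> D'"
  shows "integrable (gaussv Y') (\<lambda>u. B k (\<lambda>v. u (k, v)))"
    "(\<integral>u. B k (\<lambda>v. u (k, v)) \<partial>gaussv Y') \<le> sqrt p * (\<kappa> * (C * S + F))"
proof -
  interpret M: tensor_seminorm n U "wsup n N (V - k) (d - 1) p" by (rule wsup_sn)
  have eq: "B k (\<lambda>v. u (k, v)) = wsup n N (V - k) (d - 1) p (\<lambda>a. 1 * tprod {k} (curry u) a)" for u :: "nat set \<times> idx \<Rightarrow> real"
    by (simp add: B_def tprod_single)
  have kD: "{k} \<subseteq> D'" using k by auto
  show "integrable (gaussv Y') (\<lambda>u. B k (\<lambda>v. u (k, v)))"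
    unfolding eq by (rule M.integrable_gauss_avg[OF kD D'U[OF order_refl]])
  show "(\<integral>u. B k (\<lambda>v. u (k, v)) \<partial>gaussv Y') \<le> sqrt p * (\<kappa> * (C * S + F))"
    unfolding eq using M.gauss_avg_marginal[OF kD D'U[OF order_refl], of "\<lambda>_. 1"] EB[OF k] by (simp add: gauss_family_eq)
qed

lemma B_scale: "B k (\<lambda>v. r * x v) = \<bar>r\<bar> * B k x"
  unfolding B_def by (rule tensor_seminorm.scale[OF wsup_sn])

text \<open>Translates by \<open>x / dl e\<close> of the sublevel sets of the summed distances
  \<open>B\<close>. The translation vectors have squared norm of order \<open>X e\<close>, and the
  Gaussian mean of the sum is at most \<open>r\<close> by \<open>EB\<close>.\<close>

lemma packing_B:
  fixes J :: "((nat set \<Rightarrow> tensor) \<times> tensor) set"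
  assumes e: "0 < e" "e \<le> 1" and J: "finite J" "\<And>q. q \<in> J \<Longrightarrow> fst q \<in> unit_arrays n D'"
    and sep: "\<And>q q'. q \<in> J \<Longrightarrow> q' \<in> J \<Longrightarrow> q \<noteq> q' \<Longrightarrow> \<not> (\<forall>k\<in>D'. B k (\<lambda>u. fst q' k u - fst q k u) \<le> c * (e / 2) * \<sigma>)"
  shows "real (card J) \<le> 2 * exp (real d * X e)"
proof -
  define r where "r = real d * (\<kappa> * C * e * \<sigma>)"
  have r: "r > 0" using d2 \<kappa> C e \<sigma>0 by (simp add: r_def)
  define \<xi> where "\<xi> q b = fst q (fst b) (snd b) / dl e" for q :: "(nat set \<Rightarrow> tensor) \<times> tensor" and b :: "nat set \<times> idx"
  define h where "h u = (\<Sum>k\<in>D'. dl e * B k (\<lambda>v. u (k, v)))" for u :: "nat set \<times> idx \<Rightarrow> real"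
  note dp = dl_pos[OF e(1)]
  have hint: "integrable (gaussv Y') h"
    unfolding h_def by (intro Bochner_Integration.integrable_sum integrable_mult_right integrable_wsup_component)
  have "real (card J) \<le> 2 * exp ((2 * real d * X e) / 2)"
  proof (rule gauss_packing_seminorm[OF Y'_finite J(1) _ hint _ r])
    fix q assume q: "q \<in> J"
    have "(\<Sum>b\<in>Y'. (fst q (fst b) (snd b) / dl e)\<^sup>2) \<le> real d * 1 * X e"
      using J(2)[OF q] by (intro ball_shift_sum e) (auto simp: unit_arrays_def)
    moreover have "0 \<le> real d * X e" using p by (simp add: X_def)
    ultimately show "(\<Sum>b\<in>Y'. (\<xi> q b)\<^sup>2) \<le> 2 * real d * X e" by (simp add: \<xi>_def)
  next
    have "(\<integral>u. h u \<partial>gaussv Y') = (\<Sum>k\<in>D'. dl e * (\<integral>u. B k (\<lambda>v. u (k, v)) \<partial>gaussv Y'))"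
      unfolding h_def by (subst Bochner_Integration.integral_sum) (auto intro!: integrable_mult_right integrable_wsup_component)
    also have "\<dots> \<le> (\<Sum>k\<in>D'. \<kappa> * C * e * \<sigma>)"
    proof (rule sum_mono)
      fix k assume k: "k \<in> D'"
      have "dl e * (\<integral>u. B k (\<lambda>v. u (k, v)) \<partial>gaussv Y') \<le> dl e * (sqrt p * (\<kappa> * (C * S + F)))"
        using integrable_wsup_component(2)[OF k] dp by (intro mult_left_mono) auto
      also have "\<dots> = \<kappa> * e * (\<eta> * (C * S + F))" using p by (simp add: dl_def)
      \<comment> \<open>Noise size times sqrt p is \<eta> e, so \<open>F\<close> enters multiplied
        by \<eta>. This is why \<sigma> has to exceed only \<eta> F and not F.\<close>
      also have "\<dots> \<le> \<kappa> * e * (C * \<sigma>)"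
      proof (intro mult_left_mono)
        have "\<eta> * (C * S) \<le> 1 * (C * S)" using \<eta> C S0 by (intro mult_right_mono) auto
        moreover have "C * S \<le> C * (S / \<eta>)"
          using \<eta> S0 C by (intro mult_left_mono) (auto simp: pos_le_divide_eq mult_left_le)
        moreover have "\<eta> * F \<le> C * (\<eta> * F)" using mult_right_mono[of 1 C "\<eta> * F"] C F \<eta> by simp
        ultimately have "\<eta> * (C * S + F) \<le> C * (S / \<eta> + \<eta> * F)" by (simp add: distrib_left)
        also have "\<dots> \<le> C * \<sigma>" using \<sigma> C by (intro mult_left_mono) auto
        finally show "\<eta> * (C * S + F) \<le> C * \<sigma>" .
      qed (use \<kappa> e in auto)
      finally show "dl e * (\<integral>u. B k (\<lambda>v. u (k, v)) \<partial>gaussv Y') \<le> \<kappa> * C * e * \<sigma>" by (simp add: mult_ac)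
    qed
    also have "\<dots> \<le> r" unfolding r_def using finite_D' \<kappa> C e \<sigma>0 by (simp add: mult_right_mono)
    finally show "(\<integral>u. h u \<partial>gaussv Y') \<le> r" .
  next
    fix u show "0 \<le> h u" unfolding h_def using dp B_nonneg by (intro sum_nonneg mult_nonneg_nonneg) auto
  next
    fix q q' u assume q: "q \<in> J" "q' \<in> J" "q \<noteq> q'"
    let ?u = "\<lambda>q. \<lambda>b\<in>Y'. u b - \<xi> q b"
    obtain k where k: "k \<in> D'" and "\<not> B k (\<lambda>u. fst q' k u - fst q k u) \<le> c * (e / 2) * \<sigma>"
      using sep[OF q] by auto
    then have "c * (e / 2) * \<sigma> < B k (\<lambda>v. fst q' k v - fst q k v)" by simp
    moreover have "c * (e / 2) * \<sigma> = 8 * r" by (simp add: c_def r_def)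
    moreover have "B k (\<lambda>v. fst q' k v - fst q k v) \<le> dl e * B k (\<lambda>v. ?u q (k, v)) + dl e * B k (\<lambda>v. ?u q' (k, v))"
    proof -
      have "B k (\<lambda>v. fst q' k v - fst q k v) = B k (\<lambda>v. dl e * ?u q (k, v) - dl e * ?u q' (k, v))"
        unfolding B_def
      proof (rule tensor_seminorm.cong[OF wsup_sn])
        fix a assume "a \<in> ibox n U"
        then have "(k, restrict a k) \<in> Y'" using k restrict_ibox block(2)[of k] by auto
        then show "fst q' k (restrict a k) - fst q k (restrict a k) = dl e * ?u q (k, restrict a k) - dl e * ?u q' (k, restrict a k)"
          using dp by (simp add: \<xi>_def right_diff_distrib)
      qed
      also have "\<dots> \<le> B k (\<lambda>v. dl e * ?u q (k, v)) + B k (\<lambda>v. dl e * ?u q' (k, v))" by (rule B_diff_le)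
      finally show ?thesis unfolding B_scale using dp by simp
    qed
    moreover have hk: "dl e * B k (\<lambda>v. ?u q (k, v)) \<le> h (?u q)" for q
      unfolding h_def using finite_D' dp B_nonneg k by (intro member_le_sum) auto
    ultimately show "8 * r < h (?u q) + h (?u q')" using hk[of q] hk[of q'] by linarith
  qed
  then show ?thesis by simp
qed

text \<open>Sudakov's bound with all of \<open>V\<close> as one Gaussian block, whose average is at
  most \<open>sqrt p * S\<close> for \<open>d = 2\<close>. In that case \<open>c \<ge> 32\<close>,
  so the squared quotient is at most \<open>X e / 256\<close>, and 10000 / 256 < 40.\<close>

lemma packing_marginal_L2:
  assumes e: "0 < e" "e \<le> 1" and dd: "d = 2" and J: "finite J" "J \<subseteq> T"
    and sep: "\<And>t t'. t \<in> J \<Longrightarrow> t' \<in> J \<Longrightarrow> t \<noteq> t' \<Longrightarrow> \<not> marginal_L2 (\<lambda>a. t' a - t a) \<le> c * (e / 2) * \<sigma>"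
  shows "real (card J) \<le> exp (40 * X e)"
proof -
  let ?M = "sqrt p * (\<eta> * \<sigma>)" and ?b = "c * (e / 2) * \<sigma>"
  have "gauss_avg n N {V} (\<lambda>_. 1) \<le> p powr (1 / 2) * S" using gauss_avg_V_le dd by simp
  also have "p powr (1 / 2) = sqrt p" using p by (simp add: powr_half_sqrt)
  also have "sqrt p * S \<le> ?M" using S_le p by (intro mult_left_mono) auto
  finally have M: "gauss_avg n N {V} (\<lambda>_. 1) \<le> ?M" .
  have b: "?b > 0" using c_ge e \<sigma>0 by simp
  have "real (card J) \<le> exp (10000 * (?M / ?b)\<^sup>2)"
  proof (rule sudakov_dual[OF V M, where f="\<lambda>t. t"])
    show "?M > 0" using p \<eta> \<sigma>0 by simp
    fix t t' assume t: "t \<in> J" "t' \<in> J" "t \<noteq> t'"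
    have "?b \<le> marginal_L2 (\<lambda>a. t a - t' a)" using sep[of t' t] t by auto
    also have "marginal_L2 (\<lambda>a. t a - t' a) = l2dist (gfam n {V}) (fibre_vec n U (\<lambda>a. t a * 1)) (fibre_vec n U (\<lambda>a. t' a * 1))"
      unfolding marginal_L2_def L2_fibre_vec[symmetric] by (simp add: fibre_vec_diff[abs_def])
    finally show "?b \<le> l2dist (gfam n {V}) (fibre_vec n U (\<lambda>a. t a * 1)) (fibre_vec n U (\<lambda>a. t' a * 1))" .
  qed (use b J in auto)
  also have "\<dots> \<le> exp (40 * X e)"
  proof -
    have \<eta>e: "0 < \<eta> * e" "\<eta> * e \<le> 1" using \<eta>e_pow[OF e] by auto
    have c32: "c \<ge> 32" using c_ge dd by simp
    have "?M / ?b = 2 * sqrt p * \<eta> / (c * e)" using \<sigma>0 c_ge e by (simp add: field_simps)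
    also have "\<dots> \<le> 2 * sqrt p * (1 / \<eta>) / (32 * e)"
    proof (intro frac_le mult_left_mono mult_right_mono c32)
      have "\<eta> * \<eta> \<le> 1" using \<eta> by (simp add: mult_le_one)
      then show "\<eta> \<le> 1 / \<eta>" using \<eta> by (simp add: pos_le_divide_eq)
    qed (use p \<eta> e in auto)
    also have "\<dots> = sqrt p / (16 * (\<eta> * e))" using \<eta> e by (simp add: field_simps)
    finally have le: "?M / ?b \<le> sqrt p / (16 * (\<eta> * e))" .
    have "0 \<le> ?M / ?b" using p \<eta> \<sigma>0 b by (intro divide_nonneg_pos) auto
    with le have "(?M / ?b)\<^sup>2 \<le> (sqrt p / (16 * (\<eta> * e)))\<^sup>2"
      by (rule power_mono)
    also have "\<dots> = X e / 256" using p by (simp add: X_def power_divide power_mult_distrib)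
    finally have "10000 * (?M / ?b)\<^sup>2 \<le> 10000 * (X e / 256)" by simp
    also have "\<dots> \<le> 40 * X e" using X_ge[OF e] by simp
    finally show ?thesis by simp
  qed
  finally show ?thesis .
qed

end

text \<open>Rounding the coordinates down to multiples of \<open>k\<close> takes finitely many
  values on \<open>W\<close>; one preimage in \<open>W\<close> per value forms the net.\<close>

lemma finite_net:
  fixes v :: "'q \<Rightarrow> 'b \<Rightarrow> real"
  assumes Y: "finite Y" and bd: "\<And>q b. q \<in> W \<Longrightarrow> b \<in> Y \<Longrightarrow> \<bar>v q b\<bar> \<le> M" and k: "k > 0"
  shows "\<exists>Q. finite Q \<and> Q \<subseteq> W \<and> (\<forall>q\<in>W. \<exists>q'\<in>Q. \<forall>b\<in>Y. \<bar>v q b - v q' b\<bar> \<le> k)"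
proof -
  define r where "r q = (\<lambda>b\<in>Y. \<lfloor>v q b / k\<rfloor>)" for q
  have "r ` W \<subseteq> PiE Y (\<lambda>_. {\<lfloor>- M / k\<rfloor>..\<lfloor>M / k\<rfloor>})"
  proof
    fix s assume "s \<in> r ` W"
    then obtain q where q: "q \<in> W" "s = r q" by auto
    have "\<lfloor>- M / k\<rfloor> \<le> \<lfloor>v q b / k\<rfloor> \<and> \<lfloor>v q b / k\<rfloor> \<le> \<lfloor>M / k\<rfloor>" if "b \<in> Y" for b
    proof -
      have "- M \<le> v q b" "v q b \<le> M" using bd[OF q(1) that] by auto
      then show ?thesis using k by (intro conjI floor_mono divide_right_mono) auto
    qed
    then show "s \<in> PiE Y (\<lambda>_. {\<lfloor>- M / k\<rfloor>..\<lfloor>M / k\<rfloor>})" using q by (auto simp: r_def)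
  qed
  then have fin: "finite (r ` W)" by (rule finite_subset) (auto intro: finite_PiE Y)
  show ?thesis
  proof (intro exI conjI ballI)
    show "finite (inv_into W r ` r ` W)" using fin by simp
    show "inv_into W r ` r ` W \<subseteq> W" by (auto intro: inv_into_into)
    fix q assume q: "q \<in> W"
    let ?q = "inv_into W r (r q)"
    have eq: "r ?q = r q" using q by (intro f_inv_into_f) auto
    have "\<bar>v q b - v ?q b\<bar> \<le> k" if b: "b \<in> Y" for b
    proof -
      have "\<lfloor>v ?q b / k\<rfloor> = \<lfloor>v q b / k\<rfloor>" using fun_cong[OF eq, of b] b by (simp add: r_def)
      then have "\<bar>v q b / k - v ?q b / k\<bar> \<le> 1" by linarith
      then have "\<bar>v q b - v ?q b\<bar> / k \<le> 1" using k by (simp add: diff_divide_distrib[symmetric])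
      then show ?thesis using k by simp
    qed
    then show "\<exists>q'\<in>inv_into W r ` r ` W. \<forall>b\<in>Y. \<bar>v q b - v q' b\<bar> \<le> k" using q by blast
  qed
qed

subsection \<open>Chaining\<close>

lemma mult_le_abs_mult: "a * b \<le> \<bar>a\<bar> * \<bar>b\<bar>" for a b :: real
  by (metis abs_ge_self abs_mult)

lemma abs_ip_le:
  assumes "finite Y" "L2_set a Y \<le> R"
  shows "\<bar>ip Y a g\<bar> \<le> R * (\<Sum>b\<in>Y. \<bar>g b\<bar>)"
proof -
  have "\<bar>ip Y a g\<bar> \<le> (\<Sum>b\<in>Y. \<bar>a b\<bar> * \<bar>g b\<bar>)"
    using sum_abs[of "\<lambda>b. a b * g b" Y] by (simp add: abs_mult)
  also have "\<dots> \<le> (\<Sum>b\<in>Y. R * \<bar>g b\<bar>)"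
  proof (intro sum_mono mult_right_mono)
    fix b assume "b \<in> Y"
    then have "\<bar>a b\<bar> \<le> L2_set (\<lambda>b. \<bar>a b\<bar>) Y" using assms(1) by (intro member_le_L2_set) auto
    then show "\<bar>a b\<bar> \<le> R" using assms(2) by (simp add: L2_set_def)
  qed simp
  finally show ?thesis by (simp add: sum_distrib_left)
qed

lemma integral_maxip_recenter:
  fixes v v' :: "'q \<Rightarrow> 'i \<Rightarrow> real"
  assumes Y: "finite Y" and Q: "finite Q" "Q \<noteq> {}" and h: "integrable (gaussv Y) h"
    and le: "\<And>q g. q \<in> Q \<Longrightarrow> ip Y (v q) g \<le> ip Y (v' q) g + h g"
  shows "(\<integral>g. maxip Y Q v g \<partial>gaussv Y) \<le> (\<integral>g. maxip Y Q v' g \<partial>gaussv Y) + (\<integral>g. h g \<partial>gaussv Y)"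
proof -
  have "maxip Y Q v g \<le> maxip Y Q v' g + h g" for g
  proof (rule Max.boundedI)
    fix s assume "s \<in> (\<lambda>q. ip Y (v q) g) ` Q"
    then obtain q where q: "q \<in> Q" "s = ip Y (v q) g" by auto
    have "ip Y (v' q) g \<le> maxip Y Q v' g" using Q q by (intro Max_ge) auto
    then show "s \<le> maxip Y Q v' g + h g" using le[OF q(1), of g] q(2) by linarith
  qed (use Q in auto)
  then have "(\<integral>g. maxip Y Q v g \<partial>gaussv Y) \<le> (\<integral>g. maxip Y Q v' g + h g \<partial>gaussv Y)"
    using h by (intro integral_mono Bochner_Integration.integrable_add integrable_maxip Y Q)
  also have "\<dots> = (\<integral>g. maxip Y Q v' g \<partial>gaussv Y) + (\<integral>g. h g \<partial>gaussv Y)"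
    by (intro Bochner_Integration.integral_add integrable_maxip Y Q h)
  finally show ?thesis .
qed

context chain_setup
begin

definition gmax :: "(nat set \<Rightarrow> tensor) \<Rightarrow> tensor \<Rightarrow> ((nat set \<Rightarrow> tensor) \<times> tensor) set \<Rightarrow> real" where
  "gmax z \<tau> Q = (\<integral>g. maxip Y Q (coef z \<tau>) g \<partial>gaussv Y)"

definition Theta :: "((nat set \<Rightarrow> tensor) \<times> tensor) set" where
  "Theta = {q. fst q \<in> unit_arrays n D' \<and> snd q \<in> T}"

text \<open>The pieces \<open>W\<close> occurring at scale \<open>e\<close> of the chaining, with center \<open>(z, \<tau>)\<close>.\<close>

definition adm :: "real \<Rightarrow> ((nat set \<Rightarrow> tensor) \<times> tensor) set \<Rightarrow> (nat set \<Rightarrow> tensor) \<Rightarrow> tensor \<Rightarrow> bool" where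
  "adm e W z \<tau> \<longleftrightarrow> W \<subseteq> Theta \<and> z \<in> unit_arrays n D' \<and> \<tau> \<in> T \<and> (d \<noteq> 2 \<longrightarrow> \<tau> = (\<lambda>_. 0)) \<and>
     (\<forall>q\<in>W. near (c * e * \<sigma>) z \<tau> q) \<and> (\<forall>q\<in>W. \<forall>q'\<in>W. l2dist Y (coef z \<tau> q) (coef z \<tau> q') \<le> 64 * eb e)"

lemma adm_dest:
  assumes "adm e W z \<tau>"
  shows "W \<subseteq> Theta" "z \<in> unit_arrays n D'" "\<tau> \<in> T"
    "\<And>q q'. q \<in> W \<Longrightarrow> q' \<in> W \<Longrightarrow> l2dist Y (coef z \<tau> q) (coef z \<tau> q') \<le> 64 * eb e"
  using assms unfolding adm_def by blast+

lemma Y_finite: "finite Y"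
  by (rule finite_gfam_blocks[OF iU(2)])

lemma zero_dual: "(\<lambda>_. 0) \<in> T"
  using nonneg by (simp add: dual_ball_def)

lemma marginal_L2_minus: "marginal_L2 (\<lambda>a. t a - t' a) = marginal_L2 (\<lambda>a. t' a - t a)"
  unfolding marginal_L2_def L2_set_def fibre_sum_diff by (simp add: power2_commute)

text \<open>Three coverings are nested: of the x-parts by the distances \<open>B\<close>, of the
  dual parts when \<open>d = 2\<close>, and of each resulting set in the metric of the process. The
  last one must follow the others, since that metric depends on the new center and its covering
  number requires points near that center at scale \<open>e / 2\<close>.\<close>

lemma step:
  assumes e: "0 < e" "e \<le> 1" and A: "adm e W z \<tau>"
  obtains J :: "((((nat set \<Rightarrow> tensor) \<times> tensor) \<times> tensor) \<times> ((nat set \<Rightarrow> tensor) \<times> tensor)) set" and G zz \<tau>\<tau>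
  where "finite J" "real (card J) \<le> exp ((9 * real d + 2600) * X e)" "W = (\<Union>j\<in>J. G j)"
    "\<And>j. j \<in> J \<Longrightarrow> adm (e / 2) (G j) (zz j) (\<tau>\<tau> j)"
    "\<And>j k. j \<in> J \<Longrightarrow> k \<in> D' \<Longrightarrow> B k (\<lambda>u. zz j k u - z k u) \<le> c * e * \<sigma>"
    "\<And>j. j \<in> J \<Longrightarrow> d = 2 \<Longrightarrow> marginal_L2 (\<lambda>a. \<tau>\<tau> j a - \<tau> a) \<le> c * e * \<sigma>"
    "\<And>j. j \<in> J \<Longrightarrow> d \<noteq> 2 \<Longrightarrow> \<tau>\<tau> j = \<tau>"
proof -
  define r where "r = c * (e / 2) * \<sigma>"
  have r: "r \<ge> 0" using c_ge e \<sigma>0 by (simp add: r_def)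
  have e2: "0 < e / 2" "e / 2 \<le> 1" using e by auto
  have W: "fst q \<in> unit_arrays n D'" "snd q \<in> T" "near (c * e * \<sigma>) z \<tau> q" if "q \<in> W" for q
    using A that by (auto simp: adm_def Theta_def)
  define n1 where "n1 q q' \<longleftrightarrow> (\<forall>k\<in>D'. B k (\<lambda>u. fst q' k u - fst q k u) \<le> r)" for q q' :: "(nat set \<Rightarrow> tensor) \<times> tensor"
  have B0: "B k (\<lambda>u. y u - y u) = 0" for k y
    using B_scale[of k 0 "\<lambda>_. 0"] by simp
  obtain F1 where F1: "finite F1" "F1 \<subseteq> W" "real (card F1) \<le> 2 * exp (real d * X e)" "\<And>q. q \<in> W \<Longrightarrow> \<exists>f\<in>F1. n1 f q"
  proof (rule cover_of_packing[of W n1 "2 * exp (real d * X e)"])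
    fix F assume F: "finite F" "F \<subseteq> W" "\<And>u v. u \<in> F \<Longrightarrow> v \<in> F \<Longrightarrow> u \<noteq> v \<Longrightarrow> \<not> n1 u v"
    show "real (card F) \<le> 2 * exp (real d * X e)"
      using F W by (intro packing_B[OF e]) (auto simp: n1_def r_def)
  next
    show "n1 u u" for u unfolding n1_def B0 using r by simp
    show "n1 v u" if "n1 u v" for u v using that unfolding n1_def by (subst B_minus)
  qed blast
  define n2 where "n2 t t' \<longleftrightarrow> marginal_L2 (\<lambda>a. t' a - t a) \<le> r" for t t' :: tensor
  have "\<exists>F2. finite F2 \<and> F2 \<subseteq> T \<and> real (card F2) \<le> exp (40 * X e) \<and>
      (d = 2 \<longrightarrow> F2 \<subseteq> snd ` W \<and> (\<forall>q\<in>W. \<exists>f\<in>F2. n2 f (snd q))) \<and> (d \<noteq> 2 \<longrightarrow> F2 = {\<lambda>_. 0})"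
  proof (cases "d = 2")
    case True
    obtain F2 where F2: "finite F2" "F2 \<subseteq> snd ` W" "real (card F2) \<le> exp (40 * X e)" "\<And>t. t \<in> snd ` W \<Longrightarrow> \<exists>f\<in>F2. n2 f t"
    proof (rule cover_of_packing[of "snd ` W" n2 "exp (40 * X e)"])
      fix F assume F: "finite F" "F \<subseteq> snd ` W" "\<And>u v. u \<in> F \<Longrightarrow> v \<in> F \<Longrightarrow> u \<noteq> v \<Longrightarrow> \<not> n2 u v"
      show "real (card F) \<le> exp (40 * X e)"
        using F W by (intro packing_marginal_L2[OF e True]) (auto simp: n2_def r_def)
    next
      show "n2 u u" for u unfolding n2_def marginal_L2_def using r by (simp add: L2_set_def fibre_sum_def)
      show "n2 v u" if "n2 u v" for u v using that unfolding n2_def by (subst marginal_L2_minus)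
    qed blast
    have "F2 \<subseteq> T" using F2(2) W by auto
    moreover have "\<forall>q\<in>W. \<exists>f\<in>F2. n2 f (snd q)" using F2(4) by simp
    ultimately show ?thesis using F2(1-3) True by (intro exI[of _ F2] conjI impI) simp_all
  next
    case False
    have "1 \<le> exp (40 * X e)" using X_ge[OF e] by simp
    then show ?thesis using False zero_dual by (intro exI[of _ "{\<lambda>_. 0}"]) simp
  qed
  then obtain F2 where F2c: "finite F2 \<and> F2 \<subseteq> T \<and> real (card F2) \<le> exp (40 * X e) \<and>
      (d = 2 \<longrightarrow> F2 \<subseteq> snd ` W \<and> (\<forall>q\<in>W. \<exists>f\<in>F2. n2 f (snd q))) \<and> (d \<noteq> 2 \<longrightarrow> F2 = {\<lambda>_. 0})" ..
  have F2: "finite F2" "F2 \<subseteq> T" "real (card F2) \<le> exp (40 * X e)"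
    "d = 2 \<Longrightarrow> F2 \<subseteq> snd ` W" "\<And>q. d = 2 \<Longrightarrow> q \<in> W \<Longrightarrow> \<exists>f\<in>F2. n2 f (snd q)" "d \<noteq> 2 \<Longrightarrow> F2 = {\<lambda>_. 0}"
    using F2c by simp_all
  define W2 where "W2 f = {q \<in> W. n1 (fst f) q \<and> (d = 2 \<longrightarrow> n2 (snd f) (snd q))}" for f :: "((nat set \<Rightarrow> tensor) \<times> tensor) \<times> tensor"
  define rel where "rel f q q' \<longleftrightarrow> l2dist Y (coef (fst (fst f)) (snd f) q) (coef (fst (fst f)) (snd f) q') \<le> 32 * eb (e / 2)"
    for f :: "((nat set \<Rightarrow> tensor) \<times> tensor) \<times> tensor" and q q' :: "(nat set \<Rightarrow> tensor) \<times> tensor"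
  let ?B3 = "2 * exp ((2 * real d + 625) * X (e / 2))"
  have near2: "near (c * (e / 2) * \<sigma>) (fst (fst f)) (snd f) q" if "q \<in> W2 f" for f q
    using that by (auto simp: W2_def n1_def n2_def near_def r_def)
  have "\<exists>H. finite H \<and> H \<subseteq> W2 f \<and> real (card H) \<le> ?B3 \<and> (\<forall>q\<in>W2 f. \<exists>h\<in>H. rel f h q)" if f: "f \<in> F1 \<times> F2" for f
  proof -
    have z': "fst (fst f) \<in> unit_arrays n D'" "snd f \<in> T" using f F1(2) F2(2) W by auto
    obtain H where "finite H" "H \<subseteq> W2 f" "real (card H) \<le> ?B3" "\<And>q. q \<in> W2 f \<Longrightarrow> \<exists>h\<in>H. rel f h q"
    proof (rule cover_of_packing[of "W2 f" "rel f" ?B3])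
      fix F assume F: "finite F" "F \<subseteq> W2 f" "\<And>u v. u \<in> F \<Longrightarrow> v \<in> F \<Longrightarrow> u \<noteq> v \<Longrightarrow> \<not> rel f u v"
      show "real (card F) \<le> ?B3"
      proof (rule packing_fibre_vec[OF e2 z' F(1)])
        fix q assume "q \<in> F"
        then have "q \<in> W2 f" using F by auto
        then show "fst q \<in> unit_arrays n D' \<and> snd q \<in> T \<and> near (c * (e / 2) * \<sigma>) (fst (fst f)) (snd f) q"
          using near2[of q f] W by (auto simp: W2_def)
      qed (use F(3) in \<open>auto simp: rel_def\<close>)
    next
      show "rel f u u" for u unfolding rel_def using eb_pos[OF e2(1)] by (simp add: L2_set_def)
      show "rel f v u" if "rel f u v" for u v using that unfolding rel_def by (subst l2dist_sym)
    qed blast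
    then show ?thesis by blast
  qed
  then obtain H where H: "\<And>f. f \<in> F1 \<times> F2 \<Longrightarrow> finite (H f) \<and> H f \<subseteq> W2 f \<and> real (card (H f)) \<le> ?B3 \<and> (\<forall>q\<in>W2 f. \<exists>h\<in>H f. rel f h q)"
    by metis
  \<comment> \<open>An index consists of a point whose x-part becomes the new center, a functional
    that becomes the new dual center, and a point of the net in the process metric. The two centers
    are chosen independently of each other.\<close>
  define J where "J = (SIGMA f:F1 \<times> F2. H f)"
  define G where "G j = {q \<in> W2 (fst j). rel (fst j) (snd j) q}" for j
  show thesis
  proof
    show "finite J" unfolding J_def using F1 F2 H by (intro finite_SigmaI) auto
    have "real (card J) = (\<Sum>f\<in>F1 \<times> F2. real (card (H f)))"
      unfolding J_def using F1 F2 H by (subst card_SigmaI) auto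
    also have "\<dots> \<le> (\<Sum>f\<in>F1 \<times> F2. ?B3)" using H by (intro sum_mono) auto
    also have "\<dots> = real (card F1) * real (card F2) * ?B3" using F1 F2 by (simp add: card_cartesian_product)
    also have "\<dots> \<le> 2 * exp (real d * X e) * exp (40 * X e) * ?B3"
      using F1 F2 by (intro mult_mono) auto
    \<comment> \<open>Halving the scale multiplies \<open>X\<close> by 4, so the exponents add up to
      d + 40 + 4 (2 d + 625) = 9 d + 2540. The factor 4 is absorbed by a further 60.\<close>
    also have "\<dots> = 4 * exp ((9 * real d + 2540) * X e)"
    proof -
      have "X (e / 2) = 4 * X e" by (simp add: X_def power_divide power_mult_distrib)
      then show ?thesis by (simp add: mult_exp_exp algebra_simps)
    qed
    also have "\<dots> \<le> exp (60 * X e) * exp ((9 * real d + 2540) * X e)"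
    proof (intro mult_right_mono)
      have "4 \<le> 1 + 60 * X e" using X_ge[OF e] by simp
      also have "\<dots> \<le> exp (60 * X e)" by (rule exp_ge_add_one_self)
      finally show "4 \<le> exp (60 * X e)" .
    qed simp
    also have "\<dots> = exp ((9 * real d + 2600) * X e)" by (simp add: mult_exp_exp algebra_simps)
    finally show "real (card J) \<le> exp ((9 * real d + 2600) * X e)" .
    show "W = (\<Union>j\<in>J. G j)"
    proof
      show "(\<Union>j\<in>J. G j) \<subseteq> W" by (auto simp: G_def W2_def)
      show "W \<subseteq> (\<Union>j\<in>J. G j)"
      proof
        fix q assume q: "q \<in> W"
        obtain f1 where f1: "f1 \<in> F1" "n1 f1 q" using F1(4)[OF q] by blast
        obtain f2 where f2: "f2 \<in> F2" "d = 2 \<longrightarrow> n2 f2 (snd q)"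
          using F2(5)[OF _ q] F2(6) by (cases "d = 2") auto
        have q2: "q \<in> W2 (f1, f2)" using q f1 f2 by (simp add: W2_def)
        then obtain h where "h \<in> H (f1, f2)" "rel (f1, f2) h q" using H[of "(f1, f2)"] f1 f2 by auto
        then have "((f1, f2), h) \<in> J" "q \<in> G ((f1, f2), h)" using q2 f1 f2 by (auto simp: J_def G_def)
        then show "q \<in> (\<Union>j\<in>J. G j)" by blast
      qed
    qed
  next
    fix j assume j: "j \<in> J"
    then have f: "fst (fst j) \<in> F1" "snd (fst j) \<in> F2" by (auto simp: J_def)
    have "l2dist Y (coef (fst (fst (fst j))) (snd (fst j)) q) (coef (fst (fst (fst j))) (snd (fst j)) q') \<le> 64 * eb (e / 2)"
      if "q \<in> G j" "q' \<in> G j" for q q'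
    proof -
      let ?v = "coef (fst (fst (fst j))) (snd (fst j))"
      have "l2dist Y (?v q) (?v q') \<le> l2dist Y (?v q) (?v (snd j)) + l2dist Y (?v (snd j)) (?v q')" by (rule l2dist_triangle)
      moreover have "l2dist Y (?v (snd j)) (?v q) \<le> 32 * eb (e / 2)" "l2dist Y (?v (snd j)) (?v q') \<le> 32 * eb (e / 2)"
        using that by (auto simp: G_def rel_def)
      ultimately show ?thesis using l2dist_sym[where Y=Y and u="?v q" and v="?v (snd j)"] by linarith
    qed
    moreover have fW: "fst (fst j) \<in> W" using f(1) F1(2) by blast
    moreover have "fst (fst (fst j)) \<in> unit_arrays n D'" "snd (fst j) \<in> T"
      using W(1)[OF fW] f(2) F2(2) by blast+
    moreover have "d \<noteq> 2 \<longrightarrow> snd (fst j) = (\<lambda>_. 0)" using f F2(6) by auto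
    moreover have "G j \<subseteq> Theta" using W by (auto simp: G_def W2_def Theta_def)
    ultimately show "adm (e / 2) (G j) (fst (fst (fst j))) (snd (fst j))"
      unfolding adm_def using near2 by (auto simp: G_def)
    show "B k (\<lambda>u. fst (fst (fst j)) k u - z k u) \<le> c * e * \<sigma>" if "k \<in> D'" for k
      using W(3)[of "fst (fst j)"] f(1) F1(2) that by (auto simp: near_def)
    show "marginal_L2 (\<lambda>a. snd (fst j) a - \<tau> a) \<le> c * e * \<sigma>" if dd: "d = 2"
    proof -
      obtain q where q: "q \<in> W" "snd (fst j) = snd q" using F2(4)[OF dd] f(2) by auto
      show ?thesis unfolding q(2) using W(3)[OF q(1)] unfolding near_def using dd by blast
    qed
    show "snd (fst j) = \<tau>" if "d \<noteq> 2" using F2(6)[OF that] f(2) A that by (auto simp: adm_def)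
  qed
qed

text \<open>By multilinearity the error is the same product with the fixed array
  \<open>z' k - \<zeta> k\<close> in block \<open>k\<close>. Its supremum over the other x-variables
  is a seminorm independent of \<open>q\<close>, which can be taken out of the maximum; its mean is
  a \<open>gauss_sup\<close> with \<open>d - 1\<close> blocks, bounded by \<open>IH\<close>. The
  factor 2 comes from the two functionals, \<open>2 ^ d\<close> from differences of unit
  arrays.\<close>

lemma gmax_move_coordinate:
  assumes Q: "finite Q" "Q \<noteq> {}" "Q \<subseteq> Theta" and \<zeta>: "\<zeta> \<in> unit_arrays n D'" and z': "z' \<in> unit_arrays n D'" and \<tau>: "\<tau> \<in> T" and k: "k \<in> D'"
  shows "gmax \<zeta> \<tau> Q \<le> gmax (\<zeta>(k := z' k)) \<tau> Q + 2 * 2 ^ d * C * B k (\<lambda>u. z' k u - \<zeta> k u)"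
proof -
  let ?w = "\<lambda>u. z' k u - \<zeta> k u" and ?\<zeta> = "\<zeta>(k := z' k)"
  interpret K: tensor_seminorm n U "contract N k ?w" by (rule contract_seminorm)
  have DkU: "\<Union>(D' - {k}) \<subseteq> U" by (rule D'U) auto
  interpret P: tensor_seminorm n U "unit_sup n (contract N k ?w) (D' - {k})" by (rule K.unit_sup_seminorm[OF DkU])
  define h where "h g = 2 * 2 ^ d * unit_sup n (contract N k ?w) (D' - {k}) (\<lambda>a. 1 * tprod {i} (curry g) a)" for g
  have hint: "integrable (gaussv Y) h"
    unfolding h_def using P.integrable_gauss_avg'[OF iU(2), of "\<lambda>_. 1"] by (intro integrable_mult_right) (simp add: gauss_family_eq)
  have "gmax \<zeta> \<tau> Q \<le> gmax ?\<zeta> \<tau> Q + (\<integral>g. h g \<partial>gaussv Y)"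
    unfolding gmax_def
  proof (rule integral_maxip_recenter[OF Y_finite Q(1,2) hint])
    fix q g assume "q \<in> Q"
    then have q: "fst q \<in> unit_arrays n D'" "snd q \<in> T" using Q by (auto simp: Theta_def)
    let ?y = "\<lambda>k u. fst q k u - \<zeta> k u" and ?y' = "\<lambda>k u. fst q k u - ?\<zeta> k u" and ?s = "\<lambda>a. snd q a - \<tau> a"
    let ?R = "\<lambda>a. tprod {i} (curry g) a * tprod (D' - {k}) ?y a"
    have split: "tprod D' ?y a = tprod D' ?y' a + tprod (D' - {k}) ?y a * ?w (restrict a k)" for a
    proof -
      have k0: "k \<in> D' - {}" using k by simp
      have "tprod (D' - {k}) ?y' a = tprod (D' - {k}) ?y a" by (intro tprod_cong) auto
      then show ?thesis
        using tprod_split[OF empty_subsetI k0, of ?y a] tprod_split[OF empty_subsetI k0, of ?y' a] by (simp add: algebra_simps)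
    qed
    have "coef \<zeta> \<tau> q b = coef ?\<zeta> \<tau> q b + fibre_vec n U (\<lambda>a. ?s a * (tprod (D' - {k}) ?y a * ?w (restrict a k))) b" for b
      unfolding coef_def split fibre_vec_add[symmetric] by (simp add: distrib_left)
    then have 1: "ip Y (coef \<zeta> \<tau> q) g = ip Y (coef ?\<zeta> \<tau> q) g + ip Y (fibre_vec n U (\<lambda>a. ?s a * (tprod (D' - {k}) ?y a * ?w (restrict a k)))) g"
      by (simp add: distrib_right sum.distrib)
    have 2: "ip Y (fibre_vec n U (\<lambda>a. ?s a * (tprod (D' - {k}) ?y a * ?w (restrict a k)))) g =
       ip (ibox n U) (snd q) (\<lambda>a. ?R a * ?w (restrict a k)) - ip (ibox n U) \<tau> (\<lambda>a. ?R a * ?w (restrict a k))"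
      unfolding ip_fibre_vec[OF finite_U iU(1)] sum_subtractf[symmetric] by (intro sum.cong refl) (simp add: algebra_simps)
    have tri: "a - b \<le> 2 * m" if "\<bar>a\<bar> \<le> m" "\<bar>b\<bar> \<le> m" for a b m :: real using that by linarith
    have 3: "ip (ibox n U) (snd q) (\<lambda>a. ?R a * ?w (restrict a k)) - ip (ibox n U) \<tau> (\<lambda>a. ?R a * ?w (restrict a k)) \<le> 2 * contract N k ?w ?R"
      unfolding contract_def
      by (rule tri[OF dual_ball_abs[OF q(2), of "\<lambda>a. ?R a * ?w (restrict a k)"] dual_ball_abs[OF \<tau>, of "\<lambda>a. ?R a * ?w (restrict a k)"]])
    have 4: "contract N k ?w ?R \<le> 2 ^ card (D' - {k}) * unit_sup n (contract N k ?w) (D' - {k}) (tprod {i} (curry g))"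
      by (rule K.norm_tprod_le[OF DkU]) (use unit_arrays_diff[OF q(1) \<zeta>] in auto)
    have 5: "2 ^ card (D' - {k}) * unit_sup n (contract N k ?w) (D' - {k}) (tprod {i} (curry g)) \<le> 2 ^ d * unit_sup n (contract N k ?w) (D' - {k}) (tprod {i} (curry g))"
      using finite_D' k K.unit_sup_nonneg[OF DkU] by (intro mult_right_mono power_increasing) auto
    have 6: "h g = 2 * (2 ^ d * unit_sup n (contract N k ?w) (D' - {k}) (tprod {i} (curry g)))" by (simp add: h_def)
    show "ip Y (coef \<zeta> \<tau> q) g \<le> ip Y (coef ?\<zeta> \<tau> q) g + h g"
      using 1 2 3 4 5 6 by linarith
  qed
  also have "(\<integral>g. h g \<partial>gaussv Y) = 2 * 2 ^ d * gauss_sup n (contract N k ?w) (D - {k}) i"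
  proof -
    have "D - {k} - {i} = D' - {k}" by auto
    then show ?thesis by (simp add: h_def gauss_sup_def gauss_avg_def gauss_family_eq)
  qed
  also have "\<dots> \<le> 2 * 2 ^ d * (C * B k ?w)"
    unfolding B_def using IH[OF k, of ?w] by (intro mult_left_mono) auto
  finally show ?thesis by (simp only: mult.assoc)
qed

text \<open>The hybrid centers \<zeta> \<open>K\<close>, with new arrays on \<open>K\<close> and old
  ones elsewhere, change one block at a time and remain unit arrays.\<close>

lemma gmax_recenter_x:
  assumes Q: "finite Q" "Q \<noteq> {}" "Q \<subseteq> Theta" and z: "z \<in> unit_arrays n D'" and z': "z' \<in> unit_arrays n D'" and \<tau>: "\<tau> \<in> T"
    and r: "\<And>k. k \<in> D' \<Longrightarrow> B k (\<lambda>u. z' k u - z k u) \<le> r" "r \<ge> 0"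
  shows "gmax z \<tau> Q \<le> gmax z' \<tau> Q + real d * (2 * 2 ^ d * C * r)"
proof -
  define \<zeta> where "\<zeta> K = (\<lambda>k. if k \<in> K then z' k else z k)" for K
  have unit_arrays: "\<zeta> K \<in> unit_arrays n D'" for K using z z' by (auto simp: \<zeta>_def unit_arrays_def)
  have "gmax z \<tau> Q \<le> gmax (\<zeta> K) \<tau> Q + real (card K) * (2 * 2 ^ d * C * r)" if "finite K" "K \<subseteq> D'" for K
    using that
  proof (induction K rule: finite_induct)
    case empty
    have "\<zeta> {} = z" by (simp add: \<zeta>_def)
    then show ?case by simp
  next
    case (insert k K)
    have k: "k \<in> D'" using insert by auto
    have "(\<zeta> K)(k := z' k) = \<zeta> (insert k K)" by (auto simp: \<zeta>_def)
    moreover have "\<zeta> K k = z k" using insert by (simp add: \<zeta>_def)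
    ultimately have "gmax (\<zeta> K) \<tau> Q \<le> gmax (\<zeta> (insert k K)) \<tau> Q + 2 * 2 ^ d * C * B k (\<lambda>u. z' k u - z k u)"
      using gmax_move_coordinate[OF Q unit_arrays[of K] z' \<tau> k] by simp
    also have "2 * 2 ^ d * C * B k (\<lambda>u. z' k u - z k u) \<le> 2 * 2 ^ d * C * r"
      using r(1)[OF k] C by (intro mult_left_mono) auto
    finally show ?case using insert by (simp add: distrib_right)
  qed
  from this[OF finite_D'(1) order_refl]
  have "gmax z \<tau> Q \<le> gmax (\<zeta> D') \<tau> Q + real (card D') * (2 * 2 ^ d * C * r)" .
  also have "gmax (\<zeta> D') \<tau> Q = gmax z' \<tau> Q"
  proof -
    have "coef (\<zeta> D') \<tau> q = coef z' \<tau> q" for q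
    proof -
      have "tprod D' (\<lambda>k u. fst q k u - \<zeta> D' k u) a = tprod D' (\<lambda>k u. fst q k u - z' k u) a" for a
        by (rule tprod_cong) (simp add: \<zeta>_def)
      then show ?thesis by (simp add: coef_def)
    qed
    then show ?thesis by (simp add: gmax_def)
  qed
  also have "real (card D') * (2 * 2 ^ d * C * r) \<le> real d * (2 * 2 ^ d * C * r)"
    using finite_D' C r by (intro mult_right_mono) auto
  finally show ?thesis by simp
qed

text \<open>For \<open>d = 2\<close> there is one x-variable, and Cauchy-Schwarz in its block bounds
  the error uniformly in \<open>q\<close>. Averaging over the block \<open>i\<close> merges both
  blocks into \<open>V\<close>, and no induction hypothesis is involved.\<close>

lemma gmax_recenter_t:
  assumes Q: "finite Q" "Q \<noteq> {}" "Q \<subseteq> Theta" and z: "z \<in> unit_arrays n D'" and dd: "d = 2"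
  shows "gmax z \<tau> Q \<le> gmax z \<tau>' Q + 2 * marginal_L2 (\<lambda>a. \<tau>' a - \<tau> a)"
proof -
  have "card D' = 1" using finite_D' dd by simp
  then obtain k where k: "D' = {k}" by (auto simp: card_1_singleton_iff)
  then have kD: "k \<in> D'" by simp
  have kU: "k \<subseteq> U" using block(2) kD by auto
  let ?s = "\<lambda>a. \<tau>' a - \<tau> a"
  interpret M: tensor_seminorm n U "\<lambda>w. L2_set (fibre_vec n U (\<lambda>a. ?s a * w a)) (gfam n {k})" by (rule box_seminorm_L2_fibre_vec[OF finite_U])
  define h where "h g = 2 * L2_set (fibre_vec n U (\<lambda>a. ?s a * (1 * tprod {i} (curry g) a))) (gfam n {k})" for g
  have hint: "integrable (gaussv Y) h"
    unfolding h_def using M.integrable_gauss_avg'[OF iU(2), of "\<lambda>_. 1"] by (intro integrable_mult_right) (simp add: gauss_family_eq)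
  have "gmax z \<tau> Q \<le> gmax z \<tau>' Q + (\<integral>g. h g \<partial>gaussv Y)"
    unfolding gmax_def
  proof (rule integral_maxip_recenter[OF Y_finite Q(1,2) hint])
    fix q g assume "q \<in> Q"
    then have q: "fst q \<in> unit_arrays n D'" using Q by (auto simp: Theta_def)
    let ?y = "\<lambda>k u. fst q k u - z k u"
    let ?f = "fibre_sum n U (\<lambda>a. ?s a * (1 * tprod {i} (curry g) a)) k"
    have "coef z \<tau> q b = coef z \<tau>' q b + fibre_vec n U (\<lambda>a. ?s a * ?y k (restrict a k)) b" for b
      unfolding coef_def fibre_vec_add[symmetric] k tprod_single by (simp add: algebra_simps)
    then have "ip Y (coef z \<tau> q) g = ip Y (coef z \<tau>' q) g + ip Y (fibre_vec n U (\<lambda>a. ?s a * ?y k (restrict a k))) g"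
      by (simp add: distrib_right sum.distrib)
    also have "ip Y (fibre_vec n U (\<lambda>a. ?s a * ?y k (restrict a k))) g = (\<Sum>a\<in>ibox n U. ?s a * (1 * tprod {i} (curry g) a) * ?y k (restrict a k))"
      unfolding ip_fibre_vec[OF finite_U iU(1)] by (intro sum.cong refl) simp
    also have "\<dots> = (\<Sum>u\<in>ibox n k. ?f u * ?y k u)" by (rule sum_fibre_sum[OF finite_U kU, symmetric])
    also have "\<dots> \<le> (\<Sum>u\<in>ibox n k. \<bar>?f u\<bar> * \<bar>?y k u\<bar>)"
      by (intro sum_mono mult_le_abs_mult)
    also have "\<dots> \<le> L2_set ?f (ibox n k) * L2_set (?y k) (ibox n k)" by (rule L2_set_mult_ineq)
    also have "\<dots> \<le> L2_set ?f (ibox n k) * 2"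
    proof (intro mult_left_mono)
      have "(L2_set (?y k) (ibox n k))\<^sup>2 \<le> 2\<^sup>2" unfolding L2_set_power2 by (rule unit_arrays_diff[OF q z kD])
      then show "L2_set (?y k) (ibox n k) \<le> 2" by (rule power2_le_imp_le) simp
    qed simp
    finally show "ip Y (coef z \<tau> q) g \<le> ip Y (coef z \<tau>' q) g + h g" by (simp add: h_def L2_fibre_vec)
  qed
  also have "(\<integral>g. h g \<partial>gaussv Y) = 2 * gauss_avg n (\<lambda>w. L2_set (fibre_vec n U (\<lambda>a. ?s a * w a)) (gfam n {k})) {i} (\<lambda>_. 1)"
    by (simp add: h_def gauss_avg_def gauss_family_eq)
  also have "\<dots> \<le> 2 * marginal_L2 ?s"
  proof -
    have "k \<union> i = V" using k UD i by auto
    then show ?thesis using gauss_avg_L2_fibre_vec_le[OF finite_U iU(2) kU, of n ?s "\<lambda>_. 1"] by (simp add: marginal_L2_def)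
  qed
  finally show ?thesis by simp
qed

text \<open>\<open>a1\<close> is the cost of concentration per scale and \<open>a2\<close> that of
  recentering, in units of e \<sigma>. They depend on \<open>d\<close>, \<open>C\<close> and
  \<kappa> but not on \<eta>, which the final choice of \<eta> relies on.\<close>

definition a1 :: real where "a1 = 3 * (64 * (2 ^ d * (2 * 2 ^ d * c))) * sqrt (9 * real d + 2600)"
definition a2 :: real where "a2 = (real d * (2 * 2 ^ d * C) + 2) * c"

lemma gmax_recenter:
  assumes Q: "finite Q" "Q \<noteq> {}" "Q \<subseteq> Theta" and z: "z \<in> unit_arrays n D'" and z': "z' \<in> unit_arrays n D'" and \<tau>: "\<tau> \<in> T"
    and B: "\<And>k. k \<in> D' \<Longrightarrow> B k (\<lambda>u. z' k u - z k u) \<le> c * e * \<sigma>" and e: "0 < e"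
    and marginal_L2: "d = 2 \<Longrightarrow> marginal_L2 (\<lambda>a. \<tau>' a - \<tau> a) \<le> c * e * \<sigma>" "d \<noteq> 2 \<Longrightarrow> \<tau>' = \<tau>"
  shows "gmax z \<tau> Q \<le> gmax z' \<tau>' Q + a2 * e * \<sigma>"
proof -
  have r: "0 \<le> c * e * \<sigma>" using c_ge e \<sigma>0 by simp
  have "gmax z \<tau> Q \<le> gmax z' \<tau> Q + real d * (2 * 2 ^ d * C * (c * e * \<sigma>))"
    by (rule gmax_recenter_x[OF Q z z' \<tau> B r])
  also have "gmax z' \<tau> Q \<le> gmax z' \<tau>' Q + 2 * (c * e * \<sigma>)"
  proof (cases "d = 2")
    case True
    then show ?thesis using gmax_recenter_t[OF Q z' True, of \<tau> \<tau>'] marginal_L2(1)[OF True] by linarith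
  qed (use marginal_L2(2) r in auto)
  finally show ?thesis by (simp add: a2_def algebra_simps)
qed

definition gauss_l1 :: real where "gauss_l1 = (\<integral>g. (\<Sum>b\<in>Y. \<bar>g b\<bar>) \<partial>gaussv Y)"

lemma integrable_gauss_l1: "integrable (gaussv Y) (\<lambda>g. \<Sum>b\<in>Y. \<bar>g b\<bar>)"
  by (intro Bochner_Integration.integrable_sum integrable_abs integrable_gaussv_component Y_finite)

lemma gauss_l1_nonneg: "gauss_l1 \<ge> 0"
  unfolding gauss_l1_def by (intro Bochner_Integration.integral_nonneg sum_nonneg) auto

text \<open>A crude bound growing with the dimension through \<open>gauss_l1\<close>. It closes the
  chaining at the finest scale, and its contribution vanishes as the depth increases.\<close>

lemma gmax_diam:
  assumes Q: "finite Q" "Q \<noteq> {}" and R: "\<And>q q'. q \<in> Q \<Longrightarrow> q' \<in> Q \<Longrightarrow> l2dist Y (coef z \<tau> q) (coef z \<tau> q') \<le> R"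
  shows "gmax z \<tau> Q \<le> R * gauss_l1"
proof -
  obtain q0 where q0: "q0 \<in> Q" using Q by auto
  let ?h = "\<lambda>g. ip Y (coef z \<tau> q0) g + R * (\<Sum>b\<in>Y. \<bar>g b\<bar>)"
  have h: "integrable (gaussv Y) ?h"
    by (intro Bochner_Integration.integrable_add integrable_mult_right integrable_gauss_l1 integrable_ip Y_finite)
  have "gmax z \<tau> Q \<le> (\<integral>g. ?h g \<partial>gaussv Y)"
  proof -
    have "maxip Y Q (coef z \<tau>) g \<le> ?h g" for g
    proof (rule Max.boundedI)
      fix s assume "s \<in> (\<lambda>q. ip Y (coef z \<tau> q) g) ` Q"
      then obtain q where q: "q \<in> Q" "s = ip Y (coef z \<tau> q) g" by auto
      have "\<bar>ip Y (\<lambda>b. coef z \<tau> q b - coef z \<tau> q0 b) g\<bar> \<le> R * (\<Sum>b\<in>Y. \<bar>g b\<bar>)"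
        using R[OF q(1) q0] by (intro abs_ip_le Y_finite)
      then show "s \<le> ?h g" unfolding q(2) by (simp add: left_diff_distrib sum_subtractf)
    qed (use Q in auto)
    then show ?thesis
      unfolding gmax_def by (intro integral_mono integrable_maxip Y_finite Q h)
  qed
  moreover have "(\<integral>g. ?h g \<partial>gaussv Y) = (\<integral>g. ip Y (coef z \<tau> q0) g \<partial>gaussv Y) + (\<integral>g. R * (\<Sum>b\<in>Y. \<bar>g b\<bar>) \<partial>gaussv Y)"
    by (intro Bochner_Integration.integral_add integrable_mult_right integrable_gauss_l1 integrable_ip Y_finite)
  moreover have "(\<integral>g. ip Y (coef z \<tau> q0) g \<partial>gaussv Y) = 0" by (rule integrable_ip(2)[OF Y_finite])
  moreover have "(\<integral>g. R * (\<Sum>b\<in>Y. \<bar>g b\<bar>) \<partial>gaussv Y) = R * gauss_l1" by (simp add: gauss_l1_def)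
  ultimately show ?thesis by linarith
qed

text \<open>Diameter times the root of the entropy: p and \<eta> cancel, and e^2 / e leaves the
  summable e.\<close>

lemma eb_sqrt_X: 
  assumes e: "0 < e" "e \<le> 1"
  shows "3 * (64 * eb e) * sqrt ((9 * real d + 2600) * X e) = a1 * e * \<sigma>"
proof -
  have "sqrt (X e) = sqrt p / (\<eta> * e)" using \<eta>e_pow[OF e] by (simp add: X_def real_sqrt_divide)
  then have "eb e * sqrt (X e) = 2 ^ d * (2 * 2 ^ d * c) * e * \<sigma>"
    using \<eta> e p by (simp add: eb_def field_simps power2_eq_square)
  moreover have "3 * (64 * eb e) * sqrt ((9 * real d + 2600) * X e) = 3 * 64 * (eb e * sqrt (X e)) * sqrt (9 * real d + 2600)"
    by (simp add: real_sqrt_mult)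
  ultimately show ?thesis by (simp add: a1_def)
qed

text \<open>Induction on the depth. The pieces at \<open>e / 2\<close> account for half of the first
  term, and concentration and recentering at scale \<open>e\<close> for the other half. The
  remainder is at least halved at each step, since \<open>eb (e / 2) = eb e / 4\<close>.\<close>

lemma chain:
  assumes "0 < e" "e \<le> 1" "adm e W z \<tau>" "finite Q" "Q \<noteq> {}" "Q \<subseteq> W"
  shows "gmax z \<tau> Q \<le> 2 * (a1 + a2) * e * \<sigma> + gauss_l1 * (64 * eb e) / 2 ^ r"
  using assms
proof (induction r arbitrary: e W z \<tau> Q)
  case 0
  have "gmax z \<tau> Q \<le> (64 * eb e) * gauss_l1"
  proof (rule gmax_diam[OF 0(4,5)])
    fix q q' assume "q \<in> Q" "q' \<in> Q"
    then have "q \<in> W" "q' \<in> W" using 0(6) by auto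
    then show "l2dist Y (coef z \<tau> q) (coef z \<tau> q') \<le> 64 * eb e" by (rule adm_dest(4)[OF 0(3)])
  qed
  moreover have "0 \<le> 2 * (a1 + a2) * e * \<sigma>"
    using 0 c_ge \<sigma>0 C by (simp add: a1_def a2_def)
  ultimately show ?case by (simp add: mult.commute)
next
  case (Suc r)
  note e = Suc.prems(1,2)
  show ?case
  proof (rule step[OF e Suc.prems(3)])
    fix J :: "((((nat set \<Rightarrow> tensor) \<times> tensor) \<times> tensor) \<times> ((nat set \<Rightarrow> tensor) \<times> tensor)) set" and G zz \<tau>\<tau>
    assume J: "finite J" "real (card J) \<le> exp ((9 * real d + 2600) * X e)" "W = (\<Union>j\<in>J. G j)"
      and adm: "\<And>j. j \<in> J \<Longrightarrow> adm (e / 2) (G j) (zz j) (\<tau>\<tau> j)"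
      and nB: "\<And>j k. j \<in> J \<Longrightarrow> k \<in> D' \<Longrightarrow> B k (\<lambda>u. zz j k u - z k u) \<le> c * e * \<sigma>"
      and nh: "\<And>j. j \<in> J \<Longrightarrow> d = 2 \<Longrightarrow> marginal_L2 (\<lambda>a. \<tau>\<tau> j a - \<tau> a) \<le> c * e * \<sigma>"
      and n0: "\<And>j. j \<in> J \<Longrightarrow> d \<noteq> 2 \<Longrightarrow> \<tau>\<tau> j = \<tau>"
    define s where "s = 2 * (a1 + a2) * (e / 2) * \<sigma> + gauss_l1 * (64 * eb (e / 2)) / 2 ^ r + a2 * e * \<sigma>"
    have QW: "Q \<subseteq> Theta" "z \<in> unit_arrays n D'" "\<tau> \<in> T" using Suc.prems(6) adm_dest[OF Suc.prems(3)] by auto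
    have X1: "(9 * real d + 2600) * X e > 0" using X_ge[OF e] by simp
    have "gmax z \<tau> Q \<le> s + 3 * (64 * eb e) * sqrt ((9 * real d + 2600) * X e)"
      unfolding gmax_def
    proof (rule integral_maxip_Union_le[OF Y_finite J(1,2) X1, where G="\<lambda>j. Q \<inter> G j"])
      show "finite (Q \<inter> G j)" for j using Suc.prems by simp
      show "Q = (\<Union>j\<in>J. Q \<inter> G j)" using Suc.prems(6) J(3) by auto
      show "0 < 64 * eb e" using eb_pos[OF e(1)] by simp
      show "l2dist Y (coef z \<tau> q) (coef z \<tau> q') \<le> 64 * eb e" if "q \<in> Q" "q' \<in> Q" for q q'
        using that Suc.prems(6) by (intro adm_dest(4)[OF Suc.prems(3)]) auto
      fix j assume j: "j \<in> J" "Q \<inter> G j \<noteq> {}"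
      have fin: "finite (Q \<inter> G j)" using Suc.prems by simp
      have zj: "zz j \<in> unit_arrays n D'" by (rule adm_dest(2)[OF adm[OF j(1)]])
      have "gmax z \<tau> (Q \<inter> G j) \<le> gmax (zz j) (\<tau>\<tau> j) (Q \<inter> G j) + a2 * e * \<sigma>"
        using QW(1) by (intro gmax_recenter[OF fin j(2) _ QW(2) zj QW(3) nB[OF j(1)] e(1) nh[OF j(1)] n0[OF j(1)]]) auto
      also have "gmax (zz j) (\<tau>\<tau> j) (Q \<inter> G j) \<le> 2 * (a1 + a2) * (e / 2) * \<sigma> + gauss_l1 * (64 * eb (e / 2)) / 2 ^ r"
        using e by (intro Suc.IH[OF _ _ adm[OF j(1)] fin j(2)]) auto
      finally show "(\<integral>g. maxip Y (Q \<inter> G j) (coef z \<tau>) g \<partial>gaussv Y) \<le> s"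
        by (simp add: s_def gmax_def)
    qed (use Suc.prems in auto)
    also have "\<dots> = s + a1 * e * \<sigma>" unfolding eb_sqrt_X[OF e] ..
    also have "\<dots> \<le> 2 * (a1 + a2) * e * \<sigma> + gauss_l1 * (64 * eb e) / 2 ^ Suc r"
    proof -
      have "eb (e / 2) = eb e / 4" by (simp add: eb_def power_divide)
      then have "eb (e / 2) \<le> eb e / 2" using eb_pos[OF e(1)] by simp
      then have "gauss_l1 * (64 * eb (e / 2)) / 2 ^ r \<le> gauss_l1 * (64 * (eb e / 2)) / 2 ^ r"
        using gauss_l1_nonneg by (intro divide_right_mono mult_left_mono) auto
      then show ?thesis by (simp add: s_def algebra_simps)
    qed
    finally show "gmax z \<tau> Q \<le> 2 * (a1 + a2) * e * \<sigma> + gauss_l1 * (64 * eb e) / 2 ^ Suc r" .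
  qed
qed

text \<open>Duality in the block \<open>i\<close> gives the supremum over unit arrays in all
  \<open>d\<close> blocks, the term of \<open>S\<close> with the largest weight, sqrt p.\<close>

lemma coef_zero_L2_le:
  assumes q: "q \<in> Theta"
  shows "L2_set (coef (\<lambda>_ _. 0) (\<lambda>_. 0) q) Y \<le> S / sqrt p"
proof -
  have x: "fst q \<in> unit_arrays n D'" and t: "snd q \<in> T" using q by (auto simp: Theta_def)
  have "L2_set (coef (\<lambda>_ _. 0) (\<lambda>_. 0) q) Y = L2_set (fibre_sum n U (\<lambda>a. snd q a * tprod D' (fst q) a) i) (ibox n i)"
    by (simp add: coef_def L2_fibre_vec)
  also have "\<dots> \<le> unit_sup n N {i} (tprod D' (fst q))" by (rule dual_L2_le[OF t iU(1)])
  also have "\<dots> \<le> unit_sup n N D (\<lambda>_. 1)"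
  proof (rule unit_sup_least)
    fix y assume y: "y \<in> unit_arrays n {i}"
    let ?x = "(fst q)(i := y i)"
    have "D = insert i D'" using i by auto
    then have "tprod D ?x a = y i (restrict a i) * tprod D' ?x a" for a
      using finite_D' tprod_insert[of D' i ?x a] by simp
    moreover have "tprod D' ?x a = tprod D' (fst q) a" for a by (rule tprod_cong) auto
    ultimately have eq: "tprod D' (fst q) a * tprod {i} y a = 1 * tprod D ?x a" for a by (simp add: tprod_single)
    have xD: "?x \<in> unit_arrays n D" using x y by (auto simp: unit_arrays_def)
    show "N (\<lambda>a. tprod D' (fst q) a * tprod {i} y a) \<le> unit_sup n N D (\<lambda>_. 1)"
      unfolding eq by (rule unit_sup_upper[OF DU[OF order_refl] xD])
  qed
  also have "\<dots> \<le> p powr (- (1 / 2)) * S"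
  proof -
    have "(D, {}) \<in> splits V d" using D cardD by (simp add: splits_def)
    moreover have "weight p d (card D) = p powr (- (- (1 / 2)))" by (simp add: weight_def cardD)
    ultimately have "block_norm n N {} D \<le> p powr (- (1 / 2)) * S" by (rule wsum_term')
    then show ?thesis by (simp add: block_norm_def gauss_avg_empty)
  qed
  also have "\<dots> = S / sqrt p" using p by (simp add: powr_minus powr_half_sqrt field_simps)
  finally show ?thesis .
qed

text \<open>Scale one contains everything: the distances are at most
  \<open>S \<le> c * \<sigma>\<close>, and the diameter at most \<open>2 * S / sqrt p\<close>, where
  \<open>S \<le> \<eta> * \<sigma>\<close> supplies the factor \<eta> present in
  \<open>eb 1\<close>.\<close>

lemma adm_start: "adm 1 Theta (\<lambda>_ _. 0) (\<lambda>_. 0)"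
  unfolding adm_def
proof (intro conjI ballI)
  show "Theta \<subseteq> Theta" by simp
  show "(\<lambda>_ _. 0) \<in> unit_arrays n D'" by (rule zero_in_unit_arrays)
  show "(\<lambda>_. 0) \<in> T" by (rule zero_dual)
  show "d \<noteq> 2 \<longrightarrow> (\<lambda>_. 0) = (\<lambda>_. 0)" by simp
next
  fix q assume q: "q \<in> Theta"
  have S_c: "S \<le> c * \<sigma>" using S_le(2) c_ge(1) \<sigma>0 mult_right_mono[of 1 c \<sigma>] by linarith
  have "marginal_L2 (snd q) \<le> c * \<sigma>" if "d = 2"
  proof -
    have "marginal_L2 (snd q) \<le> unit_sup n N {V} (\<lambda>_. 1)"
      using dual_L2_le[OF _ V, of "snd q" "\<lambda>_. 1"] q by (simp add: marginal_L2_def Theta_def)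
    also have "\<dots> \<le> S" using unit_sup_full_le p that by simp
    finally show ?thesis using S_c by linarith
  qed
  moreover have "B k (fst q k) \<le> c * \<sigma>" if "k \<in> D'" for k
    using B_ball_le[OF that, of "fst q"] q S_c by (simp add: Theta_def)
  ultimately show "near (c * 1 * \<sigma>) (\<lambda>_ _. 0) (\<lambda>_. 0) q" by (simp add: near_def)
next
  fix q q' assume q: "q \<in> Theta" "q' \<in> Theta"
  let ?v = "coef (\<lambda>_ _. 0) (\<lambda>_. 0)"
  have "l2dist Y (?v q) (?v q') \<le> l2dist Y (?v q) (\<lambda>_. 0) + l2dist Y (\<lambda>_. 0) (?v q')" by (rule l2dist_triangle)
  also have "l2dist Y (\<lambda>_. 0) (?v q') = L2_set (?v q') Y" by (simp add: L2_set_def)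
  finally have "l2dist Y (?v q) (?v q') \<le> 2 * (S / sqrt p)"
    using coef_zero_L2_le[OF q(1)] coef_zero_L2_le[OF q(2)] by simp
  also have "\<dots> \<le> 2 * (\<eta> * \<sigma> / sqrt p)" using S_le p by (intro mult_left_mono divide_right_mono) auto
  also have "\<dots> \<le> (64 * (2 ^ d * (2 * 2 ^ d * c))) * (\<eta> * \<sigma> / sqrt p)"
  proof (intro mult_right_mono)
    have "1 * (1 * 1) \<le> 2 ^ d * (2 ^ d * c)" using c_ge by (intro mult_mono) auto
    moreover have "64 * (2 ^ d * (2 * 2 ^ d * c)) = 128 * (2 ^ d * (2 ^ d * c))" by simp
    ultimately show "2 \<le> 64 * (2 ^ d * (2 * 2 ^ d * c))" by linarith
  qed (use \<eta> \<sigma>0 p in auto)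
  also have "\<dots> = 64 * eb 1" by (simp add: eb_def)
  finally show "l2dist Y (?v q) (?v q') \<le> 64 * eb 1" .
qed

text \<open>Hahn-Banach writes the seminorm as a maximum of functionals, so the process is indexed
  by \<open>Theta\<close>. A finite net of coefficient vectors makes the chaining bound applicable,
  with an error at most \<open>k * gauss_l1 \<le> \<epsilon>\<close>; the depth then tends to
  infinity.\<close>

lemma gauss_sup_le: "gauss_sup n N D i \<le> 2 * (a1 + a2) * \<sigma>"
proof (rule field_le_epsilon)
  let ?v = "coef (\<lambda>_ _. 0) (\<lambda>_. 0)"
  fix \<epsilon> :: real assume \<epsilon>: "\<epsilon> > 0"
  define k where "k = \<epsilon> / (gauss_l1 + 1)"
  have k: "k > 0" using \<epsilon> gauss_l1_nonneg by (simp add: k_def)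
  have D'U': "\<Union>D' \<subseteq> U" by (rule D'U) simp
  interpret P: tensor_seminorm n U "unit_sup n N D'" by (rule unit_sup_seminorm[OF D'U'])
  have bd: "\<bar>?v q b\<bar> \<le> S / sqrt p" if "q \<in> Theta" "b \<in> Y" for q b
  proof -
    have "\<bar>?v q b\<bar> \<le> L2_set (\<lambda>b. \<bar>?v q b\<bar>) Y" using Y_finite that by (intro member_le_L2_set) auto
    also have "\<dots> = L2_set (?v q) Y" by (simp add: L2_set_def)
    finally show ?thesis using coef_zero_L2_le[OF that(1)] by simp
  qed
  obtain Q where Qc: "finite Q \<and> Q \<subseteq> Theta \<and> (\<forall>q\<in>Theta. \<exists>q'\<in>Q. \<forall>b\<in>Y. \<bar>?v q b - ?v q' b\<bar> \<le> k)"
    using finite_net[OF Y_finite bd k] ..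
  have Q: "finite Q" "Q \<subseteq> Theta" "\<And>q. q \<in> Theta \<Longrightarrow> \<exists>q'\<in>Q. \<forall>b\<in>Y. \<bar>?v q b - ?v q' b\<bar> \<le> k"
    using Qc by simp_all
  have "((\<lambda>_ _. 0), (\<lambda>_. 0)) \<in> Theta" using zero_in_unit_arrays zero_dual by (simp add: Theta_def)
  then have Qne: "Q \<noteq> {}" using Q(3) by blast
  have bound: "unit_sup n N D' (tprod {i} (curry g)) \<le> maxip Y Q ?v g + k * (\<Sum>b\<in>Y. \<bar>g b\<bar>)" for g
  proof (rule unit_sup_least)
    fix x assume x: "x \<in> unit_arrays n D'"
    obtain t where t: "t \<in> T" "ip (ibox n U) t (\<lambda>a. tprod {i} (curry g) a * tprod D' x a) = N (\<lambda>a. tprod {i} (curry g) a * tprod D' x a)"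
      by (rule bexE[OF hahn_banach]) (rule that)
    have th: "(x, t) \<in> Theta" using x t by (simp add: Theta_def)
    then obtain q where q: "q \<in> Q" "\<And>b. b \<in> Y \<Longrightarrow> \<bar>?v (x, t) b - ?v q b\<bar> \<le> k" using Q(3) by blast
    have "N (\<lambda>a. tprod {i} (curry g) a * tprod D' x a) = ip Y (?v (x, t)) g"
      unfolding t(2)[symmetric] coef_def ip_fibre_vec[OF finite_U iU(1)] by (intro sum.cong refl) simp
    also have "\<dots> = ip Y (?v q) g + (\<Sum>b\<in>Y. (?v (x, t) b - ?v q b) * g b)"
      by (simp add: left_diff_distrib sum_subtractf)
    also have "(\<Sum>b\<in>Y. (?v (x, t) b - ?v q b) * g b) \<le> (\<Sum>b\<in>Y. k * \<bar>g b\<bar>)"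
    proof (rule sum_mono)
      fix b assume "b \<in> Y"
      have "(?v (x, t) b - ?v q b) * g b \<le> \<bar>?v (x, t) b - ?v q b\<bar> * \<bar>g b\<bar>"
        by (rule mult_le_abs_mult)
      also have "\<dots> \<le> k * \<bar>g b\<bar>" using q(2)[OF \<open>b \<in> Y\<close>] by (intro mult_right_mono) auto
      finally show "(?v (x, t) b - ?v q b) * g b \<le> k * \<bar>g b\<bar>" .
    qed
    also have "ip Y (?v q) g \<le> maxip Y Q ?v g" using Q(1) q(1) by (intro Max_ge) auto
    finally show "N (\<lambda>a. tprod {i} (curry g) a * tprod D' x a) \<le> maxip Y Q ?v g + k * (\<Sum>b\<in>Y. \<bar>g b\<bar>)"
      by (simp add: sum_distrib_left)
  qed
  have "gauss_sup n N D i = (\<integral>g. unit_sup n N D' (tprod {i} (curry g)) \<partial>gaussv Y)"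
    by (simp add: gauss_sup_def gauss_avg_def gauss_family_eq)
  also have "\<dots> \<le> (\<integral>g. maxip Y Q ?v g + k * (\<Sum>b\<in>Y. \<bar>g b\<bar>) \<partial>gaussv Y)"
    using P.integrable_gauss_avg'[OF iU(2), of "\<lambda>_. 1"] bound
    by (intro integral_mono Bochner_Integration.integrable_add integrable_mult_right integrable_gauss_l1 integrable_maxip Y_finite Q Qne)
       (simp add: gauss_family_eq)
  also have "\<dots> = (\<integral>g. maxip Y Q ?v g \<partial>gaussv Y) + (\<integral>g. k * (\<Sum>b\<in>Y. \<bar>g b\<bar>) \<partial>gaussv Y)"
    by (intro Bochner_Integration.integral_add integrable_mult_right integrable_gauss_l1 integrable_maxip Y_finite Q Qne)
  also have "\<dots> = gmax (\<lambda>_ _. 0) (\<lambda>_. 0) Q + k * gauss_l1" by (simp add: gmax_def gauss_l1_def)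
  also have "gmax (\<lambda>_ _. 0) (\<lambda>_. 0) Q \<le> 2 * (a1 + a2) * \<sigma>"
  proof (rule LIMSEQ_le_const)
    have "(\<lambda>r. 2 * (a1 + a2) * 1 * \<sigma> + gauss_l1 * (64 * eb 1) * (1 / 2) ^ r) \<longlonglongrightarrow> 2 * (a1 + a2) * 1 * \<sigma> + gauss_l1 * (64 * eb 1) * 0"
      by (intro tendsto_add tendsto_const tendsto_mult LIMSEQ_power_zero) auto
    then show "(\<lambda>r. 2 * (a1 + a2) * 1 * \<sigma> + gauss_l1 * (64 * eb 1) / 2 ^ r) \<longlonglongrightarrow> 2 * (a1 + a2) * \<sigma>"
      by (simp add: power_one_over)
    show "\<exists>R. \<forall>r\<ge>R. gmax (\<lambda>_ _. 0) (\<lambda>_. 0) Q \<le> 2 * (a1 + a2) * 1 * \<sigma> + gauss_l1 * (64 * eb 1) / 2 ^ r"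
      using chain[OF _ _ adm_start Q(1) Qne Q(2)] by auto
  qed
  also have "k * gauss_l1 \<le> \<epsilon>" using \<epsilon> gauss_l1_nonneg by (simp add: k_def field_simps)
  finally show "gauss_sup n N D i \<le> 2 * (a1 + a2) * \<sigma> + \<epsilon>" by simp
qed

end

subsection \<open>Induction on the number of blocks\<close>

lemma gauss_sup_nonneg:
  assumes "tensor_seminorm n U N" "\<Union>D \<subseteq> U" "i \<in> D"
  shows "0 \<le> gauss_sup n N D i"
proof -
  interpret tensor_seminorm n U N by fact
  have 1: "\<Union>(D - {i}) \<subseteq> U" "\<Union>{i} \<subseteq> U" using assms by auto
  show ?thesis
    unfolding gauss_sup_def by (rule tensor_seminorm.nonneg[OF tensor_seminorm.gauss_avg_seminorm[OF unit_sup_seminorm[OF 1(1)] 1(2)]])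
qed

lemma gauss_sup_le_induct_step:
  assumes U: "finite U" and d: "d \<ge> 2" and C: "C \<ge> 1"
    and IH: "\<And>n p N V D i e. p \<ge> 1 \<Longrightarrow> tensor_seminorm n U N \<Longrightarrow> V \<subseteq> U \<Longrightarrow> e < d \<Longrightarrow> partition_on V D \<Longrightarrow> card D = e \<Longrightarrow> i \<in> D \<Longrightarrow>
       gauss_sup n N D i \<le> C * wsum n N V e p"
  shows "\<exists>C'\<ge>1. \<forall>n p N V D i. p \<ge> 1 \<longrightarrow> tensor_seminorm n U N \<longrightarrow> V \<subseteq> U \<longrightarrow> partition_on V D \<longrightarrow> card D = d \<longrightarrow> i \<in> D \<longrightarrow>
       gauss_sup n N D i \<le> C' * wsum n N V d p"
proof -
  define \<kappa> where "\<kappa> = real (card (Pow (Pow U) \<times> Pow (Pow U)))"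
  have fin: "finite (Pow (Pow U) \<times> Pow (Pow U))" using U by simp
  have "Pow (Pow U) \<times> Pow (Pow U) \<noteq> {}" by auto
  then have "card (Pow (Pow U) \<times> Pow (Pow U)) > 0" using fin by (metis card_gt_0_iff)
  then have \<kappa>: "\<kappa> \<ge> 1" by (simp add: \<kappa>_def del: card_cartesian_product)
  \<comment> \<open>The constants are taken from the locale before \<open>n\<close>,
    \<open>p\<close>, \<open>N\<close>, \<open>V\<close> are fixed; they are functions of
    \<open>d\<close>, \<open>C\<close> and \<kappa> alone.\<close>
  define A where "A = 2 * (chain_setup.a1 d C \<kappa> + chain_setup.a2 d C \<kappa>)"
  define \<eta> where "\<eta> = min 1 (1 / (2 * (\<bar>A\<bar> + 1)))"
  have \<eta>: "0 < \<eta>" "\<eta> \<le> 1" "\<bar>A\<bar> * \<eta> \<le> 1 / 2"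
  proof -
    show "0 < \<eta>" "\<eta> \<le> 1" by (auto simp: \<eta>_def)
    have "\<bar>A\<bar> * \<eta> \<le> \<bar>A\<bar> * (1 / (2 * (\<bar>A\<bar> + 1)))" by (intro mult_left_mono) (auto simp: \<eta>_def)
    also have "\<dots> \<le> 1 / 2" by (simp add: field_simps)
    finally show "\<bar>A\<bar> * \<eta> \<le> 1 / 2" .
  qed
  have main: "gauss_sup n N D i \<le> max 1 (2 * \<bar>A\<bar> / \<eta>) * wsum n N V d p"
    if p: "p \<ge> 1" and N: "tensor_seminorm n U N" and V: "V \<subseteq> U" and D: "partition_on V D" "card D = d" "i \<in> D"
    for n and p :: real and N V D i
  proof -
    interpret tensor_seminorm n U N by fact
    let ?S = "wsum n N V d p"
    \<comment> \<open>Finitely many values, as \<open>V\<close> is finite. Their maximum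
      \<open>F\<close> is a finite number attained by some partition, so the bound for that
      partition can be solved for \<open>F\<close>.\<close>
    define \<F> where "\<F> = (\<lambda>(D, i). gauss_sup n N D i) ` {(D, i). partition_on V D \<and> card D = d \<and> i \<in> D}"
    have finV: "finite V" using V U finite_subset by metis
    have "{(D, i). partition_on V D \<and> card D = d \<and> i \<in> D} \<subseteq> Pow (Pow V) \<times> Pow V"
      by (auto simp: partition_on_def)
    then have finF: "finite \<F>" unfolding \<F>_def using finV by (intro finite_imageI) (auto intro: finite_subset)
    define F where "F = Max \<F>"
    have F_ge: "gauss_sup n N D i \<le> F" if "partition_on V D" "card D = d" "i \<in> D" for D i
      unfolding F_def using finF that by (intro Max_ge) (auto simp: \<F>_def)
    have F0: "F \<ge> 0"
    proof -
      have "\<Union>D \<subseteq> U" using D(1) V by (simp add: partition_on_def)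
      then have "0 \<le> gauss_sup n N D i" using D(3) by (intro gauss_sup_nonneg[OF N])
      then show ?thesis using F_ge[OF D] by linarith
    qed
    have S0: "?S \<ge> 0" by (rule wsum_nonneg[OF V])
    have bound: "gauss_sup n N D i \<le> A * (?S / \<eta> + \<eta> * F)" if D: "partition_on V D" "card D = d" "i \<in> D" for D i
    proof (rule field_le_epsilon)
      fix \<epsilon> :: real assume \<epsilon>: "\<epsilon> > 0"
      \<comment> \<open>The last summand makes \<sigma> positive even if \<open>?S\<close> and
        \<open>F\<close> vanish; multiplied by \<open>A\<close> it contributes at most
        \<epsilon>.\<close>
      define \<sigma> where "\<sigma> = ?S / \<eta> + \<eta> * F + \<epsilon> / (\<bar>A\<bar> + 1)"
      have e1: "\<epsilon> / (\<bar>A\<bar> + 1) > 0" using \<epsilon> by simp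
      have n0: "0 \<le> ?S / \<eta> + \<eta> * F" using S0 F0 \<eta> by simp
      have "chain_setup n U N V D i d p C \<kappa> F \<eta> \<sigma>"
      proof (unfold_locales)
        show "0 < \<sigma>" using e1 n0 by (simp add: \<sigma>_def)
        show "?S / \<eta> + \<eta> * F \<le> \<sigma>" using e1 by (simp add: \<sigma>_def)
        fix k assume k: "k \<in> D - {i}"
        have kV: "k \<subseteq> V" "k \<noteq> {}" using k D by (auto simp: partition_on_def)
        show "gauss_sup n (contract N k x) (D - {k}) i \<le> C * wsup n N (V - k) (d - 1) p (\<lambda>a. x (restrict a k))" for x
        proof -
          have "card (D - {k}) = d - 1" using k D d by (simp add: card_Diff_singleton_if)
          then have "gauss_sup n (contract N k x) (D - {k}) i \<le> C * wsum n (contract N k x) (V - k) (d - 1) p"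
            using V k D d by (intro IH[OF p contract_seminorm] partition_on_remove) auto
          then show ?thesis by (simp add: wsum_contract)
        qed
        have finV': "finite (V - k)" using finV by simp
        have "splits (V - k) (d - 1) \<subseteq> Pow (Pow U) \<times> Pow (Pow U)"
          using V by (auto simp: splits_def partition_on_def)
        then have cK: "real (card (splits (V - k) (d - 1))) \<le> \<kappa>"
          unfolding \<kappa>_def using fin by (intro of_nat_mono card_mono)
        have "gauss_avg n (wsup n N (V - k) (d - 1) p) {k} (\<lambda>_. 1) \<le> sqrt p * (real (card (splits (V - k) (d - 1))) * (C * ?S + F))"
          using d C F0 p F_ge by (intro gauss_avg_wsup_le V kV IH[OF p]) auto
        also have "\<dots> \<le> sqrt p * (\<kappa> * (C * ?S + F))"
          using cK C S0 F0 p by (intro mult_left_mono mult_right_mono) auto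
        finally show "gauss_avg n (wsup n N (V - k) (d - 1) p) {k} (\<lambda>_. 1) \<le> sqrt p * (\<kappa> * (C * ?S + F))" .
      qed (use V D d p \<eta> C \<kappa> F0 in auto)
      then have "gauss_sup n N D i \<le> A * \<sigma>" unfolding A_def by (rule chain_setup.gauss_sup_le)
      also have "\<dots> = A * (?S / \<eta> + \<eta> * F) + A * (\<epsilon> / (\<bar>A\<bar> + 1))" by (simp add: \<sigma>_def distrib_left)
      also have "A * (\<epsilon> / (\<bar>A\<bar> + 1)) \<le> (\<bar>A\<bar> + 1) * (\<epsilon> / (\<bar>A\<bar> + 1))"
        using e1 by (intro mult_right_mono) auto
      also have "\<dots> = \<epsilon>" by simp
      finally show "gauss_sup n N D i \<le> A * (?S / \<eta> + \<eta> * F) + \<epsilon>" by simp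
    qed
    have "F \<in> \<F>" unfolding F_def using finF D by (intro Max_in) (auto simp: \<F>_def)
    then have "F \<le> A * (?S / \<eta> + \<eta> * F)" using bound by (auto simp: \<F>_def)
    also have "\<dots> \<le> \<bar>A\<bar> * (?S / \<eta> + \<eta> * F)"
      using S0 F0 \<eta> by (intro mult_right_mono) auto
    also have "\<dots> = \<bar>A\<bar> / \<eta> * ?S + (\<bar>A\<bar> * \<eta>) * F" by (simp add: distrib_left)
    also have "(\<bar>A\<bar> * \<eta>) * F \<le> 1 / 2 * F" using \<eta> F0 by (intro mult_right_mono) auto
    finally have "F \<le> 2 * (\<bar>A\<bar> / \<eta> * ?S)" by simp
    then have "F \<le> 2 * \<bar>A\<bar> / \<eta> * ?S" by simp
    also have "\<dots> \<le> max 1 (2 * \<bar>A\<bar> / \<eta>) * ?S" using S0 by (intro mult_right_mono) auto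
    finally show ?thesis using F_ge[OF D] by linarith
  qed
  show ?thesis by (intro exI[of _ "max 1 (2 * \<bar>A\<bar> / \<eta>)"]) (use main in auto)
qed

lemma gauss_sup_single_le:
  assumes p: "p \<ge> 1" and N: "tensor_seminorm n U N" and V: "V \<subseteq> U" and D: "partition_on V D" "card D = 1" "i \<in> D"
  shows "gauss_sup n N D i \<le> 1 * wsum n N V 1 p"
proof -
  interpret tensor_seminorm n U N by fact
  have Di: "D = {i}" using D by (auto simp: card_1_singleton_iff)
  then have Vi: "V = i" using D by (auto simp: partition_on_def)
  have sp: "unit_sup n M {} z = M z" for M z
    by (simp add: unit_sup_def unit_arrays_def)
  have "({}, {i}) \<in> splits V 1" using D Di by (simp add: splits_def)
  from wsum_term[OF V this, of p]
  have "weight p 1 0 * gauss_avg n N {i} (\<lambda>_. 1) \<le> wsum n N V 1 p" by (simp add: block_norm_def sp)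
  moreover have "gauss_sup n N D i = gauss_avg n N {i} (\<lambda>_. 1)" by (simp add: gauss_sup_def Di sp gauss_avg_def)
  moreover have "0 \<le> gauss_avg n N {i} (\<lambda>_. 1)"
    using tensor_seminorm.nonneg[OF gauss_avg_seminorm[of "{i}"]] V Vi by simp
  ultimately show ?thesis using p by (simp add: weight_def)
qed

text \<open>Strong induction, since merging and averaging blocks can lower their number by more than
  one. The finitely many earlier constants are dominated by one \<open>C\<close>. \<open>U\<close>
  stays fixed while seminorm, \<open>V\<close> and partition vary, so the constant depends on
  \<open>U\<close> and \<open>d\<close> only.\<close>

lemma gauss_sup_le_wsum:
  assumes U: "finite U"
  shows "\<exists>C\<ge>1. \<forall>n p N V D i. p \<ge> 1 \<longrightarrow> tensor_seminorm n U N \<longrightarrow> V \<subseteq> U \<longrightarrow> partition_on V D \<longrightarrow> card D = d \<longrightarrow> i \<in> D \<longrightarrow>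
       gauss_sup n N D i \<le> C * wsum n N V d p"
proof (induction d rule: less_induct)
  case (less d)
  consider "d = 0" | "d = 1" | "d \<ge> 2" by linarith
  then show ?case
  proof cases
    case 1
    have False if "V \<subseteq> U" "partition_on V D" "card D = 0" "i \<in> D" for V D and i :: "nat set"
    proof -
      have "D \<subseteq> Pow U" using that by (auto simp: partition_on_def)
      then have "finite D" using U finite_subset by auto
      then show False using that by simp
    qed
    then show ?thesis using 1 by (intro exI[of _ 1]) auto
  next
    case 2
    then show ?thesis using gauss_sup_single_le by (intro exI[of _ 1]) auto
  next
    case 3
    obtain c where c: "\<And>e. e < d \<Longrightarrow> c e \<ge> 1 \<and> (\<forall>n p N V D i. p \<ge> 1 \<longrightarrow> tensor_seminorm n U N \<longrightarrow> V \<subseteq> U \<longrightarrow> partition_on V D \<longrightarrow> card D = e \<longrightarrow> i \<in> D \<longrightarrow>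
       gauss_sup n N D i \<le> c e * wsum n N V e p)"
      using less.IH by metis
    define C where "C = 1 + (\<Sum>e<d. c e)"
    have ce: "c e \<le> C" if "e < d" for e
    proof -
      have "c e \<le> (\<Sum>e<d. c e)" using that c by (intro member_le_sum) (auto intro: order_trans[of 0 1])
      then show ?thesis by (simp add: C_def)
    qed
    have C1: "C \<ge> 1" unfolding C_def using c by (auto intro!: sum_nonneg intro: order_trans[of 0 1])
    show ?thesis
    proof (rule gauss_sup_le_induct_step[OF U 3 C1])
      fix n :: nat and p :: real and N V D i e
      assume a: "p \<ge> 1" "tensor_seminorm n U N" "V \<subseteq> U" "e < d" "partition_on V D" "card D = e" "i \<in> D"
      then have "gauss_sup n N D i \<le> c e * wsum n N V e p" using c[OF a(4)] by blast
      also have "\<dots> \<le> C * wsum n N V e p"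
        using ce[OF a(4)] tensor_seminorm.wsum_nonneg[OF a(2,3)] by (intro mult_right_mono) auto
      finally show "gauss_sup n N D i \<le> C * wsum n N V e p" .
    qed
  qed
qed

section \<open>From arrays and bounded symmetric sets to seminorms\<close>

definition array_norm :: "nat \<Rightarrow> nat \<Rightarrow> nat \<Rightarrow> (idx \<Rightarrow> real) \<Rightarrow> (nat \<Rightarrow> real) set \<Rightarrow> tensor \<Rightarrow> real" where
  "array_norm d n m A T z = (SUP t\<in>T. \<Sum>i\<in>Idx d n m. A i * z (restrict i {1..d}) * t (i (d + 1)))"

lemma Idx_restrict: "i \<in> Idx d n m \<Longrightarrow> restrict i {1..d} \<in> ibox n {1..d}"
proof -
  assume i: "i \<in> Idx d n m"
  have "i k \<in> {1..n}" if "k \<in> {1..d}" for k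
  proof -
    have "i k \<in> (if k \<le> d then {1..n} else {1..m})"
      using i that unfolding Idx_def by (intro PiE_mem[of i "{1..d + 1}"]) auto
    then show ?thesis using that by simp
  qed
  then show ?thesis unfolding ibox_def by (simp add: restrict_PiE_iff)
qed

lemma Idx_last: "i \<in> Idx d n m \<Longrightarrow> i (d + 1) \<in> {1..m}"
  unfolding Idx_def PiE_iff by (drule conjunct1, drule bspec[where x="d + 1"]) auto

lemma array_norm_bdd:
  fixes T :: "(nat \<Rightarrow> real) set" and A z :: "idx \<Rightarrow> real" and M :: real
  assumes M: "\<forall>t\<in>T. \<forall>j\<in>{1..m}. \<bar>t j\<bar> \<le> M"
  shows "bdd_above ((\<lambda>t. \<Sum>i\<in>Idx d n m. A i * z i * t (i (d + 1))) ` T)"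
proof (rule bdd_aboveI2)
  fix t assume t: "t \<in> T"
  show "(\<Sum>i\<in>Idx d n m. A i * z i * t (i (d + 1))) \<le> (\<Sum>i\<in>Idx d n m. \<bar>A i * z i\<bar> * M)"
  proof (rule sum_mono)
    fix i assume i: "i \<in> Idx d n m"
    have "A i * z i * t (i (d + 1)) \<le> \<bar>A i * z i\<bar> * \<bar>t (i (d + 1))\<bar>" by (rule mult_le_abs_mult)
    also have "\<dots> \<le> \<bar>A i * z i\<bar> * M" using M t Idx_last[OF i] by (intro mult_left_mono) auto
    finally show "A i * z i * t (i (d + 1)) \<le> \<bar>A i * z i\<bar> * M" .
  qed
qed

text \<open>Symmetry of \<open>T\<close> turns the one-sided supremum into one of absolute values,
  whence absolute homogeneity; boundedness makes the supremum finite. \<open>T\<close> enters the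
  induction through this seminorm alone.\<close>

lemma array_norm_seminorm:
  assumes T: "T \<noteq> {}" "\<forall>t\<in>T. (\<lambda>j. - t j) \<in> T" and M: "\<forall>t\<in>T. \<forall>j\<in>{1..m}. \<bar>t j\<bar> \<le> M"
  shows "tensor_seminorm n {1..d} (array_norm d n m A T)"
proof -
  let ?N = "array_norm d n m A T"
  let ?s = "\<lambda>z t. \<Sum>i\<in>Idx d n m. A i * z (restrict i {1..d}) * t (i (d + 1))"
  have upper: "?s z t \<le> ?N z" if "t \<in> T" for z t
    unfolding array_norm_def using that array_norm_bdd[OF M] by (intro cSUP_upper) auto
  have least: "?N z \<le> b" if "\<And>t. t \<in> T \<Longrightarrow> ?s z t \<le> b" for z b
    unfolding array_norm_def using that T(1) by (intro cSUP_least) auto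
  have abs: "\<bar>?s z t\<bar> \<le> ?N z" if "t \<in> T" for z t
  proof -
    have "(\<lambda>j. - t j) \<in> T" using T(2) that by blast
    from upper[OF this, of z] upper[OF that, of z] show ?thesis by (simp add: sum_negf)
  qed
  have add: "?N (\<lambda>i. f i + g i) \<le> ?N f + ?N g" for f g
  proof (rule least)
    fix t assume t: "t \<in> T"
    have "?s (\<lambda>i. f i + g i) t = ?s f t + ?s g t"
      unfolding sum.distrib[symmetric] by (intro sum.cong refl) (simp add: algebra_simps)
    then show "?s (\<lambda>i. f i + g i) t \<le> ?N f + ?N g" using upper[OF t, of f] upper[OF t, of g] by linarith
  qed
  have le: "?N (\<lambda>i. c * f i) \<le> \<bar>c\<bar> * ?N f" for c f
  proof (rule least)
    fix t assume t: "t \<in> T"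
    have "?s (\<lambda>i. c * f i) t = c * ?s f t" unfolding sum_distrib_left by (intro sum.cong refl) simp
    also have "\<dots> \<le> \<bar>c\<bar> * \<bar>?s f t\<bar>" by (rule mult_le_abs_mult)
    also have "\<dots> \<le> \<bar>c\<bar> * ?N f" using abs[OF t, of f] by (intro mult_left_mono) auto
    finally show "?s (\<lambda>i. c * f i) t \<le> \<bar>c\<bar> * ?N f" .
  qed
  have nonneg: "0 \<le> ?N f" for f
  proof -
    obtain t where "t \<in> T" using T(1) by auto
    from abs[OF this, of f] show ?thesis by linarith
  qed
  have scale: "?N (\<lambda>i. c * f i) = \<bar>c\<bar> * ?N f" for c f
  proof (cases "c = 0")
    case True
    have "?N (\<lambda>i. 0) \<le> 0" using le[of 0 "\<lambda>_. 0"] by simp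
    then show ?thesis using True nonneg[of "\<lambda>i. 0"] by simp
  next
    case False
    have "?N (\<lambda>i. inverse c * (c * f i)) \<le> \<bar>inverse c\<bar> * ?N (\<lambda>i. c * f i)" by (rule le)
    then have "?N f \<le> \<bar>inverse c\<bar> * ?N (\<lambda>i. c * f i)" using False by (simp add: mult.assoc[symmetric])
    then have "\<bar>c\<bar> * ?N f \<le> ?N (\<lambda>i. c * f i)" using False by (simp add: field_simps abs_inverse)
    then show ?thesis using le[of c f] by simp
  qed
  have cong: "?N f = ?N g" if "\<forall>i\<in>ibox n {1..d}. f i = g i" for f g
    unfolding array_norm_def using that Idx_restrict by (intro SUP_cong refl sum.cong) simp
  show ?thesis
    unfolding tensor_seminorm_def box_seminorm_def using add scale cong by auto
qed

lemma tprod_restrict: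
  assumes "\<Union>P \<subseteq> V"
  shows "tprod P x (restrict i V) = tprod P x i"
  unfolding tprod_def
proof (rule prod.cong[OF refl])
  fix I assume "I \<in> P"
  then have "restrict (restrict i V) I = restrict i I" using assms by (auto simp: fun_eq_iff restrict_def)
  then show "x I (restrict (restrict i V) I) = x I (restrict i I)" by simp
qed

lemma normPP_eq_block_norm:
  assumes "\<Union>P \<subseteq> {1..d}" "\<Union>P' \<subseteq> {1..d}"
  shows "normPP d n m A T P' P = block_norm n (array_norm d n m A T) P' P"
proof -
  have "(SUP t\<in>T. \<Sum>i\<in>Idx d n m. A i * (\<Prod>I\<in>P. x I (restrict i I)) * (\<Prod>J\<in>P'. g (J, restrict i J)) * t (i (d + 1))) =
     array_norm d n m A T (\<lambda>i. 1 * tprod P x i * tprod P' (curry g) i)" for x g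
    unfolding array_norm_def tprod_restrict[OF assms(1)] tprod_restrict[OF assms(2)]
    by (simp add: tprod_def mult.assoc)
  then show ?thesis
    unfolding normPP_def block_norm_def unit_sup_def gauss_avg_def unit_arrays_def ibox_def by simp
qed

lemma sum_s_k_eq_wsum:
  "(\<Sum>k=0..d. p powr ((real k + 1 - real d) / 2) * s_k d n m A T k) = wsum n (array_norm d n m A T) {1..d} d p"
proof -
  let ?Q = "\<lambda>k. {(P, P'). partition_on {1..d} (P \<union> P') \<and> P \<inter> P' = {} \<and> card P = k}"
  let ?f = "\<lambda>(P, P'). weight p d (card P) * block_norm n (array_norm d n m A T) P' P"
  have fin: "finite (splits {1..d} d)" by (rule finite_splits) simp
  have cardle: "card Q \<le> d" if "partition_on {1..d} Q" for Q
  proof -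
    \<comment> \<open>Choosing an element of each block shows that a partition of
      \<open>{1..d}\<close> has at most \<open>d\<close> blocks. The pairs in \<open>s_k\<close> are
      therefore exactly those in \<open>splits\<close>, grouped by the number of blocks in the
      supremum.\<close>
    have "\<forall>I\<in>Q. \<exists>a. a \<in> I" using partition_onD3[OF that] by (metis ex_in_conv)
    then obtain h where h: "\<And>I. I \<in> Q \<Longrightarrow> h I \<in> I" by metis
    have "inj_on h Q"
    proof (rule inj_onI)
      fix I J assume IJ: "I \<in> Q" "J \<in> Q" "h I = h J"
      then have "h I \<in> I \<inter> J" using h[of I] h[of J] by auto
      then show "I = J" using that IJ unfolding partition_on_def disjoint_def by blast
    qed
    moreover have "h ` Q \<subseteq> {1..d}" using h that by (auto simp: partition_on_def)
    ultimately have "card Q \<le> card {1..d}" by (intro card_inj_on_le) auto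
    then show ?thesis by simp
  qed
  have Q: "?Q k = {x \<in> splits {1..d} d. card (fst x) = k}" for k
    using cardle by (auto simp: splits_def)
  have "(\<Sum>k=0..d. p powr ((real k + 1 - real d) / 2) * s_k d n m A T k) = (\<Sum>k=0..d. \<Sum>x\<in>{x \<in> splits {1..d} d. card (fst x) = k}. ?f x)"
  proof (rule sum.cong[OF refl])
    fix k
    show "p powr ((real k + 1 - real d) / 2) * s_k d n m A T k = (\<Sum>x\<in>{x \<in> splits {1..d} d. card (fst x) = k}. ?f x)"
      unfolding s_k_def Q sum_distrib_left
    proof (rule sum.cong[OF refl])
      fix x assume "x \<in> {x \<in> splits {1..d} d. card (fst x) = k}"
      then obtain P P' where x: "x = (P, P')" "(P, P') \<in> splits {1..d} d" "card P = k" by (cases x) auto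
      have "normPP d n m A T P' P = block_norm n (array_norm d n m A T) P' P"
        using splitsD(2,3)[OF x(2)] by (rule normPP_eq_block_norm)
      then show "p powr ((real k + 1 - real d) / 2) * (case x of (P, P') \<Rightarrow> normPP d n m A T P' P) = ?f x"
        by (simp add: x weight_def)
    qed
  qed
  also have "\<dots> = (\<Sum>x\<in>splits {1..d} d. ?f x)"
  proof (rule sum.group[OF fin])
    show "(\<lambda>x. card (fst x)) ` splits {1..d} d \<subseteq> {0..d}"
    proof
      fix k assume "k \<in> (\<lambda>x. card (fst x)) ` splits {1..d} d"
      then obtain P P' where x: "(P, P') \<in> splits {1..d} d" "k = card P" by auto
      have "\<Union>(P \<union> P') \<subseteq> {1..d}" using splitsD(2,3)[OF x(1)] by auto
      then have "finite (P \<union> P')" by (meson finite_UnionD finite_atLeastAtMost finite_subset)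
      then have "card P \<le> card (P \<union> P')" by (intro card_mono) auto
      then show "k \<in> {0..d}" using splitsD(7)[OF x(1)] x(2) by simp
    qed
  qed simp
  also have "\<dots> = wsum n (array_norm d n m A T) {1..d} d p" by (simp add: wsum_def)
  finally show ?thesis .
qed

lemma sum_ibox_single: "(\<Sum>u\<in>ibox n {k}. f (u k)) = (\<Sum>j=1..n. f j)"
proof (rule sum.reindex_bij_witness[where i="\<lambda>j. \<lambda>x\<in>{k}. j" and j="\<lambda>u. u k"])
  fix u assume "u \<in> ibox n {k}"
  then show "(\<lambda>x\<in>{k}. u k) = u" "u k \<in> {1..n}"
    by (auto simp: ibox_def PiE_iff extensional_def fun_eq_iff)
qed (auto simp: ibox_def)

lemma partition_on_singletons: "partition_on {1..d} ((\<lambda>k. {k}) ` {1..d})"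
  by (auto simp: partition_on_def disjoint_def)

text \<open>All blocks are singletons here: each vector becomes an array on \<open>{k}\<close>, and
  the Gaussian vector is read off from the family with the single block \<open>{1}\<close>.\<close>

lemma process_le_unit_sup:
  fixes T :: "(nat \<Rightarrow> real) set"
  assumes d: "d \<ge> 2" and T: "T \<noteq> {}" "\<forall>t\<in>T. (\<lambda>j. - t j) \<in> T" and M: "\<forall>t\<in>T. \<forall>j\<in>{1..m}. \<bar>t j\<bar> \<le> M"
    and x: "\<forall>k\<in>{2..d}. (\<Sum>j=1..n. (x k j)\<^sup>2) \<le> (1::real)" and t: "t \<in> T"
    and g: "\<And>j. j \<in> {1..n} \<Longrightarrow> g j = \<omega> ({1}, \<lambda>u\<in>{1}. j)"
  shows "(\<Sum>i\<in>Idx d n m. A i * g (i 1) * (\<Prod>k=2..d. x k (i k)) * t (i (d + 1)))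
    \<le> unit_sup n (array_norm d n m A T) ((\<lambda>k. {k}) ` {1..d} - {{1}}) (\<lambda>a. 1 * tprod {{1}} (curry \<omega>) a)"
proof -
  let ?N = "array_norm d n m A T" and ?D = "(\<lambda>k. {k}) ` {1..d} - {{1::nat}}"
  interpret tensor_seminorm n "{1..d}" ?N by (rule array_norm_seminorm[OF T M])
  have D: "?D = (\<lambda>k. {k}) ` {2..d}" using d by auto
  \<comment> \<open>On a singleton block \<open>the_elem\<close> recovers the index, so that one
    formula defines the arrays for all blocks.\<close>
  define y where "y I u = x (the_elem I) (u (the_elem I))" for I :: "nat set" and u :: idx
  have y: "y \<in> unit_arrays n ?D"
  proof -
    have "(\<Sum>u\<in>ibox n {k}. (y {k} u)\<^sup>2) \<le> 1" if "k \<in> {2..d}" for k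
      using x that sum_ibox_single[of "\<lambda>j. (x k j)\<^sup>2" k n] by (simp add: y_def)
    then show ?thesis unfolding D unit_arrays_def by auto
  qed
  have tpD: "tprod ?D y i = (\<Prod>k=2..d. x k (i k))" for i
    unfolding D tprod_def by (subst prod.reindex) (auto simp: inj_on_def y_def)
  have DU: "\<Union>?D \<subseteq> {1..d}" "\<Union>{{1}} \<subseteq> {1..d}" using d by auto
  have "(\<Sum>i\<in>Idx d n m. A i * g (i 1) * (\<Prod>k=2..d. x k (i k)) * t (i (d + 1))) =
     (\<Sum>i\<in>Idx d n m. A i * (1 * tprod {{1}} (curry \<omega>) (restrict i {1..d}) * tprod ?D y (restrict i {1..d})) * t (i (d + 1)))"
  proof (rule sum.cong[OF refl])
    fix i assume i: "i \<in> Idx d n m"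
    have "restrict i {1..d} \<in> ibox n {1..d}" by (rule Idx_restrict[OF i])
    then have "restrict i {1..d} 1 \<in> {1..n}" unfolding ibox_def by (rule PiE_mem) (use d in simp)
    then have i1: "i 1 \<in> {1..n}" using d by simp
    have "restrict i {1} = (\<lambda>u\<in>{1}. i 1)" by (auto simp: fun_eq_iff)
    then have "tprod {{1}} (curry \<omega>) i = g (i 1)"
      unfolding tprod_single using g[OF i1] by simp
    then have "tprod {{1}} (curry \<omega>) (restrict i {1..d}) = g (i 1)"
      by (simp only: tprod_restrict[OF DU(2)])
    then show "A i * g (i 1) * (\<Prod>k=2..d. x k (i k)) * t (i (d + 1)) =
       A i * (1 * tprod {{1}} (curry \<omega>) (restrict i {1..d}) * tprod ?D y (restrict i {1..d})) * t (i (d + 1))"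
      unfolding tprod_restrict[OF DU(1)] tpD by simp
  qed
  also have "\<dots> \<le> ?N (\<lambda>a. 1 * tprod {{1}} (curry \<omega>) a * tprod ?D y a)"
    unfolding array_norm_def using t array_norm_bdd[OF M, where d=d and n=n and A=A and z="\<lambda>i. 1 * tprod {{1}} (curry \<omega>) (restrict i {1..d}) * tprod ?D y (restrict i {1..d})"]
    by (intro cSUP_upper) auto
  also have "\<dots> \<le> unit_sup n ?N ?D (\<lambda>a. 1 * tprod {{1}} (curry \<omega>) a)"
    by (rule unit_sup_upper[OF DU(1) y])
  finally show ?thesis .
qed

theorem theorem3p1:
  fixes d :: nat
  assumes "d \<ge> 2"
  shows "\<exists>C::real. \<forall>(n::nat) (m::nat) (T :: (nat \<Rightarrow> real) set) (A :: (nat \<Rightarrow> nat) \<Rightarrow> real) (p::real).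
    n \<ge> 1 \<longrightarrow> m \<ge> 1 \<longrightarrow> T \<noteq> {} \<longrightarrow> (\<forall>t\<in>T. (\<lambda>j. - t j) \<in> T) \<longrightarrow>
    (\<exists>M. \<forall>t\<in>T. \<forall>j\<in>{1..m}. \<bar>t j\<bar> \<le> M) \<longrightarrow> p \<ge> 1 \<longrightarrow>
    (\<integral>g. (SUP xt \<in> {(x, t). (\<forall>k\<in>{2..d}. (\<Sum>j=1..n. (x k j)^2) \<le> (1::real)) \<and> t \<in> T}.
          \<Sum>i\<in>Idx d n m. A i * g (i 1) * (\<Prod>k=2..d. fst xt k (i k)) * snd xt (i (d+1)))
       \<partial>(PiM {1..n} (\<lambda>_. gauss)))
    \<le> C * (\<Sum>k=0..d. p powr ((real k + 1 - real d) / 2) * s_k d n m A T k)"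
proof -
  let ?D = "(\<lambda>k. {k}) ` {1..d}" and ?i = "{1::nat}"
  obtain C where C: "C \<ge> 1" "\<And>n p N. p \<ge> 1 \<Longrightarrow> tensor_seminorm n {1..d} N \<Longrightarrow> gauss_sup n N ?D ?i \<le> C * wsum n N {1..d} d p"
  proof -
    have "card ?D = d" by (subst card_image) auto
    moreover have "?i \<in> ?D" using assms by auto
    ultimately show thesis
      using gauss_sup_le_wsum[of "{1..d}" d] partition_on_singletons[of d] that by (metis finite_atLeastAtMost order_refl)
  qed
  show ?thesis
  proof (intro exI[of _ C] allI impI)
    fix n m :: nat and T :: "(nat \<Rightarrow> real) set" and A :: "(nat \<Rightarrow> nat) \<Rightarrow> real" and p :: real
    assume T: "T \<noteq> {}" "\<forall>t\<in>T. (\<lambda>j. - t j) \<in> T" and M: "\<exists>M. \<forall>t\<in>T. \<forall>j\<in>{1..m}. \<bar>t j\<bar> \<le> M" and p: "p \<ge> 1"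
    obtain M where M: "\<forall>t\<in>T. \<forall>j\<in>{1..m}. \<bar>t j\<bar> \<le> M" using M ..
    let ?N = "array_norm d n m A T"
    let ?X = "{(x, t). (\<forall>k\<in>{2..d}. (\<Sum>j=1..n. (x k j)^2) \<le> (1::real)) \<and> t \<in> T}"
    let ?\<phi> = "\<lambda>g. SUP xt \<in> ?X. \<Sum>i\<in>Idx d n m. A i * g (i 1) * (\<Prod>k=2..d. fst xt k (i k)) * snd xt (i (d+1))"
    let ?h = "\<lambda>\<omega>. unit_sup n ?N (?D - {?i}) (\<lambda>a. 1 * tprod {?i} (curry \<omega>) a)"
    let ?r = "\<lambda>\<omega> :: nat set \<times> idx \<Rightarrow> real. \<lambda>j\<in>{1..n}. \<omega> (?i, \<lambda>u\<in>?i. j)"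
    interpret tensor_seminorm n "{1..d}" ?N by (rule array_norm_seminorm[OF T M])
    have iU: "\<Union>{?i} \<subseteq> {1..d}" and DU: "\<Union>(?D - {?i}) \<subseteq> {1..d}" using assms by auto
    have hint: "integrable (gaussv (gfam n {?i})) ?h"
      using tensor_seminorm.integrable_gauss_avg'[OF unit_sup_seminorm[OF DU] iU, of "\<lambda>_. 1"] by (simp add: gauss_family_eq)
    have gauss_sup_eq: "gauss_sup n ?N ?D ?i = (\<integral>\<omega>. ?h \<omega> \<partial>gaussv (gfam n {?i}))"
      by (simp add: gauss_sup_def gauss_avg_def gauss_family_eq)
    have X_ne: "?X \<noteq> {}"
    proof -
      obtain t where "t \<in> T" using T(1) by auto
      then have "(\<lambda>_ _. 0, t) \<in> ?X" by simp
      then show ?thesis by (rule ex_in_conv[THEN iffD1, OF exI])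
    qed
    \<comment> \<open>The Gaussian family of the block \<open>{1}\<close> is indexed by functions on
      \<open>{1}\<close>; reindexing by their value gives the vector of the theorem.\<close>
    have distr: "distr (gaussv (gfam n {?i})) (gaussv {1..n}) ?r = gaussv {1..n}"
    proof (rule distr_PiM_reindex)
      show "inj_on (\<lambda>j. (?i, \<lambda>u\<in>?i. j)) {1..n}"
        by (rule inj_onI) (auto simp: fun_eq_iff restrict_def split: if_splits)
      show "(\<lambda>j. (?i, \<lambda>u\<in>?i. j)) \<in> {1..n} \<rightarrow> gfam n {?i}" by (auto simp: ibox_def)
    qed (rule prob_space_gauss)
    have r: "?r \<in> gaussv (gfam n {?i}) \<rightarrow>\<^sub>M gaussv {1..n}"
      by (intro measurable_restrict measurable_component_singleton) (auto simp: ibox_def)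
    have le: "?\<phi> (?r \<omega>) \<le> ?h \<omega>" for \<omega>
    proof (rule cSUP_least[OF X_ne])
      fix xt assume "xt \<in> ?X"
      then have "\<forall>k\<in>{2..d}. (\<Sum>j=1..n. (fst xt k j)^2) \<le> (1::real)" "snd xt \<in> T" by auto
      then show "(\<Sum>i\<in>Idx d n m. A i * ?r \<omega> (i 1) * (\<Prod>k=2..d. fst xt k (i k)) * snd xt (i (d+1))) \<le> ?h \<omega>"
        by (intro process_le_unit_sup[OF assms T M]) (auto simp: restrict_def)
    qed
    have "(\<integral>g. ?\<phi> g \<partial>gaussv {1..n}) \<le> gauss_sup n ?N ?D ?i"
    proof (cases "integrable (gaussv {1..n}) ?\<phi>")
      case True
      have "(\<integral>g. ?\<phi> g \<partial>gaussv {1..n}) = (\<integral>\<omega>. ?\<phi> (?r \<omega>) \<partial>gaussv (gfam n {?i}))"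
        using integral_distr[OF r, of ?\<phi>] True distr by simp
      also have "\<dots> \<le> (\<integral>\<omega>. ?h \<omega> \<partial>gaussv (gfam n {?i}))"
      proof (rule integral_mono[OF _ hint le])
        show "integrable (gaussv (gfam n {?i})) (\<lambda>\<omega>. ?\<phi> (?r \<omega>))"
          using integrable_distr[OF r, of ?\<phi>] True distr by simp
      qed
      finally show ?thesis by (simp only: gauss_sup_eq)
    next
      \<comment> \<open>By convention the integral of a non-integrable function is zero, so here it
        suffices that the right-hand side is nonnegative.\<close>
      case False
      then have "(\<integral>g. ?\<phi> g \<partial>gaussv {1..n}) = 0" by (rule not_integrable_integral_eq)
      moreover have "0 \<le> gauss_sup n ?N ?D ?i"
        using assms by (intro gauss_sup_nonneg[OF array_norm_seminorm[OF T M]]) auto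
      ultimately show ?thesis by simp
    qed
    also have "\<dots> \<le> C * wsum n ?N {1..d} d p"
      by (rule C(2)[OF p array_norm_seminorm[OF T M]])
    finally show "(\<integral>g. ?\<phi> g \<partial>gaussv {1..n}) \<le> C * (\<Sum>k=0..d. p powr ((real k + 1 - real d) / 2) * s_k d n m A T k)"
      unfolding sum_s_k_eq_wsum .
  qed
qed

end
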